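(* Let $T$ be a complete first-order theory with infinite models. Suppose that $T$ is $\mathrm{NSOP}_1$ and rosy, and that $T^{\mathrm{eq}}$ has the stable Kim-forking property over models. Then $T$ is simple.
   Context: Work in a monster model $\mathbb{M}$ of a complete theory. A formula $\phi(x,y)$ is stable if there are no sequences $(a_i)_{i<\omega},(b_i)_{i<\omega}$ with $\models\phi(a_i,b_j)\iff i<j$ for all $i,j$. $\mathrm{NSOP}_1$: $T$ has $\mathrm{SOP}_1$ if there are a formula $\phi(x,y)$ and tuples $(c_\eta)_{\eta\in 2^{<\omega}}$ such that for every $\eta\in 2^\omega$ the set $\{\phi(x,c_{\eta|n}):n<\omega\}$ is consistent, and whenever $\nu^\frown 0\trianglelefteq \eta\in 2^{<\omega}$, the set $\{\phi(x,c_\eta),\phi(x,c_{\nu^\frown 1})\}$ is inconsistent; $T$ is $\mathrm{NSOP}_1$ otherwise. Þ-forking and rosiness: $\phi(x,b)$ strongly divides over $C$ if the set of images of $\phi(\mathbb{M},b)$ under $\mathrm{Aut}(\mathbb{M}/C)$ is infinite and $k$-inconsistent for some $k<\omega$; it þ-divides over $C$ if it strongly divides over $Cc$ for some tuple $c$; it þ-forks over $C$ if it implies a finite disjunction of formulas each of which þ-divides over $C$. $a$ is þ-independent from $B$ over $C$ if $\mathrm{tp}(a/CB)$ contains no formula þ-forking over $C$. $T$ is rosy if þ-independence in $T^{\mathrm{eq}}$ satisfies local character: for every set $A$ there is a cardinal $\kappa(A)$ such that for every $B$ there is $C\subseteq B$ with $|C|<\kappa(A)$ and $A$ þ-independent from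 $B$ over $C$. Kim-forking: for $M\models T$, a sequence $(b_i)_{i<\omega}$ is an $M$-invariant Morley sequence if there is a global $M$-invariant type $q$ with $b_i\models q|_{Mb_{<i}}$ for all $i$. A formula $\phi(x,b)$ Kim-divides over $M$ if there is an $M$-invariant Morley sequence $(b_i)_{i<\omega}$ with $b_0=b$ such that $\{\phi(x,b_i):i<\omega\}$ is inconsistent; it Kim-forks over $M$ if it implies a finite disjunction of formulas each Kim-dividing over $M$. A type Kim-forks over $M$ if it contains a formula that Kim-forks over $M$. A complete $\mathcal{L}$-theory has the stable Kim-forking property over models if for every model $M$ and every set $B\supseteq M$, whenever $p(x)\in S(B)$ Kim-forks over $M$, there exist a stable formula $\phi(x,y)\in\mathcal{L}(M)$ and a tuple $b$ from $B$ with $\phi(x,b)\in p(x)$ and $\phi(x,b)$ Kim-forks over $M$. *)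

theory Defs
  imports Main "HOL-Library.Sublist"
begin

unbundle cardinal_syntax

section \<open>Many-sorted first-order logic\<close>

text \<open>
  Many-sorted logic is needed for \<open>T\<^sup>e\<^sup>q\<close>.  A one-sorted language is one over the sort type
  \<^typ>\<open>unit\<close>.  Variables are de Bruijn indices: a formula is read in a context \<open>\<Gamma>\<close>, the list of
  the sorts of its free variables, and is evaluated at a list of elements of those sorts.
  So \<open>\<phi>(x,y)\<close> is a formula in a context \<open>\<Gamma> @ \<Delta>\<close>, and \<open>\<phi>(a,b)\<close> is its value at \<open>a @ b\<close>.
  All tuples are finite.
\<close>

datatype 'f trm = Var nat | App 'f "'f trm list"

datatype ('f, 'r, 's) fm =
    FEq "'f trm" "'f trm"
  | FRel 'r "'f trm list"
  | FNeg "('f, 'r, 's) fm"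
  | FAnd "('f, 'r, 's) fm" "('f, 'r, 's) fm"
  | FEx 's "('f, 'r, 's) fm"

record ('f, 'r, 's) lang =
  sorts :: "'s set"
  fn_sig :: "'f \<Rightarrow> ('s list \<times> 's) option"
  rel_sig :: "'r \<Rightarrow> 's list option"

definition language :: "('f, 'r, 's) lang \<Rightarrow> bool" where
  "language L \<longleftrightarrow>
     sorts L \<noteq> {} \<and>
     (\<forall>f ss s. fn_sig L f = Some (ss, s) \<longrightarrow> set ss \<subseteq> sorts L \<and> s \<in> sorts L) \<and>
     (\<forall>r ss. rel_sig L r = Some ss \<longrightarrow> set ss \<subseteq> sorts L)"

inductive has_sort :: "('f, 'r, 's) lang \<Rightarrow> 's list \<Rightarrow> 'f trm \<Rightarrow> 's \<Rightarrow> bool"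
  for L :: "('f, 'r, 's) lang" and \<Gamma> :: "'s list" where
  "i < length \<Gamma> \<Longrightarrow> has_sort L \<Gamma> (Var i) (\<Gamma> ! i)"
| "fn_sig L f = Some (ss, s) \<Longrightarrow> list_all2 (has_sort L \<Gamma>) ts ss \<Longrightarrow> has_sort L \<Gamma> (App f ts) s"

primrec wff :: "('f, 'r, 's) lang \<Rightarrow> 's list \<Rightarrow> ('f, 'r, 's) fm \<Rightarrow> bool" where
  "wff L \<Gamma> (FEq t u) \<longleftrightarrow> (\<exists>s. has_sort L \<Gamma> t s \<and> has_sort L \<Gamma> u s)"
| "wff L \<Gamma> (FRel r ts) \<longleftrightarrow> (\<exists>ss. rel_sig L r = Some ss \<and> list_all2 (has_sort L \<Gamma>) ts ss)"
| "wff L \<Gamma> (FNeg \<phi>) \<longleftrightarrow> wff L \<Gamma> \<phi>"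
| "wff L \<Gamma> (FAnd \<phi> \<psi>) \<longleftrightarrow> wff L \<Gamma> \<phi> \<and> wff L \<Gamma> \<psi>"
| "wff L \<Gamma> (FEx s \<phi>) \<longleftrightarrow> s \<in> sorts L \<and> wff L (s # \<Gamma>) \<phi>"

record ('f, 'r, 's, 'a) struc =
  univ :: "'s \<Rightarrow> 'a set"
  fn :: "'f \<Rightarrow> 'a list \<Rightarrow> 'a"
  rel :: "'r \<Rightarrow> 'a list \<Rightarrow> bool"

definition tuples :: "('f, 'r, 's, 'a) struc \<Rightarrow> 's list \<Rightarrow> 'a list set" where
  "tuples M \<Gamma> = {a. list_all2 (\<lambda>x s. x \<in> univ M s) a \<Gamma>}"

definition elems :: "('f, 'r, 's) lang \<Rightarrow> ('f, 'r, 's, 'a) struc \<Rightarrow> 'a set" where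
  "elems L M = (\<Union>s\<in>sorts L. univ M s)"

definition is_struc :: "('f, 'r, 's) lang \<Rightarrow> ('f, 'r, 's, 'a) struc \<Rightarrow> bool" where
  "is_struc L M \<longleftrightarrow>
     (\<forall>s\<in>sorts L. univ M s \<noteq> {}) \<and>
     (\<forall>s\<in>sorts L. \<forall>s'\<in>sorts L. s \<noteq> s' \<longrightarrow> univ M s \<inter> univ M s' = {}) \<and>
     (\<forall>f ss s. fn_sig L f = Some (ss, s) \<longrightarrow> (\<forall>a\<in>tuples M ss. fn M f a \<in> univ M s))"

primrec eval :: "('f, 'r, 's, 'a) struc \<Rightarrow> 'a list \<Rightarrow> 'f trm \<Rightarrow> 'a" where
  "eval M e (Var i) = e ! i"
| "eval M e (App f ts) = fn M f (map (eval M e) ts)"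

primrec sat :: "('f, 'r, 's, 'a) struc \<Rightarrow> 'a list \<Rightarrow> ('f, 'r, 's) fm \<Rightarrow> bool" where
  "sat M e (FEq t u) \<longleftrightarrow> eval M e t = eval M e u"
| "sat M e (FRel r ts) \<longleftrightarrow> rel M r (map (eval M e) ts)"
| "sat M e (FNeg \<phi>) \<longleftrightarrow> \<not> sat M e \<phi>"
| "sat M e (FAnd \<phi> \<psi>) \<longleftrightarrow> sat M e \<phi> \<and> sat M e \<psi>"
| "sat M e (FEx s \<phi>) \<longleftrightarrow> (\<exists>d\<in>univ M s. sat M (d # e) \<phi>)"


section \<open>Theories, elementary submodels, automorphisms\<close>

definition models :: "('f, 'r, 's) lang \<Rightarrow> ('f, 'r, 's) fm set \<Rightarrow> ('f, 'r, 's, 'a) struc \<Rightarrow> bool" where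
  "models L T M \<longleftrightarrow> is_struc L M \<and> (\<forall>\<phi>\<in>T. sat M [] \<phi>)"

text \<open>
  Entailment can only range over models living in a fixed type \<open>'a\<close>.  By downward
  Loewenheim--Skolem this is the usual notion as soon as \<open>'a\<close> has at least \<open>|L| + \<aleph>\<^sub>0\<close>
  elements, which holds if \<open>'a\<close> carries an infinite monster model of a theory in \<open>L\<close>.
\<close>

definition entails ::
    "'a itself \<Rightarrow> ('f, 'r, 's) lang \<Rightarrow> ('f, 'r, 's) fm set \<Rightarrow> ('f, 'r, 's) fm \<Rightarrow> bool" where
  "entails _ L T \<phi> \<longleftrightarrow> (\<forall>M :: ('f, 'r, 's, 'a) struc. models L T M \<longrightarrow> sat M [] \<phi>)"

definition complete_theory ::
    "'a itself \<Rightarrow> ('f, 'r, 's) lang \<Rightarrow> ('f, 'r, 's) fm set \<Rightarrow> bool" where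
  "complete_theory U L T \<longleftrightarrow>
     (\<forall>\<phi>\<in>T. wff L [] \<phi>) \<and>
     (\<exists>M :: ('f, 'r, 's, 'a) struc. models L T M) \<and>
     (\<forall>\<phi>. wff L [] \<phi> \<longrightarrow> entails U L T \<phi> \<or> entails U L T (FNeg \<phi>))"

definition has_infinite_models ::
    "'a itself \<Rightarrow> ('f, 'r, 's) lang \<Rightarrow> ('f, 'r, 's) fm set \<Rightarrow> bool" where
  "has_infinite_models _ L T \<longleftrightarrow>
     (\<exists>M :: ('f, 'r, 's, 'a) struc. models L T M \<and> infinite (elems L M))"

definition restrict_struc ::
    "('f, 'r, 's, 'a) struc \<Rightarrow> 'a set \<Rightarrow> ('f, 'r, 's, 'a) struc" where
  "restrict_struc M A = M\<lparr>univ := \<lambda>s. univ M s \<inter> A\<rparr>"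

definition elementary_submodel ::
    "('f, 'r, 's) lang \<Rightarrow> ('f, 'r, 's, 'a) struc \<Rightarrow> 'a set \<Rightarrow> bool" where
  "elementary_submodel L MM M \<longleftrightarrow>
     M \<subseteq> elems L MM \<and>
     is_struc L (restrict_struc MM M) \<and>
     (\<forall>\<Gamma> \<phi>. \<forall>a\<in>tuples (restrict_struc MM M) \<Gamma>.
        set \<Gamma> \<subseteq> sorts L \<longrightarrow> wff L \<Gamma> \<phi> \<longrightarrow> (sat (restrict_struc MM M) a \<phi> \<longleftrightarrow> sat MM a \<phi>))"

definition automorphisms ::
    "('f, 'r, 's) lang \<Rightarrow> ('f, 'r, 's, 'a) struc \<Rightarrow> 'a set \<Rightarrow> ('a \<Rightarrow> 'a) set" where
  "automorphisms L MM C =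
     {\<sigma>. (\<forall>s\<in>sorts L. bij_betw \<sigma> (univ MM s) (univ MM s)) \<and>
         (\<forall>f ss s. fn_sig L f = Some (ss, s) \<longrightarrow>
            (\<forall>a\<in>tuples MM ss. \<sigma> (fn MM f a) = fn MM f (map \<sigma> a))) \<and>
         (\<forall>r ss. rel_sig L r = Some ss \<longrightarrow>
            (\<forall>a\<in>tuples MM ss. rel MM r (map \<sigma> a) \<longleftrightarrow> rel MM r a)) \<and>
         (\<forall>c\<in>C. \<sigma> c = c)}"


section \<open>Formulas with parameters and types\<close>

text \<open>
  A formula \<open>\<phi>(x,b)\<close> in variables \<open>x\<close> of sorts \<open>\<Gamma>\<close> with parameters from \<open>A\<close> is a pair \<open>(\<phi>, b)\<close>.
  Formulas \<open>\<phi>(x,y) \<in> L(M)\<close> are handled by adjoining their parameters to the parameter tuple.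
\<close>

definition pforms ::
    "('f, 'r, 's) lang \<Rightarrow> ('f, 'r, 's, 'a) struc \<Rightarrow> 's list \<Rightarrow> 'a set \<Rightarrow>
     (('f, 'r, 's) fm \<times> 'a list) set" where
  "pforms L MM \<Gamma> A =
     {(\<phi>, b). \<exists>\<Delta>. set \<Delta> \<subseteq> sorts L \<and> wff L (\<Gamma> @ \<Delta>) \<phi> \<and> b \<in> tuples MM \<Delta> \<and> set b \<subseteq> A}"

definition solutions ::
    "('f, 'r, 's, 'a) struc \<Rightarrow> 's list \<Rightarrow> ('f, 'r, 's) fm \<times> 'a list \<Rightarrow> 'a list set" where
  "solutions MM \<Gamma> \<psi> = {a \<in> tuples MM \<Gamma>. sat MM (a @ snd \<psi>) (fst \<psi>)}"

definition consistent ::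
    "('f, 'r, 's, 'a) struc \<Rightarrow> 's list \<Rightarrow> (('f, 'r, 's) fm \<times> 'a list) set \<Rightarrow> bool" where
  "consistent MM \<Gamma> \<Phi> \<longleftrightarrow>
     (\<forall>F. finite F \<and> F \<subseteq> \<Phi> \<longrightarrow> (\<exists>a\<in>tuples MM \<Gamma>. \<forall>\<psi>\<in>F. a \<in> solutions MM \<Gamma> \<psi>))"

definition complete_types ::
    "('f, 'r, 's) lang \<Rightarrow> ('f, 'r, 's, 'a) struc \<Rightarrow> 's list \<Rightarrow> 'a set \<Rightarrow>
     (('f, 'r, 's) fm \<times> 'a list) set set" where
  "complete_types L MM \<Gamma> A =
     {p. p \<subseteq> pforms L MM \<Gamma> A \<and> consistent MM \<Gamma> p \<and>
         (\<forall>(\<phi>, b)\<in>pforms L MM \<Gamma> A. (\<phi>, b) \<in> p \<or> (FNeg \<phi>, b) \<in> p)}"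

definition type_of ::
    "('f, 'r, 's) lang \<Rightarrow> ('f, 'r, 's, 'a) struc \<Rightarrow> 's list \<Rightarrow> 'a list \<Rightarrow> 'a set \<Rightarrow>
     (('f, 'r, 's) fm \<times> 'a list) set" where
  "type_of L MM \<Gamma> a A = {\<psi> \<in> pforms L MM \<Gamma> A. a \<in> solutions MM \<Gamma> \<psi>}"

definition stable_formula ::
    "('f, 'r, 's, 'a) struc \<Rightarrow> 's list \<Rightarrow> 's list \<Rightarrow> ('f, 'r, 's) fm \<Rightarrow> 'a list \<Rightarrow> bool" where
  "stable_formula MM \<Gamma> \<Delta> \<phi> c \<longleftrightarrow>
     \<not> (\<exists>a b. (\<forall>i::nat. a i \<in> tuples MM \<Gamma> \<and> b i \<in> tuples MM \<Delta>) \<and>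
            (\<forall>i j. sat MM (a i @ b j @ c) \<phi> \<longleftrightarrow> i < j))"


section \<open>Monster models\<close>

definition saturated ::
    "'k rel \<Rightarrow> ('f, 'r, 's) lang \<Rightarrow> ('f, 'r, 's, 'a) struc \<Rightarrow> bool" where
  "saturated \<kappa> L MM \<longleftrightarrow>
     (\<forall>A \<Gamma> p. A \<subseteq> elems L MM \<and> |A| <o \<kappa> \<and> set \<Gamma> \<subseteq> sorts L \<and> p \<in> complete_types L MM \<Gamma> A \<longrightarrow>
        (\<exists>a\<in>tuples MM \<Gamma>. \<forall>\<psi>\<in>p. a \<in> solutions MM \<Gamma> \<psi>))"

definition strongly_homogeneous ::
    "'k rel \<Rightarrow> ('f, 'r, 's) lang \<Rightarrow> ('f, 'r, 's, 'a) struc \<Rightarrow> bool" where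
  "strongly_homogeneous \<kappa> L MM \<longleftrightarrow>
     (\<forall>A g. A \<subseteq> elems L MM \<and> |A| <o \<kappa> \<and>
        (\<forall>s\<in>sorts L. g ` (A \<inter> univ MM s) \<subseteq> univ MM s) \<and>
        (\<forall>\<Gamma> \<phi>. \<forall>a\<in>tuples MM \<Gamma>. set \<Gamma> \<subseteq> sorts L \<longrightarrow> wff L \<Gamma> \<phi> \<longrightarrow> set a \<subseteq> A \<longrightarrow>
           (sat MM (map g a) \<phi> \<longleftrightarrow> sat MM a \<phi>)) \<longrightarrow>
        (\<exists>\<sigma>\<in>automorphisms L MM {}. \<forall>a\<in>A. \<sigma> a = g a))"

text \<open>
  The cardinal \<open>\<kappa>\<close> bounds the small sets.  ``Sufficiently large'' is taken to mean: a strong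
  limit cardinal above \<open>|L| + \<aleph>\<^sub>0\<close>.
\<close>

definition monster_model ::
    "'k rel \<Rightarrow> ('f, 'r, 's) lang \<Rightarrow> ('f, 'r, 's) fm set \<Rightarrow> ('f, 'r, 's, 'a) struc \<Rightarrow> bool" where
  "monster_model \<kappa> L T MM \<longleftrightarrow>
     Card_order \<kappa> \<and> natLeq <o \<kappa> \<and>
     |{f. fn_sig L f \<noteq> None}| <o \<kappa> \<and> |{r. rel_sig L r \<noteq> None}| <o \<kappa> \<and> |sorts L| <o \<kappa> \<and>
     (\<forall>A :: 'k set. |A| <o \<kappa> \<longrightarrow> |Pow A| <o \<kappa>) \<and>
     models L T MM \<and> saturated \<kappa> L MM \<and> strongly_homogeneous \<kappa> L MM"


section \<open>\<open>SOP\<^sub>1\<close> and simplicity\<close>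

definition has_SOP1 :: "('f, 'r, 's) lang \<Rightarrow> ('f, 'r, 's, 'a) struc \<Rightarrow> bool" where
  "has_SOP1 L MM \<longleftrightarrow>
     (\<exists>\<Gamma> \<Delta> \<phi>. \<exists>c :: bool list \<Rightarrow> 'a list.
        set \<Gamma> \<subseteq> sorts L \<and> set \<Delta> \<subseteq> sorts L \<and> wff L (\<Gamma> @ \<Delta>) \<phi> \<and>
        (\<forall>\<eta>. c \<eta> \<in> tuples MM \<Delta>) \<and>
        (\<forall>\<eta> :: nat \<Rightarrow> bool. consistent MM \<Gamma> {(\<phi>, c (map \<eta> [0..<n])) | n. True}) \<and>
        (\<forall>\<nu> \<eta>. prefix (\<nu> @ [False]) \<eta> \<longrightarrow>
           \<not> consistent MM \<Gamma> {(\<phi>, c \<eta>), (\<phi>, c (\<nu> @ [True]))}))"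

definition NSOP1 :: "('f, 'r, 's) lang \<Rightarrow> ('f, 'r, 's, 'a) struc \<Rightarrow> bool" where
  "NSOP1 L MM \<longleftrightarrow> \<not> has_SOP1 L MM"

definition has_tree_property :: "('f, 'r, 's) lang \<Rightarrow> ('f, 'r, 's, 'a) struc \<Rightarrow> bool" where
  "has_tree_property L MM \<longleftrightarrow>
     (\<exists>\<Gamma> \<Delta> \<phi> k. \<exists>c :: nat list \<Rightarrow> 'a list.
        set \<Gamma> \<subseteq> sorts L \<and> set \<Delta> \<subseteq> sorts L \<and> wff L (\<Gamma> @ \<Delta>) \<phi> \<and> 2 \<le> k \<and>
        (\<forall>\<eta>. c \<eta> \<in> tuples MM \<Delta>) \<and>
        (\<forall>\<eta> :: nat \<Rightarrow> nat. consistent MM \<Gamma> {(\<phi>, c (map \<eta> [0..<n])) | n. True}) \<and>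
        (\<forall>\<nu> I. finite I \<and> card I = k \<longrightarrow> \<not> consistent MM \<Gamma> {(\<phi>, c (\<nu> @ [i])) | i. i \<in> I}))"

definition simple :: "('f, 'r, 's) lang \<Rightarrow> ('f, 'r, 's, 'a) struc \<Rightarrow> bool" where
  "simple L MM \<longleftrightarrow> \<not> has_tree_property L MM"


section \<open>Thorn-forking\<close>

definition strongly_divides ::
    "('f, 'r, 's) lang \<Rightarrow> ('f, 'r, 's, 'a) struc \<Rightarrow> 's list \<Rightarrow> 'a set \<Rightarrow>
     ('f, 'r, 's) fm \<times> 'a list \<Rightarrow> bool" where
  "strongly_divides L MM \<Gamma> C \<psi> \<longleftrightarrow>
     (let D = (\<lambda>\<sigma>. map \<sigma> ` solutions MM \<Gamma> \<psi>) ` automorphisms L MM C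
      in infinite D \<and> (\<exists>k. \<forall>S\<subseteq>D. finite S \<and> card S = k \<longrightarrow> \<Inter>S = {}))"

definition thorn_divides ::
    "('f, 'r, 's) lang \<Rightarrow> ('f, 'r, 's, 'a) struc \<Rightarrow> 's list \<Rightarrow> 'a set \<Rightarrow>
     ('f, 'r, 's) fm \<times> 'a list \<Rightarrow> bool" where
  "thorn_divides L MM \<Gamma> C \<psi> \<longleftrightarrow>
     (\<exists>c. set c \<subseteq> elems L MM \<and> strongly_divides L MM \<Gamma> (C \<union> set c) \<psi>)"

definition thorn_forks ::
    "('f, 'r, 's) lang \<Rightarrow> ('f, 'r, 's, 'a) struc \<Rightarrow> 's list \<Rightarrow> 'a set \<Rightarrow>
     ('f, 'r, 's) fm \<times> 'a list \<Rightarrow> bool" where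
  "thorn_forks L MM \<Gamma> C \<psi> \<longleftrightarrow>
     (\<exists>F. finite F \<and> F \<subseteq> pforms L MM \<Gamma> (elems L MM) \<and>
          solutions MM \<Gamma> \<psi> \<subseteq> (\<Union>\<theta>\<in>F. solutions MM \<Gamma> \<theta>) \<and>
          (\<forall>\<theta>\<in>F. thorn_divides L MM \<Gamma> C \<theta>))"

text \<open>The independence of a set \<open>A\<close> is independence of all finite tuples from \<open>A\<close>.\<close>

definition thorn_indep ::
    "('f, 'r, 's) lang \<Rightarrow> ('f, 'r, 's, 'a) struc \<Rightarrow> 'a set \<Rightarrow> 'a set \<Rightarrow> 'a set \<Rightarrow> bool" where
  "thorn_indep L MM A B C \<longleftrightarrow>
     (\<forall>\<Gamma>. \<forall>a\<in>tuples MM \<Gamma>. set \<Gamma> \<subseteq> sorts L \<longrightarrow> set a \<subseteq> A \<longrightarrow>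
        (\<forall>\<psi>\<in>type_of L MM \<Gamma> a (C \<union> B). \<not> thorn_forks L MM \<Gamma> C \<psi>))"

definition thorn_local_character ::
    "'k rel \<Rightarrow> ('f, 'r, 's) lang \<Rightarrow> ('f, 'r, 's, 'a) struc \<Rightarrow> bool" where
  "thorn_local_character \<kappa> L MM \<longleftrightarrow>
     (\<forall>A. A \<subseteq> elems L MM \<and> |A| <o \<kappa> \<longrightarrow>
        (\<exists>\<kappa>\<^sub>A :: 'k rel. Card_order \<kappa>\<^sub>A \<and> \<kappa>\<^sub>A <o \<kappa> \<and>
           (\<forall>B. B \<subseteq> elems L MM \<and> |B| <o \<kappa> \<longrightarrow>
              (\<exists>C\<subseteq>B. |C| <o \<kappa>\<^sub>A \<and> thorn_indep L MM A B C))))"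


section \<open>Kim-forking\<close>

definition invariant_global_type ::
    "('f, 'r, 's) lang \<Rightarrow> ('f, 'r, 's, 'a) struc \<Rightarrow> 's list \<Rightarrow> 'a set \<Rightarrow>
     (('f, 'r, 's) fm \<times> 'a list) set \<Rightarrow> bool" where
  "invariant_global_type L MM \<Delta> M q \<longleftrightarrow>
     q \<in> complete_types L MM \<Delta> (elems L MM) \<and>
     (\<forall>\<sigma>\<in>automorphisms L MM M. \<forall>(\<phi>, b)\<in>pforms L MM \<Delta> (elems L MM).
        (\<phi>, map \<sigma> b) \<in> q \<longleftrightarrow> (\<phi>, b) \<in> q)"

definition invariant_Morley_sequence ::
    "('f, 'r, 's) lang \<Rightarrow> ('f, 'r, 's, 'a) struc \<Rightarrow> 's list \<Rightarrow> 'a set \<Rightarrow> (nat \<Rightarrow> 'a list) \<Rightarrow> bool" where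
  "invariant_Morley_sequence L MM \<Delta> M b \<longleftrightarrow>
     (\<exists>q. invariant_global_type L MM \<Delta> M q \<and>
        (\<forall>i. b i \<in> tuples MM \<Delta> \<and>
           (\<forall>\<psi>\<in>q \<inter> pforms L MM \<Delta> (M \<union> (\<Union>j<i. set (b j))). b i \<in> solutions MM \<Delta> \<psi>)))"

definition Kim_divides ::
    "('f, 'r, 's) lang \<Rightarrow> ('f, 'r, 's, 'a) struc \<Rightarrow> 's list \<Rightarrow> 'a set \<Rightarrow>
     ('f, 'r, 's) fm \<times> 'a list \<Rightarrow> bool" where
  "Kim_divides L MM \<Gamma> M = (\<lambda>(\<phi>, b).
     \<exists>\<Delta> bs. set \<Delta> \<subseteq> sorts L \<and> wff L (\<Gamma> @ \<Delta>) \<phi> \<and>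
        invariant_Morley_sequence L MM \<Delta> M bs \<and> bs 0 = b \<and>
        \<not> consistent MM \<Gamma> {(\<phi>, bs i) | i. True})"

definition Kim_forks ::
    "('f, 'r, 's) lang \<Rightarrow> ('f, 'r, 's, 'a) struc \<Rightarrow> 's list \<Rightarrow> 'a set \<Rightarrow>
     ('f, 'r, 's) fm \<times> 'a list \<Rightarrow> bool" where
  "Kim_forks L MM \<Gamma> M \<psi> \<longleftrightarrow>
     (\<exists>F. finite F \<and> F \<subseteq> pforms L MM \<Gamma> (elems L MM) \<and>
          solutions MM \<Gamma> \<psi> \<subseteq> (\<Union>\<theta>\<in>F. solutions MM \<Gamma> \<theta>) \<and>
          (\<forall>\<theta>\<in>F. Kim_divides L MM \<Gamma> M \<theta>))"

definition stable_Kim_forking_over_models ::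
    "'k rel \<Rightarrow> ('f, 'r, 's) lang \<Rightarrow> ('f, 'r, 's, 'a) struc \<Rightarrow> bool" where
  "stable_Kim_forking_over_models \<kappa> L MM \<longleftrightarrow>
     (\<forall>M B \<Gamma> p.
        elementary_submodel L MM M \<and> M \<subseteq> B \<and> B \<subseteq> elems L MM \<and> |B| <o \<kappa> \<and>
        set \<Gamma> \<subseteq> sorts L \<and> p \<in> complete_types L MM \<Gamma> B \<and>
        (\<exists>\<psi>\<in>p. Kim_forks L MM \<Gamma> M \<psi>) \<longrightarrow>
        (\<exists>\<phi> \<Delta> \<Theta> b c.
           set \<Delta> \<subseteq> sorts L \<and> set \<Theta> \<subseteq> sorts L \<and> wff L (\<Gamma> @ \<Delta> @ \<Theta>) \<phi> \<and>
           b \<in> tuples MM \<Delta> \<and> set b \<subseteq> B \<and> c \<in> tuples MM \<Theta> \<and> set c \<subseteq> M \<and>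
           stable_formula MM \<Gamma> \<Delta> \<phi> c \<and>
           (\<phi>, b @ c) \<in> p \<and> Kim_forks L MM \<Gamma> M (\<phi>, b @ c)))"


section \<open>Imaginaries\<close>

text \<open>
  For a one-sorted language \<open>L\<close>, the language \<open>L\<^sup>e\<^sup>q\<close> has a sort \<open>(n, E)\<close> for every \<open>L\<close>-formula \<open>E\<close>
  that defines an equivalence relation on \<open>n\<close>-tuples (\<open>n \<ge> 1\<close>), a function symbol \<^term>\<open>Proj (n, E)\<close>
  for the quotient map onto that sort, and the symbols of \<open>L\<close> on the home sort, which is the
  sort of the relation \<open>x\<^sub>0 = x\<^sub>1\<close>.  That \<open>E\<close> is an equivalence relation modulo the complete
  theory of \<open>MM\<close> is tested in \<open>MM\<close>.  An element of the sort \<open>(n, E)\<close> is an equivalence class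
  tagged with \<open>(n, E)\<close>; elements \<open>x\<close> of \<open>MM\<close> become tagged singletons \<open>{[x]}\<close>.
\<close>

type_synonym ('f, 'r) eq_sort = "nat \<times> ('f, 'r, unit) fm"

datatype ('f, 'r) eq_fn = Base 'f | Proj "('f, 'r) eq_sort"

definition home :: "('f, 'r) eq_sort" where
  "home = (1, FEq (Var 0) (Var 1))"

definition eq_rel ::
    "('f, 'r, unit, 'a) struc \<Rightarrow> ('f, 'r) eq_sort \<Rightarrow> ('a list \<times> 'a list) set" where
  "eq_rel MM = (\<lambda>(n, E). {(a, b).
     a \<in> tuples MM (replicate n ()) \<and> b \<in> tuples MM (replicate n ()) \<and> sat MM (a @ b) E})"

definition eq_sorts ::
    "('f, 'r, unit) lang \<Rightarrow> ('f, 'r, unit, 'a) struc \<Rightarrow> ('f, 'r) eq_sort set" where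
  "eq_sorts L MM = {(n, E). 1 \<le> n \<and> wff L (replicate (n + n) ()) E \<and>
     equiv (tuples MM (replicate n ())) (eq_rel MM (n, E))}"

definition eq_lang ::
    "('f, 'r, unit) lang \<Rightarrow> ('f, 'r, unit, 'a) struc \<Rightarrow> (('f, 'r) eq_fn, 'r, ('f, 'r) eq_sort) lang"
  where
  "eq_lang L MM =
     \<lparr>sorts = eq_sorts L MM,
      fn_sig = (\<lambda>g. case g of
          Base f \<Rightarrow> map_option (\<lambda>(ss, s). (map (\<lambda>_. home) ss, home)) (fn_sig L f)
        | Proj s \<Rightarrow> if s \<in> eq_sorts L MM then Some (replicate (fst s) home, s) else None),
      rel_sig = (\<lambda>r. map_option (map (\<lambda>_. home)) (rel_sig L r))\<rparr>"

definition home_elem :: "('f, 'r) eq_sort \<times> 'a list set \<Rightarrow> 'a" where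
  "home_elem e = hd (the_elem (snd e))"

definition eq_struc ::
    "('f, 'r, unit) lang \<Rightarrow> ('f, 'r, unit, 'a) struc \<Rightarrow>
     (('f, 'r) eq_fn, 'r, ('f, 'r) eq_sort, ('f, 'r) eq_sort \<times> 'a list set) struc" where
  "eq_struc L MM =
     \<lparr>univ = (\<lambda>s. if s \<in> eq_sorts L MM
                   then Pair s ` (tuples MM (replicate (fst s) ()) // eq_rel MM s) else {}),
      fn = (\<lambda>g es. case g of
          Base f \<Rightarrow> (home, {[fn MM f (map home_elem es)]})
        | Proj s \<Rightarrow> (s, eq_rel MM s `` {map home_elem es})),
      rel = (\<lambda>r es. rel MM r (map home_elem es))\<rparr>"

definition rosy :: "'k rel \<Rightarrow> ('f, 'r, unit) lang \<Rightarrow> ('f, 'r, unit, 'a) struc \<Rightarrow> bool" where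
  "rosy \<kappa> L MM \<longleftrightarrow> thorn_local_character \<kappa> (eq_lang L MM) (eq_struc L MM)"

end

theory Submission
  imports Defs "HOL-Library.Countable" "HOL-Library.Infinite_Set"
begin

text \<open>
  Suppose that \<open>\<phi>(x,y)\<close> has the tree property.  Choosing \<open>c\<^sub>i\<close> as a realisation, over a model
  \<open>N\<^sub>i\<close> containing the children of a node, of a nonprincipal average of these children, one climbs
  the tree along an increasing chain of models \<open>N\<^sub>i\<close>, \<open>i < \<mu>\<^sup>+\<close>, such that \<open>\<phi>(x,c\<^sub>i)\<close> Kim-divides
  over \<open>N\<^sub>i\<close>, \<open>c\<^sub>i \<in> N\<^sub>j\<close> for \<open>i < j\<close>, and some \<open>a\<close> satisfies all \<open>\<phi>(x,c\<^sub>i)\<close>.  Let \<open>B\<close> be the union of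
  the chain and \<open>(a\<^sub>k)\<close> a Morley sequence of a coheir \<open>q\<close> of \<open>tp(a/B)\<close> over \<open>B\<close>.  Local character of
  thorn-independence, for \<open>\<mu>\<close> large enough, provides \<open>i\<close> such that no formula in
  \<open>tp(a\<^sub>0,a\<^sub>1,\<dots>/B)\<close> thorn-divides over a certain subset of \<open>N\<^sub>i\<close>.

  The stable Kim-forking property, applied to \<open>tp(a/B)\<close> and \<open>N\<^sub>i\<close>, yields a stable \<open>\<psi>(x,y)\<close> over \<open>N\<^sub>i\<close>
  and \<open>\<psi>(x,b) \<in> tp(a/B)\<close> Kim-forking over \<open>N\<^sub>i\<close>.  By stability the set \<open>X = {y. \<psi>(x,y) \<in> q}\<close> is given
  by majority vote both of finitely many points of \<open>B\<close> and of finitely many of the \<open>a\<^sub>k\<close>.  The formula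
  ``\<open>x\<^sub>0,\<dots>,x\<^sub>2\<^sub>n\<close> vote for \<open>X\<close>'' is satisfied by the \<open>a\<^sub>k\<close>, and distinct conjugates of it are disjoint,
  so \<open>X\<close> cannot have infinitely many conjugates over \<open>N\<^sub>i\<close>; hence \<open>X\<close> is definable over \<open>N\<^sub>i\<close>.  Then
  \<open>{\<psi>(x,y). y \<in> X}\<close> is finitely satisfiable in \<open>N\<^sub>i\<close>, again by stability, and extends to a coheir over
  \<open>N\<^sub>i\<close>.  As it contains \<open>\<psi>(x,b)\<close>, this formula does not Kim-fork over \<open>N\<^sub>i\<close>, a contradiction.
\<close>

section \<open>Tuples\<close>

text \<open>The delicate point is the order of choices. The stable formula, and with it the number
  of votes, is known only once \<open>N i\<close> is fixed, whereas a base for thorn-independence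
  must be chosen before i. So a base is taken for every finite initial segment of the Morley
  sequence at once. Their union is still small enough to be swallowed by a single model of the
  chain, because a successor cardinal is regular. The bound on the size of a base must not depend on
  the tuple, so local character is made uniform beforehand.

  Two votes for X are needed for different reasons. The points of B supply parameters over which X
  is definable. The Morley sequence supplies a realisation, so that the formula which would
  thorn-divide belongs to a type whose behaviour over B is controlled. The class of a voting tuple
  under "votes for the same set" takes the place of a canonical parameter of X.

  Rosiness and stable Kim-forking are assumed for the structure of imaginaries. The argument
  therefore runs in an arbitrary many-sorted structure with enough saturation and homogeneity, and
  these properties are transferred to the imaginaries.\<close>

lemma tuples_length: "a \<in> tuples M \<Gamma> \<Longrightarrow> length a = length \<Gamma>"
  by (auto simp: tuples_def list_all2_lengthD)

lemma tuples_Nil [simp]: "a \<in> tuples M [] \<longleftrightarrow> a = []"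
  by (auto simp: tuples_def)

lemma tuples_Cons [simp]: "x # a \<in> tuples M (s # \<Gamma>) \<longleftrightarrow> x \<in> univ M s \<and> a \<in> tuples M \<Gamma>"
  by (auto simp: tuples_def)

lemma tuples_ConsE:
  assumes "a \<in> tuples M (s # \<Gamma>)"
  obtains x b where "a = x # b" "x \<in> univ M s" "b \<in> tuples M \<Gamma>"
  using assms by (auto simp: tuples_def list_all2_Cons2)

lemma tuples_append: "a \<in> tuples M \<Gamma> \<Longrightarrow> b \<in> tuples M \<Delta> \<Longrightarrow> a @ b \<in> tuples M (\<Gamma> @ \<Delta>)"
  by (auto simp: tuples_def intro: list_all2_appendI)

lemma tuples_appendE:
  assumes "a \<in> tuples M (\<Gamma> @ \<Delta>)"
  obtains b c where "a = b @ c" "b \<in> tuples M \<Gamma>" "c \<in> tuples M \<Delta>"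
  using assms by (auto simp: tuples_def list_all2_append2)

lemma tuples_concat: "(\<And>k. k \<in> set ks \<Longrightarrow> u k \<in> tuples M (G k)) \<Longrightarrow>
    concat (map u ks) \<in> tuples M (concat (map G ks))"
  by (induction ks) (auto intro: tuples_append)

text \<open>Distinctness lets the blocks be returned as a function of the index; a repeated index
  could carry two different blocks.\<close>

lemma tuples_concatE:
  assumes "a \<in> tuples M (concat (map G ks))" "distinct ks"
  obtains u where "a = concat (map u ks)" "\<And>k. k \<in> set ks \<Longrightarrow> u k \<in> tuples M (G k)"
  using assms
proof (induction ks arbitrary: a thesis)
  case Nil
  then show ?case by auto
next
  case (Cons k ks)
  from Cons.prems(2) obtain b c where a: "a = b @ c" "b \<in> tuples M (G k)"
    "c \<in> tuples M (concat (map G ks))"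
    by (auto elim: tuples_appendE)
  obtain u where u: "c = concat (map u ks)" "\<And>k. k \<in> set ks \<Longrightarrow> u k \<in> tuples M (G k)"
    using Cons.IH[OF _ a(3)] Cons.prems(3) by auto
  have "map (u(k := b)) ks = map u ks"
    by (rule map_cong) (use Cons.prems(3) in auto)
  then have "a = concat (map (u(k := b)) (k # ks))"
    using a(1) u(1) by (simp only: list.map concat.simps fun_upd_same)
  then show ?case
    by (rule Cons.prems(1)) (use a u in auto)
qed

lemma tuples_nth: "a \<in> tuples M \<Gamma> \<Longrightarrow> i < length \<Gamma> \<Longrightarrow> a ! i \<in> univ M (\<Gamma> ! i)"
  by (auto simp: tuples_def list_all2_conv_all_nth)

lemma tuples_set: "a \<in> tuples M \<Gamma> \<Longrightarrow> x \<in> set a \<Longrightarrow> \<exists>s\<in>set \<Gamma>. x \<in> univ M s"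
  by (metis in_set_conv_nth tuples_length tuples_nth nth_mem)


section \<open>Renaming of variables\<close>

primrec ren_trm :: "(nat \<Rightarrow> nat) \<Rightarrow> 'f trm \<Rightarrow> 'f trm" where
  "ren_trm \<rho> (Var i) = Var (\<rho> i)"
| "ren_trm \<rho> (App f ts) = App f (map (ren_trm \<rho>) ts)"

text \<open>The map \<rho> is arbitrary, so weakening, permutation and identification of variables
  are all instances. Under a binder, index 0 stays and the other values are shifted.\<close>

primrec ren_fm :: "(nat \<Rightarrow> nat) \<Rightarrow> ('f, 'r, 's) fm \<Rightarrow> ('f, 'r, 's) fm" where
  "ren_fm \<rho> (FEq t u) = FEq (ren_trm \<rho> t) (ren_trm \<rho> u)"
| "ren_fm \<rho> (FRel r ts) = FRel r (map (ren_trm \<rho>) ts)"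
| "ren_fm \<rho> (FNeg \<phi>) = FNeg (ren_fm \<rho> \<phi>)"
| "ren_fm \<rho> (FAnd \<phi> \<psi>) = FAnd (ren_fm \<rho> \<phi>) (ren_fm \<rho> \<psi>)"
| "ren_fm \<rho> (FEx s \<phi>) = FEx s (ren_fm (case_nat 0 (\<lambda>i. Suc (\<rho> i))) \<phi>)"

lemma has_sort_ren:
  assumes "has_sort L \<Gamma> t s" "\<forall>i<length \<Gamma>. \<rho> i < length \<Gamma>' \<and> \<Gamma>' ! \<rho> i = \<Gamma> ! i"
  shows "has_sort L \<Gamma>' (ren_trm \<rho> t) s"
  using assms
proof (induction rule: has_sort.induct)
  case (1 i)
  then show ?case by (metis has_sort.intros(1) ren_trm.simps(1))
next
  case (2 f ss s ts)
  then show ?case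
    by (auto intro!: has_sort.intros(2) simp: list.rel_map elim!: list_all2_mono)
qed

lemma eval_ren:
  assumes "has_sort L \<Gamma> t s" "\<forall>i<length \<Gamma>. e ! i = e' ! \<rho> i"
  shows "eval M e' (ren_trm \<rho> t) = eval M e t"
  using assms
proof (induction rule: has_sort.induct)
  case (2 f ss s ts)
  from 2(2) have "list_all2 (\<lambda>t s. eval M e' (ren_trm \<rho> t) = eval M e t) ts ss"
    by (rule list_all2_mono) (use 2(3) in auto)
  then have "map (eval M e' \<circ> ren_trm \<rho>) ts = map (eval M e) ts"
    by (induction rule: list_all2_induct) auto
  then show ?case by (simp only: ren_trm.simps eval.simps map_map)
qed simp

lemma list_all2_has_sort_ren:
  assumes "list_all2 (has_sort L \<Gamma>) ts ss" "\<forall>i<length \<Gamma>. \<rho> i < length \<Gamma>' \<and> \<Gamma>' ! \<rho> i = \<Gamma> ! i"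
  shows "list_all2 (has_sort L \<Gamma>') (map (ren_trm \<rho>) ts) ss"
  using assms(1) by (auto simp: list.rel_map elim!: list_all2_mono intro: has_sort_ren[OF _ assms(2)])

lemma map_eval_ren:
  assumes "list_all2 (has_sort L \<Gamma>) ts ss" "\<forall>i<length \<Gamma>. e ! i = e' ! \<rho> i"
  shows "map (eval M e') (map (ren_trm \<rho>) ts) = map (eval M e) ts"
  using assms(1) by (induction rule: list_all2_induct) (auto intro: eval_ren[OF _ assms(2)])

lemma wff_ren:
  assumes "wff L \<Gamma> \<phi>" "\<forall>i<length \<Gamma>. \<rho> i < length \<Gamma>' \<and> \<Gamma>' ! \<rho> i = \<Gamma> ! i"
  shows "wff L \<Gamma>' (ren_fm \<rho> \<phi>)"
  using assms
proof (induction \<phi> arbitrary: \<Gamma> \<Gamma>' \<rho>)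
  case (FEx s \<phi>)
  show ?case
    using FEx.prems by (auto intro!: FEx.IH[of "s # \<Gamma>"] simp: less_Suc_eq_0_disj)
qed (auto intro: has_sort_ren list_all2_has_sort_ren)

lemma sat_ren:
  assumes "wff L \<Gamma> \<phi>" "\<forall>i<length \<Gamma>. e ! i = e' ! \<rho> i"
  shows "sat M e' (ren_fm \<rho> \<phi>) \<longleftrightarrow> sat M e \<phi>"
  using assms
proof (induction \<phi> arbitrary: \<Gamma> e e' \<rho>)
  case (FEq t u)
  then show ?case by (auto simp: eval_ren)
next
  case (FRel r ts)
  then obtain ss where "list_all2 (has_sort L \<Gamma>) ts ss" by auto
  from map_eval_ren[OF this FRel.prems(2), of M] show ?case by (simp del: map_map)
next
  case (FEx s \<phi>)
  have "sat M (d # e') (ren_fm (case_nat 0 (\<lambda>i. Suc (\<rho> i))) \<phi>) \<longleftrightarrow> sat M (d # e) \<phi>" for d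
    using FEx.prems by (intro FEx.IH[of "s # \<Gamma>"]) (auto simp: less_Suc_eq_0_disj)
  then show ?case by simp
qed auto

text \<open>A calculus of contexts. The set T indexes a family of valuations, and each coordinate of
  \<open>g t\<close> has to be found at one position of \<open>g' t\<close> that is the same for all
  t. A single renaming then serves the whole family, and the index arithmetic is confined to the
  closure rules below.\<close>

definition emb :: "'t set \<Rightarrow> 's list \<Rightarrow> ('t \<Rightarrow> 'a list) \<Rightarrow> 's list \<Rightarrow> ('t \<Rightarrow> 'a list) \<Rightarrow> bool" where
  "emb T \<Gamma> g \<Gamma>' g' \<longleftrightarrow> (\<forall>t\<in>T. length (g t) = length \<Gamma>) \<and>
     (\<forall>i<length \<Gamma>. \<exists>j<length \<Gamma>'. \<Gamma>' ! j = \<Gamma> ! i \<and> (\<forall>t\<in>T. g t ! i = g' t ! j))"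

lemma emb_fm:
  assumes "emb T \<Gamma> g \<Gamma>' g'" "wff L \<Gamma> \<phi>"
  shows "\<exists>\<phi>'. wff L \<Gamma>' \<phi>' \<and> (\<forall>t\<in>T. sat M (g' t) \<phi>' \<longleftrightarrow> sat M (g t) \<phi>)"
proof -
  obtain \<rho> where "\<forall>i<length \<Gamma>. \<rho> i < length \<Gamma>' \<and> \<Gamma>' ! \<rho> i = \<Gamma> ! i \<and> (\<forall>t\<in>T. g t ! i = g' t ! \<rho> i)"
    using assms(1) unfolding emb_def by metis
  then show ?thesis
    using assms(2) by (intro exI[of _ "ren_fm \<rho> \<phi>"]) (auto intro: wff_ren simp: sat_ren)
qed

lemma emb_Nil: "(\<And>t. t \<in> T \<Longrightarrow> g t = []) \<Longrightarrow> emb T [] g \<Gamma>' g'"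
  by (auto simp: emb_def)

lemma emb_refl: "(\<And>t. t \<in> T \<Longrightarrow> length (g t) = length \<Gamma>) \<Longrightarrow> emb T \<Gamma> g \<Gamma> g"
  by (auto simp: emb_def)

lemma emb_append:
  assumes "emb T \<Gamma>1 g1 \<Gamma>' g'" "emb T \<Gamma>2 g2 \<Gamma>' g'"
  shows "emb T (\<Gamma>1 @ \<Gamma>2) (\<lambda>t. g1 t @ g2 t) \<Gamma>' g'"
  unfolding emb_def
proof (intro conjI ballI allI impI)
  fix i assume i: "i < length (\<Gamma>1 @ \<Gamma>2)"
  show "\<exists>j<length \<Gamma>'. \<Gamma>' ! j = (\<Gamma>1 @ \<Gamma>2) ! i \<and> (\<forall>t\<in>T. (g1 t @ g2 t) ! i = g' t ! j)"
  proof (cases "i < length \<Gamma>1")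
    case True
    then show ?thesis using assms(1) by (auto simp: emb_def nth_append)
  next
    case False
    then have "i - length \<Gamma>1 < length \<Gamma>2" using i by auto
    then show ?thesis using False assms by (auto simp: emb_def nth_append)
  qed
qed (use assms in \<open>auto simp: emb_def\<close>)

lemma emb_left:
  assumes "emb T \<Gamma> g \<Gamma>1 g1" "\<And>t. t \<in> T \<Longrightarrow> length (g1 t) = length \<Gamma>1"
  shows "emb T \<Gamma> g (\<Gamma>1 @ \<Gamma>2) (\<lambda>t. g1 t @ g2 t)"
  unfolding emb_def
proof (intro conjI ballI allI impI)
  fix i assume "i < length \<Gamma>"
  then obtain j where "j < length \<Gamma>1" "\<Gamma>1 ! j = \<Gamma> ! i" "\<forall>t\<in>T. g t ! i = g1 t ! j"
    using assms(1) by (auto simp: emb_def)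
  then show "\<exists>j<length (\<Gamma>1 @ \<Gamma>2). (\<Gamma>1 @ \<Gamma>2) ! j = \<Gamma> ! i \<and> (\<forall>t\<in>T. g t ! i = (g1 t @ g2 t) ! j)"
    using assms(2) by (intro exI[of _ j]) (auto simp: nth_append)
qed (use assms in \<open>auto simp: emb_def\<close>)

lemma emb_right:
  assumes "emb T \<Gamma> g \<Gamma>2 g2" "\<And>t. t \<in> T \<Longrightarrow> length (g1 t) = length \<Gamma>1"
  shows "emb T \<Gamma> g (\<Gamma>1 @ \<Gamma>2) (\<lambda>t. g1 t @ g2 t)"
  unfolding emb_def
proof (intro conjI ballI allI impI)
  fix i assume "i < length \<Gamma>"
  then obtain j where "j < length \<Gamma>2" "\<Gamma>2 ! j = \<Gamma> ! i" "\<forall>t\<in>T. g t ! i = g2 t ! j"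
    using assms(1) by (auto simp: emb_def)
  then show "\<exists>j<length (\<Gamma>1 @ \<Gamma>2). (\<Gamma>1 @ \<Gamma>2) ! j = \<Gamma> ! i \<and> (\<forall>t\<in>T. g t ! i = (g1 t @ g2 t) ! j)"
    using assms(2) by (intro exI[of _ "length \<Gamma>1 + j"]) (auto simp: nth_append)
qed (use assms in \<open>auto simp: emb_def\<close>)

text \<open>Only the set of blocks matters; order and repetitions in \<open>ks\<close> are absorbed
  by the renaming.\<close>

lemma emb_concat:
  assumes "set ks \<subseteq> set vs" "\<And>t k. t \<in> T \<Longrightarrow> k \<in> set vs \<Longrightarrow> length (g t k) = length (G k)"
  shows "emb T (concat (map G ks)) (\<lambda>t. concat (map (g t) ks))
           (concat (map G vs)) (\<lambda>t. concat (map (g t) vs))"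
proof -
  have 1: "emb T (G k) (\<lambda>t. g t k) (concat (map G vs)) (\<lambda>t. concat (map (g t) vs))"
    if "k \<in> set vs" for k
    using that assms(2)
  proof (induction vs)
    case (Cons v vs)
    show ?case
    proof (cases "k = v")
      case True
      have "emb T (G k) (\<lambda>t. g t k) (G v @ concat (map G vs)) (\<lambda>t. g t v @ concat (map (g t) vs))"
        by (rule emb_left) (use True Cons.prems in \<open>auto intro: emb_refl\<close>)
      then show ?thesis by simp
    next
      case False
      have "emb T (G k) (\<lambda>t. g t k) (G v @ concat (map G vs)) (\<lambda>t. g t v @ concat (map (g t) vs))"
        by (rule emb_right[OF Cons.IH]) (use False Cons.prems in auto)
      then show ?thesis by simp
    qed
  qed simp
  show ?thesis
    using assms(1)
  proof (induction ks)
    case (Cons k ks)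
    have "emb T (G k @ concat (map G ks)) (\<lambda>t. g t k @ concat (map (g t) ks))
           (concat (map G vs)) (\<lambda>t. concat (map (g t) vs))"
      by (rule emb_append[OF 1 Cons.IH]) (use Cons.prems in auto)
    then show ?case by simp
  qed (auto intro: emb_Nil)
qed

text \<open>The head of the context is de Bruijn variable 0, so its quantifier has to be the
  innermost one.\<close>

primrec exs :: "'s list \<Rightarrow> ('f, 'r, 's) fm \<Rightarrow> ('f, 'r, 's) fm" where
  "exs [] \<phi> = \<phi>"
| "exs (s # \<Gamma>) \<phi> = exs \<Gamma> (FEx s \<phi>)"

lemma sat_exs: "sat M e (exs \<Gamma> \<phi>) \<longleftrightarrow> (\<exists>a\<in>tuples M \<Gamma>. sat M (a @ e) \<phi>)"
proof (induction \<Gamma> arbitrary: \<phi>)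
  case (Cons s \<Gamma>)
  show ?case
    by (force simp: Cons.IH elim!: tuples_ConsE intro: tuples_Cons[THEN iffD2])
qed simp

lemma wff_exs: "set \<Gamma> \<subseteq> sorts L \<Longrightarrow> wff L (\<Gamma> @ \<Delta>) \<phi> \<Longrightarrow> wff L \<Delta> (exs \<Gamma> \<phi>)"
  by (induction \<Gamma> arbitrary: \<phi>) auto


section \<open>Definable predicates on families of tuples\<close>

locale many_sorted =
  fixes L :: "('f, 'r, 's) lang" and MM :: "('f, 'r, 's, 'a) struc"
  assumes lang: "language L" and struc: "is_struc L MM"
begin

lemma univ_nonempty: "s \<in> sorts L \<Longrightarrow> univ MM s \<noteq> {}"
  using struc by (auto simp: is_struc_def)

lemma sorts_nonempty: "sorts L \<noteq> {}"
  using lang by (auto simp: language_def)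

lemma tuples_nonempty: "set \<Gamma> \<subseteq> sorts L \<Longrightarrow> \<exists>a. a \<in> tuples MM \<Gamma>"
proof (induction \<Gamma>)
  case (Cons s \<Gamma>)
  then obtain a x where "a \<in> tuples MM \<Gamma>" "x \<in> univ MM s"
    using univ_nonempty[of s] by auto
  then show ?case by (intro exI[of _ "x # a"]) simp
qed simp

lemma tuples_elems: "a \<in> tuples MM \<Gamma> \<Longrightarrow> set \<Gamma> \<subseteq> sorts L \<Longrightarrow> set a \<subseteq> elems L MM"
  by (auto simp: elems_def dest!: tuples_set)

text \<open>A variable is now a name v standing for a whole tuple, and formulas are replaced by
  predicates on families of tuples. The index type may be infinite, which is how trees and infinite
  sequences become objects of compactness.\<close>

definition fam :: "('v \<Rightarrow> 's list) \<Rightarrow> ('v \<Rightarrow> 'a list) set" where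
  "fam G = {u. \<forall>v. u v \<in> tuples MM (G v)}"

lemma famD: "u \<in> fam G \<Longrightarrow> u v \<in> tuples MM (G v)"
  by (simp add: fam_def)

lemma fam_concat: "u \<in> fam G \<Longrightarrow> concat (map u ks) \<in> tuples MM (concat (map G ks))"
  by (auto intro: tuples_concat famD)

lemma fam_length: "u \<in> fam G \<Longrightarrow> length (u v) = length (G v)"
  by (rule tuples_length[OF famD])

lemma fam_concat_length: "u \<in> fam G \<Longrightarrow> length (concat (map u ks)) = length (concat (map G ks))"
  by (rule tuples_length[OF fam_concat])

lemma fam_update: "u \<in> fam G \<Longrightarrow> a \<in> tuples MM (G v) \<Longrightarrow> u(v := a) \<in> fam G"
  by (auto simp: fam_def)

lemma fam_nonempty: "(\<And>v. set (G v) \<subseteq> sorts L) \<Longrightarrow> \<exists>u. u \<in> fam G"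
  unfolding fam_def using tuples_nonempty by (auto intro: choice)

lemma fam_option: "u \<in> fam G \<Longrightarrow> a \<in> tuples MM \<Gamma> \<Longrightarrow> case_option a u \<in> fam (case_option \<Gamma> G)"
  by (auto simp: fam_def split: option.split)

text \<open>\<open>V\<close> bounds the blocks of variables on which the predicate depends, \<open>A\<close> the parameters.\<close>

definition dfn :: "'a set \<Rightarrow> ('v \<Rightarrow> 's list) \<Rightarrow> 'v set \<Rightarrow> (('v \<Rightarrow> 'a list) \<Rightarrow> bool) \<Rightarrow> bool" where
  "dfn A G V P \<longleftrightarrow> (\<exists>ks \<Delta> \<phi> b. set ks \<subseteq> V \<and> set \<Delta> \<subseteq> sorts L \<and> wff L (concat (map G ks) @ \<Delta>) \<phi> \<and>
     b \<in> tuples MM \<Delta> \<and> set b \<subseteq> A \<and> (\<forall>u\<in>fam G. P u \<longleftrightarrow> sat MM (concat (map u ks) @ b) \<phi>))"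

lemma dfnI:
  assumes "set ks \<subseteq> V" "set \<Delta> \<subseteq> sorts L" "wff L (concat (map G ks) @ \<Delta>) \<phi>"
    "b \<in> tuples MM \<Delta>" "set b \<subseteq> A" "\<And>u. u \<in> fam G \<Longrightarrow> P u \<longleftrightarrow> sat MM (concat (map u ks) @ b) \<phi>"
  shows "dfn A G V P"
  using assms unfolding dfn_def by blast

lemma dfn_mono: "dfn A G V P \<Longrightarrow> A \<subseteq> A' \<Longrightarrow> V \<subseteq> V' \<Longrightarrow> dfn A' G V' P"
  unfolding dfn_def by (meson subset_trans)

lemma dfn_cong: "dfn A G V P \<Longrightarrow> (\<And>u. u \<in> fam G \<Longrightarrow> P u \<longleftrightarrow> Q u) \<Longrightarrow> dfn A G V Q"
  unfolding dfn_def by meson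

lemma dfn_dep:
  assumes "dfn A G V P" "u \<in> fam G" "u' \<in> fam G" "\<And>v. v \<in> V \<Longrightarrow> u v = u' v"
  shows "P u \<longleftrightarrow> P u'"
proof -
  obtain ks \<Delta> \<phi> b where 1: "set ks \<subseteq> V" "\<forall>u\<in>fam G. P u \<longleftrightarrow> sat MM (concat (map u ks) @ b) \<phi>"
    using assms(1) unfolding dfn_def by blast
  then have "map u ks = map u' ks" using assms(4) by auto
  then show ?thesis using 1 assms(2,3) by metis
qed

lemma dfn_neg: "dfn A G V P \<Longrightarrow> dfn A G V (\<lambda>u. \<not> P u)"
  unfolding dfn_def by (elim exE conjE, rule_tac x = ks in exI, rule_tac x = \<Delta> in exI,
      rule_tac x = "FNeg \<phi>" in exI, rule_tac x = b in exI) auto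

lemma dfn_conj:
  assumes "dfn A G V P" "dfn A G V Q"
  shows "dfn A G V (\<lambda>u. P u \<and> Q u)"
proof -
  obtain ks \<Delta> \<phi> b where 1: "set ks \<subseteq> V" "set \<Delta> \<subseteq> sorts L" "wff L (concat (map G ks) @ \<Delta>) \<phi>"
    "b \<in> tuples MM \<Delta>" "set b \<subseteq> A" "\<forall>u\<in>fam G. P u \<longleftrightarrow> sat MM (concat (map u ks) @ b) \<phi>"
    using assms(1) unfolding dfn_def by blast
  obtain ks' \<Delta>' \<phi>' b' where 2: "set ks' \<subseteq> V" "set \<Delta>' \<subseteq> sorts L" "wff L (concat (map G ks') @ \<Delta>') \<phi>'"
    "b' \<in> tuples MM \<Delta>'" "set b' \<subseteq> A" "\<forall>u\<in>fam G. Q u \<longleftrightarrow> sat MM (concat (map u ks') @ b') \<phi>'"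
    using assms(2) unfolding dfn_def by blast
  note len = fam_length tuples_length[OF 1(4)] tuples_length[OF 2(4)] fam_concat_length
  let ?C = "concat (map G (ks @ ks')) @ (\<Delta> @ \<Delta>')" and ?g = "\<lambda>u. concat (map u (ks @ ks')) @ (b @ b')"
  have e1: "emb (fam G) (concat (map G ks) @ \<Delta>) (\<lambda>u. concat (map u ks) @ b) ?C ?g"
  proof (rule emb_append)
    show "emb (fam G) (concat (map G ks)) (\<lambda>u. concat (map u ks)) ?C ?g"
      by (rule emb_left[OF emb_concat]) (auto simp only: len set_append)
    show "emb (fam G) \<Delta> (\<lambda>u. b) ?C ?g"
      by (rule emb_right[OF emb_left[OF emb_refl]]) (auto simp only: len)
  qed
  have e2: "emb (fam G) (concat (map G ks') @ \<Delta>') (\<lambda>u. concat (map u ks') @ b') ?C ?g"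
  proof (rule emb_append)
    show "emb (fam G) (concat (map G ks')) (\<lambda>u. concat (map u ks')) ?C ?g"
      by (rule emb_left[OF emb_concat]) (auto simp only: len set_append)
    show "emb (fam G) \<Delta>' (\<lambda>u. b') ?C ?g"
      by (rule emb_right[OF emb_right[OF emb_refl]]) (auto simp only: len)
  qed
  obtain \<chi> where \<chi>: "wff L ?C \<chi>" "\<forall>u\<in>fam G. sat MM (?g u) \<chi> \<longleftrightarrow> P u"
    using emb_fm[OF e1 1(3)] 1(6) by metis
  obtain \<chi>' where \<chi>': "wff L ?C \<chi>'" "\<forall>u\<in>fam G. sat MM (?g u) \<chi>' \<longleftrightarrow> Q u"
    using emb_fm[OF e2 2(3)] 2(6) by metis
  show ?thesis
    by (rule dfnI[of "ks @ ks'" _ "\<Delta> @ \<Delta>'" _ "FAnd \<chi> \<chi>'" "b @ b'"])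
      (use 1 2 \<chi> \<chi>' in \<open>auto intro: tuples_append\<close>)
qed

text \<open>The syntax has no truth constant; the sentence used is "some x equals itself", in a sort
  that is known to be nonempty.\<close>

lemma dfn_True: "dfn A G V (\<lambda>u. True)"
proof -
  obtain s where "s \<in> sorts L" using sorts_nonempty by auto
  moreover have "has_sort L [s] (Var 0) s"
    using has_sort.intros(1)[of 0 "[s]"] by simp
  ultimately show ?thesis
    using univ_nonempty[of s]
    by (intro dfnI[of "[]" _ "[]" _ "FEx s (FEq (Var 0) (Var 0))" "[]"]) auto
qed

lemma dfn_const: "dfn A G V (\<lambda>u. c)"
  using dfn_True dfn_neg[OF dfn_True] by (cases c) auto

lemma dfn_disj: "dfn A G V P \<Longrightarrow> dfn A G V Q \<Longrightarrow> dfn A G V (\<lambda>u. P u \<or> Q u)"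
  by (rule dfn_cong[OF dfn_neg[OF dfn_conj[OF dfn_neg dfn_neg]]]) auto

lemma dfn_imp: "dfn A G V P \<Longrightarrow> dfn A G V Q \<Longrightarrow> dfn A G V (\<lambda>u. P u \<longrightarrow> Q u)"
  by (rule dfn_cong[OF dfn_disj[OF dfn_neg]]) auto

lemma dfn_iff: "dfn A G V P \<Longrightarrow> dfn A G V Q \<Longrightarrow> dfn A G V (\<lambda>u. P u \<longleftrightarrow> Q u)"
  by (rule dfn_cong[OF dfn_conj[OF dfn_imp[of A G V P Q] dfn_imp[of A G V Q P]]]) auto

lemma dfn_ball: "finite I \<Longrightarrow> (\<And>i. i \<in> I \<Longrightarrow> dfn A G V (P i)) \<Longrightarrow> dfn A G V (\<lambda>u. \<forall>i\<in>I. P i u)"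
  by (induction rule: finite_induct) (auto intro: dfn_const dfn_conj)

lemma dfn_bex: "finite I \<Longrightarrow> (\<And>i. i \<in> I \<Longrightarrow> dfn A G V (P i)) \<Longrightarrow> dfn A G V (\<lambda>u. \<exists>i\<in>I. P i u)"
  by (rule dfn_cong[OF dfn_neg[OF dfn_ball[OF _ dfn_neg]]]) auto

lemma dfn_reindex:
  assumes "dfn A G V P" "\<And>v. H (g v) = G v"
  shows "dfn A H (g ` V) (\<lambda>w. P (\<lambda>v. w (g v)))"
proof -
  obtain ks \<Delta> \<phi> b where 1: "set ks \<subseteq> V" "set \<Delta> \<subseteq> sorts L" "wff L (concat (map G ks) @ \<Delta>) \<phi>"
    "b \<in> tuples MM \<Delta>" "set b \<subseteq> A" "\<forall>u\<in>fam G. P u \<longleftrightarrow> sat MM (concat (map u ks) @ b) \<phi>"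
    using assms(1) unfolding dfn_def by blast
  have "H \<circ> g = G" using assms(2) by auto
  moreover have "(\<lambda>v. w (g v)) \<in> fam G" if "w \<in> fam H" for w
    using that unfolding fam_def assms(2)[symmetric] by simp
  ultimately show ?thesis
    using 1 by (intro dfnI[of "map g ks" _ \<Delta> _ \<phi> b]) (auto simp: comp_def)
qed

text \<open>The bound block is called \<open>None\<close>, the remaining ones \<open>Some v\<close>,
  so the body is a predicate over a larger family and needs no substitution.\<close>

lemma dfn_ex:
  assumes "dfn A (case_option \<Gamma> G) V' (\<lambda>w. P (w None) (\<lambda>v. w (Some v)))" "set \<Gamma> \<subseteq> sorts L"
    "V' \<subseteq> insert None (Some ` V)"
  shows "dfn A G V (\<lambda>u. \<exists>x\<in>tuples MM \<Gamma>. P x u)"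
proof -
  let ?H = "case_option \<Gamma> G"
  obtain ks \<Delta> \<phi> b where 1: "set ks \<subseteq> V'" "set \<Delta> \<subseteq> sorts L"
    "wff L (concat (map ?H ks) @ \<Delta>) \<phi>"
    "b \<in> tuples MM \<Delta>" "set b \<subseteq> A"
    "\<forall>w\<in>fam ?H. P (w None) (\<lambda>v. w (Some v)) \<longleftrightarrow> sat MM (concat (map w ks) @ b) \<phi>"
    using assms(1) unfolding dfn_def by blast
  have ks: "set ks \<subseteq> insert None (Some ` V)"
    using 1(1) assms(3) by auto
  \<comment> \<open>The bound block may occur anywhere in \<open>ks\<close>, any number of times, or
    not at all. It is removed everywhere and put once in front, where \<open>exs\<close> can bind
    it.\<close>
  let ?ks = "map the (filter (\<lambda>v. v \<noteq> None) ks)"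
  let ?vs = "None # map Some ?ks"
  have "emb (fam ?H) (concat (map ?H ks) @ \<Delta>) (\<lambda>w. concat (map w ks) @ b)
      (concat (map ?H ?vs) @ \<Delta>) (\<lambda>w. concat (map w ?vs) @ b)"
  proof (intro emb_append)
    show "emb (fam ?H) (concat (map ?H ks)) (\<lambda>w. concat (map w ks))
        (concat (map ?H ?vs) @ \<Delta>) (\<lambda>w. concat (map w ?vs) @ b)"
    proof (intro emb_left[OF emb_concat])
      show "set ks \<subseteq> set ?vs"
      proof
        fix v assume "v \<in> set ks"
        then show "v \<in> set ?vs" by (cases v) (auto simp: image_iff intro!: bexI[of _ v])
      qed
    qed (erule fam_length fam_concat_length)+
    show "emb (fam ?H) \<Delta> (\<lambda>w. b) (concat (map ?H ?vs) @ \<Delta>) (\<lambda>w. concat (map w ?vs) @ b)"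
      by (intro emb_right[OF emb_refl] fam_concat_length tuples_length[OF 1(4)])
  qed
  from emb_fm[OF this 1(3)] obtain \<chi> where
    \<chi>: "wff L (concat (map ?H ?vs) @ \<Delta>) \<chi>"
      "\<forall>w\<in>fam ?H. sat MM (concat (map w ?vs) @ b) \<chi> \<longleftrightarrow> sat MM (concat (map w ks) @ b) \<phi>"
    by blast
  have P: "P x u \<longleftrightarrow> sat MM (x @ concat (map u ?ks) @ b) \<chi>" if "x \<in> tuples MM \<Gamma>" "u \<in> fam G" for x u
    using fam_option[OF that(2,1)] 1(6) \<chi>(2) by (force simp: comp_def)
  show ?thesis
  proof (rule dfnI[of ?ks _ \<Delta> _ "exs \<Gamma> \<chi>" b])
    show "set ?ks \<subseteq> V" using ks by auto
    show "wff L (concat (map G ?ks) @ \<Delta>) (exs \<Gamma> \<chi>)"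
      using \<chi>(1) assms(2) by (intro wff_exs) (auto simp: comp_def)
    show "(\<exists>x\<in>tuples MM \<Gamma>. P x u) = sat MM (concat (map u ?ks) @ b) (exs \<Gamma> \<chi>)" if "u \<in> fam G" for u
      using P that by (auto simp: sat_exs)
  qed (use 1 in auto)
qed

lemma dfn_all:
  assumes "dfn A (case_option \<Gamma> G) V' (\<lambda>w. P (w None) (\<lambda>v. w (Some v)))" "set \<Gamma> \<subseteq> sorts L"
    "V' \<subseteq> insert None (Some ` V)"
  shows "dfn A G V (\<lambda>u. \<forall>x\<in>tuples MM \<Gamma>. P x u)"
  by (rule dfn_cong[OF dfn_neg[OF dfn_ex[OF dfn_neg[OF assms(1)] assms(2,3)]]]) auto

lemma dfn_pform:
  assumes "dfn A G (set vs) P"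
  shows "\<exists>\<psi>\<in>pforms L MM (concat (map G vs)) A.
    \<forall>u\<in>fam G. concat (map u vs) \<in> solutions MM (concat (map G vs)) \<psi> \<longleftrightarrow> P u"
proof -
  obtain ks \<Delta> \<phi> b where 1: "set ks \<subseteq> set vs" "set \<Delta> \<subseteq> sorts L" "wff L (concat (map G ks) @ \<Delta>) \<phi>"
    "b \<in> tuples MM \<Delta>" "set b \<subseteq> A" "\<forall>u\<in>fam G. P u \<longleftrightarrow> sat MM (concat (map u ks) @ b) \<phi>"
    using assms(1) unfolding dfn_def by blast
  note len = fam_length tuples_length[OF 1(4)] fam_concat_length
  have "emb (fam G) (concat (map G ks) @ \<Delta>) (\<lambda>u. concat (map u ks) @ b)
      (concat (map G vs) @ \<Delta>) (\<lambda>u. concat (map u vs) @ b)"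
  proof (intro emb_append)
    show "emb (fam G) (concat (map G ks)) (\<lambda>u. concat (map u ks))
        (concat (map G vs) @ \<Delta>) (\<lambda>u. concat (map u vs) @ b)"
      using 1(1) by (intro emb_left[OF emb_concat] len) auto
    show "emb (fam G) \<Delta> (\<lambda>u. b) (concat (map G vs) @ \<Delta>) (\<lambda>u. concat (map u vs) @ b)"
      by (intro emb_right[OF emb_refl] len)
  qed
  from emb_fm[OF this 1(3)] obtain \<chi> where
    \<chi>: "wff L (concat (map G vs) @ \<Delta>) \<chi>"
      "\<forall>u\<in>fam G. sat MM (concat (map u vs) @ b) \<chi> \<longleftrightarrow> sat MM (concat (map u ks) @ b) \<phi>"
    by blast
  show ?thesis
    using 1 \<chi> by (intro bexI[of _ "(\<chi>, b)"])
      (auto simp: pforms_def solutions_def intro: fam_concat)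
qed

end

section \<open>Types\<close>

definition sols :: "('f, 'r, 's, 'a) struc \<Rightarrow> 's list \<Rightarrow> (('f, 'r, 's) fm \<times> 'a list) set \<Rightarrow> 'a list set" where
  "sols MM \<Gamma> F = {a \<in> tuples MM \<Gamma>. \<forall>\<psi>\<in>F. a \<in> solutions MM \<Gamma> \<psi>}"

text \<open>Ultrafilters are avoided: a global type is obtained from a partition regular notion \<open>pos\<close> of
  largeness all of whose finite parts it respects.  ``Meets the tuples of \<open>N\<close>'' gives coheirs over
  \<open>N\<close>, ``contains infinitely many \<open>t i\<close>'' gives nonprincipal averages of the sequence \<open>t\<close>.\<close>

definition part_reg :: "('a set \<Rightarrow> bool) \<Rightarrow> bool" where
  "part_reg pos \<longleftrightarrow> \<not> pos {} \<and> (\<forall>S T. pos (S \<union> T) \<longrightarrow> pos S \<or> pos T) \<and> (\<forall>S T. pos S \<longrightarrow> S \<subseteq> T \<longrightarrow> pos T)"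

lemma part_reg_meets: "part_reg (\<lambda>S. S \<inter> X \<noteq> {})"
  by (auto simp: part_reg_def)

lemma part_reg_infinite:
  fixes t :: "'i \<Rightarrow> 'b"
  shows "part_reg (\<lambda>S. infinite {i. t i \<in> S})"
  unfolding part_reg_def
proof (intro conjI allI impI)
  fix S T :: "'b set" assume "infinite {i. t i \<in> S \<union> T}"
  then show "infinite {i. t i \<in> S} \<or> infinite {i. t i \<in> T}"
    by (simp add: Collect_disj_eq)
next
  fix S T :: "'b set" assume "infinite {i. t i \<in> S}" "S \<subseteq> T"
  then show "infinite {i. t i \<in> T}"
    using finite_subset[of "{i. t i \<in> S}" "{i. t i \<in> T}"] by blast
qed simp

context many_sorted
begin

definition ptype :: "('a list set \<Rightarrow> bool) \<Rightarrow> 's list \<Rightarrow> 'a set \<Rightarrow> (('f, 'r, 's) fm \<times> 'a list) set \<Rightarrow> bool" where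
  "ptype pos \<Gamma> A q \<longleftrightarrow> q \<subseteq> pforms L MM \<Gamma> A \<and> (\<forall>F. finite F \<longrightarrow> F \<subseteq> q \<longrightarrow> pos (sols MM \<Gamma> F)) \<and>
     (\<forall>(\<phi>, b)\<in>pforms L MM \<Gamma> A. (\<phi>, b) \<in> q \<or> (FNeg \<phi>, b) \<in> q)"

lemma pforms_neg: "(\<phi>, b) \<in> pforms L MM \<Gamma> A \<Longrightarrow> (FNeg \<phi>, b) \<in> pforms L MM \<Gamma> A"
  by (auto simp: pforms_def)

lemma pforms_mono: "A \<subseteq> B \<Longrightarrow> pforms L MM \<Gamma> A \<subseteq> pforms L MM \<Gamma> B"
  by (auto simp: pforms_def)

text \<open>Zorn's lemma gives a maximal set all of whose finite parts have large solution sets. If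
  neither \<phi> nor its negation belonged to it, finite parts F and F' would witness this. The
  large solution set of F \<union> F' would then be covered by two sets that are not large, against
  partition regularity.\<close>

lemma ptype_exists:
  assumes "part_reg pos" "\<Phi> \<subseteq> pforms L MM \<Gamma> A"
    "\<And>F. finite F \<Longrightarrow> F \<subseteq> \<Phi> \<Longrightarrow> pos (sols MM \<Gamma> F)"
  obtains q where "ptype pos \<Gamma> A q" "\<Phi> \<subseteq> q"
proof -
  let ?fp = "\<lambda>q. \<forall>F. finite F \<longrightarrow> F \<subseteq> q \<longrightarrow> pos (sols MM \<Gamma> F)"
  let ?Q = "{q. \<Phi> \<subseteq> q \<and> q \<subseteq> pforms L MM \<Gamma> A \<and> ?fp q}"
  have "\<exists>q\<in>?Q. \<forall>X\<in>?Q. q \<subseteq> X \<longrightarrow> X = q"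
  proof (rule subset_Zorn_nonempty)
    show "?Q \<noteq> {}" using assms(2,3) by auto
    fix C assume C: "C \<noteq> {}" "subset.chain ?Q C"
    then have "C \<subseteq> ?Q" by (simp add: subset.chain_def)
    have "pos (sols MM \<Gamma> F)" if F: "finite F" "F \<subseteq> \<Union>C" for F
    proof -
      obtain X where "X \<in> C" "F \<subseteq> X"
        using finite_subset_Union_chain[OF F C] by blast
      then show ?thesis using \<open>C \<subseteq> ?Q\<close> F by auto
    qed
    then have "?fp (\<Union>C)" by blast
    moreover obtain X where X: "X \<in> C" using C(1) by blast
    have "\<Phi> \<subseteq> X" using X \<open>C \<subseteq> ?Q\<close> by auto
    then have "\<Phi> \<subseteq> \<Union>C" using X by auto
    moreover have "\<Union>C \<subseteq> pforms L MM \<Gamma> A" using \<open>C \<subseteq> ?Q\<close> by auto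
    ultimately show "\<Union>C \<in> ?Q" by simp
  qed
  then obtain q where qQ: "q \<in> ?Q" and max: "\<forall>X\<in>?Q. q \<subseteq> X \<longrightarrow> X = q" by (elim bexE)
  then have q: "\<Phi> \<subseteq> q" "q \<subseteq> pforms L MM \<Gamma> A" "?fp q" by simp_all
  have wit: "\<exists>F. finite F \<and> F \<subseteq> q \<and> \<not> pos (sols MM \<Gamma> (insert \<psi> F))"
    if "\<psi> \<in> pforms L MM \<Gamma> A" "\<psi> \<notin> q" for \<psi>
  proof (rule ccontr)
    assume *: "\<nexists>F. finite F \<and> F \<subseteq> q \<and> \<not> pos (sols MM \<Gamma> (insert \<psi> F))"
    have "pos (sols MM \<Gamma> F)" if F: "finite F" "F \<subseteq> insert \<psi> q" for F
    proof -
      have "pos (sols MM \<Gamma> (insert \<psi> (F - {\<psi>})))"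
        by (rule ccontr, rule notE[OF *], rule exI[of _ "F - {\<psi>}"]) (use F in auto)
      moreover have "sols MM \<Gamma> (insert \<psi> (F - {\<psi>})) \<subseteq> sols MM \<Gamma> F"
        by (auto simp: sols_def)
      ultimately show ?thesis using assms(1) unfolding part_reg_def by blast
    qed
    then have "insert \<psi> q \<in> ?Q" using q that by auto
    from max[rule_format, OF this] show False using that(2) by blast
  qed
  have "(\<phi>, b) \<in> q \<or> (FNeg \<phi>, b) \<in> q" if pf: "(\<phi>, b) \<in> pforms L MM \<Gamma> A" for \<phi> b
  proof (rule ccontr)
    assume "\<not> ((\<phi>, b) \<in> q \<or> (FNeg \<phi>, b) \<in> q)"
    then obtain F F' where F: "finite F" "F \<subseteq> q" "\<not> pos (sols MM \<Gamma> (insert (\<phi>, b) F))"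
      "finite F'" "F' \<subseteq> q" "\<not> pos (sols MM \<Gamma> (insert (FNeg \<phi>, b) F'))"
      using wit[OF pf] wit[OF pforms_neg[OF pf]] by blast
    have "pos (sols MM \<Gamma> (F \<union> F'))" using F q(3) by simp
    moreover have "sols MM \<Gamma> (F \<union> F') \<subseteq> sols MM \<Gamma> (insert (\<phi>, b) F) \<union> sols MM \<Gamma> (insert (FNeg \<phi>, b) F')"
      by (auto simp: sols_def solutions_def)
    ultimately show False using assms(1) F unfolding part_reg_def by meson
  qed
  then have "ptype pos \<Gamma> A q" using q by (auto simp: ptype_def)
  then show thesis using q(1) that by blast
qed

lemma ptype_complete: "part_reg pos \<Longrightarrow> ptype pos \<Gamma> A q \<Longrightarrow> q \<in> complete_types L MM \<Gamma> A"
proof -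
  assume pos: "part_reg pos" and q: "ptype pos \<Gamma> A q"
  have "consistent MM \<Gamma> q"
    unfolding consistent_def
  proof (intro allI impI)
    fix F assume "finite F \<and> F \<subseteq> q"
    then have "pos (sols MM \<Gamma> F)" using q by (simp add: ptype_def)
    then have "sols MM \<Gamma> F \<noteq> {}" using pos by (auto simp: part_reg_def)
    then show "\<exists>a\<in>tuples MM \<Gamma>. \<forall>\<psi>\<in>F. a \<in> solutions MM \<Gamma> \<psi>" by (auto simp: sols_def)
  qed
  then show ?thesis using q by (auto simp: ptype_def complete_types_def)
qed

lemma type_of_complete: "a \<in> tuples MM \<Gamma> \<Longrightarrow> type_of L MM \<Gamma> a A \<in> complete_types L MM \<Gamma> A"
  by (auto simp: complete_types_def type_of_def consistent_def solutions_def pforms_neg)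

definition defble :: "'s list \<Rightarrow> 'a set \<Rightarrow> 'a list set \<Rightarrow> bool" where
  "defble \<Gamma> A S \<longleftrightarrow> (\<exists>\<psi>\<in>pforms L MM \<Gamma> A. solutions MM \<Gamma> \<psi> = S)"

text \<open>Membership of a definable set rather than of a formula defining it, so that types can be
  handled like ultrafilters of definable sets; \<open>inq_iff\<close> leads back to
  formulas.\<close>

definition inq :: "'s list \<Rightarrow> (('f, 'r, 's) fm \<times> 'a list) set \<Rightarrow> 'a list set \<Rightarrow> bool" where
  "inq \<Gamma> q S \<longleftrightarrow> (\<exists>\<psi>\<in>q. solutions MM \<Gamma> \<psi> = S)"

lemma defble_mono: "defble \<Gamma> A S \<Longrightarrow> A \<subseteq> B \<Longrightarrow> defble \<Gamma> B S"
  unfolding defble_def using pforms_mono by blast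

lemma defble_subset: "defble \<Gamma> A S \<Longrightarrow> S \<subseteq> tuples MM \<Gamma>"
  by (auto simp: defble_def solutions_def)

lemma defble_solutions: "\<psi> \<in> pforms L MM \<Gamma> A \<Longrightarrow> defble \<Gamma> A (solutions MM \<Gamma> \<psi>)"
  by (auto simp: defble_def)

lemma solutions_neg: "solutions MM \<Gamma> (FNeg \<phi>, b) = tuples MM \<Gamma> - solutions MM \<Gamma> (\<phi>, b)"
  by (auto simp: solutions_def)

lemma ptype_pos:
  assumes "part_reg pos" "ptype pos \<Gamma> A q" "finite I" "\<And>i. i \<in> I \<Longrightarrow> inq \<Gamma> q (S i)"
  shows "pos {a \<in> tuples MM \<Gamma>. \<forall>i\<in>I. a \<in> S i}"
proof -
  obtain f where f: "\<And>i. i \<in> I \<Longrightarrow> f i \<in> q \<and> solutions MM \<Gamma> (f i) = S i"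
    using assms(4) unfolding inq_def by metis
  have "pos (sols MM \<Gamma> (f ` I))" using assms(2,3) f unfolding ptype_def by blast
  moreover have "sols MM \<Gamma> (f ` I) = {a \<in> tuples MM \<Gamma>. \<forall>i\<in>I. a \<in> S i}"
    using f by (auto simp: sols_def)
  ultimately show ?thesis by simp
qed

lemma ptype_pos1: "part_reg pos \<Longrightarrow> ptype pos \<Gamma> A q \<Longrightarrow> inq \<Gamma> q S \<Longrightarrow> pos (S \<inter> tuples MM \<Gamma>)"
  using ptype_pos[of pos \<Gamma> A q "{()}" "\<lambda>_. S"] by (simp add: Int_def conj_commute)

lemma inq_neg:
  assumes "part_reg pos" "ptype pos \<Gamma> A q" "defble \<Gamma> A S"
  shows "inq \<Gamma> q (tuples MM \<Gamma> - S) \<longleftrightarrow> \<not> inq \<Gamma> q S"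
proof
  assume "inq \<Gamma> q (tuples MM \<Gamma> - S)"
  moreover have "{a \<in> tuples MM \<Gamma>. \<forall>i\<in>UNIV. a \<in> (if i then S else tuples MM \<Gamma> - S)} = {}"
    by (auto split: if_splits)
  ultimately show "\<not> inq \<Gamma> q S"
    using ptype_pos[OF assms(1,2), of UNIV "\<lambda>i. if i then S else tuples MM \<Gamma> - S"] assms(1)
    unfolding part_reg_def by (metis (full_types) finite)
next
  assume n: "\<not> inq \<Gamma> q S"
  obtain \<phi> b where \<psi>: "(\<phi>, b) \<in> pforms L MM \<Gamma> A" "solutions MM \<Gamma> (\<phi>, b) = S"
    using assms(3) by (auto simp: defble_def)
  then have "(\<phi>, b) \<notin> q" using n unfolding inq_def by blast
  then have "(FNeg \<phi>, b) \<in> q" using \<psi>(1) assms(2) unfolding ptype_def by blast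
  then show "inq \<Gamma> q (tuples MM \<Gamma> - S)"
    unfolding inq_def \<psi>(2)[symmetric] solutions_neg[symmetric] by blast
qed

lemma inq_iff:
  assumes "part_reg pos" "ptype pos \<Gamma> A q" "\<psi> \<in> pforms L MM \<Gamma> A"
  shows "inq \<Gamma> q (solutions MM \<Gamma> \<psi>) \<longleftrightarrow> \<psi> \<in> q"
proof
  assume i: "inq \<Gamma> q (solutions MM \<Gamma> \<psi>)"
  show "\<psi> \<in> q"
  proof (rule ccontr)
    assume "\<psi> \<notin> q"
    obtain \<phi> b where \<psi>: "\<psi> = (\<phi>, b)" by (cases \<psi>)
    then have "(FNeg \<phi>, b) \<in> q" using assms(2,3) \<open>\<psi> \<notin> q\<close> unfolding ptype_def by blast
    then have "inq \<Gamma> q (tuples MM \<Gamma> - solutions MM \<Gamma> \<psi>)"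
      unfolding inq_def \<psi> solutions_neg[symmetric] by blast
    then show False using i inq_neg[OF assms(1,2)] defble_solutions[OF assms(3)] by blast
  qed
qed (auto simp: inq_def)

text \<open>The type q may be global; only sets definable over A are tested, so this is realisation
  of the restriction of q to A.\<close>

definition realizes :: "'s list \<Rightarrow> 'a set \<Rightarrow> (('f, 'r, 's) fm \<times> 'a list) set \<Rightarrow> 'a list \<Rightarrow> bool" where
  "realizes \<Gamma> A q a \<longleftrightarrow> a \<in> tuples MM \<Gamma> \<and> (\<forall>S. defble \<Gamma> A S \<longrightarrow> inq \<Gamma> q S \<longrightarrow> a \<in> S)"

lemma realizes_iff:
  assumes "part_reg pos" "ptype pos \<Gamma> B q" "A \<subseteq> B" "realizes \<Gamma> A q a" "defble \<Gamma> A S"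
  shows "a \<in> S \<longleftrightarrow> inq \<Gamma> q S"
proof -
  have "defble \<Gamma> A (tuples MM \<Gamma> - S)"
    using assms(5) unfolding defble_def by (metis pforms_neg solutions_neg surj_pair)
  then show ?thesis
    using assms inq_neg[OF assms(1,2) defble_mono[OF assms(5,3)]] unfolding realizes_def by blast
qed

lemma ptype_existsD:
  assumes "part_reg pos" "\<And>i. i \<in> I \<Longrightarrow> defble \<Gamma> A (S i)"
    "\<And>J. finite J \<Longrightarrow> J \<subseteq> I \<Longrightarrow> pos {a \<in> tuples MM \<Gamma>. \<forall>i\<in>J. a \<in> S i}"
  obtains q where "ptype pos \<Gamma> A q" "\<And>i. i \<in> I \<Longrightarrow> inq \<Gamma> q (S i)"
proof -
  obtain f where f: "\<And>i. i \<in> I \<Longrightarrow> f i \<in> pforms L MM \<Gamma> A \<and> solutions MM \<Gamma> (f i) = S i"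
    using assms(2) unfolding defble_def by metis
  have "pos (sols MM \<Gamma> F)" if F: "finite F" "F \<subseteq> f ` I" for F
  proof -
    obtain J where J: "J \<subseteq> I" "finite J" "F = f ` J" using F by (meson finite_subset_image)
    then have "sols MM \<Gamma> F = {a \<in> tuples MM \<Gamma>. \<forall>i\<in>J. a \<in> S i}"
      using f by (auto simp: sols_def)
    then show ?thesis using assms(3)[OF J(2,1)] by simp
  qed
  moreover have "f ` I \<subseteq> pforms L MM \<Gamma> A" using f by auto
  ultimately obtain q where q: "ptype pos \<Gamma> A q" "f ` I \<subseteq> q"
    using ptype_exists[OF assms(1)] by metis
  have "inq \<Gamma> q (S i)" if "i \<in> I" for i
    using f[OF that] q(2) that unfolding inq_def by blast
  then show thesis using q(1) that by blast
qed

lemma defbleI: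
  assumes "dfn A (\<lambda>_::unit. \<Gamma>) UNIV (\<lambda>u. P (u ()))"
  shows "defble \<Gamma> A {a \<in> tuples MM \<Gamma>. P a}"
proof -
  obtain \<psi> where \<psi>: "\<psi> \<in> pforms L MM (concat (map (\<lambda>_::unit. \<Gamma>) [()])) A"
    "\<forall>u\<in>fam (\<lambda>_::unit. \<Gamma>). concat (map u [()]) \<in> solutions MM (concat (map (\<lambda>_::unit. \<Gamma>) [()])) \<psi> \<longleftrightarrow> P (u ())"
    using dfn_pform[of A "\<lambda>_::unit. \<Gamma>" "[()]" "\<lambda>u. P (u ())"] assms by (auto simp: UNIV_unit)
  have "a \<in> solutions MM \<Gamma> \<psi> \<longleftrightarrow> P a" if "a \<in> tuples MM \<Gamma>" for a
    using \<psi>(2)[rule_format, of "\<lambda>_. a"] that by (simp add: fam_def)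
  then have "solutions MM \<Gamma> \<psi> = {a \<in> tuples MM \<Gamma>. P a}"
    by (auto simp: solutions_def)
  then show ?thesis using \<psi>(1) by (auto simp: defble_def)
qed

lemma dfn_mem:
  assumes "defble (G v) A S" "v \<in> V"
  shows "dfn A G V (\<lambda>u. u v \<in> S)"
proof -
  obtain \<phi> b \<Delta> where "S = solutions MM (G v) (\<phi>, b)" "set \<Delta> \<subseteq> sorts L" "wff L (G v @ \<Delta>) \<phi>"
    "b \<in> tuples MM \<Delta>" "set b \<subseteq> A"
    using assms by (auto simp: defble_def pforms_def)
  then show ?thesis
    using assms(2) by (intro dfnI[of "[v]" _ \<Delta> _ \<phi> b]) (auto simp: solutions_def famD)
qed

lemma dfn_eq_const:
  assumes "b \<in> tuples MM (G v)" "set b \<subseteq> A" "v \<in> V" "set (G v) \<subseteq> sorts L"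
  shows "dfn A G V (\<lambda>u. u v = b)"
proof -
  let ?n = "length (G v)"
  have "dfn A G V (\<lambda>u. u v ! i = b ! i)" if i: "i < ?n" for i
  proof (rule dfnI[of "[v]" _ "G v" _ "FEq (Var i) (Var (?n + i))" b])
    have "has_sort L (G v @ G v) (Var i) (G v ! i)" "has_sort L (G v @ G v) (Var (?n + i)) (G v ! i)"
      using has_sort.intros(1)[of i "G v @ G v"] has_sort.intros(1)[of "?n + i" "G v @ G v"] i
      by (auto simp: nth_append)
    then show "wff L (concat (map G [v]) @ G v) (FEq (Var i) (Var (?n + i)))" by auto
  qed (use i assms in \<open>auto simp: nth_append fam_length\<close>)
  then have "dfn A G V (\<lambda>u. \<forall>i\<in>{..<?n}. u v ! i = b ! i)"
    by (intro dfn_ball) auto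
  then show ?thesis
    by (rule dfn_cong) (use assms(1) in \<open>auto simp: list_eq_iff_nth_eq fam_length tuples_length\<close>)
qed

text \<open>Parameters are substituted semantically: the block is quantified and required to equal
  b.\<close>

lemma dfn_param:
  assumes "dfn A (case_option \<Gamma> G) V' (\<lambda>w. P (w None) (\<lambda>v. w (Some v)))" "set \<Gamma> \<subseteq> sorts L"
    "V' \<subseteq> insert None (Some ` V)" "b \<in> tuples MM \<Gamma>" "set b \<subseteq> A"
  shows "dfn A G V (\<lambda>u. P b u)"
proof -
  have "dfn A (case_option \<Gamma> G) (insert None V') (\<lambda>w. w None = b \<and> P (w None) (\<lambda>v. w (Some v)))"
    by (intro dfn_conj dfn_eq_const dfn_mono[OF assms(1)]) (use assms in auto)
  then have "dfn A G V (\<lambda>u. \<exists>x\<in>tuples MM \<Gamma>. x = b \<and> P x u)"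
    by (rule dfn_ex) (use assms(2,3) in auto)
  then show ?thesis
    by (rule dfn_cong) (use assms(4) in auto)
qed

lemma dfn_finite:
  assumes "dfn A G V P"
  obtains V' where "finite V'" "V' \<subseteq> V" "dfn A G V' P"
proof -
  obtain ks \<Delta> \<phi> b where "set ks \<subseteq> V" "set \<Delta> \<subseteq> sorts L" "wff L (concat (map G ks) @ \<Delta>) \<phi>"
    "b \<in> tuples MM \<Delta>" "set b \<subseteq> A" "\<forall>u\<in>fam G. P u \<longleftrightarrow> sat MM (concat (map u ks) @ b) \<phi>"
    using assms unfolding dfn_def by blast
  then show thesis by (intro that[of "set ks"] dfnI[of ks _ \<Delta> _ \<phi> b]) auto
qed

text \<open>The existential quantifier ranges over whole, possibly infinite families. A formula sees
  finitely many blocks, so only these are bound; the others are filled from an arbitrary member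
  \<open>u0\<close>.\<close>

lemma defble_project:
  assumes "dfn A G V Q" "\<And>w. set (G w) \<subseteq> sorts L"
  shows "defble (G v) A {d \<in> tuples MM (G v). \<exists>u\<in>fam G. u v = d \<and> Q u}"
proof -
  obtain ks \<Delta> \<phi> b where 1: "set ks \<subseteq> V" "set \<Delta> \<subseteq> sorts L" "wff L (concat (map G ks) @ \<Delta>) \<phi>"
    "b \<in> tuples MM \<Delta>" "set b \<subseteq> A" "\<forall>u\<in>fam G. Q u \<longleftrightarrow> sat MM (concat (map u ks) @ b) \<phi>"
    using assms(1) unfolding dfn_def by blast
  \<comment> \<open>Repetitions have to go before \<open>tuples_concatE\<close> can cut a value into
    blocks. The block v stays free and is put last.\<close>
  let ?k = "remdups (filter (\<lambda>w. w \<noteq> v) ks)"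
  have "emb (fam G) (concat (map G ks) @ \<Delta>) (\<lambda>u. concat (map u ks) @ b)
      (concat (map G (?k @ [v])) @ \<Delta>) (\<lambda>u. concat (map u (?k @ [v])) @ b)"
  proof (intro emb_append)
    show "emb (fam G) (concat (map G ks)) (\<lambda>u. concat (map u ks))
        (concat (map G (?k @ [v])) @ \<Delta>) (\<lambda>u. concat (map u (?k @ [v])) @ b)"
      by (intro emb_left[OF emb_concat]) (erule fam_length fam_concat_length | force)+
    show "emb (fam G) \<Delta> (\<lambda>u. b) (concat (map G (?k @ [v])) @ \<Delta>) (\<lambda>u. concat (map u (?k @ [v])) @ b)"
      by (intro emb_right[OF emb_refl] tuples_length[OF 1(4)]) (erule fam_concat_length)
  qed
  from emb_fm[OF this 1(3)] obtain \<chi> where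
    \<chi>: "wff L (concat (map G (?k @ [v])) @ \<Delta>) \<chi>"
      "\<forall>u\<in>fam G. sat MM (concat (map u (?k @ [v])) @ b) \<chi> \<longleftrightarrow> sat MM (concat (map u ks) @ b) \<phi>"
    by blast
  then have \<chi>Q: "\<forall>u\<in>fam G. sat MM (concat (map u (?k @ [v])) @ b) \<chi> \<longleftrightarrow> Q u"
    using 1(6) by blast
  obtain u0 where u0: "u0 \<in> fam G" using fam_nonempty[of G, OF assms(2)] by blast
  have "d \<in> solutions MM (G v) (exs (concat (map G ?k)) \<chi>, b) \<longleftrightarrow> (\<exists>u\<in>fam G. u v = d \<and> Q u)"
    if d: "d \<in> tuples MM (G v)" for d
  proof
    assume "d \<in> solutions MM (G v) (exs (concat (map G ?k)) \<chi>, b)"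
    then obtain a where a: "a \<in> tuples MM (concat (map G ?k))" "sat MM (a @ d @ b) \<chi>"
      by (auto simp: solutions_def sat_exs)
    obtain u where u: "a = concat (map u ?k)" "\<And>k. k \<in> set ?k \<Longrightarrow> u k \<in> tuples MM (G k)"
      by (rule tuples_concatE[OF a(1)]) auto
    define u' where "u' w = (if w = v then d else if w \<in> set ?k then u w else u0 w)" for w
    have u': "u' \<in> fam G" using u(2) u0 d unfolding fam_def u'_def by auto
    have "map u' ?k = map u ?k" by (rule map_cong) (auto simp: u'_def)
    then have "concat (map u' (?k @ [v])) = a @ d"
      unfolding map_append concat_append u(1) by (simp only:) (simp add: u'_def)
    then have "sat MM (concat (map u' (?k @ [v])) @ b) \<chi>" using a(2) by (simp only: append_assoc)
    then have "Q u'" using \<chi>Q u' by blast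
    moreover have "u' v = d" by (simp add: u'_def)
    ultimately show "\<exists>u\<in>fam G. u v = d \<and> Q u" using u' by blast
  next
    assume "\<exists>u\<in>fam G. u v = d \<and> Q u"
    then obtain u where u: "u \<in> fam G" "u v = d" "Q u" by blast
    then have "sat MM (concat (map u (?k @ [v])) @ b) \<chi>" using \<chi>Q by blast
    then have "sat MM (concat (map u ?k) @ d @ b) \<chi>" using u(2) by simp
    with u have "u \<in> fam G" "u v = d" "sat MM (concat (map u ?k) @ d @ b) \<chi>" by auto
    then show "d \<in> solutions MM (G v) (exs (concat (map G ?k)) \<chi>, b)"
      using d fam_concat[of u G ?k] by (auto simp: solutions_def sat_exs)
  qed
  then have "solutions MM (G v) (exs (concat (map G ?k)) \<chi>, b) =
      {d \<in> tuples MM (G v). \<exists>u\<in>fam G. u v = d \<and> Q u}"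
    by (auto simp: solutions_def)
  moreover have "wff L (G v @ \<Delta>) (exs (concat (map G ?k)) \<chi>)"
    using \<chi>(1) assms(2) by (intro wff_exs) (fastforce, simp)
  ultimately show ?thesis
    using 1 unfolding defble_def pforms_def by blast
qed


section \<open>Elementary submodels\<close>

text \<open>The Tarski--Vaught test.\<close>

definition TV :: "'a set \<Rightarrow> bool" where
  "TV N \<longleftrightarrow> N \<subseteq> elems L MM \<and> (\<forall>s \<Gamma> \<phi> b. s \<in> sorts L \<longrightarrow> set \<Gamma> \<subseteq> sorts L \<longrightarrow> wff L (s # \<Gamma>) \<phi> \<longrightarrow>
     b \<in> tuples MM \<Gamma> \<longrightarrow> set b \<subseteq> N \<longrightarrow> (\<exists>d\<in>univ MM s. sat MM (d # b) \<phi>) \<longrightarrow>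
     (\<exists>d\<in>univ MM s \<inter> N. sat MM (d # b) \<phi>))"

lemma TV_elems: "TV N \<Longrightarrow> N \<subseteq> elems L MM"
  by (simp add: TV_def)

lemma TV_D:
  "TV N \<Longrightarrow> s \<in> sorts L \<Longrightarrow> set \<Gamma> \<subseteq> sorts L \<Longrightarrow> wff L (s # \<Gamma>) \<phi> \<Longrightarrow> b \<in> tuples MM \<Gamma> \<Longrightarrow> set b \<subseteq> N \<Longrightarrow>
    d \<in> univ MM s \<Longrightarrow> sat MM (d # b) \<phi> \<Longrightarrow> \<exists>d\<in>univ MM s \<inter> N. sat MM (d # b) \<phi>"
  unfolding TV_def by blast

text \<open>The test handles one variable. The tail of the tuple is found first, with the head still
  quantified, and the test then supplies the head over that tail.\<close>

lemma TV_tuple_sat: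
  assumes "TV N" "set \<Gamma> \<subseteq> sorts L" "set \<Delta> \<subseteq> sorts L" "wff L (\<Gamma> @ \<Delta>) \<phi>" "b \<in> tuples MM \<Delta>" "set b \<subseteq> N"
    "a \<in> tuples MM \<Gamma>" "sat MM (a @ b) \<phi>"
  shows "\<exists>a\<in>tuples MM \<Gamma>. set a \<subseteq> N \<and> sat MM (a @ b) \<phi>"
  using assms(2,4,7,8)
proof (induction \<Gamma> arbitrary: a \<phi>)
  case (Cons s \<Gamma>)
  from Cons.prems(3) obtain x a' where a: "a = x # a'" "x \<in> univ MM s" "a' \<in> tuples MM \<Gamma>"
    by (rule tuples_ConsE)
  have "\<exists>a\<in>tuples MM \<Gamma>. set a \<subseteq> N \<and> sat MM (a @ b) (FEx s \<phi>)"
    using Cons.prems a by (intro Cons.IH[of _ a']) auto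
  then obtain a2 where a2: "a2 \<in> tuples MM \<Gamma>" "set a2 \<subseteq> N" "\<exists>d\<in>univ MM s. sat MM (d # a2 @ b) \<phi>"
    by auto
  have "s \<in> sorts L" "set (\<Gamma> @ \<Delta>) \<subseteq> sorts L" "wff L (s # \<Gamma> @ \<Delta>) \<phi>" "set (a2 @ b) \<subseteq> N"
    using Cons.prems(1,2) assms(3,6) a2(2) by auto
  then obtain d where "d \<in> univ MM s \<inter> N" "sat MM (d # a2 @ b) \<phi>"
    using assms(1) a2(3) tuples_append[OF a2(1) assms(5)] unfolding TV_def by blast
  then show ?case using a2 by (intro bexI[of _ "d # a2"]) auto
qed (use assms in auto)

lemma TV_tuple:
  assumes "TV N" "set \<Gamma> \<subseteq> sorts L" "defble \<Gamma> N S" "S \<noteq> {}"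
  obtains a where "a \<in> S" "set a \<subseteq> N"
proof -
  obtain \<phi> b \<Delta> where S: "S = solutions MM \<Gamma> (\<phi>, b)" "set \<Delta> \<subseteq> sorts L" "wff L (\<Gamma> @ \<Delta>) \<phi>"
    "b \<in> tuples MM \<Delta>" "set b \<subseteq> N"
    using assms(3) by (auto simp: defble_def pforms_def)
  obtain a where "a \<in> S" using assms(4) by auto
  then show thesis
    using TV_tuple_sat[OF assms(1,2) S(2,3,4,5), of a] S(1) that by (auto simp: solutions_def)
qed

lemma tuples_restrict: "tuples (restrict_struc MM N) \<Gamma> = {a \<in> tuples MM \<Gamma>. set a \<subseteq> N}"
  by (auto simp: tuples_def restrict_struc_def list_all2_conv_all_nth in_set_conv_nth subset_iff)

lemma eval_restrict: "eval (restrict_struc MM N) e t = eval MM e t"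
proof (induction t)
  case (App f ts)
  then have "map (eval (restrict_struc MM N) e) ts = map (eval MM e) ts" by simp
  then show ?case by (simp only: eval.simps) (simp add: restrict_struc_def)
qed simp

lemma map_eval_restrict: "map (eval (restrict_struc MM N) e) ts = map (eval MM e) ts"
  by (simp add: eval_restrict)

lemma TV_sat_restrict:
  assumes "TV N"
  shows "set \<Gamma> \<subseteq> sorts L \<Longrightarrow> wff L \<Gamma> \<phi> \<Longrightarrow> a \<in> tuples MM \<Gamma> \<Longrightarrow> set a \<subseteq> N \<Longrightarrow>
    sat (restrict_struc MM N) a \<phi> \<longleftrightarrow> sat MM a \<phi>"
proof (induction \<phi> arbitrary: \<Gamma> a)
  case (FRel r ts)
  then show ?case by (simp only: sat.simps map_eval_restrict) (simp add: restrict_struc_def)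
next
  case (FEx s \<phi>)
  have "sat (restrict_struc MM N) (d # a) \<phi> \<longleftrightarrow> sat MM (d # a) \<phi>" if "d \<in> univ MM s \<inter> N" for d
    using FEx.prems that by (intro FEx.IH[of "s # \<Gamma>"]) auto
  then have "sat (restrict_struc MM N) a (FEx s \<phi>) \<longleftrightarrow> (\<exists>d\<in>univ MM s \<inter> N. sat MM (d # a) \<phi>)"
    by (auto simp: restrict_struc_def)
  also have "\<dots> \<longleftrightarrow> sat MM a (FEx s \<phi>)"
    using TV_D[OF assms, of s \<Gamma> \<phi> a] FEx.prems by auto
  finally show ?case .
qed (auto simp: eval_restrict)

lemma has_sort_vars: "list_all2 (has_sort L (\<Delta> @ \<Gamma>)) (map (\<lambda>i. Var (length \<Delta> + i)) [0..<length \<Gamma>]) \<Gamma>"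
  unfolding list_all2_conv_all_nth
  using has_sort.intros(1)[of "length \<Delta> + _" "\<Delta> @ \<Gamma>"] by (auto simp: nth_append)

lemma TV_elementary:
  assumes "TV N"
  shows "elementary_submodel L MM N"
  unfolding elementary_submodel_def
proof (intro conjI allI ballI impI)
  show "N \<subseteq> elems L MM" using assms by (rule TV_elems)
  fix \<Gamma> \<phi> a assume "a \<in> tuples (restrict_struc MM N) \<Gamma>" "set \<Gamma> \<subseteq> sorts L" "wff L \<Gamma> \<phi>"
  then show "sat (restrict_struc MM N) a \<phi> \<longleftrightarrow> sat MM a \<phi>"
    using TV_sat_restrict[OF assms] by (auto simp: tuples_restrict)
next
  have "univ MM s \<inter> N \<noteq> {}" if s: "s \<in> sorts L" for s
  proof -
    have "has_sort L [s] (Var 0) s" using has_sort.intros(1)[of 0 "[s]"] by simp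
    then have "\<exists>d\<in>univ MM s \<inter> N. sat MM (d # []) (FEq (Var 0) (Var 0))"
      using TV_D[OF assms s, of "[]" "FEq (Var 0) (Var 0)" "[]"] univ_nonempty[OF s] by auto
    then show ?thesis by auto
  qed
  moreover have "fn MM f a \<in> N" if f: "fn_sig L f = Some (ss, s)" "a \<in> tuples MM ss" "set a \<subseteq> N" for f ss s a
  proof -
    \<comment> \<open>Closure under f is the test applied to the equation "x = f(y)", whose only
      solution is the value of f.\<close>
    let ?\<phi> = "FEq (Var 0) (App f (map (\<lambda>i. Var (length [s] + i)) [0..<length ss]))"
    have s: "s \<in> sorts L" "set ss \<subseteq> sorts L"
      using lang f(1) unfolding language_def by metis+
    have "has_sort L (s # ss) (Var 0) s" using has_sort.intros(1)[of 0 "s # ss" L] by simp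
    then have "wff L (s # ss) ?\<phi>"
      using has_sort.intros(2)[OF f(1) has_sort_vars[of "[s]" ss]] unfolding wff.simps by (metis append_Cons append_Nil)
    moreover have ev: "map (eval MM (d # a)) (map (\<lambda>i. Var (length [s] + i)) [0..<length ss]) = a" for d
      using tuples_length[OF f(2)] by (intro nth_equalityI) auto
    have st: "sat MM (d # a) ?\<phi> \<longleftrightarrow> d = fn MM f a" for d
      unfolding sat.simps eval.simps ev by simp
    moreover have "fn MM f a \<in> univ MM s"
      using struc f unfolding is_struc_def by blast
    ultimately have "\<exists>d\<in>univ MM s \<inter> N. sat MM (d # a) ?\<phi>"
      using assms s f unfolding TV_def by blast
    then show ?thesis unfolding st by auto
  qed
  ultimately show "is_struc L (restrict_struc MM N)"
    using struc unfolding is_struc_def tuples_restrict by (simp add: restrict_struc_def) blast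
qed

lemma TV_chain:
  assumes "\<And>i. i \<in> I \<Longrightarrow> TV (N i)" "I \<noteq> {}" "\<And>i j. i \<in> I \<Longrightarrow> j \<in> I \<Longrightarrow> N i \<subseteq> N j \<or> N j \<subseteq> N i"
  shows "TV (\<Union>i\<in>I. N i)"
  unfolding TV_def
proof (intro conjI allI impI)
  show "(\<Union>i\<in>I. N i) \<subseteq> elems L MM" using assms(1) TV_elems by blast
  fix s \<Gamma> \<phi> b
  assume *: "s \<in> sorts L" "set \<Gamma> \<subseteq> sorts L" "wff L (s # \<Gamma>) \<phi>" "b \<in> tuples MM \<Gamma>"
    "\<exists>d\<in>univ MM s. sat MM (d # b) \<phi>" and b: "set b \<subseteq> (\<Union>i\<in>I. N i)"
  have "\<exists>X\<in>N ` I. set b \<subseteq> X"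
  proof (rule finite_subset_Union_chain)
    show "set b \<subseteq> \<Union> (N ` I)" using b by simp
    show "subset.chain (range N) (N ` I)"
      using assms(3) by (force simp: subset.chain_def)
  qed (use assms(2) in auto)
  then obtain i where "i \<in> I" "set b \<subseteq> N i" by auto
  then have "\<exists>d\<in>univ MM s \<inter> N i. sat MM (d # b) \<phi>"
    using assms(1)[OF \<open>i \<in> I\<close>] * unfolding TV_def by blast
  then show "\<exists>d\<in>univ MM s \<inter> (\<Union>i\<in>I. N i). sat MM (d # b) \<phi>" using \<open>i \<in> I\<close> by blast
qed

end

section \<open>Small sets and downward Loewenheim--Skolem\<close>

lemma ordLeq_image: "|X| \<le>o r \<Longrightarrow> |f ` X| \<le>o r"
  by (rule ordLeq_transitive[OF card_of_image])

lemma ordLeq_subset: "|X| \<le>o r \<Longrightarrow> Z \<subseteq> X \<Longrightarrow> |Z| \<le>o r"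
  by (rule ordLeq_transitive[OF card_of_mono1])

lemma ordLeq_nat: "infinite Y \<Longrightarrow> |X :: nat set| \<le>o |Y|"
  by (meson card_of_mono1 infinite_iff_card_of_nat ordLeq_transitive subset_UNIV)

lemma ordLeq_Un: "infinite Y \<Longrightarrow> |X| \<le>o |Y| \<Longrightarrow> |Z| \<le>o |Y| \<Longrightarrow> |X \<union> Z| \<le>o |Y|"
  using card_of_Un_ordLeq_infinite_Field[of "|Y|" X Z] by (simp add: Field_card_of card_of_card_order_on)

lemma ordLeq_Times: "infinite Y \<Longrightarrow> |X| \<le>o |Y| \<Longrightarrow> |Z| \<le>o |Y| \<Longrightarrow> |X \<times> Z| \<le>o |Y|"
  using card_of_Times_ordLeq_infinite_Field[of "|Y|" X Z] by (simp add: Field_card_of card_of_card_order_on)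

lemma ordLeq_finite: "infinite Y \<Longrightarrow> finite X \<Longrightarrow> |X| \<le>o |Y|"
  by (rule ordLess_imp_ordLeq) (simp add: finite_ordLess_infinite Field_card_of card_of_well_order_on)

lemma ordLeq_UN: "infinite Y \<Longrightarrow> |I| \<le>o |Y| \<Longrightarrow> (\<And>i. i \<in> I \<Longrightarrow> |X i| \<le>o |Y| ) \<Longrightarrow> |\<Union>i\<in>I. X i| \<le>o |Y|"
  by (rule card_of_UNION_ordLeq_infinite) auto

lemma ordLeq_lists:
  assumes "infinite Y" "|X| \<le>o |Y|"
  shows "|lists X| \<le>o |Y|"
proof -
  have "|{xs \<in> lists X. length xs = n}| \<le>o |Y|" for n
  proof (induction n)
    case 0
    have "{xs \<in> lists X. length xs = 0} = {[]}" by auto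
    then show ?case using ordLeq_finite[OF assms(1), of "{[]}"] by simp
  next
    case (Suc n)
    have "{xs \<in> lists X. length xs = Suc n} \<subseteq> (\<lambda>(x, xs). x # xs) ` (X \<times> {xs \<in> lists X. length xs = n})"
      by (force simp: length_Suc_conv)
    then show ?case
      using ordLeq_subset ordLeq_image ordLeq_Times[OF assms Suc] by meson
  qed
  then have "|\<Union>n\<in>UNIV. {xs \<in> lists X. length xs = n}| \<le>o |Y|"
    by (intro ordLeq_UN ordLeq_nat assms)
  moreover have "(\<Union>n\<in>UNIV. {xs \<in> lists X. length xs = n}) = lists X" by auto
  ultimately show ?thesis by simp
qed

text \<open>Terms are counted by size: the arguments of a well-sorted application are smaller
  well-sorted terms, so each bounded level is small if the preceding one is.\<close>

lemma ordLeq_terms: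
  fixes L :: "('f, 'r, 's) lang"
  assumes "infinite Y" "|{f. fn_sig L f \<noteq> None}| \<le>o |Y|"
  shows "|{t. \<exists>\<Gamma> s. has_sort L \<Gamma> t s}| \<le>o |Y|"
proof -
  define T where "T n = {t. (\<exists>\<Gamma> s. has_sort L \<Gamma> t s) \<and> size t < n}" for n
  have "|T n| \<le>o |Y|" for n
  proof (induction n)
    case 0
    show ?case by (simp add: T_def card_of_empty)
  next
    case (Suc n)
    have "T (Suc n) \<subseteq> Var ` UNIV \<union> (\<lambda>(f, ts). App f ts) ` ({f. fn_sig L f \<noteq> None} \<times> lists (T n))"
    proof
      fix t assume "t \<in> T (Suc n)"
      then obtain \<Gamma> s where t: "has_sort L \<Gamma> t s" "size t < Suc n" by (auto simp: T_def)
      from t(1) show "t \<in> Var ` UNIV \<union> (\<lambda>(f, ts). App f ts) ` ({f. fn_sig L f \<noteq> None} \<times> lists (T n))"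
      proof cases
        case (2 f ss ts)
        have "u \<in> T n" if u: "u \<in> set ts" for u
        proof -
          have "size u < size t" using u 2(1) size_list_estimation'[OF u order_refl, of size] by simp
          moreover have "\<exists>s. has_sort L \<Gamma> u s"
            using 2(3) u by (metis in_set_conv_nth list_all2_conv_all_nth)
          ultimately show ?thesis using t(2) by (auto simp: T_def)
        qed
        then show ?thesis using 2(1,2) by (auto intro!: image_eqI[of _ _ "(f, ts)"])
      qed simp
    qed
    then show ?case
      by (rule ordLeq_subset[rotated]) (intro ordLeq_Un ordLeq_image ordLeq_Times ordLeq_lists ordLeq_nat assms Suc)
  qed
  then have "|\<Union>n\<in>UNIV. T n| \<le>o |Y|"
    by (intro ordLeq_UN ordLeq_nat assms)
  then show ?thesis by (rule ordLeq_subset) (auto simp: T_def)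
qed

lemma ordLeq_formulas:
  fixes L :: "('f, 'r, 's) lang"
  assumes "infinite Y" "|{f. fn_sig L f \<noteq> None}| \<le>o |Y|" "|{r. rel_sig L r \<noteq> None}| \<le>o |Y|"
    "|sorts L| \<le>o |Y|"
  shows "|{\<phi>. \<exists>\<Gamma>. wff L \<Gamma> \<phi>}| \<le>o |Y|"
proof -
  define F where "F n = {\<phi>. (\<exists>\<Gamma>. wff L \<Gamma> \<phi>) \<and> size \<phi> < n}" for n
  let ?T = "{t. \<exists>\<Gamma> s. has_sort L \<Gamma> t s}"
  have "|F n| \<le>o |Y|" for n
  proof (induction n)
    case 0
    show ?case by (simp add: F_def card_of_empty)
  next
    case (Suc n)
    let ?R = "(\<lambda>(t, u). FEq t u) ` (?T \<times> ?T) \<union>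
      (\<lambda>(r, ts). FRel r ts) ` ({r. rel_sig L r \<noteq> None} \<times> lists ?T) \<union>
      FNeg ` F n \<union> (\<lambda>(\<phi>, \<psi>). FAnd \<phi> \<psi>) ` (F n \<times> F n) \<union> (\<lambda>(s, \<phi>). FEx s \<phi>) ` (sorts L \<times> F n)"
    have "F (Suc n) \<subseteq> ?R"
    proof
      fix \<phi> assume "\<phi> \<in> F (Suc n)"
      then obtain \<Gamma> where "wff L \<Gamma> \<phi>" "size \<phi> < Suc n" by (auto simp: F_def)
      then show "\<phi> \<in> ?R"
      proof (cases \<phi>)
        case (FRel r ts)
        have "\<exists>s. has_sort L \<Gamma> u s" if "u \<in> set ts" for u
          using \<open>wff L \<Gamma> \<phi>\<close> FRel that by (auto simp: in_set_conv_nth list_all2_conv_all_nth)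
        then have "ts \<in> lists ?T" by blast
        then show ?thesis using FRel \<open>wff L \<Gamma> \<phi>\<close> by force
      next
        case (FEx s \<psi>)
        then have "s \<in> sorts L" "\<psi> \<in> F n"
          using \<open>wff L \<Gamma> \<phi>\<close> \<open>size \<phi> < Suc n\<close> by (auto simp: F_def)
        then show ?thesis using FEx by force
      next
        case (FAnd \<psi> \<chi>)
        then have "\<psi> \<in> F n" "\<chi> \<in> F n"
          using \<open>wff L \<Gamma> \<phi>\<close> \<open>size \<phi> < Suc n\<close> by (auto simp: F_def)
        then show ?thesis using FAnd by force
      next
        case (FNeg \<psi>)
        then have "\<psi> \<in> F n"
          using \<open>wff L \<Gamma> \<phi>\<close> \<open>size \<phi> < Suc n\<close> by (auto simp: F_def)
        then show ?thesis using FNeg by force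
      next
        case (FEq t u)
        then have "(t, u) \<in> ?T \<times> ?T" using \<open>wff L \<Gamma> \<phi>\<close> by auto
        then show ?thesis using FEq by (intro UnI1 image_eqI[of _ _ "(t, u)"]) simp_all
      qed
    qed
    then show ?case
      by (rule ordLeq_subset[rotated])
        (intro ordLeq_Un ordLeq_image ordLeq_Times ordLeq_lists ordLeq_terms assms Suc)
  qed
  then have "|\<Union>n\<in>UNIV. F n| \<le>o |Y|"
    by (intro ordLeq_UN ordLeq_nat assms)
  then show ?thesis by (rule ordLeq_subset) (auto simp: F_def)
qed

context many_sorted
begin

definition Fm :: "('f, 'r, 's) fm set" where
  "Fm = {\<phi>. \<exists>\<Gamma>. wff L \<Gamma> \<phi>}"

text \<open>Countably many rounds, each adding a chosen witness for every true existential instance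
  with parameters found so far. The finitely many parameters of a test instance all appear at some
  stage.\<close>

lemma Loewenheim_Skolem:
  assumes Y: "infinite Y" "|Fm| \<le>o |Y|" "|sorts L| \<le>o |Y|" and A: "A \<subseteq> elems L MM" "|A| \<le>o |Y|"
  obtains N where "A \<subseteq> N" "TV N" "|N| \<le>o |Y|"
proof -
  \<comment> \<open>That \<phi> fits the sorts of b is not recorded: it is enough that D stays
    small, contains all instances of the test, and that each of its members has a witness.\<close>
  define D where "D X = {(s, \<phi>, b). s \<in> sorts L \<and> \<phi> \<in> Fm \<and> b \<in> lists X \<and> (\<exists>d\<in>univ MM s. sat MM (d # b) \<phi>)}" for X
  define w where "w = (\<lambda>(s, \<phi>, b). SOME d. d \<in> univ MM s \<and> sat MM (d # b) \<phi>)"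
  define C where "C n = ((\<lambda>X. X \<union> w ` D X) ^^ n) A" for n
  have CS: "C (Suc n) = C n \<union> w ` D (C n)" for n by (simp add: C_def)
  have w: "w (s, \<phi>, b) \<in> univ MM s \<and> sat MM (w (s, \<phi>, b) # b) \<phi>" if "(s, \<phi>, b) \<in> D X" for s \<phi> b X
  proof -
    have "\<exists>d. d \<in> univ MM s \<and> sat MM (d # b) \<phi>" using that by (auto simp: D_def)
    from someI_ex[OF this] show ?thesis by (simp add: w_def)
  qed
  have mono: "C n \<subseteq> C m" if "n \<le> m" for n m
    using that by (rule lift_Suc_mono_le[rotated]) (auto simp: CS)
  have sub: "C n \<subseteq> elems L MM \<and> |C n| \<le>o |Y|" for n
  proof (induction n)
    case 0
    then show ?case using A by (simp add: C_def)
  next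
    case (Suc n)
    have "D (C n) \<subseteq> sorts L \<times> Fm \<times> lists (C n)" by (auto simp: D_def)
    then have "|D (C n)| \<le>o |Y|"
      by (rule ordLeq_subset[rotated]) (intro ordLeq_Times ordLeq_lists Y Suc[THEN conjunct2])
    moreover have "w ` D (C n) \<subseteq> elems L MM"
      using w by (fastforce simp: D_def elems_def)
    ultimately show ?case
      unfolding CS using Suc by (auto intro!: ordLeq_Un ordLeq_image Y)
  qed
  let ?N = "\<Union>n\<in>UNIV. C n"
  show thesis
  proof (rule that[of ?N])
    show "A \<subseteq> ?N" by (rule order_trans[OF _ UN_upper[of 0]]) (auto simp: C_def)
    show "|?N| \<le>o |Y|" using sub by (intro ordLeq_UN ordLeq_nat Y) auto
    show "TV ?N"
      unfolding TV_def
    proof (intro conjI allI impI)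
      fix s \<Gamma> \<phi> b
      assume *: "s \<in> sorts L" "set \<Gamma> \<subseteq> sorts L" "wff L (s # \<Gamma>) \<phi>" "b \<in> tuples MM \<Gamma>" "set b \<subseteq> ?N"
        "\<exists>d\<in>univ MM s. sat MM (d # b) \<phi>"
      have "\<exists>n. set b \<subseteq> C n"
      proof -
        have "\<exists>X\<in>range C. set b \<subseteq> X"
        proof (rule finite_subset_Union_chain)
          have "C n \<subseteq> C m \<or> C m \<subseteq> C n" for n m using mono nat_le_linear[of n m] by blast
          then show "subset.chain UNIV (range C)" by (simp add: subset_chain_def)
        qed (use *(5) in auto)
        then show ?thesis by auto
      qed
      then obtain n where "set b \<subseteq> C n" ..
      then have "(s, \<phi>, b) \<in> D (C n)" using * by (auto simp: D_def Fm_def)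
      moreover from this have "w (s, \<phi>, b) \<in> C (Suc n)" unfolding CS by blast
      ultimately show "\<exists>d\<in>univ MM s \<inter> ?N. sat MM (d # b) \<phi>"
        using w by (intro bexI[of _ "w (s, \<phi>, b)"]) auto
    qed (use sub in auto)
  qed
qed


section \<open>Automorphisms\<close>

lemma aut_tuples:
  assumes "\<sigma> \<in> automorphisms L MM C" "set \<Gamma> \<subseteq> sorts L" "a \<in> tuples MM \<Gamma>"
  shows "map \<sigma> a \<in> tuples MM \<Gamma>"
proof -
  have "\<sigma> x \<in> univ MM s" if "x \<in> univ MM s" "s \<in> sorts L" for x s
    using assms(1) that by (auto simp: automorphisms_def dest: bij_betwE)
  then show ?thesis
    using assms(2,3) unfolding tuples_def list_all2_conv_all_nth by (simp add: subset_iff)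
qed

lemma aut_tuples_surj:
  assumes "\<sigma> \<in> automorphisms L MM C" "set \<Gamma> \<subseteq> sorts L" "b \<in> tuples MM \<Gamma>"
  obtains a where "a \<in> tuples MM \<Gamma>" "b = map \<sigma> a"
proof -
  have "\<exists>a\<in>tuples MM \<Gamma>. b = map \<sigma> a"
    using assms(2,3)
  proof (induction \<Gamma> arbitrary: b)
    case (Cons s \<Gamma>)
    from Cons.prems(2) obtain x c where b: "b = x # c" "x \<in> univ MM s" "c \<in> tuples MM \<Gamma>"
      by (rule tuples_ConsE)
    obtain a where "a \<in> tuples MM \<Gamma>" "c = map \<sigma> a" using Cons.IH b(3) Cons.prems(1) by auto
    moreover have "\<sigma> ` univ MM s = univ MM s"
      using assms(1) Cons.prems(1) by (auto simp: automorphisms_def bij_betw_def)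
    then obtain y where "y \<in> univ MM s" "x = \<sigma> y" using b(2) by blast
    ultimately show ?case using b(1) by (intro bexI[of _ "y # a"]) auto
  qed simp
  then show thesis using that by blast
qed

lemma has_sort_sorts:
  assumes "has_sort L \<Gamma> t s" "set \<Gamma> \<subseteq> sorts L"
  shows "s \<in> sorts L"
  using assms
proof cases
  case (2 f ss ts)
  then show ?thesis using lang by (auto simp: language_def)
qed (use assms(2) in auto)

lemma eval_univ:
  assumes "has_sort L \<Gamma> t s" "e \<in> tuples MM \<Gamma>"
  shows "eval MM e t \<in> univ MM s"
  using assms
proof (induction rule: has_sort.induct)
  case (1 i)
  then show ?case by (simp add: tuples_nth)
next
  case (2 f ss s ts)
  then have "map (eval MM e) ts \<in> tuples MM ss"
    by (auto simp: tuples_def list.rel_map elim!: list_all2_mono)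
  then show ?case using struc 2(1) by (auto simp: is_struc_def)
qed

lemma map_eval_tuples:
  "list_all2 (has_sort L \<Gamma>) ts ss \<Longrightarrow> e \<in> tuples MM \<Gamma> \<Longrightarrow> map (eval MM e) ts \<in> tuples MM ss"
  by (auto simp: tuples_def[of _ ss] list.rel_map elim!: list_all2_mono intro: eval_univ)

lemma eval_aut:
  assumes "has_sort L \<Gamma> t s" "e \<in> tuples MM \<Gamma>" "\<sigma> \<in> automorphisms L MM C"
  shows "eval MM (map \<sigma> e) t = \<sigma> (eval MM e t)"
  using assms
proof (induction rule: has_sort.induct)
  case (1 i)
  then show ?case using tuples_length[OF 1(2)] by simp
next
  case (2 f ss s ts)
  then have "list_all2 (\<lambda>t s. eval MM (map \<sigma> e) t = \<sigma> (eval MM e t)) ts ss"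
    by (auto elim!: list_all2_mono)
  then have *: "map (eval MM (map \<sigma> e)) ts = map \<sigma> (map (eval MM e) ts)"
    by (induction rule: list_all2_induct) auto
  have "list_all2 (has_sort L \<Gamma>) ts ss" using 2(2) by (auto elim!: list_all2_mono)
  then have "map (eval MM e) ts \<in> tuples MM ss" using 2(3) by (rule map_eval_tuples)
  then show ?case using 2(1,4) unfolding eval.simps * by (auto simp: automorphisms_def)
qed

text \<open>Equations use injectivity on a sort, quantifiers use surjectivity on it.\<close>

lemma sat_aut:
  assumes "\<sigma> \<in> automorphisms L MM C"
  shows "wff L \<Gamma> \<phi> \<Longrightarrow> set \<Gamma> \<subseteq> sorts L \<Longrightarrow> e \<in> tuples MM \<Gamma> \<Longrightarrow> sat MM (map \<sigma> e) \<phi> \<longleftrightarrow> sat MM e \<phi>"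
proof (induction \<phi> arbitrary: \<Gamma> e)
  case (FEq t u)
  then obtain s where s: "has_sort L \<Gamma> t s" "has_sort L \<Gamma> u s" by auto
  have "inj_on \<sigma> (univ MM s)"
    using assms has_sort_sorts[OF s(1) FEq(2)] by (auto simp: automorphisms_def bij_betw_def)
  then show ?case
    using eval_univ[OF s(1) FEq(3)] eval_univ[OF s(2) FEq(3)] eval_aut[OF s(1) FEq(3) assms] eval_aut[OF s(2) FEq(3) assms]
    by (auto dest: inj_onD)
next
  case (FRel r ts)
  then obtain ss where ss: "rel_sig L r = Some ss" "list_all2 (has_sort L \<Gamma>) ts ss" by auto
  have "map (eval MM (map \<sigma> e)) ts = map \<sigma> (map (eval MM e) ts)"
    using ss(2) by (induction rule: list_all2_induct) (auto intro: eval_aut[OF _ FRel(3) assms])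
  moreover have "map (eval MM e) ts \<in> tuples MM ss" by (rule map_eval_tuples[OF ss(2) FRel(3)])
  ultimately show ?case using ss(1) assms by (auto simp: automorphisms_def simp del: map_map)
next
  case (FEx s \<phi>)
  have s: "s \<in> sorts L" "wff L (s # \<Gamma>) \<phi>" using FEx.prems by auto
  then have im: "\<sigma> ` univ MM s = univ MM s" using assms by (auto simp: automorphisms_def bij_betw_def)
  have "sat MM (map \<sigma> e) (FEx s \<phi>) \<longleftrightarrow> (\<exists>d\<in>univ MM s. sat MM (map \<sigma> (d # e)) \<phi>)"
    unfolding sat.simps by (subst (1) im[symmetric]) simp
  also have "\<dots> \<longleftrightarrow> sat MM e (FEx s \<phi>)"
    using FEx.IH[OF s(2), of "_ # e"] FEx.prems s(1) by auto
  finally show ?case .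
qed auto

lemma aut_mono: "C \<subseteq> C' \<Longrightarrow> automorphisms L MM C' \<subseteq> automorphisms L MM C"
  unfolding automorphisms_def by blast

lemma aut_fix: "\<sigma> \<in> automorphisms L MM C \<longleftrightarrow> \<sigma> \<in> automorphisms L MM {} \<and> (\<forall>c\<in>C. \<sigma> c = c)"
  by (auto simp: automorphisms_def)

lemma aut_comp:
  assumes "\<sigma> \<in> automorphisms L MM {}" "\<tau> \<in> automorphisms L MM {}"
  shows "\<tau> \<circ> \<sigma> \<in> automorphisms L MM {}"
  unfolding automorphisms_def mem_Collect_eq
proof (intro conjI ballI allI impI)
  show "bij_betw (\<tau> \<circ> \<sigma>) (univ MM s) (univ MM s)" if "s \<in> sorts L" for s
    using assms that by (auto simp: automorphisms_def intro: bij_betw_trans)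
next
  fix f ss s a assume f: "fn_sig L f = Some (ss, s)" "a \<in> tuples MM ss"
  have ss: "set ss \<subseteq> sorts L" using lang f(1) unfolding language_def by metis
  have "\<sigma> (fn MM f a) = fn MM f (map \<sigma> a)" "\<tau> (fn MM f (map \<sigma> a)) = fn MM f (map \<tau> (map \<sigma> a))"
    using assms f aut_tuples[OF assms(1) ss f(2)] unfolding automorphisms_def by blast+
  then show "(\<tau> \<circ> \<sigma>) (fn MM f a) = fn MM f (map (\<tau> \<circ> \<sigma>) a)" by simp
next
  fix r ss a assume r: "rel_sig L r = Some ss" "a \<in> tuples MM ss"
  have ss: "set ss \<subseteq> sorts L" using lang r(1) unfolding language_def by metis
  have "rel MM r (map \<sigma> a) = rel MM r a" "rel MM r (map \<tau> (map \<sigma> a)) = rel MM r (map \<sigma> a)"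
    using assms r aut_tuples[OF assms(1) ss r(2)] unfolding automorphisms_def by blast+
  then show "rel MM r (map (\<tau> \<circ> \<sigma>) a) = rel MM r a" by simp
qed simp

lemma aut_id_on_tuple: "\<sigma> \<in> automorphisms L MM C \<Longrightarrow> set a \<subseteq> C \<Longrightarrow> map \<sigma> a = a"
  by (auto simp: automorphisms_def intro!: map_idI)

lemma aut_solutions:
  assumes "\<sigma> \<in> automorphisms L MM C" "set \<Gamma> \<subseteq> sorts L" "(\<phi>, b) \<in> pforms L MM \<Gamma> A"
  shows "map \<sigma> ` solutions MM \<Gamma> (\<phi>, b) = solutions MM \<Gamma> (\<phi>, map \<sigma> b)"
proof -
  obtain \<Delta> where \<Delta>: "set \<Delta> \<subseteq> sorts L" "wff L (\<Gamma> @ \<Delta>) \<phi>" "b \<in> tuples MM \<Delta>"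
    using assms(3) by (auto simp: pforms_def)
  have 1: "sat MM (map \<sigma> a @ map \<sigma> b) \<phi> \<longleftrightarrow> sat MM (a @ b) \<phi>" if "a \<in> tuples MM \<Gamma>" for a
    using sat_aut[OF assms(1) \<Delta>(2), of "a @ b"] tuples_append[OF that \<Delta>(3)] \<Delta>(1) assms(2) by simp
  show ?thesis
  proof (intro subset_antisym subsetI)
    fix x assume "x \<in> solutions MM \<Gamma> (\<phi>, map \<sigma> b)"
    then have x: "x \<in> tuples MM \<Gamma>" "sat MM (x @ map \<sigma> b) \<phi>" by (auto simp: solutions_def)
    obtain a where "a \<in> tuples MM \<Gamma>" "x = map \<sigma> a" by (rule aut_tuples_surj[OF assms(1,2) x(1)])
    then show "x \<in> map \<sigma> ` solutions MM \<Gamma> (\<phi>, b)" using 1 x(2) by (auto simp: solutions_def)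
  qed (use 1 aut_tuples[OF assms(1,2)] in \<open>auto simp: solutions_def\<close>)
qed

text \<open>Membership in \<open>automorphisms\<close> restricts a map only on the elements of the
  structure, and the inverse is taken there. Injectivity across sorts comes from their
  disjointness.\<close>

lemma aut_inverse:
  assumes "\<sigma> \<in> automorphisms L MM C"
  obtains \<tau> where "\<tau> \<in> automorphisms L MM {}"
    "\<And>x. x \<in> elems L MM \<Longrightarrow> \<tau> (\<sigma> x) = x" "\<And>x. x \<in> elems L MM \<Longrightarrow> \<sigma> (\<tau> x) = x"
proof -
  have s: "bij_betw \<sigma> (univ MM s) (univ MM s)" if "s \<in> sorts L" for s
    using assms that by (auto simp: automorphisms_def)
  have inj: "inj_on \<sigma> (elems L MM)"
  proof (rule inj_onI)
    fix x y assume xy: "x \<in> elems L MM" "y \<in> elems L MM" "\<sigma> x = \<sigma> y"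
    then obtain s s' where ss: "s \<in> sorts L" "x \<in> univ MM s" "s' \<in> sorts L" "y \<in> univ MM s'"
      by (auto simp: elems_def)
    then have "\<sigma> x \<in> univ MM s \<inter> univ MM s'"
      using s[THEN bij_betwE] xy(3) by fastforce
    then have "s = s'" using struc ss by (auto simp: is_struc_def)
    then show "x = y" using ss xy(3) s[OF ss(1)] by (auto simp: bij_betw_def dest: inj_onD)
  qed
  define \<tau> where "\<tau> = inv_into (elems L MM) \<sigma>"
  have ts: "\<tau> (\<sigma> x) = x" if "x \<in> elems L MM" for x
    using inv_into_f_f[OF inj that] by (simp add: \<tau>_def)
  have usub: "univ MM s \<subseteq> elems L MM" if "s \<in> sorts L" for s using that by (auto simp: elems_def)
  have tb: "bij_betw \<tau> (univ MM s) (univ MM s)" if "s \<in> sorts L" for s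
  proof (rule bij_betw_byWitness[where f' = \<sigma>])
    have e: "\<sigma> ` univ MM s = univ MM s" using s[OF that] by (simp add: bij_betw_def)
    have "\<sigma> (\<tau> x) = x \<and> \<tau> x \<in> univ MM s" if x: "x \<in> univ MM s" for x
    proof -
      obtain y where y: "y \<in> univ MM s" "x = \<sigma> y" using x e by (metis imageE)
      then show ?thesis using ts[of y] usub[OF \<open>s \<in> sorts L\<close>] by auto
    qed
    then show "\<forall>a\<in>univ MM s. \<sigma> (\<tau> a) = a" "\<tau> ` univ MM s \<subseteq> univ MM s" by auto
    show "\<forall>a\<in>univ MM s. \<tau> (\<sigma> a) = a" using ts usub[OF that] by auto
    show "\<sigma> ` univ MM s \<subseteq> univ MM s" using e by simp
  qed
  have st: "\<sigma> (\<tau> x) = x" if "x \<in> elems L MM" for x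
  proof -
    obtain q where q: "q \<in> sorts L" "x \<in> univ MM q" using \<open>x \<in> elems L MM\<close> unfolding elems_def by blast
    then have "x \<in> \<sigma> ` univ MM q" using s[OF q(1)] by (simp add: bij_betw_def)
    then have "x \<in> \<sigma> ` elems L MM" using usub[OF q(1)] by blast
    then show ?thesis by (simp add: \<tau>_def f_inv_into_f)
  qed
  have mt: "map \<sigma> (map \<tau> a) = a" "map \<tau> (map \<sigma> a) = a" if "a \<in> tuples MM \<Gamma>" "set \<Gamma> \<subseteq> sorts L" for a \<Gamma>
    using tuples_elems[OF that] st ts by (auto intro!: map_idI)
  have tt: "map \<tau> a \<in> tuples MM \<Gamma>" if "a \<in> tuples MM \<Gamma>" "set \<Gamma> \<subseteq> sorts L" for a \<Gamma>
    using aut_tuples_surj[OF assms that(2,1)] mt(2) that(2) by metis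
  have "\<tau> \<in> automorphisms L MM {}"
    unfolding automorphisms_def mem_Collect_eq
  proof (intro conjI ballI allI impI)
    show "bij_betw \<tau> (univ MM s) (univ MM s)" if "s \<in> sorts L" for s using tb that .
  next
    fix f ss s a assume f: "fn_sig L f = Some (ss, s)" "a \<in> tuples MM ss"
    have ss: "set ss \<subseteq> sorts L" "s \<in> sorts L" using lang f(1) unfolding language_def by metis+
    have "\<sigma> (fn MM f (map \<tau> a)) = fn MM f (map \<sigma> (map \<tau> a))"
      using assms f(1) tt[OF f(2) ss(1)] unfolding automorphisms_def by blast
    then have "\<tau> (\<sigma> (fn MM f (map \<tau> a))) = \<tau> (fn MM f a)" using mt(1)[OF f(2) ss(1)] by simp
    moreover have "fn MM f (map \<tau> a) \<in> univ MM s"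
      using struc f(1) tt[OF f(2) ss(1)] unfolding is_struc_def by blast
    ultimately show "\<tau> (fn MM f a) = fn MM f (map \<tau> a)" using ts usub[OF ss(2)] by force
  next
    fix r ss a assume r: "rel_sig L r = Some ss" "a \<in> tuples MM ss"
    have ss: "set ss \<subseteq> sorts L" using lang r(1) unfolding language_def by metis
    have "rel MM r (map \<sigma> (map \<tau> a)) = rel MM r (map \<tau> a)"
      using assms r(1) tt[OF r(2) ss(1)] unfolding automorphisms_def by blast
    then show "rel MM r (map \<tau> a) = rel MM r a" using mt(1)[OF r(2) ss(1)] by simp
  qed simp
  then show thesis using ts st that by blast
qed

end

section \<open>Saturation and invariant types\<close>

context many_sorted
begin

lemma ptype_fin: "ptype pos \<Gamma> A q \<Longrightarrow> finite F \<Longrightarrow> F \<subseteq> q \<Longrightarrow> pos (sols MM \<Gamma> F)"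
  by (simp add: ptype_def)

lemma ptype_dec: "ptype pos \<Gamma> A q \<Longrightarrow> (\<phi>, b) \<in> pforms L MM \<Gamma> A \<Longrightarrow> (\<phi>, b) \<notin> q \<Longrightarrow> (FNeg \<phi>, b) \<in> q"
  unfolding ptype_def by blast

lemma dfn_sat1: "wff L (G v @ \<Delta>) \<phi> \<Longrightarrow> set \<Delta> \<subseteq> sorts L \<Longrightarrow> b \<in> tuples MM \<Delta> \<Longrightarrow> set b \<subseteq> A \<Longrightarrow> v \<in> V \<Longrightarrow>
    dfn A G V (\<lambda>u. sat MM (u v @ b) \<phi>)"
  by (rule dfnI[of "[v]" _ \<Delta> _ \<phi> b]) auto

lemma dfn_sat2: "wff L (G v @ G w @ \<Delta>) \<phi> \<Longrightarrow> set \<Delta> \<subseteq> sorts L \<Longrightarrow> b \<in> tuples MM \<Delta> \<Longrightarrow> set b \<subseteq> A \<Longrightarrow>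
    v \<in> V \<Longrightarrow> w \<in> V \<Longrightarrow> dfn A G V (\<lambda>u. sat MM (u v @ u w @ b) \<phi>)"
  by (rule dfnI[of "[v, w]" _ \<Delta> _ \<phi> b]) auto

lemma dfn_sat2': "wff L (G v @ G w) \<phi> \<Longrightarrow> v \<in> V \<Longrightarrow> w \<in> V \<Longrightarrow> dfn A G V (\<lambda>u. sat MM (u v @ u w) \<phi>)"
  by (rule dfnI[of "[v, w]" _ "[]" _ \<phi> "[]"]) auto

lemma dfn_sat_mid:
  assumes "wff L (\<Gamma> @ G v @ \<Delta>) \<phi>" "set \<Delta> \<subseteq> sorts L" "b \<in> tuples MM \<Delta>" "set b \<subseteq> A" "v \<in> V"
    "set \<Gamma> \<subseteq> sorts L" "a \<in> tuples MM \<Gamma>" "set a \<subseteq> A"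
  shows "dfn A G V (\<lambda>u. sat MM (a @ u v @ b) \<phi>)"
proof (rule dfn_param[where P = "\<lambda>x u. sat MM (x @ u v @ b) \<phi>" and V' = "insert None (Some ` V)"])
  show "dfn A (case_option \<Gamma> G) (insert None (Some ` V)) (\<lambda>w. sat MM (w None @ w (Some v) @ b) \<phi>)"
    by (rule dfn_sat2[where \<Delta> = \<Delta>]) (use assms in auto)
qed (use assms in auto)

definition same_type :: "'s list \<Rightarrow> 'a set \<Rightarrow> 'a list \<Rightarrow> 'a list \<Rightarrow> bool" where
  "same_type \<Gamma> A a b \<longleftrightarrow> a \<in> tuples MM \<Gamma> \<and> b \<in> tuples MM \<Gamma> \<and> (\<forall>S. defble \<Gamma> A S \<longrightarrow> (a \<in> S \<longleftrightarrow> b \<in> S))"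

lemma same_type_aut:
  assumes "\<sigma> \<in> automorphisms L MM N" "set \<Gamma> \<subseteq> sorts L" "a \<in> tuples MM \<Gamma>"
  shows "same_type \<Gamma> N a (map \<sigma> a)"
  unfolding same_type_def
proof (intro conjI allI impI)
  show ma: "map \<sigma> a \<in> tuples MM \<Gamma>" using aut_tuples[OF assms] .
  fix S assume "defble \<Gamma> N S"
  then obtain \<phi> b \<Delta> where S: "S = solutions MM \<Gamma> (\<phi>, b)" "set \<Delta> \<subseteq> sorts L" "wff L (\<Gamma> @ \<Delta>) \<phi>"
    "b \<in> tuples MM \<Delta>" "set b \<subseteq> N" by (auto simp: defble_def pforms_def)
  have "sat MM (map \<sigma> (a @ b)) \<phi> \<longleftrightarrow> sat MM (a @ b) \<phi>"
    by (rule sat_aut[OF assms(1) S(3)]) (use S assms tuples_append in auto)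
  then show "a \<in> S \<longleftrightarrow> map \<sigma> a \<in> S"
    using aut_id_on_tuple[OF assms(1) S(5)] ma assms(3) S(1) by (simp add: solutions_def)
qed (use assms in auto)

text \<open>A global type all of whose finite parts are large in this sense is finitely satisfiable
  in N. Coheirs over N and averages of sequences from N are treated together in this way.\<close>

definition fs :: "'a set \<Rightarrow> ('a list set \<Rightarrow> bool) \<Rightarrow> bool" where
  "fs N pos \<longleftrightarrow> (\<forall>S. pos S \<longrightarrow> S \<inter> lists N \<noteq> {})"

text \<open>If q contained \<phi>(x,b) and the negation of \<phi>(x,b'), some n from N would satisfy
  both, and the formula \<phi>(n,y) over N would separate b from b'.\<close>

lemma fs_invariant:
  assumes "part_reg pos" "ptype pos \<Gamma> (elems L MM) q" "fs N pos" "set \<Gamma> \<subseteq> sorts L" "set \<Delta> \<subseteq> sorts L"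
    "wff L (\<Gamma> @ \<Delta>) \<phi>" "same_type \<Delta> N b b'" "(\<phi>, b) \<in> q"
  shows "(\<phi>, b') \<in> q"
proof (rule ccontr)
  assume "(\<phi>, b') \<notin> q"
  have bt: "b \<in> tuples MM \<Delta>" "b' \<in> tuples MM \<Delta>" using assms(7) by (auto simp: same_type_def)
  then have "(\<phi>, b') \<in> pforms L MM \<Gamma> (elems L MM)"
    using assms(5,6) tuples_elems[OF bt(2)] by (auto simp: pforms_def)
  then have "(FNeg \<phi>, b') \<in> q" using \<open>(\<phi>, b') \<notin> q\<close> by (rule ptype_dec[OF assms(2)])
  then have "pos (sols MM \<Gamma> {(\<phi>, b), (FNeg \<phi>, b')})" using assms(8) by (intro ptype_fin[OF assms(2)]) auto
  then obtain n where n: "n \<in> tuples MM \<Gamma>" "set n \<subseteq> N" "sat MM (n @ b) \<phi>" "\<not> sat MM (n @ b') \<phi>"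
    using assms(3) by (fastforce simp: fs_def sols_def solutions_def)
  have "dfn N (\<lambda>_::unit. \<Delta>) UNIV (\<lambda>u. sat MM (n @ u () @ []) \<phi>)"
    by (rule dfn_sat_mid[where \<Gamma> = \<Gamma> and \<Delta> = "[]"]) (use n assms in auto)
  then have "defble \<Delta> N {y \<in> tuples MM \<Delta>. sat MM (n @ y) \<phi>}"
    using defbleI[of N \<Delta> "\<lambda>y. sat MM (n @ y) \<phi>"] by simp
  then have "b \<in> {y \<in> tuples MM \<Delta>. sat MM (n @ y) \<phi>} \<longleftrightarrow> b' \<in> {y \<in> tuples MM \<Delta>. sat MM (n @ y) \<phi>}"
    using assms(7) unfolding same_type_def by blast
  then show False using n bt by auto
qed

lemma fs_invariant_global_type:
  assumes "part_reg pos" "ptype pos \<Gamma> (elems L MM) q" "fs N pos" "set \<Gamma> \<subseteq> sorts L"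
  shows "invariant_global_type L MM \<Gamma> N q"
proof -
  have "(\<phi>, map \<sigma> b) \<in> q \<longleftrightarrow> (\<phi>, b) \<in> q"
    if \<sigma>: "\<sigma> \<in> automorphisms L MM N" and p: "(\<phi>, b) \<in> pforms L MM \<Gamma> (elems L MM)" for \<sigma> \<phi> b
  proof -
    obtain \<Delta> where \<Delta>: "set \<Delta> \<subseteq> sorts L" "wff L (\<Gamma> @ \<Delta>) \<phi>" "b \<in> tuples MM \<Delta>"
      using p by (auto simp: pforms_def)
    have "same_type \<Delta> N b (map \<sigma> b)" by (rule same_type_aut[OF \<sigma> \<Delta>(1,3)])
    moreover from this have "same_type \<Delta> N (map \<sigma> b) b" by (auto simp: same_type_def)
    ultimately show ?thesis using fs_invariant[OF assms \<Delta>(1,2)] by blast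
  qed
  then show ?thesis
    using ptype_complete[OF assms(1,2)] unfolding invariant_global_type_def by blast
qed

text \<open>If \<psi> implied a finite disjunction of Kim-dividing formulas, completeness would put
  one of them, \<theta>(x,d), into q. An invariant Morley sequence starting with d has constant type
  over N. By invariance all its instances of \<theta> lie in q, hence are consistent, so it cannot
  witness Kim-dividing.\<close>

lemma fs_not_Kim_forks:
  assumes "part_reg pos" "ptype pos \<Gamma> (elems L MM) q" "fs N pos" "set \<Gamma> \<subseteq> sorts L" "N \<subseteq> elems L MM" "\<psi> \<in> q"
  shows "\<not> Kim_forks L MM \<Gamma> N \<psi>"
proof
  assume "Kim_forks L MM \<Gamma> N \<psi>"
  then obtain F where F: "finite F" "F \<subseteq> pforms L MM \<Gamma> (elems L MM)"
    "solutions MM \<Gamma> \<psi> \<subseteq> (\<Union>\<theta>\<in>F. solutions MM \<Gamma> \<theta>)" "\<forall>\<theta>\<in>F. Kim_divides L MM \<Gamma> N \<theta>"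
    unfolding Kim_forks_def by blast
  have "\<exists>\<theta>\<in>F. \<theta> \<in> q"
  proof (rule ccontr)
    assume n: "\<not> (\<exists>\<theta>\<in>F. \<theta> \<in> q)"
    let ?F = "insert \<psi> ((\<lambda>(\<phi>, b). (FNeg \<phi>, b)) ` F)"
    have "?F \<subseteq> q"
    proof
      fix \<chi> assume "\<chi> \<in> ?F"
      then consider "\<chi> = \<psi>" | \<phi> b where "(\<phi>, b) \<in> F" "\<chi> = (FNeg \<phi>, b)" by auto
      then show "\<chi> \<in> q"
      proof cases
        case 2
        then have "(\<phi>, b) \<in> pforms L MM \<Gamma> (elems L MM)" "(\<phi>, b) \<notin> q" using F(2) n by auto
        then show ?thesis unfolding 2(2) by (rule ptype_dec[OF assms(2)])
      qed (use assms(6) in simp)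
    qed
    then have "pos (sols MM \<Gamma> ?F)" by (intro ptype_fin[OF assms(2)]) (use F(1) in auto)
    moreover have "sols MM \<Gamma> ?F = {}" using F(3) by (force simp: sols_def solutions_def)
    ultimately show False using assms(1) by (simp add: part_reg_def)
  qed
  then obtain \<theta> d where \<theta>: "(\<theta>, d) \<in> F" "(\<theta>, d) \<in> q" by auto
  then obtain \<Delta> bs where D: "set \<Delta> \<subseteq> sorts L" "wff L (\<Gamma> @ \<Delta>) \<theta>"
    "invariant_Morley_sequence L MM \<Delta> N bs" "bs 0 = d" "\<not> consistent MM \<Gamma> {(\<theta>, bs i) |i. True}"
    using F(4) unfolding Kim_divides_def by fast
  obtain r where r: "r \<in> complete_types L MM \<Delta> (elems L MM)"
    "\<And>i. bs i \<in> tuples MM \<Delta>" "\<And>i \<chi>. \<chi> \<in> r \<Longrightarrow> \<chi> \<in> pforms L MM \<Delta> (N \<union> (\<Union>j<i. set (bs j))) \<Longrightarrow> bs i \<in> solutions MM \<Delta> \<chi>"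
    using D(3) unfolding invariant_Morley_sequence_def invariant_global_type_def by blast
  have "bs i \<in> S \<longleftrightarrow> bs 0 \<in> S" if S: "defble \<Delta> N S" for i S
  proof -
    obtain \<chi> c where \<chi>: "(\<chi>, c) \<in> pforms L MM \<Delta> N" "S = solutions MM \<Delta> (\<chi>, c)"
      using S by (auto simp: defble_def)
    then have pf: "(\<chi>, c) \<in> pforms L MM \<Delta> (N \<union> X)" "(FNeg \<chi>, c) \<in> pforms L MM \<Delta> (N \<union> X)" for X
      using pforms_mono[of N "N \<union> X"] pforms_neg[of \<chi> c] by auto
    have "(\<chi>, c) \<in> pforms L MM \<Delta> (elems L MM)" using \<chi>(1) pforms_mono[OF assms(5)] by blast
    then consider "(\<chi>, c) \<in> r" | "(FNeg \<chi>, c) \<in> r" using r(1) unfolding complete_types_def by blast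
    then show ?thesis
      using r(3)[OF _ pf(1)] r(3)[OF _ pf(2)] \<chi>(2) by cases (auto simp: solutions_def)
  qed
  then have "same_type \<Delta> N d (bs i)" for i using r(2) D(4) by (auto simp: same_type_def)
  then have "{(\<theta>, bs i) |i. True} \<subseteq> q" using fs_invariant[OF assms(1-4) D(1,2) _ \<theta>(2)] by blast
  moreover have "consistent MM \<Gamma> q"
    using ptype_complete[OF assms(1,2)] by (simp add: complete_types_def)
  ultimately have "consistent MM \<Gamma> {(\<theta>, bs i) |i. True}"
    unfolding consistent_def by (meson subset_trans)
  then show False using D(5) by simp
qed

end

section \<open>Compactness in saturated structures\<close>

locale saturated_struc = many_sorted L MM
  for L :: "('f, 'r, 's) lang" and MM :: "('f, 'r, 's, 'a) struc" +
  fixes \<kappa> :: "'k rel"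
  assumes \<kappa>: "Card_order \<kappa>" "natLeq <o \<kappa>"
    and saturated: "saturated \<kappa> L MM"
begin

lemma \<kappa>_infinite: "infinite (Field \<kappa>)"
proof -
  have "|UNIV :: nat set| <o \<kappa>" using \<kappa>(2) card_of_nat ordIso_ordLess_trans by blast
  then have "|UNIV :: nat set| \<le>o |Field \<kappa>|"
    using \<kappa>(1) card_of_Field_ordIso ordIso_symmetric ordLess_imp_ordLeq ordLeq_ordIso_trans by blast
  then show ?thesis by (simp add: infinite_iff_card_of_nat)
qed

lemma small_Un: "|A| <o \<kappa> \<Longrightarrow> |B| <o \<kappa> \<Longrightarrow> |A \<union> B| <o \<kappa>"
  by (rule card_of_Un_ordLess_infinite_Field[OF \<kappa>_infinite \<kappa>(1)])

lemma small_countable: "|range (f :: nat \<Rightarrow> 'x)| <o \<kappa>"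
  by (rule ordLeq_ordLess_trans[OF card_of_image]) (use \<kappa>(2) card_of_nat ordIso_ordLess_trans in blast)

lemma small_finite: "finite A \<Longrightarrow> |A| <o \<kappa>"
  using finite_ordLess_infinite[of "|A|" \<kappa>] \<kappa>(1) \<kappa>_infinite
  by (simp add: Field_card_of card_of_well_order_on card_order_on_def)

lemma small_subset: "|A| <o \<kappa> \<Longrightarrow> B \<subseteq> A \<Longrightarrow> |B| <o \<kappa>"
  using card_of_mono1 ordLeq_ordLess_trans by blast

text \<open>Saturation speaks of complete types. A finitely satisfiable family is completed with
  mere nonemptiness as the notion of largeness, written as meeting \<open>UNIV\<close>.\<close>

lemma realize:
  assumes A: "A \<subseteq> elems L MM" "|A| <o \<kappa>" and \<Gamma>: "set \<Gamma> \<subseteq> sorts L"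
    and S: "\<And>i. i \<in> I \<Longrightarrow> defble \<Gamma> A (S i)"
    and fin: "\<And>J. finite J \<Longrightarrow> J \<subseteq> I \<Longrightarrow> \<exists>a\<in>tuples MM \<Gamma>. \<forall>i\<in>J. a \<in> S i"
  shows "\<exists>a\<in>tuples MM \<Gamma>. \<forall>i\<in>I. a \<in> S i"
proof -
  have pr: "part_reg (\<lambda>S. S \<inter> UNIV \<noteq> {})" by (rule part_reg_meets)
  obtain q where q: "ptype (\<lambda>S. S \<inter> UNIV \<noteq> {}) \<Gamma> A q" "\<And>i. i \<in> I \<Longrightarrow> inq \<Gamma> q (S i)"
    by (rule ptype_existsD[OF pr, of I \<Gamma> A S]) (use S fin in \<open>simp_all add: Bex_def Ball_def\<close>)
  then obtain a where "a \<in> tuples MM \<Gamma>" "\<forall>\<psi>\<in>q. a \<in> solutions MM \<Gamma> \<psi>"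
    using saturated A \<Gamma> ptype_complete[OF pr q(1)] unfolding saturated_def by blast
  then show ?thesis using q(2) unfolding inq_def by blast
qed

lemma realize_ptype:
  assumes "part_reg pos" "ptype pos \<Gamma> B q" "A \<subseteq> B" "A \<subseteq> elems L MM" "|A| <o \<kappa>" "set \<Gamma> \<subseteq> sorts L"
  shows "\<exists>a. realizes \<Gamma> A q a"
proof -
  have "\<exists>a\<in>tuples MM \<Gamma>. \<forall>S\<in>{S. defble \<Gamma> A S \<and> inq \<Gamma> q S}. a \<in> S"
  proof (rule realize[OF assms(4-6)])
    fix J assume J: "finite J" "J \<subseteq> {S. defble \<Gamma> A S \<and> inq \<Gamma> q S}"
    have "pos {a \<in> tuples MM \<Gamma>. \<forall>S\<in>J. a \<in> S}"
      by (rule ptype_pos[OF assms(1,2) J(1)]) (use J in auto)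
    then have "{a \<in> tuples MM \<Gamma>. \<forall>S\<in>J. a \<in> S} \<noteq> {}"
      using assms(1) by (metis part_reg_def)
    then show "\<exists>a\<in>tuples MM \<Gamma>. \<forall>i\<in>J. a \<in> i" by blast
  qed auto
  then show ?thesis unfolding realizes_def by blast
qed

text \<open>Saturation realises types in finitely many variables. For countably many blocks the
  values are fixed one at a time, preserving that every finite part of \<Sigma> is satisfied by some
  family agreeing with the choices made so far. The values admissible for the next block form
  definable sets over A and finitely many earlier values, so \<open>realize\<close> applies at each
  stage.\<close>

lemma realize_fam:
  fixes G :: "'v::countable \<Rightarrow> 's list"
  assumes A: "A \<subseteq> elems L MM" "|A| <o \<kappa>" and G: "\<And>v. set (G v) \<subseteq> sorts L"
    and dfn: "\<And>P. P \<in> \<Sigma> \<Longrightarrow> dfn A G UNIV P"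
    and fin: "\<And>F. finite F \<Longrightarrow> F \<subseteq> \<Sigma> \<Longrightarrow> \<exists>u\<in>fam G. \<forall>P\<in>F. P u"
  shows "\<exists>u\<in>fam G. \<forall>P\<in>\<Sigma>. P u"
proof -
  define f :: "nat \<Rightarrow> 'v" where "f = from_nat"
  define agree where "agree n u u' \<longleftrightarrow> (\<forall>i<n. u' (f i) = u (f i))" for n and u u' :: "'v \<Rightarrow> 'a list"
  define ok where "ok n u \<longleftrightarrow> u \<in> fam G \<and> (\<forall>F. finite F \<longrightarrow> F \<subseteq> \<Sigma> \<longrightarrow> (\<exists>u'\<in>fam G. agree n u u' \<and> (\<forall>P\<in>F. P u')))" for n u
  have "\<exists>u2. ok (Suc n) u2 \<and> agree n u u2" if u: "ok n u" for n u
  proof -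
    let ?A = "A \<union> (\<Union>i<n. set (u (f i)))"
    have uf: "u \<in> fam G" using u by (simp add: ok_def)
    define S where "S F = {d \<in> tuples MM (G (f n)). \<exists>u'\<in>fam G. u' (f n) = d \<and> (agree n u u' \<and> (\<forall>P\<in>F. P u'))}" for F
    have "\<exists>d\<in>tuples MM (G (f n)). \<forall>F\<in>{F. finite F \<and> F \<subseteq> \<Sigma>}. d \<in> S F"
    proof (rule realize)
      have "finite (\<Union>i<n. set (u (f i)))" by auto
      then show "|?A| <o \<kappa>" using A(2) small_Un small_finite by blast
      show "?A \<subseteq> elems L MM" using A(1) tuples_elems[OF famD[OF uf] G] by auto
      show "set (G (f n)) \<subseteq> sorts L" by (rule G)
      show "defble (G (f n)) ?A (S F)" if F: "F \<in> {F. finite F \<and> F \<subseteq> \<Sigma>}" for F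
        unfolding S_def
      proof (rule defble_project[where V = UNIV])
        have "dfn ?A G UNIV (\<lambda>u'. \<forall>i\<in>{..<n}. u' (f i) = u (f i))"
          by (intro dfn_ball dfn_eq_const) (use famD[OF uf] G in auto)
        moreover have "dfn ?A G UNIV (\<lambda>u'. \<forall>P\<in>F. P u')"
          by (intro dfn_ball) (use F dfn dfn_mono[of A G UNIV _ ?A UNIV] in auto)
        ultimately show "dfn ?A G UNIV (\<lambda>u'. agree n u u' \<and> (\<forall>P\<in>F. P u'))"
          unfolding agree_def by (intro dfn_conj) (simp_all add: Ball_def)
      qed (rule G)
      show "\<exists>d\<in>tuples MM (G (f n)). \<forall>F\<in>J. d \<in> S F" if J: "finite J" "J \<subseteq> {F. finite F \<and> F \<subseteq> \<Sigma>}" for J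
      proof -
        have "finite (\<Union>J)" "\<Union>J \<subseteq> \<Sigma>" using J by auto
        then obtain u' where "u' \<in> fam G" "agree n u u'" "\<forall>P\<in>\<Union>J. P u'"
          using u unfolding ok_def by blast
        then show ?thesis by (intro bexI[of _ "u' (f n)"]) (auto simp: S_def famD)
      qed
    qed
    then obtain d where d: "d \<in> tuples MM (G (f n))" "\<And>F. finite F \<Longrightarrow> F \<subseteq> \<Sigma> \<Longrightarrow> d \<in> S F" by blast
    have "agree n u (u(f n := d))"
      using d(2)[of "{}"] by (auto simp: S_def agree_def)
    moreover have "ok (Suc n) (u(f n := d))"
      unfolding ok_def
    proof (intro conjI allI impI)
      show "u(f n := d) \<in> fam G" using uf d(1) by (rule fam_update)
      fix F assume "finite F" "F \<subseteq> \<Sigma>"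
      from d(2)[OF this] obtain u' where "u' \<in> fam G" "u' (f n) = d" "agree n u u'" "\<forall>P\<in>F. P u'"
        by (auto simp: S_def)
      then show "\<exists>u'\<in>fam G. agree (Suc n) (u(f n := d)) u' \<and> (\<forall>P\<in>F. P u')"
        by (intro bexI[of _ u']) (auto simp: agree_def less_Suc_eq)
    qed
    ultimately show ?thesis by blast
  qed
  moreover have "\<exists>u. ok 0 u"
    using fin fam_nonempty[of G, OF G] unfolding ok_def agree_def by auto
  ultimately obtain U where U: "\<And>n. ok n (U n)" "\<And>n. agree n (U n) (U (Suc n))"
    using dependent_nat_choice[of ok "\<lambda>n. agree n"] by metis
  have ag: "agree n (U n) (U m)" if "n \<le> m" for n m
    using that
  proof (induction rule: dec_induct)
    case (step m)
    then show ?case using U(2)[of m] by (auto simp: agree_def)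
  qed (simp add: agree_def)
  \<comment> \<open>Stage n has settled the blocks with code below n, so block v is final from stage
    \<open>Suc (to_nat v)\<close> on.\<close>
  define u where "u v = U (Suc (to_nat v)) v" for v
  have uU: "u v = U n v" if "to_nat v < n" for v n
    using ag[of "Suc (to_nat v)" n] that unfolding agree_def u_def f_def
    by (metis Suc_leI from_nat_to_nat lessI)
  have ufam: "u \<in> fam G"
    using U(1) unfolding ok_def fam_def u_def by auto
  moreover have "P u" if P: "P \<in> \<Sigma>" for P
  proof -
    obtain V where V: "finite V" "dfn A G V P"
      using dfn_finite[OF dfn[OF P]] by blast
    obtain n where n: "\<forall>v\<in>V. to_nat v < n"
      using V(1) finite_nat_set_iff_bounded[of "to_nat ` V"] by auto
    obtain u' where u': "u' \<in> fam G" "agree n (U n) u'" "P u'"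
      using U(1)[of n] P unfolding ok_def by (metis finite.emptyI finite_insert insert_subset empty_subsetI insertI1)
    have "u v = u' v" if "v \<in> V" for v
    proof -
      have "to_nat v < n" using n that by blast
      then show ?thesis using uU[of v n] u'(2) unfolding agree_def f_def by (metis from_nat_to_nat)
    qed
    then show ?thesis using dfn_dep[OF V(2) ufam u'(1)] u'(3) by blast
  qed
  ultimately show ?thesis by blast
qed

end

section \<open>Chains of Kim-dividing formulas from the tree property\<close>

lemma finite_max:
  assumes "Well_order r" "finite Z" "Z \<noteq> {}" "Z \<subseteq> Field r"
  shows "\<exists>z\<in>Z. \<forall>y\<in>Z. (y, z) \<in> r"
  using assms(2,3,4)
proof (induction rule: finite_ne_induct)
  have lin: "refl_on (Field r) r" "trans r" "total_on (Field r) r"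
    using assms(1) by (auto simp: well_order_on_def linear_order_on_def partial_order_on_def preorder_on_def)
  {
    case (singleton x)
    then show ?case using lin(1) by (auto simp: refl_on_def)
  next
    case (insert x Z)
    then obtain z where z: "z \<in> Z" "\<forall>y\<in>Z. (y, z) \<in> r" by auto
    have xz: "x \<in> Field r" "z \<in> Field r" using insert.prems z(1) by auto
    show ?case
    proof (cases "(x, z) \<in> r")
      case False
      then have "(z, x) \<in> r" "(x, x) \<in> r"
        using lin(1,3) xz unfolding total_on_def refl_on_def by metis+
      then show ?thesis using z lin(2) by (auto dest: transD)
    qed (use z in auto)
  }
qed

text \<open>A set belonging to q contains \<open>t j\<close> for infinitely many j. As all
  \<open>t j\<close> lie in N, the type q is finitely satisfiable in N, hence N-invariant, and its
  Morley sequence over N started at c witnesses Kim-dividing.\<close>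

lemma (in saturated_struc) Kim_divides_average:
  assumes wf: "set \<Gamma> \<subseteq> sorts L" "set \<Delta> \<subseteq> sorts L" "wff L (\<Gamma> @ \<Delta>) \<phi>"
    and N: "N \<subseteq> elems L MM" "|N| <o \<kappa>"
    and t: "\<And>j::nat. t j \<in> tuples MM \<Delta>" "\<And>j. set (t j) \<subseteq> N"
    and inc: "\<And>J. finite J \<Longrightarrow> card J = k \<Longrightarrow> \<not> (\<exists>x\<in>tuples MM \<Gamma>. \<forall>j\<in>J. sat MM (x @ t j) \<phi>)"
    and q: "ptype (\<lambda>S. infinite {j. t j \<in> S}) \<Delta> (elems L MM) q"
    and c: "realizes \<Delta> N q c"
  shows "Kim_divides L MM \<Gamma> N (\<phi>, c)"
proof -
  let ?pos = "\<lambda>S. infinite {j. t j \<in> S}"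
  have pr: "part_reg ?pos" by (rule part_reg_infinite)
  have fs: "fs N ?pos"
    unfolding fs_def
  proof (intro allI impI)
    fix S assume "infinite {j. t j \<in> S}"
    then obtain j where "t j \<in> S" by (metis Collect_empty_eq finite.emptyI)
    moreover have "t j \<in> lists N" using t(2)[of j] by auto
    ultimately show "S \<inter> lists N \<noteq> {}" by blast
  qed
  let ?N = "\<lambda>f n. N \<union> (\<Union>j<n::nat. set (f j))"
  have "\<exists>bs. \<forall>n::nat. realizes \<Delta> (?N bs n) q (bs n) \<and> (n = 0 \<longrightarrow> bs n = c)"
  proof (rule dependent_wellorder_choice)
    fix n :: nat and f :: "nat \<Rightarrow> 'a list"
    assume IH: "\<And>m. m < n \<Longrightarrow> realizes \<Delta> (?N f m) q (f m) \<and> (m = 0 \<longrightarrow> f m = c)"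
    show "\<exists>b. realizes \<Delta> (?N f n) q b \<and> (n = 0 \<longrightarrow> b = c)"
    proof (cases "n = 0")
      case True
      then show ?thesis using c by auto
    next
      case False
      have "f j \<in> tuples MM \<Delta>" if "j < n" for j using IH[OF that] by (simp add: realizes_def)
      then have "?N f n \<subseteq> elems L MM" using N(1) tuples_elems[OF _ wf(2)] by blast
      moreover have "|?N f n| <o \<kappa>" by (intro small_Un[OF N(2)] small_finite) auto
      ultimately show ?thesis using realize_ptype[OF pr q _ _ _ wf(2)] False by blast
    qed
  next
    fix b :: "'a list" and f g :: "nat \<Rightarrow> 'a list" and n :: nat
    assume "\<And>m. m < n \<Longrightarrow> f m = g m"
    then have "?N f n = ?N g n" by auto
    then show "(realizes \<Delta> (?N f n) q b \<and> (n = 0 \<longrightarrow> b = c)) =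
        (realizes \<Delta> (?N g n) q b \<and> (n = 0 \<longrightarrow> b = c))" by simp
  qed
  then obtain bs where "\<forall>n. realizes \<Delta> (?N bs n) q (bs n) \<and> (n = 0 \<longrightarrow> bs n = c)" ..
  then have bs: "\<And>n. realizes \<Delta> (?N bs n) q (bs n)" "bs 0 = c" by simp_all
  have bst: "bs n \<in> tuples MM \<Delta>" for n using bs(1) by (simp add: realizes_def)
  have bsN: "?N bs n \<subseteq> elems L MM" for n using N(1) tuples_elems[OF bst wf(2)] by blast
  have "invariant_Morley_sequence L MM \<Delta> N bs"
    unfolding invariant_Morley_sequence_def
  proof (intro exI conjI allI ballI)
    show "invariant_global_type L MM \<Delta> N q" by (rule fs_invariant_global_type[OF pr q fs wf(2)])
    show "bs i \<in> tuples MM \<Delta>" for i by (rule bst)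
    fix i \<psi> assume "\<psi> \<in> q \<inter> pforms L MM \<Delta> (?N bs i)"
    then show "bs i \<in> solutions MM \<Delta> \<psi>"
      using bs(1)[of i] defble_solutions unfolding realizes_def inq_def by blast
  qed
  \<comment> \<open>Of k instances, l sit on the Morley sequence and the rest on t. If the condition
    held for \<open>bs l\<close>, it would hold for \<open>t j\<close> with infinitely many j, so
    one outside J can replace \<open>bs l\<close>. At l = 0 this contradicts the k-inconsistency
    along t.\<close>
  moreover have "\<not> (\<exists>x\<in>tuples MM \<Gamma>. (\<forall>j\<in>J. sat MM (x @ t j) \<phi>) \<and> (\<forall>i<l. sat MM (x @ bs i) \<phi>))"
    if "l \<le> k" "finite J" "card J = k - l" for l J
    using that
  proof (induction l arbitrary: J)
    case 0
    then show ?case using inc[of J] by auto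
  next
    case (Suc l)
    let ?P = "\<lambda>y. \<exists>x\<in>tuples MM \<Gamma>. sat MM (x @ y) \<phi> \<and> (\<forall>j\<in>J. sat MM (x @ t j) \<phi>) \<and> (\<forall>i\<in>{..<l}. sat MM (x @ bs i) \<phi>)"
    let ?S = "{y \<in> tuples MM \<Delta>. ?P y}"
    have "dfn (?N bs l) (\<lambda>_::unit. \<Delta>) UNIV (\<lambda>u. ?P (u ()))"
    proof (rule dfn_ex[where V' = UNIV])
      show "dfn (?N bs l) (case_option \<Gamma> (\<lambda>_::unit. \<Delta>)) UNIV (\<lambda>w. sat MM (w None @ w (Some ())) \<phi> \<and>
          (\<forall>j\<in>J. sat MM (w None @ t j) \<phi>) \<and> (\<forall>i\<in>{..<l}. sat MM (w None @ bs i) \<phi>))"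
        by (intro dfn_conj dfn_ball dfn_sat2' dfn_sat1[where \<Delta> = \<Delta>]) (use wf Suc.prems(2) t(1) bst t(2)[THEN subsetD] in auto)
    qed (use wf in \<open>auto simp: UNIV_option_conv\<close>)
    then have S: "defble \<Delta> (?N bs l) ?S" by (rule defbleI)
    show ?case
    proof
      assume "\<exists>x\<in>tuples MM \<Gamma>. (\<forall>j\<in>J. sat MM (x @ t j) \<phi>) \<and> (\<forall>i<Suc l. sat MM (x @ bs i) \<phi>)"
      then have "bs l \<in> ?S" using bst by auto
      then have "inq \<Delta> q ?S" using realizes_iff[OF pr q bsN bs(1) S] by simp
      from ptype_pos1[OF pr q this] have "infinite {j. t j \<in> ?S \<inter> tuples MM \<Delta>}" .
      then have "\<not> {j. t j \<in> ?S \<inter> tuples MM \<Delta>} \<subseteq> J" using Suc.prems(2) finite_subset by blast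
      then obtain j where j: "?P (t j)" "j \<notin> J" by blast
      then have "\<exists>x\<in>tuples MM \<Gamma>. (\<forall>i\<in>insert j J. sat MM (x @ t i) \<phi>) \<and> (\<forall>i<l. sat MM (x @ bs i) \<phi>)" by auto
      moreover have "card (insert j J) = k - l" using j(2) Suc.prems by simp
      ultimately show False using Suc.IH[of "insert j J"] Suc.prems by simp
    qed
  qed
  from this[of k "{}"] have "\<not> consistent MM \<Gamma> {(\<phi>, bs i) |i. True}"
  proof -
    assume "k \<le> k \<Longrightarrow> finite {} \<Longrightarrow> card {} = k - k \<Longrightarrow>
      \<not> (\<exists>x\<in>tuples MM \<Gamma>. (\<forall>j\<in>{}. sat MM (x @ t j) \<phi>) \<and> (\<forall>i<k. sat MM (x @ bs i) \<phi>))"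
    then have no: "\<not> (\<exists>x\<in>tuples MM \<Gamma>. \<forall>i<k. sat MM (x @ bs i) \<phi>)" by simp
    let ?F = "(\<lambda>i. (\<phi>, bs i)) ` {..<k}"
    show ?thesis
    proof
      assume "consistent MM \<Gamma> {(\<phi>, bs i) |i. True}"
      moreover have "finite ?F" "?F \<subseteq> {(\<phi>, bs i) |i. True}" by auto
      ultimately have "\<exists>a\<in>tuples MM \<Gamma>. \<forall>\<psi>\<in>?F. a \<in> solutions MM \<Gamma> \<psi>" unfolding consistent_def by blast
      then show False using no by (simp add: solutions_def) blast
    qed
  qed
  ultimately show ?thesis
    using wf bs(2) unfolding Kim_divides_def by auto
qed

section \<open>Climbing a tree that witnesses the tree property\<close>

locale tree_formula = saturated_struc L MM \<kappa>
  for L :: "('f, 'r, 's) lang" and MM :: "('f, 'r, 's, 'a) struc" and \<kappa> :: "'k rel" +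
  fixes \<Gamma> \<Delta> :: "'s list" and \<phi> :: "('f, 'r, 's) fm" and k :: nat
  assumes phi: "set \<Gamma> \<subseteq> sorts L" "set \<Delta> \<subseteq> sorts L" "wff L (\<Gamma> @ \<Delta>) \<phi>"
begin

text \<open>The root and the end point \<eta> are both included. Only finite branches are mentioned,
  so each condition is a single definable predicate of the tree.\<close>

definition branch :: "nat list \<Rightarrow> 'a list set \<Rightarrow> (nat list \<Rightarrow> 'a list) \<Rightarrow> bool" where
  "branch \<eta> C t \<longleftrightarrow> (\<exists>x\<in>tuples MM \<Gamma>. (\<forall>n\<in>{..length \<eta>}. sat MM (x @ t (take n \<eta>)) \<phi>) \<and> (\<forall>c\<in>C. sat MM (x @ c) \<phi>))"

definition siblings :: "nat list \<Rightarrow> nat set \<Rightarrow> (nat list \<Rightarrow> 'a list) \<Rightarrow> bool" where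
  "siblings \<nu> J t \<longleftrightarrow> \<not> (\<exists>x\<in>tuples MM \<Gamma>. \<forall>j\<in>J. sat MM (x @ t (\<nu> @ [j])) \<phi>)"

definition conds :: "'a list set \<Rightarrow> ((nat list \<Rightarrow> 'a list) \<Rightarrow> bool) set" where
  "conds C = {branch \<eta> C0 |\<eta> C0. finite C0 \<and> C0 \<subseteq> C} \<union> {siblings \<nu> J |\<nu> J. finite J \<and> card J = k}"

lemma branch_conds: "finite C0 \<Longrightarrow> C0 \<subseteq> C \<Longrightarrow> branch \<eta> C0 \<in> conds C"
  unfolding conds_def by blast

lemma siblings_conds: "finite J \<Longrightarrow> card J = k \<Longrightarrow> siblings \<nu> J \<in> conds C"
  unfolding conds_def by blast

lemma conds_cases:
  assumes "P \<in> conds C"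
  obtains \<eta> C0 where "P = branch \<eta> C0" "finite C0" "C0 \<subseteq> C" | \<nu> J where "P = siblings \<nu> J" "finite J" "card J = k"
  using assms unfolding conds_def by blast

lemma conds_mono: "C \<subseteq> C' \<Longrightarrow> conds C \<subseteq> conds C'"
  by (rule subsetI, erule conds_cases)
    (simp_all add: branch_conds siblings_conds subset_trans[of _ C C'])

text \<open>\<open>good C\<close>: the instances \<open>\<phi>(x,c)\<close>, \<open>c \<in> C\<close>, leave room for a whole tree witnessing the tree
  property.  By compactness this has finite character, which carries it through limit stages.\<close>

definition good :: "'a list set \<Rightarrow> bool" where
  "good C \<longleftrightarrow> (\<exists>t\<in>fam (\<lambda>_. \<Delta>). \<forall>P\<in>conds C. P t)"

lemma good_mono: "good C \<Longrightarrow> C' \<subseteq> C \<Longrightarrow> good C'"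
  unfolding good_def using conds_mono by (meson subsetD)

lemma good_consistent:
  assumes "good C" "finite C"
  shows "\<exists>x\<in>tuples MM \<Gamma>. \<forall>c\<in>C. sat MM (x @ c) \<phi>"
proof -
  obtain t where "\<forall>P\<in>conds C. P t" using assms(1) by (auto simp: good_def)
  then have "branch [] C t" using branch_conds[OF assms(2) subset_refl, of "[]"] by (rule bspec)
  then show ?thesis unfolding branch_def by fast
qed

lemma dfn_branch:
  assumes "finite C" "\<And>c. c \<in> C \<Longrightarrow> c \<in> tuples MM \<Delta> \<and> set c \<subseteq> A"
  shows "dfn A (\<lambda>_. \<Delta>) UNIV (branch \<eta> C)"
proof -
  have "dfn A (\<lambda>_. \<Delta>) UNIV (\<lambda>t. \<exists>x\<in>tuples MM \<Gamma>. (\<forall>n\<in>{..length \<eta>}. sat MM (x @ t (take n \<eta>)) \<phi>) \<and> (\<forall>c\<in>C. sat MM (x @ c) \<phi>))"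
  proof (rule dfn_ex[where V' = UNIV])
    show "dfn A (case_option \<Gamma> (\<lambda>_. \<Delta>)) UNIV (\<lambda>w. (\<forall>n\<in>{..length \<eta>}. sat MM (w None @ w (Some (take n \<eta>))) \<phi>) \<and>
        (\<forall>c\<in>C. sat MM (w None @ c) \<phi>))"
      by (intro dfn_conj dfn_ball dfn_sat2' dfn_sat1[where \<Delta> = \<Delta>]) (use phi assms in auto)
  qed (use phi in \<open>auto simp: UNIV_option_conv\<close>)
  then show ?thesis by (simp add: branch_def[abs_def])
qed

lemma dfn_siblings:
  assumes "finite J"
  shows "dfn A (\<lambda>_. \<Delta>) UNIV (siblings \<nu> J)"
proof -
  have "dfn A (\<lambda>_. \<Delta>) UNIV (\<lambda>t. \<exists>x\<in>tuples MM \<Gamma>. \<forall>j\<in>J. sat MM (x @ t (\<nu> @ [j])) \<phi>)"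
  proof (rule dfn_ex[where V' = UNIV])
    show "dfn A (case_option \<Gamma> (\<lambda>_. \<Delta>)) UNIV (\<lambda>w. \<forall>j\<in>J. sat MM (w None @ w (Some (\<nu> @ [j]))) \<phi>)"
      by (intro dfn_ball dfn_sat2') (use phi assms in auto)
  qed (use phi in \<open>auto simp: UNIV_option_conv\<close>)
  from dfn_neg[OF this] show ?thesis by (simp add: siblings_def[abs_def])
qed

lemma dfn_conds:
  assumes "P \<in> conds C" "\<And>c. c \<in> C \<Longrightarrow> c \<in> tuples MM \<Delta> \<and> set c \<subseteq> A"
  shows "dfn A (\<lambda>_. \<Delta>) UNIV P"
  using assms(1)
proof (cases rule: conds_cases)
  case (1 \<eta> C0)
  have "dfn A (\<lambda>_. \<Delta>) UNIV (branch \<eta> C0)" by (rule dfn_branch) (use 1 assms(2) in auto)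
  then show ?thesis using 1 by simp
qed (simp add: dfn_siblings)

text \<open>Each condition mentions finitely many members of C; this is the finite character behind
  \<open>good_compact\<close>.\<close>

lemma conds_finite:
  assumes "finite F" "F \<subseteq> conds C"
  obtains C0 where "finite C0" "C0 \<subseteq> C" "F \<subseteq> conds C0"
proof -
  have "\<exists>C0. finite C0 \<and> C0 \<subseteq> C \<and> F \<subseteq> conds C0"
    using assms
  proof (induction F rule: finite_induct)
    case (insert P F)
    then obtain C0 where C0: "finite C0" "C0 \<subseteq> C" "F \<subseteq> conds C0" by auto
    from insert.prems have "P \<in> conds C" by simp
    then obtain C1 where C1: "finite C1" "C1 \<subseteq> C" "P \<in> conds C1"
    proof (cases rule: conds_cases)
      case (1 \<eta> C1)
      then show ?thesis using that[of C1] branch_conds by simp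
    next
      case (2 \<nu> J)
      then show ?thesis using that[of "{}"] siblings_conds by simp
    qed
    have "insert P F \<subseteq> conds (C0 \<union> C1)"
      using C0(3) C1(3) conds_mono[of C0 "C0 \<union> C1"] conds_mono[of C1 "C0 \<union> C1"] by auto
    then show ?case using C0 C1 by (intro exI[of _ "C0 \<union> C1"]) simp
  qed auto
  then show thesis using that by blast
qed

lemma good_compact:
  assumes A: "A \<subseteq> elems L MM" "|A| <o \<kappa>" and C: "\<And>c. c \<in> C \<Longrightarrow> c \<in> tuples MM \<Delta> \<and> set c \<subseteq> A"
    and fin: "\<And>C0. finite C0 \<Longrightarrow> C0 \<subseteq> C \<Longrightarrow> good C0"
  shows "good C"
  unfolding good_def
proof (rule realize_fam[OF A])
  fix F assume F: "finite F" "F \<subseteq> conds C"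
  then obtain C0 where "finite C0" "C0 \<subseteq> C" "F \<subseteq> conds C0" by (rule conds_finite)
  moreover from this obtain u where "u \<in> fam (\<lambda>_. \<Delta>)" "\<forall>P\<in>conds C0. P u"
    using fin[of C0] unfolding good_def by metis
  ultimately show "\<exists>u\<in>fam (\<lambda>_. \<Delta>). \<forall>P\<in>F. P u" by (meson subsetD)
qed (use phi dfn_conds[OF _ C] in auto)

text \<open>The new c realises, over a model N containing A and the children of the root, an average
  of these children. Each child is the root of a tree satisfying the conditions of C, and this
  passes to c by compactness. Being a root, c lies on every branch of its tree, so it may be added
  to C.\<close>

lemma good_step:
  assumes Y: "infinite Y" "|Fm| \<le>o |Y|" "|sorts L| \<le>o |Y|" "|Y| <o \<kappa>"
    and A: "A \<subseteq> elems L MM" "|A| \<le>o |Y|" and C: "\<And>c. c \<in> C \<Longrightarrow> c \<in> tuples MM \<Delta> \<and> set c \<subseteq> A"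
    and good: "good C"
  obtains N c where "A \<subseteq> N" "TV N" "|N| \<le>o |Y|" "c \<in> tuples MM \<Delta>" "Kim_divides L MM \<Gamma> N (\<phi>, c)" "good (insert c C)"
proof -
  obtain t where t: "t \<in> fam (\<lambda>_. \<Delta>)" "\<And>P. P \<in> conds C \<Longrightarrow> P t"
    using good unfolding good_def by metis
  have tt: "t \<eta> \<in> tuples MM \<Delta>" for \<eta> using famD[OF t(1)] .
  let ?A = "A \<union> (\<Union>j. set (t [j]))"
  have "|?A| \<le>o |Y|"
    using A(2) ordLeq_finite[OF Y(1)] by (intro ordLeq_Un ordLeq_UN ordLeq_nat Y) auto
  moreover have "?A \<subseteq> elems L MM" using A(1) tuples_elems[OF tt phi(2)] by blast
  ultimately obtain N where N: "?A \<subseteq> N" "TV N" "|N| \<le>o |Y|"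
    using Loewenheim_Skolem[OF Y(1-3)] by metis
  have Ns: "N \<subseteq> elems L MM" "|N| <o \<kappa>"
    using TV_elems[OF N(2)] ordLeq_ordLess_trans[OF N(3) Y(4)] by auto
  let ?pos = "\<lambda>S. infinite {j. t [j] \<in> S}"
  have pr: "part_reg ?pos" by (rule part_reg_infinite)
  obtain q where q: "ptype ?pos \<Delta> (elems L MM) q"
    by (rule ptype_existsD[OF pr, of "{}" \<Delta> "elems L MM" "\<lambda>_. {}"]) (use tt in auto)
  obtain c where c: "realizes \<Delta> N q c"
    using realize_ptype[OF pr q Ns(1) Ns phi(2)] by blast
  then have ct: "c \<in> tuples MM \<Delta>" by (simp add: realizes_def)
  have "Kim_divides L MM \<Gamma> N (\<phi>, c)"
  proof (rule Kim_divides_average[OF phi Ns _ _ _ q c])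
    fix J :: "nat set" assume "finite J" "card J = k"
    then have "siblings [] J t" using t(2)[OF siblings_conds] by simp
    then show "\<not> (\<exists>x\<in>tuples MM \<Gamma>. \<forall>j\<in>J. sat MM (x @ t [j]) \<phi>)" by (simp add: siblings_def)
  next
    show "t [j] \<in> tuples MM \<Delta>" "set (t [j]) \<subseteq> N" for j using tt N(1) by blast+
  qed
  moreover have "good (insert c C)"
  proof -
    have "\<exists>u\<in>fam (\<lambda>_. \<Delta>). \<forall>P\<in>insert (\<lambda>u. u [] = c) (conds C). P u"
    proof (rule realize_fam)
      show "A \<union> set c \<subseteq> elems L MM" using A(1) tuples_elems[OF ct phi(2)] by simp
      show "|A \<union> set c| <o \<kappa>"
        by (intro small_Un[OF ordLeq_ordLess_trans[OF A(2) Y(4)]] small_finite) auto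
      show "dfn (A \<union> set c) (\<lambda>_. \<Delta>) UNIV P" if "P \<in> insert (\<lambda>u. u [] = c) (conds C)" for P
        using that dfn_conds[of P C "A \<union> set c"] C ct phi(2) by (auto intro!: dfn_eq_const)
      fix F assume F: "finite F" "F \<subseteq> insert (\<lambda>u. u [] = c) (conds C)"
      let ?F = "F \<inter> conds C"
      \<comment> \<open>The possible roots of trees satisfying the given finitely many conditions, a
        set definable over A. It contains every \<open>t [j]\<close>, so it belongs to q, and c lies
        in it.\<close>
      let ?S = "{d \<in> tuples MM \<Delta>. \<exists>u\<in>fam (\<lambda>_::nat list. \<Delta>). u [] = d \<and> (\<forall>P\<in>?F. P u)}"
      have "dfn A (\<lambda>_. \<Delta>) UNIV (\<lambda>u. \<forall>P\<in>?F. P u)"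
        by (intro dfn_ball dfn_conds[where C = C]) (use F C in auto)
      then have S: "defble \<Delta> A ?S"
        by (rule defble_project) (use phi in auto)
      have "t [j] \<in> ?S" for j
      proof -
        \<comment> \<open>The subtree above \<open>t [j]\<close>, re-rooted there. A branch \<eta>
          of it is part of the branch j # \<eta> of t, with the old root left out.\<close>
        have "P (\<lambda>\<nu>. t (j # \<nu>))" if "P \<in> conds C" for P
          using that
        proof (cases rule: conds_cases)
          case P: (1 \<eta> C0)
          then have "branch (j # \<eta>) C0 t" using t(2)[OF branch_conds] by simp
          then obtain x where x: "x \<in> tuples MM \<Gamma>" "\<And>n. n \<le> Suc (length \<eta>) \<Longrightarrow> sat MM (x @ t (take n (j # \<eta>))) \<phi>"
            "\<forall>c\<in>C0. sat MM (x @ c) \<phi>" by (auto simp: branch_def)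
          have "sat MM (x @ t (j # take n \<eta>)) \<phi>" if "n \<le> length \<eta>" for n
            using x(2)[of "Suc n"] that by simp
          then show ?thesis using x P(1) by (auto simp: branch_def)
        next
          case P: (2 \<nu> J)
          then have "siblings (j # \<nu>) J t" using t(2)[OF siblings_conds] by simp
          then show ?thesis using P(1) by (simp add: siblings_def)
        qed
        moreover have "(\<lambda>\<nu>. t (j # \<nu>)) \<in> fam (\<lambda>_. \<Delta>)" using tt by (simp add: fam_def)
        ultimately show ?thesis using tt by (intro CollectI conjI bexI[of _ "\<lambda>\<nu>. t (j # \<nu>)"]) auto
      qed
      then have "\<not> ?pos ((tuples MM \<Delta> - ?S) \<inter> tuples MM \<Delta>)" by auto
      then have "\<not> inq \<Delta> q (tuples MM \<Delta> - ?S)" using ptype_pos1[OF pr q] by blast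
      then have "inq \<Delta> q ?S" using inq_neg[OF pr q defble_mono[OF S A(1)]] by simp
      moreover have "A \<subseteq> N" using N(1) by simp
      ultimately have "c \<in> ?S" using c defble_mono[OF S] unfolding realizes_def by blast
      then obtain u where "u \<in> fam (\<lambda>_. \<Delta>)" "u [] = c" "\<forall>P\<in>?F. P u" by blast
      then show "\<exists>u\<in>fam (\<lambda>_. \<Delta>). \<forall>P\<in>F. P u" using F(2) by (intro bexI[of _ u] ballI) auto
    qed (use phi in auto)
    then obtain u where u: "u \<in> fam (\<lambda>_. \<Delta>)" "u [] = c" "\<And>P. P \<in> conds C \<Longrightarrow> P u" by auto
    \<comment> \<open>The instance at c comes for free: it is the root condition, n = 0, of every
      branch.\<close>
    have "P u" if "P \<in> conds (insert c C)" for P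
      using that
    proof (cases rule: conds_cases)
      case P: (1 \<eta> C0)
      then have "branch \<eta> (C0 - {c}) \<in> conds C" by (intro branch_conds) auto
      from u(3)[OF this] obtain x where x: "x \<in> tuples MM \<Gamma>" "\<forall>n\<in>{..length \<eta>}. sat MM (x @ u (take n \<eta>)) \<phi>"
        "\<forall>c\<in>C0 - {c}. sat MM (x @ c) \<phi>" unfolding branch_def by blast
      have "sat MM (x @ c) \<phi>" using x(2)[rule_format, of 0] u(2) by simp
      then show ?thesis using x P(1) unfolding branch_def by blast
    next
      case (2 \<nu> J)
      then show ?thesis using u(3)[OF siblings_conds] by simp
    qed
    then show ?thesis using u(1) unfolding good_def by blast
  qed
  ultimately show thesis using that[of N c] N ct by blast
qed

text \<open>Recursion along \<open>cardSuc |Y|\<close>: proper initial segments have size at most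
  |Y|, so all models can be kept of that size. Limit stages cause no trouble because
  \<open>good\<close> has finite character. The element a exists since all the instances together
  use a small set of parameters.\<close>

lemma Kim_chain:
  assumes Y: "infinite Y" "|Fm| \<le>o |Y|" "|sorts L| \<le>o |Y|" "cardSuc |Y| <o \<kappa>" and good: "good {}"
  obtains N c a where
    "\<And>i. i \<in> Field (cardSuc |Y| ) \<Longrightarrow> TV (N i) \<and> |N i| \<le>o |Y| \<and> c i \<in> tuples MM \<Delta> \<and> Kim_divides L MM \<Gamma> (N i) (\<phi>, c i)"
    "\<And>i j. (i, j) \<in> cardSuc |Y| \<Longrightarrow> i \<noteq> j \<Longrightarrow> N i \<union> set (c i) \<subseteq> N j"
    "a \<in> tuples MM \<Gamma>" "\<And>i. i \<in> Field (cardSuc |Y| ) \<Longrightarrow> sat MM (a @ c i) \<phi>"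
proof -
  let ?r = "cardSuc |Y|"
  have CY: "Card_order |Y|" by (rule card_of_Card_order)
  have Cr: "Card_order ?r" by (rule cardSuc_Card_order[OF CY])
  then have wo: "Well_order ?r" by (simp add: card_order_on_def)
  then have lin: "refl_on (Field ?r) ?r" "trans ?r" "total_on (Field ?r) ?r" "antisym ?r" and wf: "wf (?r - Id)"
    by (auto simp: well_order_on_def linear_order_on_def partial_order_on_def preorder_on_def)
  have Yk: "|Y| <o \<kappa>" using cardSuc_greater[OF CY] Y(4) ordLess_transitive by blast
  define U where "U x = {y. (y, x) \<in> ?r - Id}" for x
  have UF: "U x \<subseteq> Field ?r" for x by (auto simp: U_def Field_def)
  have Uc: "|U x| \<le>o |Y|" for x
  proof (cases "x \<in> Field ?r")
    case True
    have "U x = underS ?r x" by (auto simp: U_def underS_def)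
    then have "|U x| <o ?r" using card_of_underS[OF Cr True] by simp
    then show ?thesis using cardSuc_ordLeq_ordLess[OF CY card_of_Card_order] by blast
  next
    case False
    then have "U x = {}" by (auto simp: U_def Field_def)
    then show ?thesis by (simp add: card_of_empty)
  qed
  \<comment> \<open>The pair at a stage consists of the model and the parameter. Its parameter must
    be good together with all earlier ones, not only with the last.\<close>
  define P where "P f x r \<longleftrightarrow> TV (fst r) \<and> |fst r| \<le>o |Y| \<and> (\<forall>y\<in>U x. fst (f y) \<union> set (snd (f y)) \<subseteq> fst r) \<and>
    snd r \<in> tuples MM \<Delta> \<and> Kim_divides L MM \<Gamma> (fst r) (\<phi>, snd r) \<and> good (insert (snd r) ((\<lambda>y. snd (f y)) ` U x))"
    for f :: "'b set \<Rightarrow> 'a set \<times> 'a list" and x r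
  \<comment> \<open>A finite set of stages lies at or below its largest member z, and the invariant
    at z covers all of it.\<close>
  have gd: "good ((\<lambda>y. snd (f y)) ` Z)" if Z: "finite Z" "Z \<subseteq> Field ?r" "\<And>y. y \<in> Z \<Longrightarrow> P f y (f y)" for f Z
  proof (cases "Z = {}")
    case False
    obtain z where z: "z \<in> Z" "\<forall>y\<in>Z. (y, z) \<in> ?r" using finite_max[OF wo Z(1) False Z(2)] by blast
    then have "Z \<subseteq> insert z (U z)" by (auto simp: U_def)
    moreover have "good (insert (snd (f z)) ((\<lambda>y. snd (f y)) ` U z))" using Z(3)[OF z(1)] by (simp add: P_def)
    ultimately show ?thesis by (elim good_mono) auto
  qed (use good in simp)
  have "\<exists>f. \<forall>x. P f x (f x)"
  proof (rule dependent_wf_choice[OF wf])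
    fix f g :: "'b set \<Rightarrow> 'a set \<times> 'a list" and x and r :: "'a set \<times> 'a list"
    assume "\<And>z. (z, x) \<in> ?r - Id \<Longrightarrow> f z = g z"
    then have "\<forall>z\<in>U x. f z = g z" by (simp add: U_def)
    then have "(\<lambda>y. snd (f y)) ` U x = (\<lambda>y. snd (g y)) ` U x"
      "(\<forall>y\<in>U x. fst (f y) \<union> set (snd (f y)) \<subseteq> fst r) = (\<forall>y\<in>U x. fst (g y) \<union> set (snd (g y)) \<subseteq> fst r)" by auto
    then show "P f x r = P g x r" unfolding P_def by simp
  next
    fix x f assume "\<And>y. (y, x) \<in> ?r - Id \<Longrightarrow> P f y (f y)"
    then have IH: "\<And>y. y \<in> U x \<Longrightarrow> P f y (f y)" by (simp add: U_def)
    let ?C = "(\<lambda>y. snd (f y)) ` U x" and ?A = "\<Union>y\<in>U x. fst (f y) \<union> set (snd (f y))"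
    have Ae: "?A \<subseteq> elems L MM"
      using IH TV_elems tuples_elems phi(2) unfolding P_def by blast
    have Ac: "|?A| \<le>o |Y|"
      by (rule ordLeq_UN[OF Y(1) Uc], rule ordLeq_Un[OF Y(1) _ ordLeq_finite[OF Y(1)]])
        (use IH in \<open>auto simp: P_def\<close>)
    have C: "c \<in> tuples MM \<Delta> \<and> set c \<subseteq> ?A" if "c \<in> ?C" for c
      using that IH unfolding P_def by blast
    have gC: "good ?C"
    proof (rule good_compact[OF Ae ordLeq_ordLess_trans[OF Ac Yk] C])
      fix C0 assume "finite C0" "C0 \<subseteq> ?C"
      then obtain Z where "finite Z" "Z \<subseteq> U x" "C0 = (\<lambda>y. snd (f y)) ` Z" by (meson finite_subset_image)
      then show "good C0" using gd[of Z f] UF IH by blast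
    qed
    obtain N c where "?A \<subseteq> N" "TV N" "|N| \<le>o |Y|"
      "c \<in> tuples MM \<Delta>" "Kim_divides L MM \<Gamma> N (\<phi>, c)" "good (insert c ?C)"
      by (rule good_step[OF Y(1-3) Yk Ae Ac C gC])
    then show "\<exists>r. P f x r" by (intro exI[of _ "(N, c)"]) (auto simp: P_def)
  qed
  then obtain f where f: "\<And>x. P f x (f x)" by blast
  let ?A = "\<Union>i\<in>Field ?r. set (snd (f i))"
  have Ae: "?A \<subseteq> elems L MM"
    using f tuples_elems phi(2) unfolding P_def by blast
  have inf: "infinite (Field ?r)" using Y(1) cardSuc_finite[OF CY] by (simp add: Field_card_of)
  have "|?A| \<le>o |Field ?r|"
    by (rule ordLeq_UN[OF inf card_of_mono1[OF order_refl]]) (rule ordLeq_finite[OF inf], simp)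
  then have Ac: "|?A| <o \<kappa>"
    using Y(4) card_of_Field_ordIso[OF Cr] ordLeq_ordIso_trans ordLeq_ordLess_trans by blast
  have "\<exists>a\<in>tuples MM \<Gamma>. \<forall>i\<in>Field ?r. a \<in> {x \<in> tuples MM \<Gamma>. sat MM (x @ snd (f i)) \<phi>}"
  proof (rule realize[OF Ae Ac])
    show "defble \<Gamma> ?A {x \<in> tuples MM \<Gamma>. sat MM (x @ snd (f i)) \<phi>}" if "i \<in> Field ?r" for i
    proof (rule defbleI)
      show "dfn ?A (\<lambda>_::unit. \<Gamma>) UNIV (\<lambda>u. sat MM (u () @ snd (f i)) \<phi>)"
        by (rule dfn_sat1[where \<Delta> = \<Delta>]) (use that f[of i] phi(2) phi(3) in \<open>auto simp: P_def\<close>)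
    qed
    fix J assume J: "finite J" "J \<subseteq> Field ?r"
    show "\<exists>a\<in>tuples MM \<Gamma>. \<forall>i\<in>J. a \<in> {x \<in> tuples MM \<Gamma>. sat MM (x @ snd (f i)) \<phi>}"
      using good_consistent[OF gd[OF J f]] J(1) by fastforce
  qed (rule phi(1))
  then obtain a where a: "a \<in> tuples MM \<Gamma>" "\<And>i. i \<in> Field ?r \<Longrightarrow> sat MM (a @ snd (f i)) \<phi>" by blast
  show thesis
    by (rule that[of "\<lambda>i. fst (f i)" "\<lambda>i. snd (f i)" a])
      (use a f in \<open>auto simp: P_def U_def\<close>)
qed

end

section \<open>Stable formulas\<close>

text \<open>The order property of length n. Finite lengths are used because the number of votes is
  computed from a bound on them.\<close>

definition has_order :: "('x \<Rightarrow> 'y \<Rightarrow> bool) \<Rightarrow> 'x set \<Rightarrow> 'y set \<Rightarrow> nat \<Rightarrow> bool" where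
  "has_order R A B n \<longleftrightarrow> (\<exists>a b. \<forall>i<n. a i \<in> A \<and> b i \<in> B \<and> (\<forall>j<n. R (a i) (b j) \<longleftrightarrow> i < j))"

lemma has_orderI:
  assumes "\<And>i. i \<le> n \<Longrightarrow> a i \<in> A \<and> b i \<in> B" "\<And>i j. i \<le> n \<Longrightarrow> j \<le> n \<Longrightarrow> R (a i) (b j) \<longleftrightarrow> i < j"
  shows "has_order R A B n"
  unfolding has_order_def using assms by (intro exI[of _ a] exI[of _ b]) auto

text \<open>Reading both sequences backwards and shifting one of them by a step turns
  \<open>j \<le> i\<close> into \<open>i < j\<close>. The shift is the reason why indices up to and
  including n are supplied for an order of length n.\<close>

lemma has_orderI_rev:
  assumes "\<And>i. i \<le> n \<Longrightarrow> a i \<in> A \<and> b i \<in> B" "\<And>i j. i \<le> n \<Longrightarrow> j \<le> n \<Longrightarrow> R (a i) (b j) \<longleftrightarrow> j \<le> i"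
  shows "has_order R A B n"
  unfolding has_order_def
proof (intro exI allI impI conjI)
  fix i assume i: "i < n"
  show "a (n - 1 - i) \<in> A" "b (n - i) \<in> B" using assms(1) by auto
  fix j assume j: "j < n"
  show "R (a (n - 1 - i)) (b (n - j)) \<longleftrightarrow> i < j" using assms(2)[of "n - 1 - i" "n - j"] i j by auto
qed

text \<open>More than half of the first 2n+1 points say yes. Written as a finite disjunction over
  sets of exactly n+1 voters, so that it is visibly first-order.\<close>

definition maj :: "('x \<Rightarrow> 'y \<Rightarrow> bool) \<Rightarrow> nat \<Rightarrow> (nat \<Rightarrow> 'x) \<Rightarrow> 'y \<Rightarrow> bool" where
  "maj R n a y \<longleftrightarrow> (\<exists>w\<in>{w \<in> Pow {..<2 * n + 1}. card w = Suc n}. \<forall>k\<in>w. R (a k) y)"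

text \<open>Suppose n+1 voters, enumerated increasingly by h, were wrong about y. By richness
  \<open>Y (h r)\<close> contains some z on the same side as y about which the voters h 0, ..., h
  (r-1) are wrong too. The voters from h r on are right about it, since it lies in their sets. This
  is an order of length n, so at most n of 2n+1 votes are wrong.\<close>

lemma majority_vote:
  assumes no: "\<not> has_order R A B n"
    and m: "\<And>k. m k \<in> A" and YB: "\<And>k. Y k \<subseteq> B"
    and Y: "\<And>k y. y \<in> Y k \<Longrightarrow> R (m k) y \<longleftrightarrow> y \<in> X" "\<And>k l. k \<le> l \<Longrightarrow> Y k \<subseteq> Y l"
    and richT: "\<And>k w y. w \<subseteq> {..<k} \<Longrightarrow> y \<in> B \<Longrightarrow> y \<in> X \<Longrightarrow> \<forall>j\<in>w. \<not> R (m j) y \<Longrightarrow> \<exists>y\<in>Y k. y \<in> X \<and> (\<forall>j\<in>w. \<not> R (m j) y)"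
    and richF: "\<And>k w y. w \<subseteq> {..<k} \<Longrightarrow> y \<in> B \<Longrightarrow> y \<notin> X \<Longrightarrow> \<forall>j\<in>w. R (m j) y \<Longrightarrow> \<exists>y\<in>Y k. y \<notin> X \<and> (\<forall>j\<in>w. R (m j) y)"
    and y: "y \<in> B"
  shows "y \<in> X \<longleftrightarrow> maj R n m y"
proof -
  have enum: "\<exists>h. strict_mono_on {..<Suc n} h \<and> (\<forall>s\<le>n. h s \<in> w)" if "finite w" "card w = Suc n" for w :: "nat set"
    using finite_enumerate[OF that(1)] that(2) by (metis lessThan_iff less_Suc_eq_le)
  have T: "\<not> (\<forall>k\<in>w. \<not> R (m k) y)" if w: "finite w" "card w = Suc n" and "y \<in> X" for w
  proof
    assume *: "\<forall>k\<in>w. \<not> R (m k) y"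
    obtain h where h: "strict_mono_on {..<Suc n} h" "\<And>s. s \<le> n \<Longrightarrow> h s \<in> w" using enum[OF w] by auto
    have "\<exists>z\<in>Y (h r). z \<in> X \<and> (\<forall>j\<in>h ` {..<r}. \<not> R (m j) z)" if "r \<le> n" for r
      by (rule richT[OF _ y \<open>y \<in> X\<close>]) (use * h that in \<open>auto simp: strict_mono_on_def\<close>)
    then obtain z where z: "\<And>r. r \<le> n \<Longrightarrow> z r \<in> Y (h r) \<and> z r \<in> X \<and> (\<forall>j\<in>h ` {..<r}. \<not> R (m j) (z r))" by metis
    have "has_order R A B n"
    proof (rule has_orderI_rev[of _ "m \<circ> h" _ z])
      show "(m \<circ> h) i \<in> A \<and> z i \<in> B" if "i \<le> n" for i using m z[OF that] YB by auto
      fix s r assume sr: "s \<le> n" "r \<le> n"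
      show "R ((m \<circ> h) s) (z r) \<longleftrightarrow> r \<le> s"
      proof (cases "r \<le> s")
        case True
        then have "h r \<le> h s" using h(1) sr by (cases "r = s") (auto simp: strict_mono_on_def intro: less_imp_le)
        then have "z r \<in> Y (h s)" using Y(2) z[OF sr(2)] by blast
        then show ?thesis using Y(1) z[OF sr(2)] True by simp
      next
        case False
        then have "h s \<in> h ` {..<r}" by auto
        then show ?thesis using z[OF sr(2)] False by auto
      qed
    qed
    then show False using no by simp
  qed
  have F: "\<not> (\<forall>k\<in>w. R (m k) y)" if w: "finite w" "card w = Suc n" and "y \<notin> X" for w
  proof
    assume *: "\<forall>k\<in>w. R (m k) y"
    obtain h where h: "strict_mono_on {..<Suc n} h" "\<And>s. s \<le> n \<Longrightarrow> h s \<in> w" using enum[OF w] by auto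
    have "\<exists>z\<in>Y (h r). z \<notin> X \<and> (\<forall>j\<in>h ` {..<r}. R (m j) z)" if "r \<le> n" for r
      by (rule richF[OF _ y \<open>y \<notin> X\<close>]) (use * h that in \<open>auto simp: strict_mono_on_def\<close>)
    then obtain z where z: "\<And>r. r \<le> n \<Longrightarrow> z r \<in> Y (h r) \<and> z r \<notin> X \<and> (\<forall>j\<in>h ` {..<r}. R (m j) (z r))" by metis
    have "has_order R A B n"
    proof (rule has_orderI[of _ "m \<circ> h" _ z])
      show "(m \<circ> h) i \<in> A \<and> z i \<in> B" if "i \<le> n" for i using m z[OF that] YB by auto
      fix s r assume sr: "s \<le> n" "r \<le> n"
      show "R ((m \<circ> h) s) (z r) \<longleftrightarrow> s < r"
      proof (cases "r \<le> s")
        case True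
        then have "h r \<le> h s" using h(1) sr by (cases "r = s") (auto simp: strict_mono_on_def intro: less_imp_le)
        then have "z r \<in> Y (h s)" using Y(2) z[OF sr(2)] by blast
        then show ?thesis using Y(1) z[OF sr(2)] True by simp
      next
        case False
        then have "h s \<in> h ` {..<r}" by auto
        then show ?thesis using z[OF sr(2)] False by auto
      qed
    qed
    then show False using no by simp
  qed
  let ?P = "{k\<in>{..<2 * n + 1}. R (m k) y}" and ?N = "{k\<in>{..<2 * n + 1}. \<not> R (m k) y}"
  have "card ?P + card ?N = card (?P \<union> ?N)" by (rule card_Un_disjoint[symmetric]) auto
  also have "?P \<union> ?N = {..<2 * n + 1}" by auto
  finally have sum: "card ?P + card ?N = 2 * n + 1" by simp
  show ?thesis
  proof
    assume "y \<in> X"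
    have "\<not> Suc n \<le> card ?N"
    proof
      assume "Suc n \<le> card ?N"
      then obtain w where "w \<subseteq> ?N" "card w = Suc n" "finite w" by (meson obtain_subset_with_card_n)
      then show False using T[of w] \<open>y \<in> X\<close> by auto
    qed
    then have "Suc n \<le> card ?P" using sum by simp
    then obtain w where "w \<subseteq> ?P" "card w = Suc n" by (meson obtain_subset_with_card_n)
    then show "maj R n m y" unfolding maj_def by auto
  next
    assume "maj R n m y"
    then obtain w where "w \<subseteq> {..<2 * n + 1}" "card w = Suc n" "\<forall>k\<in>w. R (m k) y" unfolding maj_def by auto
    then show "y \<in> X" using F[of w] finite_subset by blast
  qed
qed

section \<open>Definability of types with respect to a stable formula\<close>

locale two_sided_formula = saturated_struc L MM \<kappa>
  for L :: "('f, 'r, 's) lang" and MM :: "('f, 'r, 's, 'a) struc" and \<kappa> :: "'k rel" +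
  fixes \<Gamma> \<Delta> \<Theta> :: "'s list" and \<psi> :: "('f, 'r, 's) fm" and c :: "'a list"
  assumes psi: "set \<Gamma> \<subseteq> sorts L" "set \<Delta> \<subseteq> sorts L" "set \<Theta> \<subseteq> sorts L" "wff L (\<Gamma> @ \<Delta> @ \<Theta>) \<psi>"
    and c: "c \<in> tuples MM \<Theta>"
begin

definition R :: "'a list \<Rightarrow> 'a list \<Rightarrow> bool" where
  "R x y \<longleftrightarrow> sat MM (x @ y @ c) \<psi>"

lemma dfn_R: "G v = \<Gamma> \<Longrightarrow> G w = \<Delta> \<Longrightarrow> set c \<subseteq> A \<Longrightarrow> v \<in> V \<Longrightarrow> w \<in> V \<Longrightarrow> dfn A G V (\<lambda>u. R (u v) (u w))"
  unfolding R_def by (rule dfn_sat2[where \<Delta> = \<Theta>]) (use psi c in auto)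

lemma dfn_R_left: "G v = \<Gamma> \<Longrightarrow> y \<in> tuples MM \<Delta> \<Longrightarrow> set y \<union> set c \<subseteq> A \<Longrightarrow> v \<in> V \<Longrightarrow> dfn A G V (\<lambda>u. R (u v) y)"
  unfolding R_def by (rule dfn_sat1[where \<Delta> = "\<Delta> @ \<Theta>"]) (use psi c tuples_append in auto)

lemma dfn_R_right: "G v = \<Delta> \<Longrightarrow> x \<in> tuples MM \<Gamma> \<Longrightarrow> set x \<union> set c \<subseteq> A \<Longrightarrow> v \<in> V \<Longrightarrow> dfn A G V (\<lambda>u. R x (u v))"
  unfolding R_def by (rule dfn_sat_mid[where \<Gamma> = \<Gamma> and \<Delta> = \<Theta>]) (use psi c in auto)

lemma defble_R_left: "y \<in> tuples MM \<Delta> \<Longrightarrow> set y \<union> set c \<subseteq> A \<Longrightarrow> defble \<Gamma> A {x \<in> tuples MM \<Gamma>. R x y}"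
  by (rule defbleI[where P = "\<lambda>x. R x y"]) (rule dfn_R_left, auto)

lemma defble_maj:
  assumes "\<And>k. k < 2 * n + 1 \<Longrightarrow> m k \<in> tuples MM \<Gamma> \<and> set (m k) \<subseteq> A" "set c \<subseteq> A"
  shows "defble \<Delta> A {y \<in> tuples MM \<Delta>. maj R n m y}"
proof (rule defbleI)
  show "dfn A (\<lambda>_::unit. \<Delta>) UNIV (\<lambda>u. maj R n m (u ()))"
    unfolding maj_def
  proof (intro dfn_bex dfn_ball dfn_R_right)
    fix w k assume "w \<in> {w \<in> Pow {..<2 * n + 1}. card w = Suc n}" "k \<in> w"
    then have "k < 2 * n + 1" by auto
    then show "m k \<in> tuples MM \<Gamma>" "set (m k) \<union> set c \<subseteq> A" using assms by auto
  qed (auto intro: finite_subset)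
qed

text \<open>Compactness: orders of every finite length would yield an infinite one. In the family of
  variables, \<open>(True, i)\<close> names the i-th point on the left and \<open>(False, j)\<close>
  the j-th point on the right.\<close>

lemma stable_bound:
  assumes "stable_formula MM \<Gamma> \<Delta> \<psi> c"
  shows "\<exists>n. \<not> has_order R (tuples MM \<Gamma>) (tuples MM \<Delta>) n"
proof (rule ccontr)
  assume ord: "\<nexists>n. \<not> has_order R (tuples MM \<Gamma>) (tuples MM \<Delta>) n"
  define P where "P n u \<longleftrightarrow> (\<forall>i\<in>{..<n}. \<forall>j\<in>{..<n}. R (u (True, i)) (u (False, j)) \<longleftrightarrow> i < j)"
    for n :: nat and u :: "bool \<times> nat \<Rightarrow> 'a list"
  let ?G = "\<lambda>v :: bool \<times> nat. if fst v then \<Gamma> else \<Delta>"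
  have "\<exists>u\<in>fam ?G. \<forall>Q\<in>range P. Q u"
  proof (rule realize_fam)
    show "set c \<subseteq> elems L MM" using tuples_elems[OF c psi(3)] .
    show "|set c| <o \<kappa>" by (rule small_finite) simp
    show "dfn (set c) ?G UNIV Q" if "Q \<in> range P" for Q
    proof -
      have "dfn (set c) ?G UNIV (P n)" for n
        unfolding P_def[abs_def] by (intro dfn_ball dfn_iff dfn_const dfn_R) auto
      then show ?thesis using that by auto
    qed
    fix F assume "finite F" "F \<subseteq> range P"
    then obtain I where I: "finite I" "F = P ` I" by (meson finite_subset_image)
    then obtain n where n: "\<forall>i\<in>I. i < n" using finite_nat_set_iff_bounded by blast
    obtain a b where ab: "\<forall>i<n. a i \<in> tuples MM \<Gamma> \<and> b i \<in> tuples MM \<Delta> \<and> (\<forall>j<n. R (a i) (b j) \<longleftrightarrow> i < j)"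
      using ord unfolding has_order_def by blast
    obtain x y where xy: "x \<in> tuples MM \<Gamma>" "y \<in> tuples MM \<Delta>" using tuples_nonempty psi by blast
    define u where "u v = (if fst v then (if snd v < n then a (snd v) else x) else (if snd v < n then b (snd v) else y))"
      for v :: "bool \<times> nat"
    have "u \<in> fam ?G" using ab xy by (auto simp: fam_def u_def)
    moreover have "P i u" if "i \<in> I" for i using ab n that by (fastforce simp: P_def u_def)
    ultimately show "\<exists>u\<in>fam ?G. \<forall>Q\<in>F. Q u" using I(2) by blast
  qed (use psi in auto)
  then obtain u where u: "u \<in> fam ?G" "\<And>n. P n u" by blast
  have "sat MM (u (True, i) @ u (False, j) @ c) \<psi> \<longleftrightarrow> i < j" for i j
    using u(2)[of "Suc (max i j)"] by (auto simp: P_def R_def less_Suc_eq_le)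
  moreover have "u (True, i) \<in> tuples MM \<Gamma>" "u (False, i) \<in> tuples MM \<Delta>" for i
    using famD[OF u(1), of "(True, i)"] famD[OF u(1), of "(False, i)"] by auto
  ultimately have "\<not> stable_formula MM \<Gamma> \<Delta> \<psi> c"
    unfolding stable_formula_def not_not
    by (intro exI[of _ "\<lambda>i. u (True, i)"] exI[of _ "\<lambda>i. u (False, i)"]) simp
  then show False using assms by simp
qed

text \<open>Finite satisfiability in B yields voters from B, each agreeing with q on a finite set of
  tests. The result describes q at all y of the structure, not only at those from B.\<close>

lemma majority_inside:
  assumes no: "\<not> has_order R (tuples MM \<Gamma>) (tuples MM \<Delta>) n"
    and pr: "part_reg pos" and q: "ptype pos \<Gamma> (elems L MM) q" and fs: "fs B pos"
  obtains m where "\<And>k. m k \<in> tuples MM \<Gamma> \<and> set (m k) \<subseteq> B"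
    "\<And>y. y \<in> tuples MM \<Delta> \<Longrightarrow> inq \<Gamma> q {x \<in> tuples MM \<Gamma>. R x y} \<longleftrightarrow> maj R n m y"
proof -
  let ?S = "\<lambda>y. {x \<in> tuples MM \<Gamma>. R x y}"
  define X where "X = {y \<in> tuples MM \<Delta>. inq \<Gamma> q (?S y)}"
  have dS: "defble \<Gamma> (elems L MM) (?S y)" if "y \<in> tuples MM \<Delta>" for y
    by (rule defble_R_left[OF that]) (use tuples_elems[OF that psi(2)] tuples_elems[OF c psi(3)] in simp)
  define P where "P f k r \<longleftrightarrow> finite (snd r) \<and> snd r \<subseteq> tuples MM \<Delta> \<and> (\<forall>j<k. snd (f j) \<subseteq> snd r) \<and>
     (\<forall>w\<subseteq>{..<k}. (\<exists>y\<in>tuples MM \<Delta>. y \<in> X \<and> (\<forall>j\<in>w. \<not> R (fst (f j)) y)) \<longrightarrow> (\<exists>y\<in>snd r. y \<in> X \<and> (\<forall>j\<in>w. \<not> R (fst (f j)) y))) \<and>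
     (\<forall>w\<subseteq>{..<k}. (\<exists>y\<in>tuples MM \<Delta>. y \<notin> X \<and> (\<forall>j\<in>w. R (fst (f j)) y)) \<longrightarrow> (\<exists>y\<in>snd r. y \<notin> X \<and> (\<forall>j\<in>w. R (fst (f j)) y))) \<and>
     fst r \<in> tuples MM \<Gamma> \<and> set (fst r) \<subseteq> B \<and> (\<forall>y\<in>snd r. R (fst r) y \<longleftrightarrow> y \<in> X)"
    for f :: "nat \<Rightarrow> 'a list \<times> 'a list set" and k and r
  have PY: "finite (snd r)" "snd r \<subseteq> tuples MM \<Delta>" if "P f k r" for f k r
    using that by (simp_all add: P_def)
  have "\<exists>f. \<forall>k. P f k (f k)"
  proof (rule dependent_wellorder_choice)
    fix r and f g :: "nat \<Rightarrow> 'a list \<times> 'a list set" and k :: nat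
    assume eq: "\<And>j. j < k \<Longrightarrow> f j = g j"
    have e: "w \<subseteq> {..<k} \<Longrightarrow> (\<forall>j\<in>w. \<not> R (fst (f j)) y) = (\<forall>j\<in>w. \<not> R (fst (g j)) y)"
      "w \<subseteq> {..<k} \<Longrightarrow> (\<forall>j\<in>w. R (fst (f j)) y) = (\<forall>j\<in>w. R (fst (g j)) y)" for w y
      by (intro ball_cong refl; use eq in auto)+
    show "P f k r = P g k r" unfolding P_def by (simp add: eq e cong: conj_cong imp_cong)
  next
    fix k and f :: "nat \<Rightarrow> 'a list \<times> 'a list set"
    assume IH: "\<And>j. j < k \<Longrightarrow> P f j (f j)"
    define T F where "T w y \<longleftrightarrow> y \<in> tuples MM \<Delta> \<and> y \<in> X \<and> (\<forall>j\<in>w. \<not> R (fst (f j)) y)"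
      and "F w y \<longleftrightarrow> y \<in> tuples MM \<Delta> \<and> y \<notin> X \<and> (\<forall>j\<in>w. R (fst (f j)) y)" for w y
    \<comment> \<open>One test for each set w of earlier voters and each side on which they can be
      jointly wrong. There are finitely many such w, so Y stays finite and a single point of B can
      agree with q on all of it.\<close>
    let ?pick = "\<lambda>Q. (\<lambda>w. SOME y. Q w y) ` {w \<in> Pow {..<k}. \<exists>y. Q w y}"
    define Y where "Y = (\<Union>j<k. snd (f j)) \<union> ?pick T \<union> ?pick F"
    have pick: "Q w (SOME y. Q w y)" if "\<exists>y. Q w y" for Q :: "nat set \<Rightarrow> 'a list \<Rightarrow> bool" and w
      using someI_ex[OF that] .
    have "finite Y" unfolding Y_def using PY(1)[OF IH] by auto
    moreover have "Y \<subseteq> tuples MM \<Delta>"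
    proof
      fix y assume "y \<in> Y"
      then consider j where "j < k" "y \<in> snd (f j)" | w where "T w y" | w where "F w y"
        unfolding Y_def using pick[of T] pick[of F] by blast
      then show "y \<in> tuples MM \<Delta>"
      proof cases
        case (1 j)
        then show ?thesis using PY(2)[OF IH] by blast
      qed (simp_all add: T_def F_def)
    qed
    ultimately have Y: "finite Y" "Y \<subseteq> tuples MM \<Delta>" by auto
    \<comment> \<open>Each test enters with its set or the complement, whichever belongs to q; a
      large intersection meets the tuples of B.\<close>
    have "pos {x \<in> tuples MM \<Gamma>. \<forall>y\<in>Y. x \<in> (if y \<in> X then ?S y else tuples MM \<Gamma> - ?S y)}"
    proof (rule ptype_pos[OF pr q Y(1)])
      fix y assume "y \<in> Y"
      then have "y \<in> tuples MM \<Delta>" using Y by auto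
      then show "inq \<Gamma> q (if y \<in> X then ?S y else tuples MM \<Gamma> - ?S y)"
        using inq_neg[OF pr q dS] unfolding X_def by auto
    qed
    then obtain x where x: "x \<in> tuples MM \<Gamma>" "x \<in> lists B" "\<forall>y\<in>Y. x \<in> (if y \<in> X then ?S y else tuples MM \<Gamma> - ?S y)"
      using fs unfolding fs_def by blast
    have "\<exists>y\<in>Y. y \<in> X \<and> (\<forall>j\<in>w. \<not> R (fst (f j)) y)" if "w \<subseteq> {..<k}" "\<exists>y\<in>tuples MM \<Delta>. y \<in> X \<and> (\<forall>j\<in>w. \<not> R (fst (f j)) y)" for w
    proof -
      have e: "\<exists>y. T w y" using that(2) by (auto simp: T_def)
      then have "(SOME y. T w y) \<in> Y" using that(1) unfolding Y_def by blast
      then show ?thesis using pick[of T, OF e] by (auto simp: T_def)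
    qed
    moreover have "\<exists>y\<in>Y. y \<notin> X \<and> (\<forall>j\<in>w. R (fst (f j)) y)" if "w \<subseteq> {..<k}" "\<exists>y\<in>tuples MM \<Delta>. y \<notin> X \<and> (\<forall>j\<in>w. R (fst (f j)) y)" for w
    proof -
      have e: "\<exists>y. F w y" using that(2) by (auto simp: F_def)
      then have "(SOME y. F w y) \<in> Y" using that(1) unfolding Y_def by blast
      then show ?thesis using pick[of F, OF e] by (auto simp: F_def)
    qed
    moreover have "\<forall>j<k. snd (f j) \<subseteq> Y" unfolding Y_def by blast
    moreover have "\<forall>y\<in>Y. R x y \<longleftrightarrow> y \<in> X" using x by (auto split: if_splits)
    ultimately show "\<exists>r. P f k r"
      using Y x by (intro exI[of _ "(x, Y)"]) (auto simp: P_def)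
  qed
  then obtain f where f: "\<And>k. P f k (f k)" by blast
  have sub: "snd (f k) \<subseteq> snd (f l)" if "k \<le> l" for k l
    using that f[of l] by (cases "k = l") (auto simp: P_def)
  have "y \<in> X \<longleftrightarrow> maj R n (\<lambda>k. fst (f k)) y" if "y \<in> tuples MM \<Delta>" for y
  proof (rule majority_vote[OF no, where Y = "\<lambda>k. snd (f k)"])
    show "fst (f k) \<in> tuples MM \<Gamma>" "snd (f k) \<subseteq> tuples MM \<Delta>" for k using f[of k] by (auto simp: P_def)
    show "R (fst (f k)) y = (y \<in> X)" if "y \<in> snd (f k)" for k y using f[of k] that by (auto simp: P_def)
    show "\<exists>y\<in>snd (f k). y \<in> X \<and> (\<forall>j\<in>w. \<not> R (fst (f j)) y)"
      if "w \<subseteq> {..<k}" "y \<in> tuples MM \<Delta>" "y \<in> X" "\<forall>j\<in>w. \<not> R (fst (f j)) y" for k w y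
      using f[of k] that unfolding P_def by blast
    show "\<exists>y\<in>snd (f k). y \<notin> X \<and> (\<forall>j\<in>w. R (fst (f j)) y)"
      if "w \<subseteq> {..<k}" "y \<in> tuples MM \<Delta>" "y \<notin> X" "\<forall>j\<in>w. R (fst (f j)) y" for k w y
      using f[of k] that unfolding P_def by blast
  qed (use sub that in auto)
  then show thesis
    by (intro that[of "\<lambda>k. fst (f k)"]) (use f in \<open>auto simp: P_def X_def\<close>)
qed

text \<open>Here the k-th voter realises q over the model \<open>B k\<close>, so it is right about
  all y from \<open>B k\<close>. Richness is elementarity: as X is definable over
  \<open>B 0\<close>, a pattern of wrong votes of earlier voters is definable over
  \<open>B k\<close> and has a witness there.\<close>

lemma majority_outside:
  assumes no: "\<not> has_order R (tuples MM \<Gamma>) (tuples MM \<Delta>) n"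
    and pr: "part_reg pos" and q: "ptype pos \<Gamma> (elems L MM) q"
    and B: "\<And>k. TV (B k)" "\<And>k l. k \<le> l \<Longrightarrow> B k \<subseteq> B l" "set c \<subseteq> B 0"
    and a: "\<And>k. realizes \<Gamma> (B k) q (a k)" "\<And>k. set (a k) \<subseteq> B (Suc k)"
    and X: "defble \<Delta> (B 0) X" "\<And>y. y \<in> tuples MM \<Delta> \<Longrightarrow> y \<in> X \<longleftrightarrow> inq \<Gamma> q {x \<in> tuples MM \<Gamma>. R x y}"
    and y: "y \<in> tuples MM \<Delta>"
  shows "y \<in> X \<longleftrightarrow> maj R n a y"
proof -
  have at: "a k \<in> tuples MM \<Gamma>" for k using a(1) by (simp add: realizes_def)
  have aB: "set (a j) \<subseteq> B k" if "j < k" for j k using a(2)[of j] B(2)[of "Suc j" k] that by auto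
  have cB: "set c \<subseteq> B k" and XB: "defble \<Delta> (B k) X" for k using B(2)[of 0 k] B(3) defble_mono[OF X(1)] by auto
  have dX: "dfn (B k) (\<lambda>_::unit. \<Delta>) UNIV (\<lambda>u. u () \<in> X)" for k by (rule dfn_mem) (use XB in auto)
  have get: "\<exists>y\<in>tuples MM \<Delta> \<inter> lists (B k). Q y"
    if "dfn (B k) (\<lambda>_::unit. \<Delta>) UNIV (\<lambda>u. Q (u ()))" "y \<in> tuples MM \<Delta>" "Q y" for k Q y
  proof -
    have "{y \<in> tuples MM \<Delta>. Q y} \<noteq> {}" using that by auto
    with TV_tuple[OF B(1) psi(2) defbleI[OF that(1)]] obtain z where "z \<in> {y \<in> tuples MM \<Delta>. Q y}" "set z \<subseteq> B k" by metis
    then show ?thesis by auto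
  qed
  show ?thesis
  proof (rule majority_vote[OF no at, where Y = "\<lambda>k. tuples MM \<Delta> \<inter> lists (B k)"])
    fix k y assume y: "y \<in> tuples MM \<Delta> \<inter> lists (B k)"
    have "defble \<Gamma> (B k) {x \<in> tuples MM \<Gamma>. R x y}" by (rule defble_R_left) (use y cB in auto)
    from realizes_iff[OF pr q TV_elems[OF B(1)] a(1) this]
    show "R (a k) y \<longleftrightarrow> y \<in> X" using X(2) y at by simp
  next
    fix k w y assume *: "w \<subseteq> {..<k}" "y \<in> tuples MM \<Delta>" "y \<in> X" "\<forall>j\<in>w. \<not> R (a j) y"
    have "\<exists>y\<in>tuples MM \<Delta> \<inter> lists (B k). y \<in> X \<and> (\<forall>j\<in>w. \<not> R (a j) y)"
      by (rule get[OF _ *(2)], intro dfn_conj dX dfn_ball dfn_neg dfn_R_right)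
        (use * at aB[THEN subsetD] cB[THEN subsetD] finite_subset[OF *(1)] in auto)
    then show "\<exists>y\<in>tuples MM \<Delta> \<inter> lists (B k). y \<in> X \<and> (\<forall>j\<in>w. \<not> R (a j) y)" .
  next
    fix k w y assume *: "w \<subseteq> {..<k}" "y \<in> tuples MM \<Delta>" "y \<notin> X" "\<forall>j\<in>w. R (a j) y"
    have "\<exists>y\<in>tuples MM \<Delta> \<inter> lists (B k). y \<notin> X \<and> (\<forall>j\<in>w. R (a j) y)"
      by (rule get[OF _ *(2)], intro dfn_conj dfn_neg dX dfn_ball dfn_R_right)
        (use * at aB[THEN subsetD] cB[THEN subsetD] finite_subset[OF *(1)] in auto)
    then show "\<exists>y\<in>tuples MM \<Delta> \<inter> lists (B k). y \<notin> X \<and> (\<forall>j\<in>w. R (a j) y)" .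
  qed (use y B(2) in auto)
qed

text \<open>Suppose no point of N is related to all of Y. Points of N and copies of each y in X
  \<inter> N are built alternately. A new copy of y repeats the failures of the earlier points at y,
  by elementarity and definability of X. A new point is related to all copies so far, as a is. Every
  point fails at some y, and a y failed infinitely often gives arbitrarily long orders.\<close>

lemma definable_type_fin_sat:
  assumes no: "\<not> has_order R (tuples MM \<Gamma>) (tuples MM \<Delta>) n"
    and N: "TV N" "set c \<subseteq> N" and X: "defble \<Delta> N X"
    and a: "a \<in> tuples MM \<Gamma>" "\<And>y. y \<in> tuples MM \<Delta> \<Longrightarrow> set y \<subseteq> N \<Longrightarrow> y \<in> X \<Longrightarrow> R a y"
    and Y: "finite Y" "Y \<subseteq> X"
  shows "\<exists>x\<in>tuples MM \<Gamma> \<inter> lists N. \<forall>y\<in>Y. R x y"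
proof (rule ccontr)
  assume none: "\<not> ?thesis"
  have Xt: "X \<subseteq> tuples MM \<Delta>" by (rule defble_subset[OF X])
  \<comment> \<open>At stage i, \<open>fst r\<close> is the new point and \<open>snd r\<close>
    assigns to every y in Y its new copy; the copy is chosen before the point, which has to be
    related to it.\<close>
  define P where "P f i r \<longleftrightarrow> (\<forall>y\<in>Y. snd r y \<in> X \<inter> lists N \<and> (\<forall>j<i. \<not> R (fst (f j)) y \<longrightarrow> \<not> R (fst (f j)) (snd r y))) \<and>
     fst r \<in> tuples MM \<Gamma> \<inter> lists N \<and> (\<forall>y\<in>Y. R (fst r) (snd r y) \<and> (\<forall>j<i. R (fst r) (snd (f j) y)))"
    for f :: "nat \<Rightarrow> 'a list \<times> ('a list \<Rightarrow> 'a list)" and i r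
  have "\<exists>f. \<forall>i. P f i (f i)"
  proof (rule dependent_wellorder_choice)
    fix r and f g :: "nat \<Rightarrow> 'a list \<times> ('a list \<Rightarrow> 'a list)" and k :: nat
    assume eq: "\<And>j. j < k \<Longrightarrow> f j = g j"
    then show "P f k r = P g k r" unfolding P_def by (simp cong: conj_cong)
  next
    fix i and f :: "nat \<Rightarrow> 'a list \<times> ('a list \<Rightarrow> 'a list)"
    assume IH: "\<And>j. j < i \<Longrightarrow> P f j (f j)"
    have "\<exists>z\<in>X \<inter> lists N. \<forall>j<i. \<not> R (fst (f j)) y \<longrightarrow> \<not> R (fst (f j)) z" if "y \<in> Y" for y
    proof -
      let ?J = "{j. j < i \<and> \<not> R (fst (f j)) y}"
      have "dfn N (\<lambda>_::unit. \<Delta>) UNIV (\<lambda>u. u () \<in> X \<and> (\<forall>j\<in>?J. \<not> R (fst (f j)) (u ())))"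
        by (intro dfn_conj dfn_mem dfn_ball dfn_neg dfn_R_right) (use X IH N(2) in \<open>auto simp: P_def\<close>)
      from defbleI[OF this] have d: "defble \<Delta> N {z \<in> tuples MM \<Delta>. z \<in> X \<and> (\<forall>j\<in>?J. \<not> R (fst (f j)) z)}" .
      have "y \<in> {z \<in> tuples MM \<Delta>. z \<in> X \<and> (\<forall>j\<in>?J. \<not> R (fst (f j)) z)}" using that Y Xt by auto
      then obtain z where "z \<in> {z \<in> tuples MM \<Delta>. z \<in> X \<and> (\<forall>j\<in>?J. \<not> R (fst (f j)) z)}" "set z \<subseteq> N"
        using TV_tuple[OF N(1) psi(2) d] by blast
      then show ?thesis by (intro bexI[of _ z]) auto
    qed
    then obtain g where g: "\<And>y. y \<in> Y \<Longrightarrow> g y \<in> X \<inter> lists N \<and> (\<forall>j<i. \<not> R (fst (f j)) y \<longrightarrow> \<not> R (fst (f j)) (g y))"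
      by metis
    let ?Q = "\<lambda>x. \<forall>y\<in>Y. R x (g y) \<and> (\<forall>j\<in>{..<i}. R x (snd (f j) y))"
    have "dfn N (\<lambda>_::unit. \<Gamma>) UNIV (\<lambda>u. ?Q (u ()))"
    proof (intro dfn_ball dfn_conj dfn_R_left)
      show "finite Y" by (rule Y)
      show "g y \<in> tuples MM \<Delta>" "set (g y) \<union> set c \<subseteq> N" if "y \<in> Y" for y using g[OF that] Xt N(2) by auto
      show "snd (f j) y \<in> tuples MM \<Delta>" "set (snd (f j) y) \<union> set c \<subseteq> N" if "y \<in> Y" "j \<in> {..<i}" for y j
        using IH[of j] that Xt N(2) by (auto simp: P_def)
    qed auto
    from defbleI[OF this] have d: "defble \<Gamma> N {x \<in> tuples MM \<Gamma>. ?Q x}" .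
    have "a \<in> {x \<in> tuples MM \<Gamma>. ?Q x}"
    proof (intro CollectI conjI ballI a(1) a(2))
      fix y assume y: "y \<in> Y"
      show "g y \<in> X" "g y \<in> tuples MM \<Delta>" "set (g y) \<subseteq> N" using g[OF y] Xt by auto
      fix j assume "j \<in> {..<i}"
      then show "snd (f j) y \<in> X" "snd (f j) y \<in> tuples MM \<Delta>" "set (snd (f j) y) \<subseteq> N"
        using IH[of j] y Xt by (auto simp: P_def)
    qed
    then obtain x where "x \<in> {x \<in> tuples MM \<Gamma>. ?Q x}" "set x \<subseteq> N" using TV_tuple[OF N(1) psi(1) d] by blast
    then show "\<exists>r. P f i r"
      using g by (intro exI[of _ "(x, g)"]) (auto simp: P_def)
  qed
  then obtain f where f: "\<And>i. P f i (f i)" by blast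
  have "\<forall>i. \<exists>y\<in>Y. \<not> R (fst (f i)) y" using none f unfolding P_def by blast
  then obtain l where l: "\<And>i. l i \<in> Y \<and> \<not> R (fst (f i)) (l i)" by metis
  \<comment> \<open>Y is finite, so one y is failed by infinitely many points; the order is read off
    along their indices.\<close>
  have "\<exists>y. infinite {i. l i = y}"
  proof -
    have "finite (range l)" using l Y(1) by (meson finite_subset image_subsetI)
    then show ?thesis using pigeonhole_infinite[of UNIV l] by auto
  qed
  then obtain y where y: "infinite {i. l i = y}" by blast
  let ?h = "enumerate {i. l i = y}"
  have h: "l (?h s) = y" for s using enumerate_in_set[OF y, of s] by simp
  have yY: "y \<in> Y" using l[of "?h 0"] h by simp
  have "has_order R (tuples MM \<Gamma>) (tuples MM \<Delta>) n"
  proof (rule has_orderI_rev[of _ "\<lambda>s. fst (f (?h s))" _ "\<lambda>s. snd (f (?h s)) y"])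
    show "fst (f (?h s)) \<in> tuples MM \<Gamma> \<and> snd (f (?h s)) y \<in> tuples MM \<Delta>" for s
      using f[of "?h s"] yY Xt by (auto simp: P_def)
    fix s r
    show "R (fst (f (?h s))) (snd (f (?h r)) y) \<longleftrightarrow> r \<le> s"
    proof (cases "r \<le> s")
      case True
      then have "?h r \<le> ?h s" using enumerate_mono[OF _ y, of r s] by (cases "r = s") auto
      then have "?h r < ?h s \<or> ?h r = ?h s" by auto
      then have "R (fst (f (?h s))) (snd (f (?h r)) y)"
        using f[of "?h s"] yY unfolding P_def by auto
      then show ?thesis using True by simp
    next
      case False
      then have "?h s < ?h r" using enumerate_mono[OF _ y, of s r] by auto
      moreover have "\<not> R (fst (f (?h s))) y" using l[of "?h s"] h by simp
      ultimately have "\<not> R (fst (f (?h s))) (snd (f (?h r)) y)"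
        using f[of "?h r"] yY unfolding P_def by auto
      then show ?thesis using False by simp
    qed
  qed
  then show False using no by simp
qed

end

section \<open>Coheirs of types over models\<close>

context saturated_struc
begin

text \<open>The type of m over an elementary submodel N is finitely satisfiable in N, so it extends
  to a global type with that property.\<close>

lemma coheir_exists:
  assumes N: "TV N" and \<Lambda>: "set \<Lambda> \<subseteq> sorts L" and m: "m \<in> tuples MM \<Lambda>"
  obtains q where "ptype (\<lambda>S. S \<inter> lists N \<noteq> {}) \<Lambda> (elems L MM) q" "\<And>S. defble \<Lambda> N S \<Longrightarrow> inq \<Lambda> q S \<longleftrightarrow> m \<in> S"
proof -
  let ?pos = "\<lambda>S. S \<inter> lists N \<noteq> {}"
  have pr: "part_reg ?pos" by (rule part_reg_meets)
  have Ne: "N \<subseteq> elems L MM" by (rule TV_elems[OF N])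
  obtain q where q: "ptype ?pos \<Lambda> (elems L MM) q" "\<And>S. defble \<Lambda> N S \<Longrightarrow> m \<in> S \<Longrightarrow> inq \<Lambda> q S"
  proof (rule ptype_existsD[OF pr, of "{S. defble \<Lambda> N S \<and> m \<in> S}" \<Lambda> "elems L MM" "\<lambda>S. S"])
    show "defble \<Lambda> (elems L MM) S" if "S \<in> {S. defble \<Lambda> N S \<and> m \<in> S}" for S
      using that defble_mono Ne by blast
    fix J assume J: "finite J" "J \<subseteq> {S. defble \<Lambda> N S \<and> m \<in> S}"
    have "dfn N (\<lambda>_::unit. \<Lambda>) UNIV (\<lambda>u. \<forall>S\<in>J. u () \<in> S)"
      by (intro dfn_ball dfn_mem) (use J in auto)
    from defbleI[OF this] obtain x where "x \<in> {a \<in> tuples MM \<Lambda>. \<forall>S\<in>J. a \<in> S}" "set x \<subseteq> N"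
      by (rule TV_tuple[OF N \<Lambda>]) (use J m in auto)
    then show "?pos {a \<in> tuples MM \<Lambda>. \<forall>S\<in>J. a \<in> S}" by auto
  qed auto
  have "inq \<Lambda> q S \<longleftrightarrow> m \<in> S" if S: "defble \<Lambda> N S" for S
  proof -
    have "defble \<Lambda> N (tuples MM \<Lambda> - S)"
      using S unfolding defble_def by (metis pforms_neg solutions_neg surj_pair)
    then show ?thesis
      using q(2) S inq_neg[OF pr q(1) defble_mono[OF S Ne]] m by blast
  qed
  then show thesis using q(1) that by blast
qed

text \<open>Members of a coheir sequence of \<open>tp(m/N)\<close> are conjugates of \<open>m\<close>; two equivalent ones would yield
  an equivalent tuple in \<open>N\<close> by finite satisfiability.\<close>

lemma coheir_dichotomy:
  assumes N: "TV N" "|N| <o \<kappa>" and \<Lambda>: "set \<Lambda> \<subseteq> sorts L" and m: "m \<in> tuples MM \<Lambda>"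
    and E: "dfn N (\<lambda>_::bool. \<Lambda>) UNIV (\<lambda>u. E (u True) (u False))"
    and none: "\<And>n. n \<in> tuples MM \<Lambda> \<Longrightarrow> set n \<subseteq> N \<Longrightarrow> \<not> E m n"
  obtains ms :: "nat \<Rightarrow> 'a list" where "\<And>j. same_type \<Lambda> N m (ms j)" "\<And>i j. i < j \<Longrightarrow> \<not> E (ms i) (ms j)"
proof -
  let ?pos = "\<lambda>S. S \<inter> lists N \<noteq> {}"
  have pr: "part_reg ?pos" by (rule part_reg_meets)
  obtain q where q: "ptype ?pos \<Lambda> (elems L MM) q" "\<And>S. defble \<Lambda> N S \<Longrightarrow> inq \<Lambda> q S \<longleftrightarrow> m \<in> S"
    using coheir_exists[OF N(1) \<Lambda> m] by blast
  let ?N = "\<lambda>f j. N \<union> (\<Union>i<j::nat. set (f i))"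
  have Ne: "N \<subseteq> elems L MM" by (rule TV_elems[OF N(1)])
  have "\<exists>ms. \<forall>j. realizes \<Lambda> (?N ms j) q (ms j)"
  proof (rule dependent_wellorder_choice)
    fix r and f g :: "nat \<Rightarrow> 'a list" and j :: nat
    assume "\<And>i. i < j \<Longrightarrow> f i = g i"
    then have "?N f j = ?N g j" by auto
    then show "realizes \<Lambda> (?N f j) q r = realizes \<Lambda> (?N g j) q r" by simp
  next
    fix j and f :: "nat \<Rightarrow> 'a list"
    assume IH: "\<And>i. i < j \<Longrightarrow> realizes \<Lambda> (?N f i) q (f i)"
    then have "f i \<in> tuples MM \<Lambda>" if "i < j" for i using that by (simp add: realizes_def)
    then have "?N f j \<subseteq> elems L MM" using Ne tuples_elems[OF _ \<Lambda>] by blast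
    moreover have "|?N f j| <o \<kappa>" by (intro small_Un[OF N(2)] small_finite) auto
    ultimately show "\<exists>r. realizes \<Lambda> (?N f j) q r" using realize_ptype[OF pr q(1) _ _ _ \<Lambda>] by blast
  qed
  then obtain ms where ms: "\<forall>j. realizes \<Lambda> (?N ms j) q (ms j)" by blast
  then have mst: "ms j \<in> tuples MM \<Lambda>" for j by (simp add: realizes_def)
  have mse: "?N ms j \<subseteq> elems L MM" for j using Ne tuples_elems[OF mst \<Lambda>] by blast
  have st: "same_type \<Lambda> N m (ms j)" for j
    unfolding same_type_def
  proof (intro conjI allI impI m mst)
    fix S assume S: "defble \<Lambda> N S"
    have "m \<in> S \<longleftrightarrow> inq \<Lambda> q S" using q(2)[OF S] by simp
    also have "\<dots> \<longleftrightarrow> ms j \<in> S"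
      using realizes_iff[OF pr q(1) mse ms[rule_format] defble_mono[OF S]] by blast
    finally show "m \<in> S \<longleftrightarrow> ms j \<in> S" .
  qed
  have "\<not> E (ms i) (ms j)" if "i < j" for i j
  proof
    assume *: "E (ms i) (ms j)"
    have E2: "dfn (?N ms j) (\<lambda>_::unit. \<Lambda>) UNIV (\<lambda>u. E (ms i) (u ()))"
    proof (rule dfn_param[where P = "\<lambda>x u. E x (u ())" and V' = UNIV])
      have "dfn N (case_option \<Lambda> (\<lambda>_::unit. \<Lambda>)) ((\<lambda>b. if b then None else Some ()) ` UNIV)
          (\<lambda>w. E (w (if True then None else Some ())) (w (if False then None else Some ())))"
        by (rule dfn_reindex[OF E, of _ "\<lambda>b. if b then None else Some ()"]) auto
      then show "dfn (?N ms j) (case_option \<Lambda> (\<lambda>_::unit. \<Lambda>)) UNIV (\<lambda>w. E (w None) (w (Some ())))"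
        by (auto elim: dfn_mono)
    qed (use \<Lambda> mst that in \<open>auto simp: UNIV_option_conv\<close>)
    then have d: "defble \<Lambda> (?N ms j) {x \<in> tuples MM \<Lambda>. E (ms i) x}" by (rule defbleI)
    have "inq \<Lambda> q {x \<in> tuples MM \<Lambda>. E (ms i) x}"
      using realizes_iff[OF pr q(1) mse ms[rule_format] d] * mst by simp
    then obtain n where n: "n \<in> tuples MM \<Lambda>" "set n \<subseteq> N" "E (ms i) n"
      using ptype_pos1[OF pr q(1)] by fastforce
    have "dfn N (\<lambda>_::unit. \<Lambda>) UNIV (\<lambda>u. E (u ()) n)"
    proof (rule dfn_param[where P = "\<lambda>x u. E (u ()) x" and V' = UNIV])
      have "dfn N (case_option \<Lambda> (\<lambda>_::unit. \<Lambda>)) ((\<lambda>b. if b then Some () else None) ` UNIV)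
          (\<lambda>w. E (w (if True then Some () else None)) (w (if False then Some () else None)))"
        by (rule dfn_reindex[OF E, of _ "\<lambda>b. if b then Some () else None"]) auto
      then show "dfn N (case_option \<Lambda> (\<lambda>_::unit. \<Lambda>)) UNIV (\<lambda>w. E (w (Some ())) (w None))"
        by (auto elim: dfn_mono)
    qed (use \<Lambda> n in \<open>auto simp: UNIV_option_conv\<close>)
    from defbleI[OF this] have "E m n"
      using st[of i] n(3) mst m unfolding same_type_def by blast
    then show False using none n by blast
  qed
  then show thesis using st that by blast
qed

end

section \<open>Thorn-forking\<close>

lemma (in many_sorted) aut_elems: "\<sigma> \<in> automorphisms L MM C \<Longrightarrow> x \<in> elems L MM \<Longrightarrow> \<sigma> x \<in> elems L MM"
  unfolding elems_def automorphisms_def by (auto dest: bij_betwE)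

text \<open>Conjugation by \<sigma> sends automorphisms fixing C to automorphisms fixing its image,
  and so the family of conjugates \<open>?D\<close> onto \<open>?D'\<close>. As \<sigma> is
  controlled only on elements of the structure, injectivity on sets of tuples is obtained through
  the inverse \<sigma>'.\<close>

lemma (in many_sorted) strongly_divides_move:
  assumes \<sigma>: "\<sigma> \<in> automorphisms L MM {}" and \<Gamma>: "set \<Gamma> \<subseteq> sorts L" and b: "(\<phi>, b) \<in> pforms L MM \<Gamma> (elems L MM)"
    and C: "C \<subseteq> elems L MM" and sd: "strongly_divides L MM \<Gamma> C (\<phi>, b)"
  shows "strongly_divides L MM \<Gamma> (\<sigma> ` C) (\<phi>, map \<sigma> b)"
proof -
  obtain \<sigma>' where \<sigma>': "\<sigma>' \<in> automorphisms L MM {}"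
    "\<And>x. x \<in> elems L MM \<Longrightarrow> \<sigma>' (\<sigma> x) = x" "\<And>x. x \<in> elems L MM \<Longrightarrow> \<sigma> (\<sigma>' x) = x"
    using aut_inverse[OF \<sigma>] by metis
  let ?S = "solutions MM \<Gamma> (\<phi>, b)"
  let ?D = "(\<lambda>\<tau>. map \<tau> ` ?S) ` automorphisms L MM C"
  let ?D' = "(\<lambda>\<tau>. map \<tau> ` solutions MM \<Gamma> (\<phi>, map \<sigma> b)) ` automorphisms L MM (\<sigma> ` C)"
  have S: "?S \<subseteq> tuples MM \<Gamma>" by (auto simp: solutions_def)
  have S': "solutions MM \<Gamma> (\<phi>, map \<sigma> b) = map \<sigma> ` ?S" using aut_solutions[OF \<sigma> \<Gamma> b] by simp
  have el: "set x \<subseteq> elems L MM" if "x \<in> tuples MM \<Gamma>" for x using tuples_elems[OF that \<Gamma>] .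
  have "image (map \<sigma>) ` ?D \<subseteq> ?D'"
  proof
    fix T assume "T \<in> image (map \<sigma>) ` ?D"
    then obtain \<tau> where \<tau>: "\<tau> \<in> automorphisms L MM C" "T = map \<sigma> ` map \<tau> ` ?S" by auto
    let ?\<rho> = "\<sigma> \<circ> (\<tau> \<circ> \<sigma>')"
    have t0: "\<tau> \<in> automorphisms L MM {}" using \<tau>(1) aut_mono[of "{}" C] by auto
    have "?\<rho> \<in> automorphisms L MM (\<sigma> ` C)"
      unfolding aut_fix[of _ "\<sigma> ` C"]
    proof (intro conjI ballI)
      show "?\<rho> \<in> automorphisms L MM {}" by (intro aut_comp \<sigma> \<sigma>'(1) t0)
      fix x assume "x \<in> \<sigma> ` C"
      then obtain y where "y \<in> C" "x = \<sigma> y" by auto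
      then show "?\<rho> x = x" using C \<sigma>'(2)[of y] \<tau>(1) by (auto simp: automorphisms_def)
    qed
    moreover have "map ?\<rho> (map \<sigma> x) = map \<sigma> (map \<tau> x)" if "x \<in> ?S" for x
      using el[OF subsetD[OF S that]] \<sigma>'(2) by auto
    then have "map ?\<rho> ` map \<sigma> ` ?S = T" unfolding \<tau>(2) image_image by (intro image_cong refl)
    ultimately show "T \<in> ?D'" unfolding S' by blast
  qed
  moreover have "?D' \<subseteq> image (map \<sigma>) ` ?D"
  proof
    fix T assume "T \<in> ?D'"
    then obtain \<tau> where \<tau>: "\<tau> \<in> automorphisms L MM (\<sigma> ` C)" "T = map \<tau> ` map \<sigma> ` ?S" unfolding S' by auto
    let ?\<rho> = "\<sigma>' \<circ> (\<tau> \<circ> \<sigma>)"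
    have t0: "\<tau> \<in> automorphisms L MM {}" using \<tau>(1) aut_mono[of "{}" "\<sigma> ` C"] by auto
    have "?\<rho> \<in> automorphisms L MM C"
      unfolding aut_fix[of _ C]
    proof (intro conjI ballI)
      show "?\<rho> \<in> automorphisms L MM {}" by (intro aut_comp \<sigma> \<sigma>'(1) t0)
      fix x assume "x \<in> C"
      then show "?\<rho> x = x" using C \<sigma>'(2)[of x] \<tau>(1) by (auto simp: automorphisms_def)
    qed
    moreover have "map \<sigma> (map ?\<rho> x) = map \<tau> (map \<sigma> x)" if "x \<in> ?S" for x
      using el[OF subsetD[OF S that]] \<sigma>'(3) aut_elems[OF \<sigma>] aut_elems[OF t0] by auto
    then have "map \<sigma> ` map ?\<rho> ` ?S = T" unfolding \<tau>(2) image_image by (intro image_cong refl)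
    ultimately show "T \<in> image (map \<sigma>) ` ?D" by blast
  qed
  ultimately have D': "?D' = image (map \<sigma>) ` ?D" by blast
  have Dt: "T \<subseteq> tuples MM \<Gamma>" if "T \<in> ?D" for T
    using that S aut_tuples[OF _ \<Gamma>] by blast
  have inv: "map \<sigma>' (map \<sigma> x) = x" if "x \<in> tuples MM \<Gamma>" for x
    using el[OF that] \<sigma>'(2) by (auto intro!: map_idI)
  have "inj_on (map \<sigma>) (tuples MM \<Gamma>)" by (rule inj_on_inverseI[of _ "map \<sigma>'"]) (rule inv)
  then have injD: "inj_on (image (map \<sigma>)) ?D"
    using Dt by (intro inj_onI) (metis inj_on_image_eq_iff)
  have "infinite ?D \<and> (\<exists>k. \<forall>S\<subseteq>?D. finite S \<and> card S = k \<longrightarrow> \<Inter>S = {})"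
    using sd unfolding strongly_divides_def Let_def .
  then obtain k where k0: "infinite ?D" "\<forall>S\<subseteq>?D. finite S \<and> card S = k \<longrightarrow> \<Inter>S = {}"
    by (elim conjE exE)
  then have k: "infinite ?D" "\<And>T. T \<subseteq> ?D \<Longrightarrow> finite T \<Longrightarrow> card T = k \<Longrightarrow> \<Inter>T = {}"
    by simp_all
  have "infinite ?D'" unfolding D' using k(1) injD finite_image_iff by blast
  moreover have "\<Inter>T' = {}" if T': "T' \<subseteq> ?D'" "finite T'" "card T' = k" for T'
  proof -
    obtain T where T: "T \<subseteq> ?D" "T' = image (map \<sigma>) ` T" using T'(1) unfolding D' by (meson subset_imageE)
    then have i: "inj_on (image (map \<sigma>)) T" using inj_on_subset[OF injD T(1)] by simp
    then have "finite T" "card T = k" using T'(2,3) T(2) finite_image_iff card_image by metis+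
    then have e: "\<Inter>T = {}" using k(2) T(1) by blast
    then have "T \<noteq> {}" by auto
    show ?thesis
    proof (rule ccontr)
      assume "\<Inter>T' \<noteq> {}"
      then obtain z where z: "\<And>W. W \<in> T \<Longrightarrow> z \<in> map \<sigma> ` W" unfolding T(2) by blast
      have "map \<sigma>' z \<in> W" if W: "W \<in> T" for W
      proof -
        obtain x where "x \<in> W" "z = map \<sigma> x" using z[OF W] by auto
        moreover have "x \<in> tuples MM \<Gamma>" using Dt T(1) W \<open>x \<in> W\<close> by blast
        ultimately show ?thesis using inv by simp
      qed
      then show False using e by blast
    qed
  qed
  ultimately show ?thesis unfolding strongly_divides_def Let_def by blast
qed

lemma (in many_sorted) thorn_divides_move:
  assumes \<sigma>: "\<sigma> \<in> automorphisms L MM {}" and \<Gamma>: "set \<Gamma> \<subseteq> sorts L" and b: "(\<phi>, b) \<in> pforms L MM \<Gamma> (elems L MM)"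
    and C: "C \<subseteq> elems L MM" and td: "thorn_divides L MM \<Gamma> C (\<phi>, b)"
  shows "thorn_divides L MM \<Gamma> (\<sigma> ` C) (\<phi>, map \<sigma> b)"
proof -
  obtain c where c: "set c \<subseteq> elems L MM" "strongly_divides L MM \<Gamma> (C \<union> set c) (\<phi>, b)"
    using td unfolding thorn_divides_def by blast
  have "strongly_divides L MM \<Gamma> (\<sigma> ` (C \<union> set c)) (\<phi>, map \<sigma> b)"
    by (rule strongly_divides_move[OF \<sigma> \<Gamma> b _ c(2)]) (use C c in auto)
  then show ?thesis
    unfolding thorn_divides_def using c(1) aut_elems[OF \<sigma>]
    by (intro exI[of _ "map \<sigma> c"]) (auto simp: image_Un)
qed

lemma thorn_divides_forks: "\<psi> \<in> pforms L MM \<Gamma> (elems L MM) \<Longrightarrow> thorn_divides L MM \<Gamma> C \<psi> \<Longrightarrow> thorn_forks L MM \<Gamma> C \<psi>"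
  unfolding thorn_forks_def by (intro exI[of _ "{\<psi>}"]) auto


section \<open>The theorem for many-sorted structures\<close>

locale small_struc = saturated_struc L MM \<kappa>
  for L :: "('f, 'r, 's) lang" and MM :: "('f, 'r, 's, 'a) struc" and \<kappa> :: "'k rel" +
  assumes sig: "|{f. fn_sig L f \<noteq> None}| <o \<kappa>" "|{r. rel_sig L r \<noteq> None}| <o \<kappa>" "|sorts L| <o \<kappa>"
    and strong_limit: "\<And>A :: 'k set. |A| <o \<kappa> \<Longrightarrow> |Pow A| <o \<kappa>"
begin

text \<open>Small sets of any type are copied into the type of \<kappa>, where they can be united
  and where the strong limit assumption is stated.\<close>

lemma small_copy:
  assumes "|X| <o \<kappa>"
  obtains Z :: "'k set" where "|X| \<le>o |Z|" "|Z| <o \<kappa>"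
proof -
  have "|X| \<le>o |Field \<kappa>|"
    using assms \<kappa>(1) card_of_Field_ordIso ordIso_symmetric ordLess_imp_ordLeq ordLeq_ordIso_trans by blast
  then obtain f where f: "inj_on f X" "f ` X \<subseteq> Field \<kappa>" using card_of_ordLeq by metis
  then have iso: "|X| =o |f ` X|" using card_of_ordIsoI inj_on_imp_bij_betw by blast
  then show thesis
    using that[of "f ` X"] assms ordIso_iff_ordLeq ordLeq_ordLess_trans by blast
qed

lemma ordLeq_Pow:
  assumes "|X| \<le>o |Y|"
  shows "|Pow X| \<le>o |Pow Y|"
proof -
  obtain f where f: "inj_on f X" "f ` X \<subseteq> Y" using assms card_of_ordLeq by metis
  then have "inj_on (image f) (Pow X)" "image f ` Pow X \<subseteq> Pow Y" by (auto intro: inj_on_image_Pow)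
  then show ?thesis using card_of_ordLeq by blast
qed

lemma small_bound:
  obtains Y :: "'k set" where "infinite Y" "|Y| <o \<kappa>" "|Fm| \<le>o |Y|" "|sorts L| \<le>o |Y|"
proof -
  obtain Z1 :: "'k set" where Z1: "|{f. fn_sig L f \<noteq> None}| \<le>o |Z1|" "|Z1| <o \<kappa>" using small_copy[OF sig(1)] by metis
  obtain Z2 :: "'k set" where Z2: "|{r. rel_sig L r \<noteq> None}| \<le>o |Z2|" "|Z2| <o \<kappa>" using small_copy[OF sig(2)] by metis
  obtain Z3 :: "'k set" where Z3: "|sorts L| \<le>o |Z3|" "|Z3| <o \<kappa>" using small_copy[OF sig(3)] by metis
  have "|UNIV :: nat set| <o \<kappa>" using small_countable[of "\<lambda>x. x"] by simp
  then obtain Z4 :: "'k set" where Z4: "|UNIV :: nat set| \<le>o |Z4|" "|Z4| <o \<kappa>" using small_copy by metis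
  let ?Y = "Z1 \<union> Z2 \<union> Z3 \<union> Z4"
  have le: "|Z1| \<le>o |?Y|" "|Z2| \<le>o |?Y|" "|Z3| \<le>o |?Y|" "|Z4| \<le>o |?Y|" by (auto intro!: card_of_mono1)
  have inf: "infinite ?Y"
    unfolding infinite_iff_card_of_nat by (rule ordLeq_transitive[OF Z4(1) le(4)])
  have s: "|sorts L| \<le>o |?Y|" using ordLeq_transitive[OF Z3(1) le(3)] .
  have "|{\<phi>. \<exists>\<Gamma>. wff L \<Gamma> \<phi>}| \<le>o |?Y|"
    using ordLeq_formulas[OF inf ordLeq_transitive[OF Z1(1) le(1)] ordLeq_transitive[OF Z2(1) le(2)] s] .
  then show thesis
    using that[of ?Y] inf s Z1(2) Z2(2) Z3(2) Z4(2) unfolding Fm_def by (simp add: small_Un)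
qed

end

text \<open>Homogeneity is required over models and over the empty set only. Among the imaginaries
  these are the cases in which every parameter has a representative whose entries already belong to
  the parameter set.\<close>

locale monster_struc = small_struc L MM \<kappa>
  for L :: "('f, 'r, 's) lang" and MM :: "('f, 'r, 's, 'a) struc" and \<kappa> :: "'k rel" +
  assumes homogeneous: "\<And>N \<Lambda> a b. TV N \<or> N = {} \<Longrightarrow> |N| <o \<kappa> \<Longrightarrow> set \<Lambda> \<subseteq> sorts L \<Longrightarrow> same_type \<Lambda> N a b \<Longrightarrow>
      \<exists>\<sigma>\<in>automorphisms L MM N. map \<sigma> a = b"
begin

text \<open>A type over the empty set is a set of formulas, so there are at most as many as subsets
  of Y, and this is small because \<kappa> is a strong limit. One representative of each type is
  kept.\<close>

lemma universal_small_set: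
  obtains A where "A \<subseteq> elems L MM" "|A| <o \<kappa>"
    "\<And>\<Lambda> a. set \<Lambda> \<subseteq> sorts L \<Longrightarrow> a \<in> tuples MM \<Lambda> \<Longrightarrow> \<exists>b. same_type \<Lambda> {} a b \<and> set b \<subseteq> A"
proof -
  obtain Y :: "'k set" where Y: "infinite Y" "|Y| <o \<kappa>" "|Fm| \<le>o |Y|" "|sorts L| \<le>o |Y|" by (rule small_bound)
  define tp where "tp \<Lambda> a = {\<phi>. wff L \<Lambda> \<phi> \<and> sat MM a \<phi>}" for \<Lambda> a
  let ?I = "{(\<Lambda>, tp \<Lambda> a) |\<Lambda> a. set \<Lambda> \<subseteq> sorts L \<and> a \<in> tuples MM \<Lambda>}"
  define rep where "rep i = (SOME a. a \<in> tuples MM (fst i) \<and> tp (fst i) a = snd i)" for i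
  let ?A = "\<Union>i\<in>?I. set (rep i)"
  have rep: "rep (\<Lambda>, tp \<Lambda> a) \<in> tuples MM \<Lambda> \<and> tp \<Lambda> (rep (\<Lambda>, tp \<Lambda> a)) = tp \<Lambda> a" if "a \<in> tuples MM \<Lambda>" for \<Lambda> a
    unfolding rep_def fst_conv snd_conv by (rule someI_ex) (use that in blast)
  have infP: "infinite (Pow Y)" using Y(1) by simp
  have YP: "|Y| \<le>o |Pow Y|" using card_of_Pow ordLess_imp_ordLeq by blast
  have "?I \<subseteq> lists (sorts L) \<times> Pow Fm" by (auto simp: tp_def Fm_def)
  then have "|?I| \<le>o |Pow Y|"
    by (rule ordLeq_subset[rotated])
      (intro ordLeq_Times[OF infP] ordLeq_lists[OF infP] ordLeq_Pow Y(3) ordLeq_transitive[OF Y(4) YP])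
  then have "|?A| \<le>o |Pow Y|" by (rule ordLeq_UN[OF infP]) (rule ordLeq_finite[OF infP], simp)
  then have "|?A| <o \<kappa>" using strong_limit[OF Y(2)] ordLeq_ordLess_trans by blast
  moreover have "?A \<subseteq> elems L MM" using rep tuples_elems by blast
  moreover have "same_type \<Lambda> {} a (rep (\<Lambda>, tp \<Lambda> a))" if a: "a \<in> tuples MM \<Lambda>" for \<Lambda> a
    unfolding same_type_def
  proof (intro conjI allI impI a)
    show r: "rep (\<Lambda>, tp \<Lambda> a) \<in> tuples MM \<Lambda>" using rep[OF a] by simp
    fix S assume "defble \<Lambda> {} S"
    then obtain \<phi> b \<Delta> where S: "S = solutions MM \<Lambda> (\<phi>, b)" "wff L (\<Lambda> @ \<Delta>) \<phi>" "b \<in> tuples MM \<Delta>" "set b \<subseteq> {}"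
      by (auto simp: defble_def pforms_def)
    then have b: "b = []" by simp
    then have "\<Delta> = []" using tuples_length[OF S(3)] by simp
    then have "wff L \<Lambda> \<phi>" using S(2) by simp
    have "\<phi> \<in> tp \<Lambda> a \<longleftrightarrow> \<phi> \<in> tp \<Lambda> (rep (\<Lambda>, tp \<Lambda> a))" using rep[OF a] by simp
    then show "a \<in> S \<longleftrightarrow> rep (\<Lambda>, tp \<Lambda> a) \<in> S"
      using \<open>wff L \<Lambda> \<phi>\<close> a r unfolding S(1) b tp_def solutions_def by simp
  qed
  then have "\<exists>b. same_type \<Lambda> {} a b \<and> set b \<subseteq> ?A" if "set \<Lambda> \<subseteq> sorts L" "a \<in> tuples MM \<Lambda>" for \<Lambda> a
    using that by (intro exI[of _ "rep (\<Lambda>, tp \<Lambda> a)"]) blast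
  ultimately show thesis using that[of ?A] by blast
qed

text \<open>Local character is uniform over finite tuples: \<open>\<kappa>\<^sub>A\<close> for a set \<open>A\<close> realising all types of
  finite tuples works for every tuple, since it can be moved into \<open>A\<close>.\<close>

lemma uniform_local_character:
  assumes "thorn_local_character \<kappa> L MM"
  obtains \<mu> :: "'k rel" where "Card_order \<mu>" "\<mu> <o \<kappa>"
    "\<And>\<Lambda> a B. set \<Lambda> \<subseteq> sorts L \<Longrightarrow> a \<in> tuples MM \<Lambda> \<Longrightarrow> B \<subseteq> elems L MM \<Longrightarrow> |B| <o \<kappa> \<Longrightarrow>
      \<exists>C\<subseteq>B. |C| <o \<mu> \<and> (\<forall>\<psi>\<in>type_of L MM \<Lambda> a B. \<not> thorn_divides L MM \<Lambda> C \<psi>)"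
proof -
  obtain A where A: "A \<subseteq> elems L MM" "|A| <o \<kappa>"
    "\<And>\<Lambda> a. set \<Lambda> \<subseteq> sorts L \<Longrightarrow> a \<in> tuples MM \<Lambda> \<Longrightarrow> \<exists>b. same_type \<Lambda> {} a b \<and> set b \<subseteq> A"
    using universal_small_set by metis
  have "\<exists>\<mu> :: 'k rel. Card_order \<mu> \<and> \<mu> <o \<kappa> \<and> (\<forall>B. B \<subseteq> elems L MM \<and> |B| <o \<kappa> \<longrightarrow>
      (\<exists>C\<subseteq>B. |C| <o \<mu> \<and> thorn_indep L MM A B C))"
    using assms[unfolded thorn_local_character_def, rule_format, of A] A(1,2) by simp
  then obtain \<mu> :: "'k rel" where \<mu>: "Card_order \<mu>" "\<mu> <o \<kappa>"
    "\<And>B. B \<subseteq> elems L MM \<Longrightarrow> |B| <o \<kappa> \<Longrightarrow> \<exists>C\<subseteq>B. |C| <o \<mu> \<and> thorn_indep L MM A B C"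
    by (elim exE conjE) simp
  have "\<exists>C\<subseteq>B. |C| <o \<mu> \<and> (\<forall>\<psi>\<in>type_of L MM \<Lambda> a B. \<not> thorn_divides L MM \<Lambda> C \<psi>)"
    if \<Lambda>: "set \<Lambda> \<subseteq> sorts L" and a: "a \<in> tuples MM \<Lambda>" and B: "B \<subseteq> elems L MM" "|B| <o \<kappa>" for \<Lambda> a B
  proof -
    obtain b where b: "same_type \<Lambda> {} a b" "set b \<subseteq> A" using A(3)[OF \<Lambda> a] by blast
    obtain \<sigma> where \<sigma>: "\<sigma> \<in> automorphisms L MM {}" "map \<sigma> a = b"
      using homogeneous[OF _ _ \<Lambda> b(1)] small_finite[of "{}"] by auto
    have "\<sigma> ` B \<subseteq> elems L MM" using B(1) aut_elems[OF \<sigma>(1)] by blast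
    moreover have "|\<sigma> ` B| <o \<kappa>" using B(2) card_of_image ordLeq_ordLess_trans by blast
    ultimately have "\<exists>C'\<subseteq>\<sigma> ` B. |C'| <o \<mu> \<and> thorn_indep L MM A (\<sigma> ` B) C'" by (rule \<mu>(3))
    then obtain C' where C': "C' \<subseteq> \<sigma> ` B" "|C'| <o \<mu>" "thorn_indep L MM A (\<sigma> ` B) C'" by (elim exE conjE)
    \<comment> \<open>Of the preimage of C' only a set on which \<sigma> is injective is kept, so
      that C is no larger than C'.\<close>
    obtain C where C: "C \<subseteq> B" "inj_on \<sigma> C" "C' = \<sigma> ` C" using C'(1) by (meson subset_image_inj)
    have Cc: "|C| <o \<mu>"
    proof -
      have "|C| =o |C'|" using C(2,3) card_of_ordIsoI inj_on_imp_bij_betw by metis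
      then show ?thesis using C'(2) ordIso_ordLess_trans by blast
    qed
    have "\<not> thorn_divides L MM \<Lambda> C \<psi>" if \<psi>: "\<psi> \<in> type_of L MM \<Lambda> a B" for \<psi>
    proof
      assume td: "thorn_divides L MM \<Lambda> C \<psi>"
      obtain \<phi> d \<Delta> where d: "\<psi> = (\<phi>, d)" "set \<Delta> \<subseteq> sorts L" "wff L (\<Lambda> @ \<Delta>) \<phi>" "d \<in> tuples MM \<Delta>" "set d \<subseteq> B" "sat MM (a @ d) \<phi>"
        using \<psi> by (cases \<psi>) (auto simp: type_of_def pforms_def solutions_def)
      have pf: "(\<phi>, d) \<in> pforms L MM \<Lambda> (elems L MM)" using d B(1) by (auto simp: pforms_def)
      have md: "map \<sigma> d \<in> tuples MM \<Delta>" by (rule aut_tuples[OF \<sigma>(1) d(2,4)])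
      have "sat MM (map \<sigma> (a @ d)) \<phi>"
        using sat_aut[OF \<sigma>(1) d(3) _ tuples_append[OF a d(4)]] d(2,6) \<Lambda> by simp
      moreover have bt: "b \<in> tuples MM \<Lambda>" using b(1) by (simp add: same_type_def)
      ultimately have "(\<phi>, map \<sigma> d) \<in> type_of L MM \<Lambda> b (C' \<union> \<sigma> ` B)"
        using d md \<sigma>(2) unfolding type_of_def pforms_def solutions_def by auto
      then have "\<not> thorn_forks L MM \<Lambda> C' (\<phi>, map \<sigma> d)"
        using C'(3) bt \<Lambda> b(2) unfolding thorn_indep_def by blast
      moreover have "(\<phi>, map \<sigma> d) \<in> pforms L MM \<Lambda> (elems L MM)"
        using d md tuples_elems[OF md d(2)] by (auto simp: pforms_def)
      moreover have "thorn_divides L MM \<Lambda> C' (\<phi>, map \<sigma> d)"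
        unfolding C(3) by (rule thorn_divides_move[OF \<sigma>(1) \<Lambda> pf]) (use td d(1) C(1) B(1) in auto)
      ultimately show False using thorn_divides_forks by blast
    qed
    then show ?thesis using C(1) Cc by blast
  qed
  then show thesis using that \<mu>(1,2) by blast
qed

text \<open>The witness of the tree property is itself a tree for the empty set of extra instances;
  only the passage from infinite branches to finite ones has to be made.\<close>

lemma tree_property_good:
  assumes "has_tree_property L MM"
  obtains \<Gamma> \<Delta> \<phi> k where "tree_formula L MM \<kappa> \<Gamma> \<Delta> \<phi>" "tree_formula.good MM \<Gamma> \<Delta> \<phi> k {}"
proof -
  obtain \<Gamma> \<Delta> \<phi> k and c :: "nat list \<Rightarrow> 'a list" where
    tp: "set \<Gamma> \<subseteq> sorts L \<and> set \<Delta> \<subseteq> sorts L \<and> wff L (\<Gamma> @ \<Delta>) \<phi> \<and> 2 \<le> k \<and>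
        (\<forall>\<eta>. c \<eta> \<in> tuples MM \<Delta>) \<and>
        (\<forall>\<eta> :: nat \<Rightarrow> nat. consistent MM \<Gamma> {(\<phi>, c (map \<eta> [0..<n])) | n. True}) \<and>
        (\<forall>\<nu> I. finite I \<and> card I = k \<longrightarrow> \<not> consistent MM \<Gamma> {(\<phi>, c (\<nu> @ [i])) | i. i \<in> I})"
    using assms unfolding has_tree_property_def by (elim exE)
  then have wf: "set \<Gamma> \<subseteq> sorts L" "set \<Delta> \<subseteq> sorts L" "wff L (\<Gamma> @ \<Delta>) \<phi>" and c: "\<And>\<eta>. c \<eta> \<in> tuples MM \<Delta>"
    and br: "\<And>\<eta> :: nat \<Rightarrow> nat. consistent MM \<Gamma> {(\<phi>, c (map \<eta> [0..<n])) | n. True}"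
    and si: "\<And>\<nu> I. finite I \<Longrightarrow> card I = k \<Longrightarrow> \<not> consistent MM \<Gamma> {(\<phi>, c (\<nu> @ [i])) | i. i \<in> I}"
    by simp_all
  interpret tree_formula L MM \<kappa> \<Gamma> \<Delta> \<phi> k by unfold_locales (rule wf)+
  have b: "branch \<eta> {} c" for \<eta>
  proof -
    \<comment> \<open>The finite branch is prolonged by zeros; any infinite branch through it would
      do.\<close>
    let ?\<eta> = "\<lambda>i. if i < length \<eta> then \<eta> ! i else 0"
    have tk: "map ?\<eta> [0..<n] = take n \<eta>" if "n \<le> length \<eta>" for n
      using that by (intro nth_equalityI) auto
    let ?F = "(\<lambda>n. (\<phi>, c (map ?\<eta> [0..<n]))) ` {..length \<eta>}"
    have "finite ?F" "?F \<subseteq> {(\<phi>, c (map ?\<eta> [0..<n])) | n. True}" by auto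
    then obtain x where "x \<in> tuples MM \<Gamma>" "\<forall>\<psi>\<in>?F. x \<in> solutions MM \<Gamma> \<psi>"
      using br[of ?\<eta>] unfolding consistent_def by blast
    then show ?thesis unfolding branch_def by (intro bexI[of _ x]) (auto simp: solutions_def tk)
  qed
  have s: "siblings \<nu> J c" if J: "finite J" "card J = k" for \<nu> J
    unfolding siblings_def
  proof
    assume "\<exists>x\<in>tuples MM \<Gamma>. \<forall>j\<in>J. sat MM (x @ c (\<nu> @ [j])) \<phi>"
    then obtain x where "x \<in> tuples MM \<Gamma>" "\<forall>j\<in>J. sat MM (x @ c (\<nu> @ [j])) \<phi>" by blast
    then have "consistent MM \<Gamma> {(\<phi>, c (\<nu> @ [i])) | i. i \<in> J}"
      unfolding consistent_def by (intro allI impI bexI[of _ x]) (auto simp: solutions_def)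
    then show False using si[OF J] by simp
  qed
  have "P c" if "P \<in> conds {}" for P
    by (rule conds_cases[OF that]) (use b s in auto)
  moreover have "c \<in> fam (\<lambda>_. \<Delta>)" using c by (simp add: fam_def)
  ultimately have "good {}" unfolding good_def by blast
  then show thesis using that tree_formula_axioms by blast
qed

end

section \<open>Voting tuples up to the set they vote for\<close>

context two_sided_formula
begin

definition cat :: "nat \<Rightarrow> (nat \<Rightarrow> 'a list) \<Rightarrow> 'a list" where
  "cat K m = concat (map m [0..<K])"

definition ctx :: "nat \<Rightarrow> 's list" where
  "ctx K = concat (map (\<lambda>_. \<Gamma>) [0..<K])"

lemma ctx_sorts: "set (ctx K) \<subseteq> sorts L"
  using psi(1) by (auto simp: ctx_def)

lemma cat_tuples: "(\<And>k. k < K \<Longrightarrow> m k \<in> tuples MM \<Gamma>) \<Longrightarrow> cat K m \<in> tuples MM (ctx K)"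
  unfolding cat_def ctx_def by (rule tuples_concat) simp

lemma cat_set: "set (cat K m) = (\<Union>k<K. set (m k))"
  by (auto simp: cat_def)

lemma cat_cases:
  assumes "x \<in> tuples MM (ctx K)"
  obtains m where "x = cat K m" "\<And>k. m k \<in> tuples MM \<Gamma>"
proof -
  obtain u where u: "x = concat (map u [0..<K])" "\<And>k. k \<in> set [0..<K] \<Longrightarrow> u k \<in> tuples MM \<Gamma>"
    using assms unfolding ctx_def by (rule tuples_concatE) auto
  obtain g where "g \<in> tuples MM \<Gamma>" using tuples_nonempty psi by blast
  then show thesis
    by (intro that[of "\<lambda>k. if k < K then u k else g"]) (use u in \<open>auto simp: cat_def intro!: arg_cong[of _ _ concat]\<close>)
qed

text \<open>Voting for the same set is a definable equivalence relation on tuples of 2n+1 voters,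
  with parameters among those allowed for c. It is returned as a formula because thorn-dividing is a
  property of formulas.\<close>

lemma vote_equivalence:
  fixes n :: nat
  defines "K \<equiv> 2 * n + 1"
  assumes "set c \<subseteq> A"
  obtains \<chi> d \<Delta>' where "wff L (ctx K @ ctx K @ \<Delta>') \<chi>" "set \<Delta>' \<subseteq> sorts L" "d \<in> tuples MM \<Delta>'" "set d \<subseteq> A"
    "\<And>m m'. (\<And>k. m k \<in> tuples MM \<Gamma>) \<Longrightarrow> (\<And>k. m' k \<in> tuples MM \<Gamma>) \<Longrightarrow>
      sat MM (cat K m @ cat K m' @ d) \<chi> \<longleftrightarrow> (\<forall>y\<in>tuples MM \<Delta>. maj R n m y \<longleftrightarrow> maj R n m' y)"
proof -
  \<comment> \<open>The blocks \<open>(True, k)\<close> and \<open>(False, k)\<close> are the voters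
    of the two tuples; in \<open>?V\<close> the point voted on is the additional block
    \<open>None\<close>.\<close>
  let ?G = "\<lambda>_ :: bool \<times> nat. \<Gamma>"
  let ?vs = "map (Pair True) [0..<K] @ map (Pair False) [0..<K]"
  let ?V = "insert None (Some ` set ?vs)"
  have sel: "dfn A (case_option \<Delta> ?G) ?V (\<lambda>w. maj R n (\<lambda>k. w (Some (s, k))) (w None))" for s
    unfolding maj_def
  proof (intro dfn_bex dfn_ball)
    fix w k assume "w \<in> {w \<in> Pow {..<2 * n + 1}. card w = Suc n}" "k \<in> w"
    then have "k < K" by (auto simp: K_def)
    then show "dfn A (case_option \<Delta> ?G) ?V (\<lambda>u. R (u (Some (s, k))) (u None))"
      by (intro dfn_R) (use assms(2) in \<open>cases s; auto\<close>)+
  qed (auto intro: finite_subset)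
  have "dfn A ?G (set ?vs) (\<lambda>u. \<forall>y\<in>tuples MM \<Delta>. maj R n (\<lambda>k. u (True, k)) y \<longleftrightarrow> maj R n (\<lambda>k. u (False, k)) y)"
    by (rule dfn_all[where V' = ?V], intro dfn_iff sel) (use psi in auto)
  from dfn_pform[OF this] obtain \<chi>d where
    \<chi>d: "\<chi>d \<in> pforms L MM (concat (map ?G ?vs)) A"
    "\<forall>u\<in>fam ?G. concat (map u ?vs) \<in> solutions MM (concat (map ?G ?vs)) \<chi>d \<longleftrightarrow>
      (\<forall>y\<in>tuples MM \<Delta>. maj R n (\<lambda>k. u (True, k)) y \<longleftrightarrow> maj R n (\<lambda>k. u (False, k)) y)"
    by (elim bexE)
  obtain \<chi> d where "\<chi>d = (\<chi>, d)" by (cases \<chi>d)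
  with \<chi>d have \<chi>: "(\<chi>, d) \<in> pforms L MM (concat (map ?G ?vs)) A"
    "\<And>u. u \<in> fam ?G \<Longrightarrow> concat (map u ?vs) \<in> solutions MM (concat (map ?G ?vs)) (\<chi>, d) \<longleftrightarrow>
      (\<forall>y\<in>tuples MM \<Delta>. maj R n (\<lambda>k. u (True, k)) y \<longleftrightarrow> maj R n (\<lambda>k. u (False, k)) y)"
    by blast+
  have cc: "concat (map ?G ?vs) = ctx K @ ctx K" by (simp add: ctx_def comp_def)
  obtain \<Delta>' where \<Delta>': "wff L (ctx K @ ctx K @ \<Delta>') \<chi>" "set \<Delta>' \<subseteq> sorts L" "d \<in> tuples MM \<Delta>'" "set d \<subseteq> A"
    using \<chi>(1) unfolding cc pforms_def by auto
  have "sat MM (cat K m @ cat K m' @ d) \<chi> \<longleftrightarrow> (\<forall>y\<in>tuples MM \<Delta>. maj R n m y \<longleftrightarrow> maj R n m' y)"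
    if m: "\<And>k. m k \<in> tuples MM \<Gamma>" "\<And>k. m' k \<in> tuples MM \<Gamma>" for m m'
  proof -
    define u where "u v = (if fst v then m (snd v) else m' (snd v))" for v :: "bool \<times> nat"
    have uf: "u \<in> fam ?G" using m by (auto simp: u_def fam_def)
    have "concat (map u ?vs) = cat K m @ cat K m'" by (simp add: u_def cat_def comp_def)
    then show ?thesis
      using \<chi>(2)[OF uf] fam_concat[OF uf, of ?vs] unfolding cc by (simp add: solutions_def u_def)
  qed
  then show thesis using that \<Delta>' by blast
qed

end

section \<open>The tree property against local character and stable Kim-forking\<close>

context monster_struc
begin

theorem no_tree_property:
  assumes tp: "has_tree_property L MM" and lc: "thorn_local_character \<kappa> L MM"
    and st: "stable_Kim_forking_over_models \<kappa> L MM"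
  shows False
proof -
  obtain \<mu> :: "'k rel" where \<mu>: "Card_order \<mu>" "\<mu> <o \<kappa>"
    and loc: "\<And>\<Lambda> a B. set \<Lambda> \<subseteq> sorts L \<Longrightarrow> a \<in> tuples MM \<Lambda> \<Longrightarrow> B \<subseteq> elems L MM \<Longrightarrow> |B| <o \<kappa> \<Longrightarrow>
      \<exists>C\<subseteq>B. |C| <o \<mu> \<and> (\<forall>\<psi>\<in>type_of L MM \<Lambda> a B. \<not> thorn_divides L MM \<Lambda> C \<psi>)"
    using uniform_local_character[OF lc] by metis
  obtain Y0 :: "'k set" where Y0: "infinite Y0" "|Y0| <o \<kappa>" "|Fm| \<le>o |Y0|" "|sorts L| \<le>o |Y0|"
    by (rule small_bound)
  have \<mu>F: "\<mu> =o |Field \<mu>|" using card_of_Field_ordIso[OF \<mu>(1)] ordIso_symmetric by blast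
  \<comment> \<open>Y bounds the number of formulas, for small models, and also \<mu>, so that
    countably many sets of size below \<mu> have a union of size at most |Y|.\<close>
  define Y where "Y = Y0 \<union> Field \<mu>"
  have YY: "|Y0| \<le>o |Y|" "|Field \<mu>| \<le>o |Y|" by (auto simp: Y_def intro!: card_of_mono1)
  have "|Field \<mu>| <o \<kappa>" using card_of_Field_ordIso[OF \<mu>(1)] \<mu>(2) ordIso_ordLess_trans by blast
  then have Y: "infinite Y" "|Y| <o \<kappa>" "|Fm| \<le>o |Y|" "|sorts L| \<le>o |Y|" "\<mu> \<le>o |Y|"
    using Y0 YY ordLeq_transitive ordIso_ordLeq_trans[OF \<mu>F YY(2)] by (auto simp: Y_def intro: small_Un)
  let ?r = "cardSuc |Y|"
  have CY: "Card_order |Y|" by (rule card_of_Card_order)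
  have Cr: "Card_order ?r" by (rule cardSuc_Card_order[OF CY])
  have rF: "|Field ?r| =o ?r" by (rule card_of_Field_ordIso[OF Cr])
  have "?r \<le>o |Pow Y|" by (rule cardSuc_least[OF CY card_of_Card_order card_of_Pow])
  then have r\<kappa>: "?r <o \<kappa>" using strong_limit[OF Y(2)] ordLeq_ordLess_trans by blast
  have infF: "infinite (Field ?r)" using Y(1) cardSuc_finite[OF CY] by (simp add: Field_card_of)
  have YF: "|Y| \<le>o |Field ?r|"
    using cardSuc_ordLeq[OF CY] ordIso_symmetric[OF rF] ordLeq_ordIso_trans by blast

  obtain \<Gamma> \<Delta> \<phi> k where tf: "tree_formula L MM \<kappa> \<Gamma> \<Delta> \<phi>" "tree_formula.good MM \<Gamma> \<Delta> \<phi> k {}"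
    by (rule tree_property_good[OF tp])
  interpret T: tree_formula L MM \<kappa> \<Gamma> \<Delta> \<phi> k by (rule tf(1))
  obtain N c a where N: "\<And>i. i \<in> Field ?r \<Longrightarrow> TV (N i) \<and> |N i| \<le>o |Y| \<and> c i \<in> tuples MM \<Delta> \<and> Kim_divides L MM \<Gamma> (N i) (\<phi>, c i)"
    and Nmono: "\<And>i j. (i, j) \<in> ?r \<Longrightarrow> i \<noteq> j \<Longrightarrow> N i \<union> set (c i) \<subseteq> N j"
    and a: "a \<in> tuples MM \<Gamma>" "\<And>i. i \<in> Field ?r \<Longrightarrow> sat MM (a @ c i) \<phi>"
    by (rule T.Kim_chain[OF Y(1,3,4) r\<kappa> tf(2)]) blast
  define B where "B = (\<Union>i\<in>Field ?r. N i)"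
  have tot: "total_on (Field ?r) ?r"
    using Cr by (simp add: card_order_on_def well_order_on_def linear_order_on_def)
  have chain: "N i \<subseteq> N j \<or> N j \<subseteq> N i" if "i \<in> Field ?r" "j \<in> Field ?r" for i j
    using tot that Nmono[of i j] Nmono[of j i] unfolding total_on_def by (cases "i = j") auto
  have TVB: "TV B" unfolding B_def by (rule TV_chain) (use N infF chain in auto)
  have Be: "B \<subseteq> elems L MM" by (rule TV_elems[OF TVB])
  have Bc: "|B| \<le>o |Field ?r|"
    unfolding B_def
    by (rule ordLeq_UN[OF infF card_of_mono1[OF subset_refl]]) (use N YF ordLeq_transitive in blast)
  have Fk: "|Field ?r| <o \<kappa>" using rF r\<kappa> ordIso_ordLess_trans by blast
  have Bk: "|B| <o \<kappa>" using Bc Fk ordLeq_ordLess_trans by blast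
  have cB: "set (c i) \<subseteq> B" if i: "i \<in> Field ?r" for i
  proof -
    \<comment> \<open>An infinite cardinal has no last element, so the parameter of stage i is
      contained in the model of a later stage.\<close>
    obtain j where "j \<in> Field ?r" "i \<noteq> j" "(i, j) \<in> ?r" using infinite_Card_order_limit[OF Cr infF i] by blast
    then show ?thesis using Nmono unfolding B_def by blast
  qed

  let ?pos = "\<lambda>S. S \<inter> lists B \<noteq> {}"
  have pr: "part_reg ?pos" by (rule part_reg_meets)
  have fsB: "fs B ?pos" by (simp add: fs_def)
  obtain q where q: "ptype ?pos \<Gamma> (elems L MM) q" "\<And>S. defble \<Gamma> B S \<Longrightarrow> inq \<Gamma> q S \<longleftrightarrow> a \<in> S"
    using coheir_exists[OF TVB T.phi(1) a(1)] by metis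
  \<comment> \<open>Each stage is a model containing B and all earlier data, together with a
    realisation of q over it. Models are needed, not just sets, for the richness argument in
    \<open>majority_outside\<close>.\<close>
  define P where "P f n x \<longleftrightarrow> TV (fst x) \<and> |fst x| \<le>o |Field ?r| \<and> B \<subseteq> fst x \<and>
      (\<forall>j<n. fst (f j) \<union> set (snd (f j)) \<subseteq> fst x) \<and> realizes \<Gamma> (fst x) q (snd x)"
    for f :: "nat \<Rightarrow> 'a set \<times> 'a list" and n x
  have "\<exists>f. \<forall>n. P f n (f n)"
  proof (rule dependent_wellorder_choice)
    fix x and f g :: "nat \<Rightarrow> 'a set \<times> 'a list" and n :: nat
    assume "\<And>j. j < n \<Longrightarrow> f j = g j"
    then show "P f n x = P g n x" unfolding P_def by (simp cong: conj_cong)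
  next
    fix n and f :: "nat \<Rightarrow> 'a set \<times> 'a list"
    assume IH: "\<And>j. j < n \<Longrightarrow> P f j (f j)"
    let ?A = "B \<union> (\<Union>j\<in>{..<n}. fst (f j) \<union> set (snd (f j)))"
    have "|fst (f j) \<union> set (snd (f j))| \<le>o |Field ?r|" if "j \<in> {..<n}" for j
      using IH[of j] that by (intro ordLeq_Un[OF infF _ ordLeq_finite[OF infF]]) (auto simp: P_def)
    then have "|?A| \<le>o |Field ?r|" by (intro ordLeq_Un[OF infF Bc] ordLeq_UN[OF infF ordLeq_nat[OF infF]])
    moreover have "fst (f j) \<union> set (snd (f j)) \<subseteq> elems L MM" if "j \<in> {..<n}" for j
      using IH[of j] that TV_elems tuples_elems[OF _ T.phi(1)] by (auto simp: P_def realizes_def)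
    then have "?A \<subseteq> elems L MM" using Be by blast
    ultimately obtain B' where B': "?A \<subseteq> B'" "TV B'" "|B'| \<le>o |Field ?r|"
      by (elim Loewenheim_Skolem[OF infF ordLeq_transitive[OF Y(3) YF] ordLeq_transitive[OF Y(4) YF], rotated 2])
    have "B' \<subseteq> elems L MM" by (rule TV_elems[OF B'(2)])
    moreover have "|B'| <o \<kappa>" using B'(3) Fk ordLeq_ordLess_trans by blast
    ultimately obtain x where "realizes \<Gamma> B' q x" using realize_ptype[OF pr q(1) _ _ _ T.phi(1)] by blast
    then show "\<exists>x. P f n x" using B' by (intro exI[of _ "(B', x)"]) (auto simp: P_def)
  qed
  then obtain f where f: "\<And>n. P f n (f n)" by blast
  define BB av where "BB n = fst (f n)" and "av n = snd (f n)" for n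
  have BB: "\<And>n. TV (BB n)" "\<And>n. B \<subseteq> BB n" "\<And>n. realizes \<Gamma> (BB n) q (av n)" "\<And>n. set (av n) \<subseteq> BB (Suc n)"
    using f by (auto simp: P_def BB_def av_def)
  have BBmono: "BB k \<subseteq> BB l" if "k \<le> l" for k l
    using that f[of l] by (cases "k = l") (auto simp: P_def BB_def)
  have avt: "av n \<in> tuples MM \<Gamma>" for n using BB(3) by (simp add: realizes_def)

  \<comment> \<open>These coincide with \<open>S.ctx\<close> and \<open>S.cat\<close> for the Morley
    sequence, but are needed before the stable formula, and hence the locale S, is
    available.\<close>
  define ctx where "ctx K = concat (map (\<lambda>_. \<Gamma>) [0..<K])" for K :: nat
  define av_tuple where "av_tuple K = concat (map av [0..<K])" for K
  have ctxs: "set (ctx K) \<subseteq> sorts L" for K using T.phi(1) by (auto simp: ctx_def)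
  have avtt: "av_tuple K \<in> tuples MM (ctx K)" for K
    unfolding ctx_def av_tuple_def by (rule tuples_concat) (rule avt)
  have "\<exists>C. \<forall>K. C K \<subseteq> B \<and> |C K| <o \<mu> \<and> (\<forall>\<psi>\<in>type_of L MM (ctx K) (av_tuple K) B. \<not> thorn_divides L MM (ctx K) (C K) \<psi>)"
    using loc[OF ctxs avtt Be Bk] by metis
  then obtain C where C: "\<And>K. C K \<subseteq> B" "\<And>K. |C K| <o \<mu>"
    "\<And>K \<psi>. \<psi> \<in> type_of L MM (ctx K) (av_tuple K) B \<Longrightarrow> \<not> thorn_divides L MM (ctx K) (C K) \<psi>"
    by blast
  have "|\<Union>K. C K| \<le>o |Y|"
    by (rule ordLeq_UN[OF Y(1) ordLeq_nat[OF Y(1)]])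
      (rule ordLeq_transitive[OF ordLess_imp_ordLeq[OF C(2)] Y(5)])
  moreover have "relChain ?r N" unfolding relChain_def using Nmono by blast
  moreover have "(\<Union>K. C K) \<subseteq> (\<Union>i\<in>Field ?r. N i)" using C(1) by (auto simp: B_def)
  \<comment> \<open>Regularity of the successor of |Y|: the bases for all lengths K lie together in
    one model of the chain.\<close>
  ultimately obtain i where i: "i \<in> Field ?r" "(\<Union>K. C K) \<subseteq> N i"
    using cardSuc_UNION[OF CY, of N "\<Union>K. C K"] Y(1) by (auto simp: Field_card_of)
  note Ni = N[OF i(1)]
  have TVN: "TV (N i)" and NB: "N i \<subseteq> B" using Ni i(1) by (auto simp: B_def)
  have Nk: "|N i| <o \<kappa>" using Ni Y(2) ordLeq_ordLess_trans by blast
  have Ne: "N i \<subseteq> elems L MM" by (rule TV_elems[OF TVN])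

  have ptB: "(\<phi>, c i) \<in> pforms L MM \<Gamma> B" using Ni cB[OF i(1)] T.phi by (auto simp: pforms_def)
  have "(\<phi>, c i) \<in> type_of L MM \<Gamma> a B" using ptB a i(1) by (auto simp: type_of_def solutions_def)
  moreover have "Kim_forks L MM \<Gamma> (N i) (\<phi>, c i)"
    unfolding Kim_forks_def using Ni pforms_mono[OF Be] ptB by (intro exI[of _ "{(\<phi>, c i)}"]) auto
  ultimately obtain \<psi> \<Delta>' \<Theta> b d where
    wf: "set \<Delta>' \<subseteq> sorts L" "set \<Theta> \<subseteq> sorts L" "wff L (\<Gamma> @ \<Delta>' @ \<Theta>) \<psi>"
    and b: "b \<in> tuples MM \<Delta>'" "set b \<subseteq> B" and d: "d \<in> tuples MM \<Theta>" "set d \<subseteq> N i"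
    and stab: "stable_formula MM \<Gamma> \<Delta>' \<psi> d" and bp: "(\<psi>, b @ d) \<in> type_of L MM \<Gamma> a B"
    and Kf: "Kim_forks L MM \<Gamma> (N i) (\<psi>, b @ d)"
    using st[unfolded stable_Kim_forking_over_models_def, rule_format, of "N i" B \<Gamma> "type_of L MM \<Gamma> a B"]
      TV_elementary[OF TVN] NB Be Bk T.phi(1) type_of_complete[OF a(1)] by blast
  interpret S: two_sided_formula L MM \<kappa> \<Gamma> \<Delta>' \<Theta> \<psi> d
    by unfold_locales (use T.phi(1) wf d in auto)
  obtain n where no: "\<not> has_order S.R (tuples MM \<Gamma>) (tuples MM \<Delta>') n" using S.stable_bound[OF stab] by blast
  obtain m where m: "\<And>k. m k \<in> tuples MM \<Gamma> \<and> set (m k) \<subseteq> B"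
    "\<And>y. y \<in> tuples MM \<Delta>' \<Longrightarrow> inq \<Gamma> q {x \<in> tuples MM \<Gamma>. S.R x y} \<longleftrightarrow> maj S.R n m y"
    by (rule S.majority_inside[OF no pr q(1) fsB]) blast
  define X where "X = {y \<in> tuples MM \<Delta>'. maj S.R n m y}"
  have dB: "set d \<subseteq> B" using d(2) NB by simp
  have dX: "defble \<Delta>' B X" unfolding X_def by (rule S.defble_maj) (use m dB in auto)
  have Xav: "y \<in> X \<longleftrightarrow> maj S.R n av y" if "y \<in> tuples MM \<Delta>'" for y
  proof (rule S.majority_outside[where B = BB, OF no pr q(1)])
    show "set d \<subseteq> BB 0" using dB BB(2) by blast
    show "defble \<Delta>' (BB 0) X" by (rule defble_mono[OF dX BB(2)])
    show "y \<in> X \<longleftrightarrow> inq \<Gamma> q {x \<in> tuples MM \<Gamma>. S.R x y}" if "y \<in> tuples MM \<Delta>'" for y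
      using m(2)[OF that] that by (simp add: X_def)
  qed (use BB BBmono that in auto)
  have Ra: "S.R a y \<longleftrightarrow> y \<in> X" if y: "y \<in> tuples MM \<Delta>'" "set y \<subseteq> B" for y
  proof -
    have "defble \<Gamma> B {x \<in> tuples MM \<Gamma>. S.R x y}" by (rule S.defble_R_left) (use y dB in auto)
    from q(2)[OF this] show ?thesis using m(2)[OF y(1)] y(1) a(1) by (simp add: X_def)
  qed
  have "S.R a b" using bp by (simp add: type_of_def solutions_def S.R_def)
  then have bX: "b \<in> X" using Ra b by simp

  define K where "K = 2 * n + 1"
  \<comment> \<open>With \<psi> fixed, the number K of voters is known, and the base
    \<open>C K\<close> chosen earlier becomes the relevant one.\<close>
  have ctx: "S.ctx K = ctx K" and cav: "S.cat K av = av_tuple K"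
    by (simp_all only: S.ctx_def ctx_def S.cat_def av_tuple_def)
  obtain \<chi> e \<Xi> where \<chi>: "wff L (S.ctx K @ S.ctx K @ \<Xi>) \<chi>" "set \<Xi> \<subseteq> sorts L" "e \<in> tuples MM \<Xi>" "set e \<subseteq> N i"
    and \<chi>s: "\<And>m m'. (\<And>k. m k \<in> tuples MM \<Gamma>) \<Longrightarrow> (\<And>k. m' k \<in> tuples MM \<Gamma>) \<Longrightarrow>
      sat MM (S.cat K m @ S.cat K m' @ e) \<chi> \<longleftrightarrow> (\<forall>y\<in>tuples MM \<Delta>'. maj S.R n m y \<longleftrightarrow> maj S.R n m' y)"
    by (rule S.vote_equivalence[OF d(2), of n, folded K_def]) blast
  define \<Lambda> where "\<Lambda> = S.ctx K"
  have \<Lambda>: "set \<Lambda> \<subseteq> sorts L" unfolding \<Lambda>_def by (rule S.ctx_sorts)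
  define E where "E x x' \<longleftrightarrow> sat MM (x @ x' @ e) \<chi>" for x x'
  have Ecat: "E (S.cat K m) (S.cat K m') \<longleftrightarrow> (\<forall>y\<in>tuples MM \<Delta>'. maj S.R n m y \<longleftrightarrow> maj S.R n m' y)"
    if "\<And>k. m k \<in> tuples MM \<Gamma>" "\<And>k. m' k \<in> tuples MM \<Gamma>" for m m'
    unfolding E_def by (rule \<chi>s) (use that in auto)
  have Erefl: "E x x" if "x \<in> tuples MM \<Lambda>" for x
    using that unfolding \<Lambda>_def by (elim S.cat_cases) (simp add: Ecat)
  have Eright: "E x z" if "x \<in> tuples MM \<Lambda>" "y \<in> tuples MM \<Lambda>" "z \<in> tuples MM \<Lambda>" "E x y" "E y z" for x y z
    using that unfolding \<Lambda>_def by (elim S.cat_cases) (simp add: Ecat)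
  have Esym: "E y x" if "x \<in> tuples MM \<Lambda>" "y \<in> tuples MM \<Lambda>" "E x y" for x y
    using that unfolding \<Lambda>_def by (elim S.cat_cases) (simp add: Ecat)
  define mm where "mm = S.cat K m"
  have mmt: "mm \<in> tuples MM \<Lambda>" unfolding mm_def \<Lambda>_def using m(1) by (intro S.cat_tuples) auto
  have mmB: "set mm \<subseteq> B" unfolding mm_def S.cat_set using m(1) by auto
  have dE: "dfn (N i) (\<lambda>_::bool. \<Lambda>) UNIV (\<lambda>u. E (u True) (u False))"
    unfolding E_def by (rule dfn_sat2[where \<Delta> = \<Xi>]) (use \<chi> in \<open>auto simp: \<Lambda>_def\<close>)
  \<comment> \<open>X is voted for by a tuple from B; the claim is that voters can be found in
    \<open>N i\<close>. If not, \<open>coheir_dichotomy\<close> produces infinitely many conjugates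
    of \<open>mm\<close> in different classes.\<close>
  have "\<exists>x\<in>tuples MM \<Lambda>. set x \<subseteq> N i \<and> E mm x"
  proof (rule ccontr)
    assume "\<not> ?thesis"
    then obtain ms :: "nat \<Rightarrow> 'a list" where ms: "\<And>j. same_type \<Lambda> (N i) mm (ms j)" "\<And>i j. i < j \<Longrightarrow> \<not> E (ms i) (ms j)"
      using coheir_dichotomy[OF TVN Nk \<Lambda> mmt dE] by blast
    have mst: "ms j \<in> tuples MM \<Lambda>" for j using ms(1) by (simp add: same_type_def)
    let ?\<psi> = "(\<chi>, mm @ e)"
    \<comment> \<open>Thorn-dividing over \<open>C K\<close> permits a further finite tuple in the
      base. It is spent on e, so that automorphisms fixing \<open>?C\<close> preserve the
      equivalence relation E.\<close>
    let ?C = "C K \<union> set e"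
    have CN: "?C \<subseteq> N i" using i(2) \<chi>(4) by blast
    have pfB: "?\<psi> \<in> pforms L MM \<Lambda> B"
      using \<chi> mmt mmB NB \<Lambda> tuples_append[OF mmt \<chi>(3)] unfolding pforms_def \<Lambda>_def
      by (auto intro!: exI[of _ "S.ctx K @ \<Xi>"])
    then have pf: "?\<psi> \<in> pforms L MM \<Lambda> (elems L MM)" using pforms_mono[OF Be] by blast
    let ?T = "\<lambda>z. {x \<in> tuples MM \<Lambda>. E x z}"
    have im: "map \<sigma> ` solutions MM \<Lambda> ?\<psi> = ?T (map \<sigma> mm)" if "\<sigma> \<in> automorphisms L MM ?C" for \<sigma>
      unfolding aut_solutions[OF that \<Lambda> pf] using aut_id_on_tuple[OF that, of e]
      by (simp add: solutions_def E_def)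
    let ?D = "(\<lambda>\<sigma>. map \<sigma> ` solutions MM \<Lambda> ?\<psi>) ` automorphisms L MM ?C"
    have "?T (ms j) \<in> ?D" for j
    proof -
      obtain \<sigma> where \<sigma>: "\<sigma> \<in> automorphisms L MM (N i)" "map \<sigma> mm = ms j"
        using homogeneous[OF _ Nk \<Lambda> ms(1)] TVN by blast
      then have \<sigma>C: "\<sigma> \<in> automorphisms L MM ?C" using aut_mono[OF CN] by blast
      have "?T (ms j) = map \<sigma> ` solutions MM \<Lambda> ?\<psi>" unfolding im[OF \<sigma>C] \<sigma>(2) ..
      then show ?thesis using \<sigma>C by (rule image_eqI)
    qed
    moreover have "inj (\<lambda>j. ?T (ms j))"
    proof (rule linorder_injI)
      fix j l :: nat assume "j < l"
      have "ms j \<in> ?T (ms j)" "ms j \<notin> ?T (ms l)" using Erefl mst ms(2)[OF \<open>j < l\<close>] by auto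
      then show "?T (ms j) \<noteq> ?T (ms l)" by blast
    qed
    ultimately have "infinite ?D" using infinite_super[of "range (\<lambda>j. ?T (ms j))" ?D] range_inj_infinite by blast
    moreover have "\<Inter>W = {}" if W: "W \<subseteq> ?D" "card W = 2" for W
    proof (rule ccontr)
      assume "\<Inter>W \<noteq> {}"
      then obtain x where x: "\<And>U. U \<in> W \<Longrightarrow> x \<in> U" by blast
      obtain U1 U2 where U: "W = {U1, U2}" "U1 \<noteq> U2" using W(2) by (auto simp: card_2_iff)
      obtain \<sigma> \<tau> where \<sigma>: "\<sigma> \<in> automorphisms L MM ?C" "U1 = ?T (map \<sigma> mm)"
        and \<tau>: "\<tau> \<in> automorphisms L MM ?C" "U2 = ?T (map \<tau> mm)"
        using W(1) U(1) im by auto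
      have t: "map \<sigma> mm \<in> tuples MM \<Lambda>" "map \<tau> mm \<in> tuples MM \<Lambda>" using aut_tuples[OF _ \<Lambda> mmt] \<sigma> \<tau> by auto
      have xx: "x \<in> tuples MM \<Lambda>" "E x (map \<sigma> mm)" "E x (map \<tau> mm)" using x[of U1] x[of U2] U(1) \<sigma>(2) \<tau>(2) by auto
      have "E (map \<sigma> mm) (map \<tau> mm)" using Eright[OF t(1) xx(1) t(2) Esym[OF xx(1) t(1) xx(2)] xx(3)] .
      then have "U1 = U2" unfolding \<sigma>(2) \<tau>(2) using Eright Esym t by blast
      then show False using U(2) by simp
    qed
    ultimately have "strongly_divides L MM \<Lambda> ?C ?\<psi>"
      unfolding strongly_divides_def Let_def by (intro conjI exI[of _ 2]) auto
    then have "thorn_divides L MM \<Lambda> (C K) ?\<psi>"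
      unfolding thorn_divides_def using \<chi>(4) Ne by blast
    \<comment> \<open>The Morley sequence and the voters from B both vote for X. Hence the formula
      "x votes like \<open>mm\<close>" belongs to the type of the Morley sequence over B, from which
      \<open>C K\<close> excludes thorn-dividing formulas.\<close>
    moreover have "E (S.cat K av) mm"
      unfolding mm_def using Ecat[of av m] avt m(1) Xav by (auto simp: X_def)
    then have "?\<psi> \<in> type_of L MM (ctx K) (av_tuple K) B"
      using pfB avtt[of K] unfolding type_of_def solutions_def E_def \<Lambda>_def ctx cav by auto
    ultimately show False using C(3) unfolding \<Lambda>_def ctx by blast
  qed
  then obtain x where x: "x \<in> tuples MM \<Lambda>" "set x \<subseteq> N i" "E mm x" by blast
  obtain \<nu> where \<nu>: "x = S.cat K \<nu>" "\<And>k. \<nu> k \<in> tuples MM \<Gamma>" using x(1) unfolding \<Lambda>_def by (rule S.cat_cases) blast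
  have X\<nu>: "X = {y \<in> tuples MM \<Delta>'. maj S.R n \<nu> y}"
    using x(3) Ecat[of m \<nu>] m(1) \<nu> unfolding mm_def X_def by auto
  have "set (\<nu> k) \<subseteq> N i" if "k < K" for k
    using x(2) that unfolding \<nu>(1) S.cat_set by auto
  then have dXN: "defble \<Delta>' (N i) X"
    unfolding X\<nu> by (intro S.defble_maj conjI) (use \<nu>(2) d(2) in \<open>auto simp: K_def\<close>)
  let ?posN = "\<lambda>S. S \<inter> lists (N i) \<noteq> {}"
  have prN: "part_reg ?posN" by (rule part_reg_meets)
  have Xt: "X \<subseteq> tuples MM \<Delta>'" by (rule defble_subset[OF dX])
  have dR: "defble \<Gamma> (elems L MM) {x \<in> tuples MM \<Gamma>. S.R x y}" if "y \<in> X" for y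
    by (rule S.defble_R_left) (use that Xt tuples_elems[OF subsetD[OF Xt that] wf(1)] dB Be in auto)
  obtain r where r: "ptype ?posN \<Gamma> (elems L MM) r" "\<And>y. y \<in> X \<Longrightarrow> inq \<Gamma> r {x \<in> tuples MM \<Gamma>. S.R x y}"
  proof (rule ptype_existsD[OF prN dR])
    fix Z assume "finite Z" "Z \<subseteq> X"
    then have "\<exists>x\<in>tuples MM \<Gamma> \<inter> lists (N i). \<forall>y\<in>Z. S.R x y"
      using S.definable_type_fin_sat[OF no TVN d(2) dXN a(1)] Ra NB by blast
    then show "?posN {a \<in> tuples MM \<Gamma>. \<forall>y\<in>Z. a \<in> {x \<in> tuples MM \<Gamma>. S.R x y}}" by blast
  qed blast+
  have "solutions MM \<Gamma> (\<psi>, b @ d) = {x \<in> tuples MM \<Gamma>. S.R x b}" by (simp add: solutions_def S.R_def)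
  moreover have "(\<psi>, b @ d) \<in> pforms L MM \<Gamma> (elems L MM)"
    using bp pforms_mono[OF Be] by (auto simp: type_of_def)
  ultimately have "(\<psi>, b @ d) \<in> r" using r(2)[OF bX] inq_iff[OF prN r(1), of "(\<psi>, b @ d)"] by metis
  moreover have "fs (N i) ?posN" by (simp add: fs_def)
  ultimately show False using fs_not_Kim_forks[OF prN r(1) _ T.phi(1) Ne] Kf by blast
qed

end

section \<open>Imaginaries\<close>

lemma tuples_concat_listE:
  assumes "a \<in> tuples M (concat Gs)"
  obtains xs where "a = concat xs" "list_all2 (\<lambda>x g. x \<in> tuples M g) xs Gs"
  using assms
proof (induction Gs arbitrary: a thesis)
  case (Cons g Gs)
  from Cons.prems(2) obtain b c where a: "a = b @ c" "b \<in> tuples M g" "c \<in> tuples M (concat Gs)"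
    by (auto elim: tuples_appendE)
  obtain xs where "c = concat xs" "list_all2 (\<lambda>x g. x \<in> tuples M g) xs Gs" using Cons.IH[OF _ a(3)] .
  then show ?case using Cons.prems(1)[of "b # xs"] a by auto
qed auto

lemma list_all2_ex:
  "list_all2 (\<lambda>x y. \<exists>z. P x y z) xs ys \<Longrightarrow> \<exists>zs. length zs = length xs \<and> (\<forall>i<length xs. P (xs ! i) (ys ! i) (zs ! i))"
proof (induction rule: list_all2_induct)
  case (Cons x xs y ys)
  then obtain z zs where "P x y z" "length zs = length xs" "\<forall>i<length xs. P (xs ! i) (ys ! i) (zs ! i)" by blast
  then show ?case by (intro exI[of _ "z # zs"]) (auto simp: less_Suc_eq_0_disj)
qed simp

primrec lift_trm :: "'f trm \<Rightarrow> ('f, 'r) eq_fn trm" where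
  "lift_trm (Var i) = Var i"
| "lift_trm (App f ts) = App (Base f) (map lift_trm ts)"

primrec lift_fm :: "('f, 'r, unit) fm \<Rightarrow> (('f, 'r) eq_fn, 'r, ('f, 'r) eq_sort) fm" where
  "lift_fm (FEq t u) = FEq (lift_trm t) (lift_trm u)"
| "lift_fm (FRel r ts) = FRel r (map lift_trm ts)"
| "lift_fm (FNeg \<phi>) = FNeg (lift_fm \<phi>)"
| "lift_fm (FAnd \<phi> \<psi>) = FAnd (lift_fm \<phi>) (lift_fm \<psi>)"
| "lift_fm (FEx s \<phi>) = FEx home (lift_fm \<phi>)"

text \<open>Substitution of terms is obtained semantically, from "some z has coordinates equal to
  the terms and satisfies E". Working over the empty parameter set guarantees that the resulting
  formula has no parameters.\<close>

lemma (in many_sorted) subst_formula: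
  assumes E: "wff L \<Delta> E" "set \<Delta> \<subseteq> sorts L" and ts: "list_all2 (has_sort L \<Gamma>) ts \<Delta>"
  shows "\<exists>\<phi>. wff L \<Gamma> \<phi> \<and> (\<forall>e\<in>tuples MM \<Gamma>. sat MM e \<phi> \<longleftrightarrow> sat MM (map (eval MM e) ts) E)"
proof -
  let ?G = "\<lambda>_::unit. \<Gamma>" and ?n = "length \<Delta>"
  have len: "length ts = ?n" using ts by (rule list_all2_lengthD)
  have eq: "dfn {} (case_option \<Delta> ?G) UNIV (\<lambda>w. w None ! i = eval MM (w (Some ())) (ts ! i))" if i: "i < ?n" for i
  proof (rule dfnI[of "[None, Some ()]" _ "[]" _ "FEq (Var i) (ren_trm (\<lambda>j. ?n + j) (ts ! i))" "[]"])
    have t: "has_sort L \<Gamma> (ts ! i) (\<Delta> ! i)" using ts i len by (auto simp: list_all2_conv_all_nth)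
    have "has_sort L (\<Delta> @ \<Gamma>) (ren_trm (\<lambda>j. ?n + j) (ts ! i)) (\<Delta> ! i)"
      by (rule has_sort_ren[OF t]) (auto simp: nth_append)
    moreover have "has_sort L (\<Delta> @ \<Gamma>) (Var i) (\<Delta> ! i)"
      using has_sort.intros(1)[of i "\<Delta> @ \<Gamma>" L] i by (simp add: nth_append)
    ultimately show "wff L (concat (map (case_option \<Delta> ?G) [None, Some ()]) @ []) (FEq (Var i) (ren_trm (\<lambda>j. ?n + j) (ts ! i)))"
      by auto
    fix w assume w: "w \<in> fam (case_option \<Delta> ?G)"
    have l: "length (w None) = ?n" using fam_length[OF w, of None] by simp
    have "eval MM (w None @ w (Some ())) (ren_trm (\<lambda>j. ?n + j) (ts ! i)) = eval MM (w (Some ())) (ts ! i)"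
      by (rule eval_ren[OF t]) (simp add: l nth_append)
    then show "w None ! i = eval MM (w (Some ())) (ts ! i) \<longleftrightarrow>
        sat MM (concat (map w [None, Some ()]) @ []) (FEq (Var i) (ren_trm (\<lambda>j. ?n + j) (ts ! i)))"
      using i l by (simp add: nth_append)
  qed auto
  have "dfn {} (case_option \<Delta> ?G) UNIV (\<lambda>w. sat MM (w None @ []) E)"
    by (rule dfn_sat1[where \<Delta> = "[]"]) (use E in auto)
  then have "dfn {} (case_option \<Delta> ?G) UNIV (\<lambda>w. (\<forall>i\<in>{..<?n}. w None ! i = eval MM (w (Some ())) (ts ! i)) \<and> sat MM (w None) E)"
    by (intro dfn_conj dfn_ball eq) auto
  then have "dfn {} ?G UNIV (\<lambda>u. \<exists>z\<in>tuples MM \<Delta>. (\<forall>i\<in>{..<?n}. z ! i = eval MM (u ()) (ts ! i)) \<and> sat MM z E)"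
    by (rule dfn_ex) (use E in \<open>auto simp: UNIV_option_conv\<close>)
  moreover have "(\<exists>z\<in>tuples MM \<Delta>. (\<forall>i\<in>{..<?n}. z ! i = eval MM e (ts ! i)) \<and> sat MM z E) \<longleftrightarrow>
      sat MM (map (eval MM e) ts) E" if e: "e \<in> tuples MM \<Gamma>" for e
  proof -
    have "z = map (eval MM e) ts" if "z \<in> tuples MM \<Delta>" "\<forall>i\<in>{..<?n}. z ! i = eval MM e (ts ! i)" for z
      using that tuples_length[OF that(1)] len by (intro nth_equalityI) auto
    moreover have "map (eval MM e) ts \<in> tuples MM \<Delta>" by (rule map_eval_tuples[OF ts e])
    moreover have "\<forall>i\<in>{..<?n}. map (eval MM e) ts ! i = eval MM e (ts ! i)" using len by simp
    ultimately show ?thesis by metis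
  qed
  ultimately have "defble \<Gamma> {} {e \<in> tuples MM \<Gamma>. sat MM (map (eval MM e) ts) E}"
    using defbleI[of "{}" \<Gamma> "\<lambda>e. \<exists>z\<in>tuples MM \<Delta>. (\<forall>i\<in>{..<?n}. z ! i = eval MM e (ts ! i)) \<and> sat MM z E"]
    by (simp cong: conj_cong)
  then obtain \<phi> b \<Xi> where \<phi>: "solutions MM \<Gamma> (\<phi>, b) = {e \<in> tuples MM \<Gamma>. sat MM (map (eval MM e) ts) E}"
    "wff L (\<Gamma> @ \<Xi>) \<phi>" "b \<in> tuples MM \<Xi>" "set b \<subseteq> {}" by (auto simp: defble_def pforms_def)
  then have "b = []" by simp
  moreover from this have "\<Xi> = []" using tuples_length[OF \<phi>(3)] by simp
  ultimately show ?thesis using \<phi>(1,2) by (intro exI[of _ \<phi>]) (auto simp: solutions_def)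
qed

section \<open>The structure of imaginaries and its home sort\<close>

locale one_sorted = many_sorted L MM
  for L :: "('f, 'r, unit) lang" and MM :: "('f, 'r, unit, 'a) struc"
begin

abbreviation "Leq \<equiv> eq_lang L MM"
abbreviation "Meq \<equiv> eq_struc L MM"
abbreviation "nb n \<equiv> replicate n ()"

definition cls :: "('f, 'r) eq_sort \<Rightarrow> 'a list \<Rightarrow> ('f, 'r) eq_sort \<times> 'a list set" where
  "cls s x = (s, eq_rel MM s `` {x})"

definition hm :: "'a \<Rightarrow> ('f, 'r) eq_sort \<times> 'a list set" where
  "hm x = (home, {[x]})"

lemma sorts_unit: "sorts L = {()}"
  using sorts_nonempty by auto

lemma unit_context: "set \<Gamma> \<subseteq> sorts L"
  by (simp add: sorts_unit subset_iff)

lemma eq_rel_home: "eq_rel MM home = Id_on (tuples MM [()])"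
  by (auto simp: eq_rel_def home_def Id_on_def elim!: tuples_ConsE)

lemma home_sort: "home \<in> eq_sorts L MM"
proof -
  have "has_sort L [(), ()] (Var 0) ()" "has_sort L [(), ()] (Var 1) ()"
    using has_sort.intros(1)[of 0 "[(), ()]" L] has_sort.intros(1)[of 1 "[(), ()]" L] by auto
  then have "wff L (nb (1 + 1)) (FEq (Var 0) (Var 1))" by (auto simp: numeral_2_eq_2)
  moreover have "equiv (tuples MM [()]) (eq_rel MM home)"
    unfolding eq_rel_home by (auto simp: equiv_def refl_on_def sym_def trans_def Id_on_def)
  ultimately show ?thesis unfolding eq_sorts_def by (simp add: home_def)
qed

lemma eq_sort_equiv: "s \<in> eq_sorts L MM \<Longrightarrow> equiv (tuples MM (nb (fst s))) (eq_rel MM s)"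
  by (cases s) (auto simp: eq_sorts_def)

lemma univ_eq: "s \<in> eq_sorts L MM \<Longrightarrow> univ Meq s = cls s ` tuples MM (nb (fst s))"
  by (auto simp: eq_struc_def cls_def quotient_def)

lemma cls_eq: "s \<in> eq_sorts L MM \<Longrightarrow> x \<in> tuples MM (nb (fst s)) \<Longrightarrow> y \<in> tuples MM (nb (fst s)) \<Longrightarrow>
    cls s x = cls s y \<longleftrightarrow> (x, y) \<in> eq_rel MM s"
  by (simp add: cls_def eq_equiv_class_iff[OF eq_sort_equiv])

lemma cls_home: "x \<in> univ MM () \<Longrightarrow> cls home [x] = hm x"
  by (simp add: cls_def hm_def eq_rel_home)

lemma home_elem_hm [simp]: "home_elem (hm x) = x"
  by (simp add: home_elem_def hm_def)

lemma fst_home [simp]: "fst home = 1"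
  by (simp add: home_def)

lemma univ_home: "univ Meq home = hm ` univ MM ()"
proof -
  have "tuples MM [()] = (\<lambda>x. [x]) ` univ MM ()" by (auto elim!: tuples_ConsE)
  then show ?thesis unfolding univ_eq[OF home_sort] by (simp add: image_image cls_home)
qed

lemma home_elem_comp_hm [simp]: "home_elem \<circ> hm = id"
  by (simp add: fun_eq_iff)

lemma inj_hm: "inj hm"
  by (auto simp: inj_def hm_def)

lemma tuples_hm: "tuples Meq (map (\<lambda>_. home) \<Gamma>) = map hm ` tuples MM \<Gamma>"
proof (induction \<Gamma>)
  case (Cons s \<Gamma>)
  show ?case
  proof (intro subset_antisym subsetI)
    fix a assume "a \<in> tuples Meq (map (\<lambda>_. home) (s # \<Gamma>))"
    then obtain x b where "a = hm x # map hm b" "x \<in> univ MM ()" "b \<in> tuples MM \<Gamma>"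
      using Cons by (auto elim!: tuples_ConsE simp: univ_home)
    then show "a \<in> map hm ` tuples MM (s # \<Gamma>)" by (intro image_eqI[of _ _ "x # b"]) auto
  next
    fix a assume "a \<in> map hm ` tuples MM (s # \<Gamma>)"
    then show "a \<in> tuples Meq (map (\<lambda>_. home) (s # \<Gamma>))"
      using Cons by (auto elim!: tuples_ConsE simp: univ_home)
  qed
qed (auto simp: tuples_def)

lemma home_elem_map_hm [simp]: "map home_elem (map hm x) = x"
  by (simp add: comp_def)

lemma sorts_eq: "sorts Leq = eq_sorts L MM"
  by (simp add: eq_lang_def)

lemma fn_sig_Base: "fn_sig Leq (Base f) = map_option (\<lambda>(ss, s). (map (\<lambda>_. home) ss, home)) (fn_sig L f)"
  by (simp add: eq_lang_def)

lemma fn_sig_Proj: "fn_sig Leq (Proj s) = (if s \<in> eq_sorts L MM then Some (replicate (fst s) home, s) else None)"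
  by (simp add: eq_lang_def)

lemma rel_sig_eq: "rel_sig Leq r = map_option (map (\<lambda>_. home)) (rel_sig L r)"
  by (simp add: eq_lang_def)

lemma fn_Base: "fn Meq (Base f) es = hm (fn MM f (map home_elem es))"
  by (simp add: eq_struc_def hm_def)

lemma fn_Proj: "fn Meq (Proj s) es = cls s (map home_elem es)"
  by (simp add: eq_struc_def cls_def)

lemma rel_eq: "rel Meq r es \<longleftrightarrow> rel MM r (map home_elem es)"
  by (simp add: eq_struc_def)

lemma language_eq: "language Leq"
  unfolding language_def
proof (intro conjI allI impI)
  show "sorts Leq \<noteq> {}" using home_sort by (auto simp: sorts_eq)
  fix g ss s assume "fn_sig Leq g = Some (ss, s)"
  then have "set ss \<subseteq> sorts Leq \<and> s \<in> sorts Leq"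
    using home_sort by (cases g) (auto simp: fn_sig_Base fn_sig_Proj sorts_eq split: if_splits)
  then show "set ss \<subseteq> sorts Leq" "s \<in> sorts Leq" by simp_all
next
  fix r ss assume "rel_sig Leq r = Some ss"
  then show "set ss \<subseteq> sorts Leq" using home_sort by (auto simp: rel_sig_eq sorts_eq)
qed

lemma is_struc_eq: "is_struc Leq Meq"
  unfolding is_struc_def sorts_eq
proof (intro conjI ballI allI impI)
  fix s assume "s \<in> eq_sorts L MM"
  then show "univ Meq s \<noteq> {}" using univ_eq tuples_nonempty[OF unit_context, of "nb (fst s)"] by auto
next
  fix s s' assume "s \<in> eq_sorts L MM" "s' \<in> eq_sorts L MM" "s \<noteq> s'"
  then show "univ Meq s \<inter> univ Meq s' = {}" by (auto simp: univ_eq cls_def)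
next
  fix g ss s a assume g: "fn_sig Leq g = Some (ss, s)" and a: "a \<in> tuples Meq ss"
  show "fn Meq g a \<in> univ Meq s"
  proof (cases g)
    case (Base f)
    then obtain ss' u where f: "fn_sig L f = Some (ss', u)" "ss = map (\<lambda>_. home) ss'" "s = home"
      using g by (auto simp: fn_sig_Base)
    obtain x where x: "x \<in> tuples MM ss'" "a = map hm x" using a unfolding f(2) tuples_hm by auto
    have "fn MM f x \<in> univ MM u" using struc f(1) x(1) unfolding is_struc_def by blast
    then show ?thesis unfolding f(3) univ_home Base fn_Base x(2) by simp
  next
    case (Proj s')
    then have s: "s \<in> eq_sorts L MM" "ss = map (\<lambda>_. home) (nb (fst s))" "s' = s"
      using g by (auto simp: fn_sig_Proj split: if_splits)
    obtain x where "x \<in> tuples MM (nb (fst s))" "a = map hm x" using a unfolding s(2) tuples_hm by auto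
    then show ?thesis unfolding univ_eq[OF s(1)] Proj s(3) fn_Proj by simp
  qed
qed

sublocale Q: many_sorted Leq Meq
  by unfold_locales (rule language_eq is_struc_eq)+

section \<open>Formulas of the original language read on the home sort\<close>

lemma has_sort_lift: "has_sort L \<Gamma> t s \<Longrightarrow> has_sort Leq (map (\<lambda>_. home) \<Gamma>) (lift_trm t) home"
proof (induction rule: has_sort.induct)
  case (1 i)
  then show ?case using has_sort.intros(1)[of i "map (\<lambda>_. home) \<Gamma>" Leq] by simp
next
  case (2 f ss s ts)
  have "list_all2 (has_sort Leq (map (\<lambda>_. home) \<Gamma>)) (map lift_trm ts) (map (\<lambda>_. home) ss)"
    using 2(2) by (auto simp: list.rel_map elim!: list_all2_mono)
  then show ?case unfolding lift_trm.simps by (intro has_sort.intros(2)) (auto simp: fn_sig_Base 2(1))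
qed

lemma eval_lift:
  assumes "has_sort L \<Gamma> t s" "e \<in> tuples MM \<Gamma>"
  shows "eval Meq (map hm e) (lift_trm t) = hm (eval MM e t)"
  using assms
proof (induction rule: has_sort.induct)
  case (1 i)
  then show ?case using tuples_length[OF 1(2)] by simp
next
  case (2 f ss s ts)
  then have "list_all2 (\<lambda>t s. eval Meq (map hm e) (lift_trm t) = hm (eval MM e t)) ts ss"
    by (auto elim!: list_all2_mono)
  then have "map (eval Meq (map hm e)) (map lift_trm ts) = map hm (map (eval MM e) ts)"
    by (induction rule: list_all2_induct) auto
  then show ?case unfolding lift_trm.simps eval.simps fn_Base by (simp del: map_map)
qed

lemma list_lift:
  assumes "list_all2 (has_sort L \<Gamma>) ts ss"
  shows "list_all2 (has_sort Leq (map (\<lambda>_. home) \<Gamma>)) (map lift_trm ts) (map (\<lambda>_. home) ss)"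
    "e \<in> tuples MM \<Gamma> \<Longrightarrow> map (eval Meq (map hm e)) (map lift_trm ts) = map hm (map (eval MM e) ts)"
  using assms by (induction rule: list_all2_induct) (auto intro: has_sort_lift eval_lift)

lemma wff_lift: "wff L \<Gamma> \<phi> \<Longrightarrow> wff Leq (map (\<lambda>_. home) \<Gamma>) (lift_fm \<phi>)"
proof (induction \<phi> arbitrary: \<Gamma>)
  case (FEq t u)
  then have "has_sort Leq (map (\<lambda>_. home) \<Gamma>) (lift_trm t) home" "has_sort Leq (map (\<lambda>_. home) \<Gamma>) (lift_trm u) home"
    by (auto intro: has_sort_lift)
  then show ?case unfolding lift_fm.simps wff.simps by blast
next
  case (FRel r ts)
  then obtain ss where "rel_sig L r = Some ss" "list_all2 (has_sort L \<Gamma>) ts ss" by auto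
  then show ?case using list_lift(1) by (auto simp: rel_sig_eq)
next
  case (FEx s \<phi>)
  then have "wff L (s # \<Gamma>) \<phi>" by simp
  from FEx.IH[OF this] show ?case using home_sort by (simp add: sorts_eq)
qed (auto intro: has_sort_lift)

lemma sat_lift: "wff L \<Gamma> \<phi> \<Longrightarrow> e \<in> tuples MM \<Gamma> \<Longrightarrow> sat Meq (map hm e) (lift_fm \<phi>) \<longleftrightarrow> sat MM e \<phi>"
proof (induction \<phi> arbitrary: \<Gamma> e)
  case (FEq t u)
  then show ?case using inj_hm by (auto simp: eval_lift dest: injD)
next
  case (FRel r ts)
  then obtain ss where "list_all2 (has_sort L \<Gamma>) ts ss" by auto
  from list_lift(2)[OF this FRel.prems(2)] show ?case by (simp add: rel_eq del: map_map)
next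
  case (FEx s \<phi>)
  have "sat Meq (map hm (d # e)) (lift_fm \<phi>) \<longleftrightarrow> sat MM (d # e) \<phi>" if "d \<in> univ MM ()" for d
    using FEx.prems that by (intro FEx.IH[of "s # \<Gamma>"]) auto
  then show ?case by (auto simp: univ_home)
qed auto

text \<open>An element of sort \<open>s\<close> is represented by a home tuple of length \<open>fst s\<close>; a tuple of
  elements by the concatenation of representatives, which lives in the context \<open>flat \<Gamma>\<close>.\<close>

definition flat :: "('f, 'r) eq_sort list \<Rightarrow> unit list" where
  "flat \<Gamma> = concat (map (\<lambda>s. nb (fst s)) \<Gamma>)"

definition reps :: "('f, 'r) eq_sort list \<Rightarrow> 'a list list \<Rightarrow> bool" where
  "reps \<Gamma> xs \<longleftrightarrow> list_all2 (\<lambda>x s. x \<in> tuples MM (nb (fst s))) xs \<Gamma>"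

definition prj :: "('f, 'r) eq_sort list \<Rightarrow> 'a list list \<Rightarrow> (('f, 'r) eq_sort \<times> 'a list set) list" where
  "prj \<Gamma> xs = map2 cls \<Gamma> xs"

lemma reps_concat: "reps \<Gamma> xs \<Longrightarrow> concat xs \<in> tuples MM (flat \<Gamma>)"
  unfolding reps_def flat_def by (induction rule: list_all2_induct) (auto intro: tuples_append)

lemma reps_length: "reps \<Gamma> xs \<Longrightarrow> length xs = length \<Gamma>"
  by (simp add: reps_def list_all2_lengthD)

lemma reps_cases:
  assumes "x \<in> tuples MM (flat \<Gamma>)"
  obtains xs where "x = concat xs" "reps \<Gamma> xs"
  using tuples_concat_listE[OF assms[unfolded flat_def]] unfolding reps_def list.rel_map by metis

lemma reps_nth: "reps \<Gamma> xs \<Longrightarrow> i < length \<Gamma> \<Longrightarrow> xs ! i \<in> tuples MM (nb (fst (\<Gamma> ! i)))"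
  by (simp add: reps_def list_all2_conv_all_nth)

lemma reps_nth_length: "reps \<Gamma> xs \<Longrightarrow> i < length \<Gamma> \<Longrightarrow> length (xs ! i) = fst (\<Gamma> ! i)"
  using tuples_length[OF reps_nth] by simp

text \<open>The block lengths are dictated by \<Gamma>, so the concatenation determines the
  blocks.\<close>

lemma reps_concat_inj:
  assumes "reps \<Gamma> xs" "reps \<Gamma> ys" "concat xs = concat ys"
  shows "xs = ys"
proof -
  have "length xs = length ys" using assms(1,2) by (simp add: reps_length)
  moreover have "\<forall>(x, y)\<in>set (zip xs ys). length x = length y"
    using assms(1,2) by (auto simp: set_zip reps_nth_length reps_length)
  ultimately show ?thesis using assms(3) concat_eq_concat_iff by blast
qed

lemma reps_append: "reps \<Gamma> xs \<Longrightarrow> reps \<Delta> ys \<Longrightarrow> reps (\<Gamma> @ \<Delta>) (xs @ ys)"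
  unfolding reps_def by (rule list_all2_appendI)

lemma prj_append: "reps \<Gamma> xs \<Longrightarrow> prj (\<Gamma> @ \<Delta>) (xs @ ys) = prj \<Gamma> xs @ prj \<Delta> ys"
  by (simp add: prj_def reps_length)

lemma prj_nth: "reps \<Gamma> xs \<Longrightarrow> i < length \<Gamma> \<Longrightarrow> prj \<Gamma> xs ! i = cls (\<Gamma> ! i) (xs ! i)"
  by (simp add: prj_def reps_length)

lemma prj_tuples:
  assumes "set \<Gamma> \<subseteq> eq_sorts L MM" "reps \<Gamma> xs"
  shows "prj \<Gamma> xs \<in> tuples Meq \<Gamma>"
  using assms(2,1) unfolding reps_def
  by (induction rule: list_all2_induct) (auto simp: prj_def univ_eq)

lemma prj_cases:
  assumes "a \<in> tuples Meq \<Gamma>" "set \<Gamma> \<subseteq> eq_sorts L MM"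
  obtains xs where "a = prj \<Gamma> xs" "reps \<Gamma> xs"
  using assms
proof (induction \<Gamma> arbitrary: a thesis)
  case Nil
  then show ?case by (auto simp: prj_def reps_def)
next
  case (Cons s \<Gamma>)
  from Cons.prems(2) obtain e b where a: "a = e # b" "e \<in> univ Meq s" "b \<in> tuples Meq \<Gamma>"
    by (rule tuples_ConsE)
  obtain x where "x \<in> tuples MM (nb (fst s))" "e = cls s x" using a(2) Cons.prems(3) univ_eq by auto
  moreover obtain xs where "b = prj \<Gamma> xs" "reps \<Gamma> xs" using Cons.IH[OF _ a(3)] Cons.prems(3) by auto
  ultimately show ?case using Cons.prems(1)[of "x # xs"] a(1) by (simp add: prj_def reps_def)
qed

definition off :: "('f, 'r) eq_sort list \<Rightarrow> nat \<Rightarrow> nat" where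
  "off \<Gamma> i = length (flat (take i \<Gamma>))"

lemma flat_split: "i < length \<Gamma> \<Longrightarrow> flat \<Gamma> = flat (take i \<Gamma>) @ nb (fst (\<Gamma> ! i)) @ flat (drop (Suc i) \<Gamma>)"
  unfolding flat_def by (subst id_take_nth_drop[of i \<Gamma>]) simp_all

lemma off_bound: "i < length \<Gamma> \<Longrightarrow> j < fst (\<Gamma> ! i) \<Longrightarrow> off \<Gamma> i + j < length (flat \<Gamma>)"
  using flat_split[of i \<Gamma>] by (simp add: off_def)

lemma concat_nth:
  assumes "reps \<Gamma> xs" "i < length \<Gamma>" "j < fst (\<Gamma> ! i)"
  shows "concat xs ! (off \<Gamma> i + j) = xs ! i ! j"
proof -
  have i: "i < length xs" using assms by (simp add: reps_length)
  have "reps (take i \<Gamma>) (take i xs)" using assms(1) unfolding reps_def by (rule list_all2_takeI)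
  then have "length (concat (take i xs)) = off \<Gamma> i"
    unfolding off_def by (rule tuples_length[OF reps_concat])
  moreover have "length (xs ! i) = fst (\<Gamma> ! i)"
    using assms(1,2) by (simp add: reps_nth_length)
  moreover have "concat xs = concat (take i xs) @ xs ! i @ concat (drop (Suc i) xs)"
    by (subst id_take_nth_drop[OF i]) simp
  ultimately show ?thesis using assms(3) by (simp add: nth_append)
qed

section \<open>Translation of formulas on imaginaries into the original language\<close>

lemma unit_has_sort: "i < length \<Gamma> \<Longrightarrow> has_sort L \<Gamma> (Var i) ()"
  using has_sort.intros(1)[of i \<Gamma> L] by simp

text \<open>A term of sort s is represented by \<open>fst s\<close> terms in the representatives,
  whose values represent its value. Arguments of function symbols are always of the home sort, hence
  single terms; a projection keeps the tuple of its arguments, and the class is formed only on the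
  outside.\<close>

lemma translate_term:
  assumes "has_sort Leq \<Gamma> t s" "set \<Gamma> \<subseteq> eq_sorts L MM"
  shows "\<exists>ts. list_all2 (has_sort L (flat \<Gamma>)) ts (nb (fst s)) \<and>
    (\<forall>xs. reps \<Gamma> xs \<longrightarrow> eval Meq (prj \<Gamma> xs) t = cls s (map (eval MM (concat xs)) ts))"
  using assms
proof (induction rule: has_sort.induct)
  case (1 i)
  let ?ts = "map (\<lambda>j. Var (off \<Gamma> i + j)) [0..<fst (\<Gamma> ! i)]"
  have "list_all2 (has_sort L (flat \<Gamma>)) ?ts (nb (fst (\<Gamma> ! i)))"
    using 1(1) by (auto simp: list_all2_conv_all_nth intro!: unit_has_sort off_bound)
  moreover have "eval Meq (prj \<Gamma> xs) (Var i) = cls (\<Gamma> ! i) (map (eval MM (concat xs)) ?ts)" if xs: "reps \<Gamma> xs" for xs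
  proof -
    have "length (xs ! i) = fst (\<Gamma> ! i)"
      using xs 1(1) by (simp add: reps_nth_length)
    then have "map (eval MM (concat xs)) ?ts = xs ! i"
      using concat_nth[OF xs 1(1)] by (intro nth_equalityI) auto
    then show ?thesis by (simp add: prj_nth[OF xs 1(1)])
  qed
  ultimately show ?case by blast
next
  case (2 g ss s ts)
  have ss: "\<And>s'. s' \<in> set ss \<Longrightarrow> s' = home"
    using 2(1) by (cases g) (auto simp: fn_sig_Base fn_sig_Proj split: if_splits)
  let ?P = "\<lambda>t s t'. has_sort L (flat \<Gamma>) t' () \<and> (\<forall>xs. reps \<Gamma> xs \<longrightarrow> eval Meq (prj \<Gamma> xs) t = hm (eval MM (concat xs) t'))"
  have "list_all2 (\<lambda>t s. \<exists>t'. ?P t s t') ts ss"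
    unfolding list_all2_conv_all_nth
  proof (intro conjI allI impI)
    show "length ts = length ss" using 2(2) by (rule list_all2_lengthD)
    fix i assume i: "i < length ts"
    then have s: "ss ! i = home" using ss \<open>length ts = length ss\<close> by simp
    have "\<exists>us. list_all2 (has_sort L (flat \<Gamma>)) us (nb (fst (ss ! i))) \<and>
        (\<forall>xs. reps \<Gamma> xs \<longrightarrow> eval Meq (prj \<Gamma> xs) (ts ! i) = cls (ss ! i) (map (eval MM (concat xs)) us))"
      using list_all2_nthD[OF 2(2) i] 2(3) by blast
    then obtain us where us: "list_all2 (has_sort L (flat \<Gamma>)) us [()]"
      "\<And>xs. reps \<Gamma> xs \<Longrightarrow> eval Meq (prj \<Gamma> xs) (ts ! i) = cls home (map (eval MM (concat xs)) us)"
      unfolding s by auto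
    then obtain t' where t': "us = [t']" "has_sort L (flat \<Gamma>) t' ()" by (auto simp: list_all2_Cons2)
    have "eval Meq (prj \<Gamma> xs) (ts ! i) = hm (eval MM (concat xs) t')" if "reps \<Gamma> xs" for xs
      using us(2)[OF that] t' eval_univ[OF t'(2) reps_concat[OF that]] by (simp add: cls_home)
    then show "\<exists>t'. ?P (ts ! i) (ss ! i) t'" using t'(2) by blast
  qed
  from list_all2_ex[OF this] obtain us where us: "length us = length ts" "\<And>i. i < length ts \<Longrightarrow> ?P (ts ! i) (ss ! i) (us ! i)"
    by blast
  have len: "length ts = length ss" using 2(2) by (rule list_all2_lengthD)
  have ev: "map home_elem (map (eval Meq (prj \<Gamma> xs)) ts) = map (eval MM (concat xs)) us" if "reps \<Gamma> xs" for xs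
    using us that by (intro nth_equalityI) auto
  show ?case
  proof (cases g)
    case (Base f)
    then obtain ss' u where f: "fn_sig L f = Some (ss', ())" "ss = map (\<lambda>_. home) ss'" "s = home"
      using 2(1) by (auto simp: fn_sig_Base)
    have "list_all2 (has_sort L (flat \<Gamma>)) us ss'"
      using us len f(2) by (auto simp: list_all2_conv_all_nth)
    then have h: "has_sort L (flat \<Gamma>) (App f us) ()" by (rule has_sort.intros(2)[OF f(1)])
    have "eval Meq (prj \<Gamma> xs) (App g ts) = cls s (map (eval MM (concat xs)) [App f us])" if "reps \<Gamma> xs" for xs
      using eval_univ[OF h reps_concat[OF that]] unfolding Base f(3) eval.simps fn_Base ev[OF that] by (simp add: cls_home)
    then show ?thesis using h f(3) by (intro exI[of _ "[App f us]"]) simp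
  next
    case (Proj s')
    then have s: "ss = replicate (fst s) home" "s' = s"
      using 2(1) by (auto simp: fn_sig_Proj split: if_splits)
    have "list_all2 (has_sort L (flat \<Gamma>)) us (nb (fst s))"
      using us len s(1) by (auto simp: list_all2_conv_all_nth)
    moreover have "eval Meq (prj \<Gamma> xs) (App g ts) = cls s (map (eval MM (concat xs)) us)" if "reps \<Gamma> xs" for xs
      unfolding Proj s(2) eval.simps fn_Proj ev[OF that] ..
    ultimately show ?thesis by blast
  qed
qed

text \<open>Equality in the sort (n, E) becomes E between representatives, and a quantifier over
  that sort becomes n quantifiers over the home sort. Relation symbols take home arguments and
  remain as they are.\<close>

lemma translate:
  "wff Leq \<Gamma> \<chi> \<Longrightarrow> set \<Gamma> \<subseteq> eq_sorts L MM \<Longrightarrow>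
    \<exists>\<phi>. wff L (flat \<Gamma>) \<phi> \<and> (\<forall>xs. reps \<Gamma> xs \<longrightarrow> (sat Meq (prj \<Gamma> xs) \<chi> \<longleftrightarrow> sat MM (concat xs) \<phi>))"
proof (induction \<chi> arbitrary: \<Gamma>)
  case (FEq t u)
  then obtain s where tu: "has_sort Leq \<Gamma> t s" "has_sort Leq \<Gamma> u s" by auto
  have s: "s \<in> eq_sorts L MM" using Q.has_sort_sorts[OF tu(1)] FEq.prems(2) by (simp add: sorts_eq)
  obtain n E where nE: "s = (n, E)" by (cases s)
  have E: "wff L (nb n @ nb n) E" using s nE by (auto simp: eq_sorts_def replicate_add)
  obtain ts where ts: "list_all2 (has_sort L (flat \<Gamma>)) ts (nb n)"
    "\<And>xs. reps \<Gamma> xs \<Longrightarrow> eval Meq (prj \<Gamma> xs) t = cls s (map (eval MM (concat xs)) ts)"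
    using translate_term[OF tu(1) FEq.prems(2)] nE by auto
  obtain us where us: "list_all2 (has_sort L (flat \<Gamma>)) us (nb n)"
    "\<And>xs. reps \<Gamma> xs \<Longrightarrow> eval Meq (prj \<Gamma> xs) u = cls s (map (eval MM (concat xs)) us)"
    using translate_term[OF tu(2) FEq.prems(2)] nE by auto
  obtain \<phi> where \<phi>: "wff L (flat \<Gamma>) \<phi>"
    "\<And>e. e \<in> tuples MM (flat \<Gamma>) \<Longrightarrow> sat MM e \<phi> \<longleftrightarrow> sat MM (map (eval MM e) (ts @ us)) E"
    using subst_formula[OF E unit_context list_all2_appendI[OF ts(1) us(1)]] by blast
  have "sat Meq (prj \<Gamma> xs) (FEq t u) \<longleftrightarrow> sat MM (concat xs) \<phi>" if "reps \<Gamma> xs" for xs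
  proof -
    note c = reps_concat[OF that]
    have "map (eval MM (concat xs)) ts \<in> tuples MM (nb n)" "map (eval MM (concat xs)) us \<in> tuples MM (nb n)"
      by (rule map_eval_tuples[OF _ c], rule ts us)+
    then show ?thesis using s nE \<phi>(2)[OF c] ts(2)[OF that] us(2)[OF that] by (simp add: cls_eq eq_rel_def)
  qed
  then show ?case using \<phi>(1) by blast
next
  case (FRel r ts)
  then obtain ss where r: "rel_sig L r = Some ss" and ts: "list_all2 (has_sort Leq \<Gamma>) ts (map (\<lambda>_. home) ss)"
    by (auto simp: rel_sig_eq)
  let ?P = "\<lambda>t s t'. has_sort L (flat \<Gamma>) t' () \<and> (\<forall>xs. reps \<Gamma> xs \<longrightarrow> eval Meq (prj \<Gamma> xs) t = hm (eval MM (concat xs) t'))"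
  have "list_all2 (\<lambda>t s. \<exists>t'. ?P t s t') ts ss"
    unfolding list_all2_conv_all_nth
  proof (intro conjI allI impI)
    show "length ts = length ss" using list_all2_lengthD[OF ts] by simp
    fix i assume i: "i < length ts"
    then have "has_sort Leq \<Gamma> (ts ! i) home" using ts by (auto simp: list_all2_conv_all_nth)
    from translate_term[OF this FRel.prems(2)] obtain us where us: "list_all2 (has_sort L (flat \<Gamma>)) us [()]"
      "\<And>xs. reps \<Gamma> xs \<Longrightarrow> eval Meq (prj \<Gamma> xs) (ts ! i) = cls home (map (eval MM (concat xs)) us)"
      by auto
    then obtain t' where t': "us = [t']" "has_sort L (flat \<Gamma>) t' ()" by (auto simp: list_all2_Cons2)
    have "eval Meq (prj \<Gamma> xs) (ts ! i) = hm (eval MM (concat xs) t')" if "reps \<Gamma> xs" for xs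
      using us(2)[OF that] t' eval_univ[OF t'(2) reps_concat[OF that]] by (simp add: cls_home)
    then show "\<exists>t'. ?P (ts ! i) (ss ! i) t'" using t'(2) by blast
  qed
  from list_all2_ex[OF this] obtain us where us: "length us = length ts" "\<And>i. i < length ts \<Longrightarrow> ?P (ts ! i) (ss ! i) (us ! i)"
    by blast
  have len: "length ts = length ss" using list_all2_lengthD[OF ts] by simp
  have ev: "map home_elem (map (eval Meq (prj \<Gamma> xs)) ts) = map (eval MM (concat xs)) us" if "reps \<Gamma> xs" for xs
    using us that by (intro nth_equalityI) auto
  have "list_all2 (has_sort L (flat \<Gamma>)) us ss"
    using us len by (auto simp: list_all2_conv_all_nth)
  then have "wff L (flat \<Gamma>) (FRel r us)" using r by auto
  moreover have "sat Meq (prj \<Gamma> xs) (FRel r ts) \<longleftrightarrow> sat MM (concat xs) (FRel r us)" if "reps \<Gamma> xs" for xs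
    unfolding sat.simps rel_eq ev[OF that] ..
  ultimately show ?case by blast
next
  case (FNeg \<chi>)
  from FNeg.prems(1) have "wff Leq \<Gamma> \<chi>" by simp
  from FNeg.IH[OF this FNeg.prems(2)] obtain \<phi> where
    "wff L (flat \<Gamma>) \<phi>" "\<forall>xs. reps \<Gamma> xs \<longrightarrow> (sat Meq (prj \<Gamma> xs) \<chi> \<longleftrightarrow> sat MM (concat xs) \<phi>)" by blast
  then show ?case by (intro exI[of _ "FNeg \<phi>"]) simp
next
  case (FAnd \<chi> \<chi>')
  from FAnd.prems(1) have w: "wff Leq \<Gamma> \<chi>" "wff Leq \<Gamma> \<chi>'" by simp_all
  from FAnd.IH(1)[OF w(1) FAnd.prems(2)] obtain \<phi> where
    "wff L (flat \<Gamma>) \<phi>" "\<forall>xs. reps \<Gamma> xs \<longrightarrow> (sat Meq (prj \<Gamma> xs) \<chi> \<longleftrightarrow> sat MM (concat xs) \<phi>)" by blast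
  moreover from FAnd.IH(2)[OF w(2) FAnd.prems(2)] obtain \<phi>' where
    "wff L (flat \<Gamma>) \<phi>'" "\<forall>xs. reps \<Gamma> xs \<longrightarrow> (sat Meq (prj \<Gamma> xs) \<chi>' \<longleftrightarrow> sat MM (concat xs) \<phi>')" by blast
  ultimately show ?case by (intro exI[of _ "FAnd \<phi> \<phi>'"]) simp
next
  case (FEx s \<chi>)
  then have s: "s \<in> eq_sorts L MM" "wff Leq (s # \<Gamma>) \<chi>" "set (s # \<Gamma>) \<subseteq> eq_sorts L MM" by (auto simp: sorts_eq)
  from FEx.IH[OF s(2,3)] obtain \<phi> where \<phi>: "wff L (flat (s # \<Gamma>)) \<phi>"
    "\<And>xs. reps (s # \<Gamma>) xs \<Longrightarrow> sat Meq (prj (s # \<Gamma>) xs) \<chi> \<longleftrightarrow> sat MM (concat xs) \<phi>" by blast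
  have "wff L (flat \<Gamma>) (exs (nb (fst s)) \<phi>)"
    using \<phi>(1) by (intro wff_exs unit_context) (simp add: flat_def)
  moreover have "sat Meq (prj \<Gamma> xs) (FEx s \<chi>) \<longleftrightarrow> sat MM (concat xs) (exs (nb (fst s)) \<phi>)" if xs: "reps \<Gamma> xs" for xs
  proof -
    have "sat Meq (cls s x # prj \<Gamma> xs) \<chi> \<longleftrightarrow> sat MM (x @ concat xs) \<phi>" if "x \<in> tuples MM (nb (fst s))" for x
      using \<phi>(2)[of "x # xs"] that xs by (simp add: reps_def prj_def)
    then show ?thesis by (auto simp: sat_exs univ_eq[OF s(1)])
  qed
  ultimately show ?case by blast
qed

text \<open>Representatives of the imaginary parameters are available in A', so a formula over A can
  be translated into one over A'.\<close>

definition covers :: "'a set \<Rightarrow> (('f, 'r) eq_sort \<times> 'a list set) set \<Rightarrow> bool" where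
  "covers A' A \<longleftrightarrow> (\<forall>s\<in>eq_sorts L MM. \<forall>e\<in>A \<inter> univ Meq s. \<exists>x\<in>tuples MM (nb (fst s)). set x \<subseteq> A' \<and> e = cls s x)"

lemma covers_tuple:
  assumes "covers A' A" "set \<Gamma> \<subseteq> eq_sorts L MM" "a \<in> tuples Meq \<Gamma>" "set a \<subseteq> A"
  obtains xs where "a = prj \<Gamma> xs" "reps \<Gamma> xs" "set (concat xs) \<subseteq> A'"
  using assms(2-)
proof (induction \<Gamma> arbitrary: a thesis)
  case Nil
  then show ?case by (auto simp: prj_def reps_def)
next
  case (Cons s \<Gamma>)
  from Cons.prems(3) obtain e b where a: "a = e # b" "e \<in> univ Meq s" "b \<in> tuples Meq \<Gamma>"
    by (rule tuples_ConsE)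
  then obtain x where "x \<in> tuples MM (nb (fst s))" "set x \<subseteq> A'" "e = cls s x"
    using assms(1) Cons.prems(2,4) unfolding covers_def by force
  moreover obtain xs where "b = prj \<Gamma> xs" "reps \<Gamma> xs" "set (concat xs) \<subseteq> A'"
    using Cons.IH[OF _ _ a(3)] Cons.prems(2,4) a(1) by auto
  ultimately show ?case using Cons.prems(1)[of "x # xs"] a(1) by (simp add: prj_def reps_def)
qed

definition pull :: "('f, 'r) eq_sort list \<Rightarrow> (('f, 'r) eq_sort \<times> 'a list set) list set \<Rightarrow> 'a list set" where
  "pull \<Gamma> S = {concat xs |xs. reps \<Gamma> xs \<and> prj \<Gamma> xs \<in> S}"

lemma pull_iff: "reps \<Gamma> xs \<Longrightarrow> concat xs \<in> pull \<Gamma> S \<longleftrightarrow> prj \<Gamma> xs \<in> S"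
  unfolding pull_def using reps_concat_inj by blast

lemma defble_pull:
  assumes "covers A' A" "set \<Gamma> \<subseteq> eq_sorts L MM" "Q.defble \<Gamma> A S"
  shows "defble (flat \<Gamma>) A' (pull \<Gamma> S)"
proof -
  obtain \<chi> b \<Delta> where S: "S = solutions Meq \<Gamma> (\<chi>, b)" "set \<Delta> \<subseteq> eq_sorts L MM" "wff Leq (\<Gamma> @ \<Delta>) \<chi>"
    "b \<in> tuples Meq \<Delta>" "set b \<subseteq> A"
    using assms(3) by (auto simp: Q.defble_def pforms_def sorts_eq)
  obtain ys where ys: "b = prj \<Delta> ys" "reps \<Delta> ys" "set (concat ys) \<subseteq> A'"
    by (rule covers_tuple[OF assms(1) S(2,4,5)])
  obtain \<phi> where \<phi>: "wff L (flat (\<Gamma> @ \<Delta>)) \<phi>"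
    "\<And>xs. reps (\<Gamma> @ \<Delta>) xs \<Longrightarrow> sat Meq (prj (\<Gamma> @ \<Delta>) xs) \<chi> \<longleftrightarrow> sat MM (concat xs) \<phi>"
    using translate[OF S(3)] assms(2) S(2) by auto
  have *: "concat xs \<in> solutions MM (flat \<Gamma>) (\<phi>, concat ys) \<longleftrightarrow> prj \<Gamma> xs \<in> S" if xs: "reps \<Gamma> xs" for xs
    using \<phi>(2)[OF reps_append[OF xs ys(2)]] reps_concat[OF xs] prj_tuples[OF assms(2) xs]
    unfolding S(1) ys(1) prj_append[OF xs] by (simp add: solutions_def)
  have "solutions MM (flat \<Gamma>) (\<phi>, concat ys) = pull \<Gamma> S"
  proof (intro subset_antisym subsetI)
    fix x assume x: "x \<in> solutions MM (flat \<Gamma>) (\<phi>, concat ys)"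
    then have "x \<in> tuples MM (flat \<Gamma>)" by (simp add: solutions_def)
    then obtain xs where "x = concat xs" "reps \<Gamma> xs" by (rule reps_cases)
    then show "x \<in> pull \<Gamma> S" using * x pull_iff by simp
  next
    fix x assume "x \<in> pull \<Gamma> S"
    then show "x \<in> solutions MM (flat \<Gamma>) (\<phi>, concat ys)" using * unfolding pull_def by auto
  qed
  moreover have "(\<phi>, concat ys) \<in> pforms L MM (flat \<Gamma>) A'"
    using \<phi>(1) reps_concat[OF ys(2)] ys(3) unit_context unfolding pforms_def flat_def by auto
  ultimately show ?thesis unfolding defble_def by blast
qed

text \<open>A projected set is defined among the imaginaries by quantifying over a home tuple that
  satisfies the lifted formula and whose blocks project to the given coordinates. The parameters are
  home elements of A.\<close>

lemma defble_push:
  assumes "set \<Gamma> \<subseteq> eq_sorts L MM" "defble (flat \<Gamma>) {x. hm x \<in> A} S"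
  shows "Q.defble \<Gamma> A {a \<in> tuples Meq \<Gamma>. \<exists>xs. reps \<Gamma> xs \<and> prj \<Gamma> xs = a \<and> concat xs \<in> S}"
proof -
  obtain \<theta> b \<Delta> where S: "S = solutions MM (flat \<Gamma>) (\<theta>, b)" "wff L (flat \<Gamma> @ \<Delta>) \<theta>"
    "b \<in> tuples MM \<Delta>" "set b \<subseteq> {x. hm x \<in> A}"
    using assms(2) by (auto simp: defble_def pforms_def)
  let ?H = "map (\<lambda>_. home) (flat \<Gamma>)" and ?n = "length (flat \<Gamma>)"
  \<comment> \<open>The home tuple comes first in the context, so coordinate i of the tuple of
    imaginaries is variable \<open>?n + i\<close>; the i-th block of the home tuple starts at
    \<open>off \<Gamma> i\<close>.\<close>
  let ?F = "\<lambda>i. FEq (App (Proj (\<Gamma> ! i)) (map (\<lambda>j. Var (off \<Gamma> i + j)) [0..<fst (\<Gamma> ! i)])) (Var (?n + i))"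
  have st: "sat Meq (map hm (concat xs) @ a) (?F i) \<longleftrightarrow> prj \<Gamma> xs ! i = a ! i" if "reps \<Gamma> xs" "i < length \<Gamma>" for xs a i
  proof -
    have l: "length (concat xs) = ?n" by (rule tuples_length[OF reps_concat[OF that(1)]])
    have l2: "length (xs ! i) = fst (\<Gamma> ! i)"
      using that by (simp add: reps_nth_length)
    have "map home_elem (map (eval Meq (map hm (concat xs) @ a)) (map (\<lambda>j. Var (off \<Gamma> i + j)) [0..<fst (\<Gamma> ! i)])) = xs ! i"
      using l2 l off_bound[OF that(2)] concat_nth[OF that] by (intro nth_equalityI) (auto simp: nth_append)
    then show ?thesis unfolding sat.simps eval.simps fn_Proj using l prj_nth[OF that] by (simp add: nth_append)
  qed
  have d1: "Q.dfn A (case_option ?H (\<lambda>_::unit. \<Gamma>)) UNIV (\<lambda>w. sat Meq (w None @ w (Some ())) (?F i))" if i: "i < length \<Gamma>" for i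
  proof (rule Q.dfnI[of "[None, Some ()]" _ "[]" _ "?F i" "[]"])
    have si: "\<Gamma> ! i \<in> eq_sorts L MM" using assms(1) i by auto
    have "has_sort Leq (?H @ \<Gamma>) (Var (off \<Gamma> i + j)) home" if "j < fst (\<Gamma> ! i)" for j
      using has_sort.intros(1)[of "off \<Gamma> i + j" "?H @ \<Gamma>" Leq] off_bound[OF i that] by (simp add: nth_append)
    then have "has_sort Leq (?H @ \<Gamma>) (App (Proj (\<Gamma> ! i)) (map (\<lambda>j. Var (off \<Gamma> i + j)) [0..<fst (\<Gamma> ! i)])) (\<Gamma> ! i)"
      by (intro has_sort.intros(2)[where ss = "replicate (fst (\<Gamma> ! i)) home"])
        (auto simp: fn_sig_Proj si list_all2_conv_all_nth)
    moreover have "has_sort Leq (?H @ \<Gamma>) (Var (?n + i)) (\<Gamma> ! i)"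
      using has_sort.intros(1)[of "?n + i" "?H @ \<Gamma>" Leq] i by (simp add: nth_append)
    ultimately have "wff Leq (?H @ \<Gamma>) (?F i)" unfolding wff.simps by blast
    then show "wff Leq (concat (map (case_option ?H (\<lambda>_. \<Gamma>)) [None, Some ()]) @ []) (?F i)" by simp
  qed auto
  have d2: "Q.dfn A (case_option ?H (\<lambda>_::unit. \<Gamma>)) UNIV (\<lambda>w. sat Meq (w None @ map hm b) (lift_fm \<theta>))"
  proof (rule Q.dfn_sat1[where \<Delta> = "map (\<lambda>_. home) \<Delta>"])
    show "map hm b \<in> tuples Meq (map (\<lambda>_. home) \<Delta>)" using S(3) by (simp add: tuples_hm)
    show "wff Leq (case_option ?H (\<lambda>_. \<Gamma>) None @ map (\<lambda>_. home) \<Delta>) (lift_fm \<theta>)" using wff_lift[OF S(2)] by simp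
  qed (use S(4) home_sort in \<open>auto simp: sorts_eq\<close>)
  have "Q.dfn A (\<lambda>_::unit. \<Gamma>) UNIV (\<lambda>u. \<exists>z\<in>tuples Meq ?H. (\<forall>i\<in>{..<length \<Gamma>}. sat Meq (z @ u ()) (?F i)) \<and> sat Meq (z @ map hm b) (lift_fm \<theta>))"
    by (rule Q.dfn_ex[where V' = UNIV], intro Q.dfn_conj Q.dfn_ball d1 d2)
      (use home_sort in \<open>auto simp: UNIV_option_conv sorts_eq\<close>)
  from Q.defbleI[OF this] have D: "Q.defble \<Gamma> A {a \<in> tuples Meq \<Gamma>. \<exists>z\<in>tuples Meq ?H. (\<forall>i\<in>{..<length \<Gamma>}. sat Meq (z @ a) (?F i)) \<and> sat Meq (z @ map hm b) (lift_fm \<theta>)}" .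
  have "(\<exists>z\<in>tuples Meq ?H. (\<forall>i\<in>{..<length \<Gamma>}. sat Meq (z @ a) (?F i)) \<and> sat Meq (z @ map hm b) (lift_fm \<theta>)) \<longleftrightarrow>
      (\<exists>xs. reps \<Gamma> xs \<and> prj \<Gamma> xs = a \<and> concat xs \<in> S)" if a: "a \<in> tuples Meq \<Gamma>" for a
  proof -
    have "(\<forall>i\<in>{..<length \<Gamma>}. sat Meq (map hm (concat xs) @ a) (?F i)) \<longleftrightarrow> prj \<Gamma> xs = a" if "reps \<Gamma> xs" for xs
      using st[OF that] tuples_length[OF a] reps_length[OF that] by (auto simp: list_eq_iff_nth_eq prj_def simp del: sat.simps)
    moreover have "sat Meq (map hm (concat xs) @ map hm b) (lift_fm \<theta>) \<longleftrightarrow> concat xs \<in> S" if "reps \<Gamma> xs" for xs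
      using sat_lift[OF S(2) tuples_append[OF reps_concat[OF that] S(3)]] reps_concat[OF that]
      by (simp add: S(1) solutions_def)
    ultimately have *: "(\<forall>i\<in>{..<length \<Gamma>}. sat Meq (map hm (concat xs) @ a) (?F i)) \<and> sat Meq (map hm (concat xs) @ map hm b) (lift_fm \<theta>) \<longleftrightarrow>
        prj \<Gamma> xs = a \<and> concat xs \<in> S" if "reps \<Gamma> xs" for xs using that by blast
    have T: "tuples Meq ?H = {map hm (concat xs) |xs. reps \<Gamma> xs}"
      unfolding tuples_hm using reps_concat by (auto elim!: reps_cases)
    have "(\<exists>z\<in>tuples Meq ?H. Z z) \<longleftrightarrow> (\<exists>xs. reps \<Gamma> xs \<and> Z (map hm (concat xs)))" for Z
      unfolding T by blast
    then show ?thesis using * by (simp only: cong: conj_cong)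
  qed
  then show ?thesis using D by (simp cong: conj_cong)
qed

end

lemma (in saturated_struc) small_UN_finite:
  assumes "|I| <o \<kappa>" "\<And>i. i \<in> I \<Longrightarrow> finite (X i)"
  shows "|\<Union>i\<in>I. X i| <o \<kappa>"
proof (cases "finite I")
  case False
  have "|\<Union>i\<in>I. X i| \<le>o |I|"
    by (rule ordLeq_UN[OF False card_of_mono1[OF subset_refl] ordLeq_finite[OF False assms(2)]])
  then show ?thesis using assms(1) ordLeq_ordLess_trans by blast
qed (use assms in \<open>auto intro: small_finite\<close>)

lemma (in many_sorted) consistent_instances:
  assumes "wff L (\<Gamma> @ \<Delta>) \<phi>"
  shows "consistent MM \<Gamma> ((\<lambda>i. (\<phi>, c i)) ` I) \<longleftrightarrow> (\<forall>J. finite J \<longrightarrow> J \<subseteq> I \<longrightarrow> (\<exists>a\<in>tuples MM \<Gamma>. \<forall>i\<in>J. sat MM (a @ c i) \<phi>))"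
  unfolding consistent_def
proof (intro iffI allI impI)
  fix J assume *: "\<forall>F. finite F \<and> F \<subseteq> (\<lambda>i. (\<phi>, c i)) ` I \<longrightarrow> (\<exists>a\<in>tuples MM \<Gamma>. \<forall>\<psi>\<in>F. a \<in> solutions MM \<Gamma> \<psi>)"
    and "finite J" "J \<subseteq> I"
  then have "finite ((\<lambda>i. (\<phi>, c i)) ` J) \<and> (\<lambda>i. (\<phi>, c i)) ` J \<subseteq> (\<lambda>i. (\<phi>, c i)) ` I" by auto
  from *[rule_format, OF this] obtain a where "a \<in> tuples MM \<Gamma>" "\<forall>\<psi>\<in>(\<lambda>i. (\<phi>, c i)) ` J. a \<in> solutions MM \<Gamma> \<psi>"
    by (elim bexE)
  then show "\<exists>a\<in>tuples MM \<Gamma>. \<forall>i\<in>J. sat MM (a @ c i) \<phi>" by (auto simp: solutions_def)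
next
  fix F assume *: "\<forall>J. finite J \<longrightarrow> J \<subseteq> I \<longrightarrow> (\<exists>a\<in>tuples MM \<Gamma>. \<forall>i\<in>J. sat MM (a @ c i) \<phi>)"
    and F: "finite F \<and> F \<subseteq> (\<lambda>i. (\<phi>, c i)) ` I"
  then obtain J where J: "finite J" "J \<subseteq> I" "F = (\<lambda>i. (\<phi>, c i)) ` J" by (meson finite_subset_image)
  from *[rule_format, OF J(1,2)] obtain a where "a \<in> tuples MM \<Gamma>" "\<forall>i\<in>J. sat MM (a @ c i) \<phi>" by (elim bexE)
  then show "\<exists>a\<in>tuples MM \<Gamma>. \<forall>\<psi>\<in>F. a \<in> solutions MM \<Gamma> \<psi>"
    unfolding J(3) by (auto simp: solutions_def)
qed

section \<open>Saturation and homogeneity of the imaginaries\<close>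

locale one_sorted_monster = small_struc L MM \<kappa> + one_sorted L MM
  for L :: "('f, 'r, unit) lang" and MM :: "('f, 'r, unit, 'a) struc" and \<kappa> :: "'k rel" +
  assumes strongly_homogeneous: "strongly_homogeneous \<kappa> L MM"
begin

lemma elems_univ: "elems L MM = univ MM ()"
  by (simp add: elems_def sorts_unit)

lemma covers_exists:
  assumes "A \<subseteq> elems Leq Meq" "|A| <o \<kappa>"
  obtains A' where "covers A' A" "A' \<subseteq> elems L MM" "|A'| <o \<kappa>"
proof -
  define r where "r e = (SOME x. x \<in> tuples MM (nb (fst (fst e))) \<and> e = cls (fst e) x)" for e
  have r: "r e \<in> tuples MM (nb (fst s)) \<and> e = cls s (r e)" if e: "s \<in> eq_sorts L MM" "e \<in> univ Meq s" for s e
  proof -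
    obtain x where x: "x \<in> tuples MM (nb (fst s))" "e = cls s x" using e univ_eq by auto
    then have s: "fst e = s" by (simp add: cls_def)
    have "\<exists>x. x \<in> tuples MM (nb (fst (fst e))) \<and> e = cls (fst e) x" using x unfolding s by blast
    from someI_ex[OF this] show ?thesis unfolding r_def s .
  qed
  let ?A = "\<Union>e\<in>A. set (r e)"
  have "covers ?A A" unfolding covers_def using r by blast
  moreover have "?A \<subseteq> elems L MM"
  proof
    fix y assume "y \<in> ?A"
    then obtain e s where "y \<in> set (r e)" "s \<in> eq_sorts L MM" "e \<in> univ Meq s"
      using assms(1) by (auto simp: elems_def sorts_eq)
    then show "y \<in> elems L MM" using r tuples_elems[OF _ unit_context] by blast
  qed
  moreover have "|?A| <o \<kappa>" by (rule small_UN_finite[OF assms(2)]) simp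
  ultimately show thesis using that by blast
qed

text \<open>A type of imaginaries is pulled back to representatives, realised there by saturation of
  the original structure over a small covering set, and the realisation is projected.\<close>

lemma saturated_eq: "saturated \<kappa> Leq Meq"
  unfolding saturated_def
proof (intro allI impI, elim conjE)
  fix A \<Gamma> p
  assume A: "A \<subseteq> elems Leq Meq" "|A| <o \<kappa>" and \<Gamma>: "set \<Gamma> \<subseteq> sorts Leq" and p: "p \<in> complete_types Leq Meq \<Gamma> A"
  have \<Gamma>': "set \<Gamma> \<subseteq> eq_sorts L MM" using \<Gamma> by (simp add: sorts_eq)
  obtain A' where A': "covers A' A" "A' \<subseteq> elems L MM" "|A'| <o \<kappa>" by (rule covers_exists[OF A])
  have "\<exists>x\<in>tuples MM (flat \<Gamma>). \<forall>\<psi>\<in>p. x \<in> pull \<Gamma> (solutions Meq \<Gamma> \<psi>)"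
  proof (rule realize[OF A'(2,3) unit_context])
    show "defble (flat \<Gamma>) A' (pull \<Gamma> (solutions Meq \<Gamma> \<psi>))" if "\<psi> \<in> p" for \<psi>
    proof (rule defble_pull[OF A'(1) \<Gamma>'])
      show "Q.defble \<Gamma> A (solutions Meq \<Gamma> \<psi>)"
        using that p by (intro Q.defble_solutions) (auto simp: complete_types_def)
    qed
    fix J assume "finite J" "J \<subseteq> p"
    then obtain a where a: "a \<in> tuples Meq \<Gamma>" "\<forall>\<psi>\<in>J. a \<in> solutions Meq \<Gamma> \<psi>"
      using p unfolding complete_types_def consistent_def by blast
    obtain xs where "a = prj \<Gamma> xs" "reps \<Gamma> xs" by (rule prj_cases[OF a(1) \<Gamma>'])
    then show "\<exists>x\<in>tuples MM (flat \<Gamma>). \<forall>\<psi>\<in>J. x \<in> pull \<Gamma> (solutions Meq \<Gamma> \<psi>)"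
      using a(2) by (intro bexI[of _ "concat xs"]) (auto simp: pull_iff reps_concat)
  qed
  then obtain x where x: "x \<in> tuples MM (flat \<Gamma>)" "\<forall>\<psi>\<in>p. x \<in> pull \<Gamma> (solutions Meq \<Gamma> \<psi>)" by blast
  obtain xs where xs: "x = concat xs" "reps \<Gamma> xs" by (rule reps_cases[OF x(1)])
  have "\<forall>\<psi>\<in>p. prj \<Gamma> xs \<in> solutions Meq \<Gamma> \<psi>" using x(2) xs by (simp add: pull_iff)
  then show "\<exists>a\<in>tuples Meq \<Gamma>. \<forall>\<psi>\<in>p. a \<in> solutions Meq \<Gamma> \<psi>"
    using prj_tuples[OF \<Gamma>' xs(2)] by blast
qed

text \<open>Strong homogeneity extends elementary maps on small sets. The map in question fixes N
  and sends x to x' coordinatewise. It is well defined because equalities among coordinates of x,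
  and between them and elements of N, are part of the type over N.\<close>

lemma homogeneous_tuples:
  assumes N: "N \<subseteq> elems L MM" "|N| <o \<kappa>" and st: "same_type \<Gamma> N x x'"
  shows "\<exists>\<sigma>\<in>automorphisms L MM N. map \<sigma> x = x'"
proof -
  have xt: "x \<in> tuples MM \<Gamma>" "x' \<in> tuples MM \<Gamma>"
    and same: "\<And>S. defble \<Gamma> N S \<Longrightarrow> x \<in> S \<longleftrightarrow> x' \<in> S" using st by (auto simp: same_type_def)
  have len: "length x = length \<Gamma>" "length x' = length \<Gamma>" using xt by (auto dest: tuples_length)
  \<comment> \<open>If an entry occurs at several positions of x, any of them may be chosen, since
    x' has equal entries there by \<open>eqs\<close>.\<close>
  define g where "g y = (if y \<in> N then y else x' ! (SOME i. i < length x \<and> x ! i = y))" for y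
  have inN: "x' ! i = x ! i" if i: "i < length x" "x ! i \<in> N" for i
  proof -
    have "dfn N (\<lambda>_::unit. \<Gamma>) UNIV (\<lambda>u. sat MM (u () @ [x ! i]) (FEq (Var i) (Var (length x))))"
      by (rule dfn_sat1[where \<Delta> = "[()]"])
        (use i xt tuples_nth[of x MM \<Gamma> i] len in \<open>auto intro!: unit_has_sort exI[of _ "()"] simp: sorts_unit\<close>)
    from same[OF defbleI[OF this]] show ?thesis using xt i len by (simp add: nth_append)
  qed
  have eqs: "x' ! i = x' ! j" if i: "i < length x" "j < length x" "x ! i = x ! j" for i j
  proof -
    have "dfn N (\<lambda>_::unit. \<Gamma>) UNIV (\<lambda>u. sat MM (u () @ []) (FEq (Var i) (Var j)))"
      by (rule dfn_sat1[where \<Delta> = "[]"]) (use i len in \<open>auto intro!: unit_has_sort exI[of _ "()"]\<close>)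
    from same[OF defbleI[OF this]] show ?thesis using xt i by simp
  qed
  have gx: "g (x ! i) = x' ! i" if i: "i < length x" for i
  proof (cases "x ! i \<in> N")
    case True
    then show ?thesis using inN[OF i] by (simp add: g_def)
  next
    case False
    have "\<exists>j. j < length x \<and> x ! j = x ! i" using i by blast
    define j where "j = (SOME j. j < length x \<and> x ! j = x ! i)"
    have "j < length x \<and> x ! j = x ! i" unfolding j_def by (rule someI_ex) fact
    moreover have "g (x ! i) = x' ! j" using False by (simp add: g_def j_def)
    ultimately show ?thesis using eqs[of j i] i by simp
  qed
  let ?A = "N \<union> set x"
  have "\<exists>\<sigma>\<in>automorphisms L MM {}. \<forall>a\<in>?A. \<sigma> a = g a"
  proof (rule strongly_homogeneous[unfolded strongly_homogeneous_def, rule_format], intro conjI ballI allI impI)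
    show "?A \<subseteq> elems L MM" using N(1) tuples_elems[OF xt(1) unit_context] by simp
    show "|?A| <o \<kappa>" by (intro small_Un[OF N(2)] small_finite) simp
    show "g ` (?A \<inter> univ MM s) \<subseteq> univ MM s" for s
    proof
      fix z assume "z \<in> g ` (?A \<inter> univ MM s)"
      then obtain y where y: "z = g y" "y \<in> N \<or> y \<in> set x" "y \<in> univ MM ()" by auto
      show "z \<in> univ MM s"
      proof (cases "y \<in> N")
        case True
        then show ?thesis using y by (simp add: g_def)
      next
        case False
        then obtain i where "i < length x" "y = x ! i" using y(2) by (metis in_set_conv_nth)
        then show ?thesis using y(1) gx tuples_nth[OF xt(2)] len by simp
      qed
    qed
    fix \<Xi> \<phi> e assume e: "e \<in> tuples MM \<Xi>" "wff L \<Xi> \<phi>" "set e \<subseteq> ?A"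
    let ?n = "filter (\<lambda>y. y \<in> N) e"
    let ?C = "\<Gamma> @ nb (length ?n)"
    have lx: "length (if t then x else x') = length \<Gamma>" for t using len by simp
    have le: "length e = length \<Xi>" using e(1) by (rule tuples_length)
    \<comment> \<open>The Boolean t chooses between the original tuple and its image, so one formula
      \<phi>' expresses \<phi> for both; it differs only in x or x' and is decided by the type over
      N.\<close>
    have "emb UNIV \<Xi> (\<lambda>t. if t then e else map g e) ?C (\<lambda>t. (if t then x else x') @ ?n)"
      unfolding emb_def
    proof (intro conjI ballI allI impI)
      fix t show "length (if t then e else map g e) = length \<Xi>" using le by simp
    next
      fix i assume i: "i < length \<Xi>"
      then have "e ! i \<in> set e" using le by simp
      then have ei: "e ! i \<in> N \<or> e ! i \<in> set x" using e(3) by blast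
      show "\<exists>j<length ?C. ?C ! j = \<Xi> ! i \<and> (\<forall>t\<in>UNIV. (if t then e else map g e) ! i = ((if t then x else x') @ ?n) ! j)"
      proof (cases "e ! i \<in> N")
        case True
        then have "e ! i \<in> set ?n" using i le by simp
        then obtain k where k: "k < length ?n" "?n ! k = e ! i" by (metis in_set_conv_nth)
        have "(if t then e else map g e) ! i = ((if t then x else x') @ ?n) ! (length \<Gamma> + k)" for t
          using True k i le lx[of t] by (cases t) (simp_all add: nth_append g_def len)
        then show ?thesis using k(1) by (intro exI[of _ "length \<Gamma> + k"]) simp
      next
        case False
        then obtain k where k: "k < length x" "x ! k = e ! i" using ei by (metis in_set_conv_nth)
        have "(if t then e else map g e) ! i = ((if t then x else x') @ ?n) ! k" for t
          using k i le gx[OF k(1)] len by (cases t) (simp_all add: nth_append)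
        then show ?thesis using k(1) len by (intro exI[of _ k]) simp
      qed
    qed
    from emb_fm[OF this e(2)] obtain \<phi>' where \<phi>': "wff L ?C \<phi>'"
      "\<And>t. sat MM ((if t then x else x') @ ?n) \<phi>' \<longleftrightarrow> sat MM (if t then e else map g e) \<phi>" by blast
    have nt: "?n \<in> tuples MM (nb (length ?n))"
    proof -
      have "\<forall>y\<in>set e. y \<in> univ MM ()" using e(1) by (auto dest!: tuples_set)
      then show ?thesis by (auto simp: tuples_def list_all2_conv_all_nth) (metis filter_is_subset nth_mem subsetD)
    qed
    have "dfn N (\<lambda>_::unit. \<Gamma>) UNIV (\<lambda>u. sat MM (u () @ ?n) \<phi>')"
      by (rule dfn_sat1[where \<Delta> = "nb (length ?n)"]) (use \<phi>'(1) nt unit_context in auto)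
    from same[OF defbleI[OF this]] have "sat MM (x @ ?n) \<phi>' \<longleftrightarrow> sat MM (x' @ ?n) \<phi>'" using xt by simp
    then show "sat MM (map g e) \<phi> \<longleftrightarrow> sat MM e \<phi>" using \<phi>'(2)[of True] \<phi>'(2)[of False] by simp
  qed
  then obtain \<sigma> where \<sigma>: "\<sigma> \<in> automorphisms L MM {}" "\<And>a. a \<in> ?A \<Longrightarrow> \<sigma> a = g a" by blast
  have "\<sigma> \<in> automorphisms L MM N" unfolding aut_fix[of \<sigma> N] using \<sigma> by (simp add: g_def)
  moreover have "map \<sigma> x = x'" using \<sigma>(2) gx len by (intro nth_equalityI) auto
  ultimately show ?thesis by blast
qed

definition lift_aut :: "('a \<Rightarrow> 'a) \<Rightarrow> ('f, 'r) eq_sort \<times> 'a list set \<Rightarrow> ('f, 'r) eq_sort \<times> 'a list set" where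
  "lift_aut \<sigma> e = (fst e, map \<sigma> ` snd e)"

lemma eq_rel_aut:
  assumes "\<sigma> \<in> automorphisms L MM C" "s \<in> eq_sorts L MM" "x \<in> tuples MM (nb (fst s))" "y \<in> tuples MM (nb (fst s))"
  shows "(map \<sigma> x, map \<sigma> y) \<in> eq_rel MM s \<longleftrightarrow> (x, y) \<in> eq_rel MM s"
proof -
  obtain n E where s: "s = (n, E)" by (cases s)
  have "sat MM (map \<sigma> (x @ y)) E \<longleftrightarrow> sat MM (x @ y) E"
    by (rule sat_aut[OF assms(1), of "nb n @ nb n"])
      (use assms s tuples_append in \<open>auto simp: eq_sorts_def replicate_add sorts_unit\<close>)
  then show ?thesis
    using assms(3,4) aut_tuples[OF assms(1) unit_context assms(3)] aut_tuples[OF assms(1) unit_context assms(4)]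
    by (simp add: s eq_rel_def)
qed

lemma lift_aut_cls:
  assumes "\<sigma> \<in> automorphisms L MM C" "s \<in> eq_sorts L MM" "x \<in> tuples MM (nb (fst s))"
  shows "lift_aut \<sigma> (cls s x) = cls s (map \<sigma> x)"
proof -
  have er: "eq_rel MM s \<subseteq> tuples MM (nb (fst s)) \<times> tuples MM (nb (fst s))"
    by (cases s) (auto simp: eq_rel_def)
  have "map \<sigma> ` (eq_rel MM s `` {x}) = eq_rel MM s `` {map \<sigma> x}"
  proof (intro subset_antisym subsetI)
    fix z assume "z \<in> eq_rel MM s `` {map \<sigma> x}"
    then have z: "(map \<sigma> x, z) \<in> eq_rel MM s" "z \<in> tuples MM (nb (fst s))" using er by auto
    obtain y where "y \<in> tuples MM (nb (fst s))" "z = map \<sigma> y" by (rule aut_tuples_surj[OF assms(1) unit_context z(2)])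
    then show "z \<in> map \<sigma> ` (eq_rel MM s `` {x})" using z(1) eq_rel_aut[OF assms(1,2,3)] by auto
  qed (use er eq_rel_aut[OF assms(1,2,3)] in auto)
  then show ?thesis by (simp add: lift_aut_def cls_def)
qed

lemma lift_aut_hm: "lift_aut \<sigma> (hm x) = hm (\<sigma> x)"
  by (simp add: lift_aut_def hm_def)

lemma lift_aut_automorphism:
  assumes "\<sigma> \<in> automorphisms L MM {}"
  shows "lift_aut \<sigma> \<in> automorphisms Leq Meq {}"
  unfolding automorphisms_def mem_Collect_eq sorts_eq
proof (intro conjI ballI allI impI)
  fix s assume s: "s \<in> eq_sorts L MM"
  let ?T = "tuples MM (nb (fst s))"
  have im: "map \<sigma> ` ?T = ?T"
    using aut_tuples[OF assms unit_context] aut_tuples_surj[OF assms unit_context] by blast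
  show "bij_betw (lift_aut \<sigma>) (univ Meq s) (univ Meq s)"
    unfolding bij_betw_def
  proof
    show "inj_on (lift_aut \<sigma>) (univ Meq s)"
    proof (rule inj_onI)
      fix e e' assume e: "e \<in> univ Meq s" "e' \<in> univ Meq s" "lift_aut \<sigma> e = lift_aut \<sigma> e'"
      then obtain x y where x: "x \<in> ?T" "e = cls s x" and y: "y \<in> ?T" "e' = cls s y" using univ_eq[OF s] by auto
      then have "cls s (map \<sigma> x) = cls s (map \<sigma> y)" using e(3) lift_aut_cls[OF assms s] by simp
      then show "e = e'"
        using x y cls_eq[OF s] eq_rel_aut[OF assms s] aut_tuples[OF assms unit_context] by simp
    qed
    have "lift_aut \<sigma> ` univ Meq s = cls s ` map \<sigma> ` ?T"
      unfolding univ_eq[OF s] image_image by (intro image_cong refl lift_aut_cls[OF assms s])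
    then show "lift_aut \<sigma> ` univ Meq s = univ Meq s" unfolding im univ_eq[OF s] .
  qed
next
  fix g ss s a assume g: "fn_sig Leq g = Some (ss, s)" and a: "a \<in> tuples Meq ss"
  show "lift_aut \<sigma> (fn Meq g a) = fn Meq g (map (lift_aut \<sigma>) a)"
  proof (cases g)
    case (Base f)
    then obtain ss' u where f: "fn_sig L f = Some (ss', u)" "ss = map (\<lambda>_. home) ss'"
      using g by (auto simp: fn_sig_Base)
    obtain x where x: "x \<in> tuples MM ss'" "a = map hm x" using a unfolding f(2) tuples_hm by auto
    have "\<sigma> (fn MM f x) = fn MM f (map \<sigma> x)" using assms f(1) x(1) unfolding automorphisms_def by blast
    moreover have "map home_elem (map (lift_aut \<sigma>) (map hm x)) = map \<sigma> x" by (simp add: lift_aut_hm)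
    ultimately show ?thesis unfolding Base fn_Base x(2) home_elem_map_hm lift_aut_hm by (simp del: map_map)
  next
    case (Proj s')
    then have s: "s \<in> eq_sorts L MM" "ss = map (\<lambda>_. home) (nb (fst s))" "s' = s"
      using g by (auto simp: fn_sig_Proj split: if_splits)
    obtain x where x: "x \<in> tuples MM (nb (fst s))" "a = map hm x" using a unfolding s(2) tuples_hm by auto
    have "map home_elem (map (lift_aut \<sigma>) (map hm x)) = map \<sigma> x" by (simp add: lift_aut_hm)
    then show ?thesis unfolding Proj s(3) fn_Proj x(2) home_elem_map_hm
      using lift_aut_cls[OF assms s(1) x(1)] by (simp del: map_map)
  qed
next
  fix r ss a assume r: "rel_sig Leq r = Some ss" and a: "a \<in> tuples Meq ss"
  then obtain ss' where ss': "rel_sig L r = Some ss'" "ss = map (\<lambda>_. home) ss'" by (auto simp: rel_sig_eq)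
  obtain x where x: "x \<in> tuples MM ss'" "a = map hm x" using a unfolding ss'(2) tuples_hm by auto
  have "map home_elem (map (lift_aut \<sigma>) (map hm x)) = map \<sigma> x" by (simp add: lift_aut_hm)
  moreover have "rel MM r (map \<sigma> x) = rel MM r x" using assms ss'(1) x(1) unfolding automorphisms_def by blast
  ultimately show "rel Meq r (map (lift_aut \<sigma>) a) = rel Meq r a"
    unfolding rel_eq x(2) home_elem_map_hm by (simp del: map_map)
qed simp

text \<open>The equation "the class of y is e" is solvable, so by elementarity it has a solution by
  home elements of N.\<close>

lemma TV_covers:
  assumes "Q.TV N"
  shows "covers {x. hm x \<in> N} N"
  unfolding covers_def
proof (intro ballI)
  fix s e assume s: "s \<in> eq_sorts L MM" and e: "e \<in> N \<inter> univ Meq s"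
  obtain x where x: "x \<in> tuples MM (nb (fst s))" "e = cls s x" using e univ_eq[OF s] by auto
  let ?H = "replicate (fst s) home"
  have H: "?H = map (\<lambda>_. home) (nb (fst s))" by simp
  let ?F = "FEq (App (Proj s) (map Var [0..<fst s])) (Var (fst s))"
  have "has_sort Leq (?H @ [s]) (Var j) home" if "j < fst s" for j
    using has_sort.intros(1)[of j "?H @ [s]" Leq] that by (simp add: nth_append)
  then have "has_sort Leq (?H @ [s]) (App (Proj s) (map Var [0..<fst s])) s"
    by (intro has_sort.intros(2)[where ss = ?H]) (auto simp: fn_sig_Proj s list_all2_conv_all_nth)
  moreover have "has_sort Leq (?H @ [s]) (Var (fst s)) s"
    using has_sort.intros(1)[of "fst s" "?H @ [s]" Leq] by (simp add: nth_append)
  ultimately have "wff Leq (?H @ [s]) ?F" unfolding wff.simps by blast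
  then have "(?F, [e]) \<in> pforms Leq Meq ?H N"
    using e s unfolding pforms_def by (auto simp: sorts_eq intro!: exI[of _ "[s]"])
  then have D: "Q.defble ?H N (solutions Meq ?H (?F, [e]))" by (rule Q.defble_solutions)
  have sat: "map hm y \<in> solutions Meq ?H (?F, [e]) \<longleftrightarrow> cls s y = e" if y: "y \<in> tuples MM (nb (fst s))" for y
  proof -
    have l: "length y = fst s" using tuples_length[OF y] by simp
    have "map home_elem (map (eval Meq (map hm y @ [e])) (map Var [0..<fst s])) = y"
      using l by (intro nth_equalityI) (auto simp: nth_append)
    moreover have "map hm y \<in> tuples Meq ?H" unfolding H tuples_hm using y by simp
    ultimately show ?thesis using l by (simp add: solutions_def fn_Proj nth_append del: map_map)
  qed
  obtain z where z: "z \<in> solutions Meq ?H (?F, [e])" "set z \<subseteq> N"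
    by (rule Q.TV_tuple[OF assms _ D]) (use sat[OF x(1)] x(2) home_sort in \<open>auto simp: sorts_eq\<close>)
  then have "z \<in> tuples Meq ?H" by (simp add: solutions_def)
  then obtain y where "y \<in> tuples MM (nb (fst s))" "z = map hm y" unfolding H tuples_hm by auto
  then show "\<exists>x\<in>tuples MM (nb (fst s)). set x \<subseteq> {x. hm x \<in> N} \<and> e = cls s x" using z sat by auto
qed

text \<open>Fix representatives \<open>xs\<close> of a. It suffices to find representatives of b
  with the same type over the home part of N, for an automorphism carrying \<open>xs\<close> to them
  lifts to the imaginaries. It fixes N because every element of N has a representative in the home
  part.\<close>

lemma homogeneous_eq:
  assumes N: "Q.TV N \<or> N = {}" "|N| <o \<kappa>" and \<Lambda>: "set \<Lambda> \<subseteq> sorts Leq" and st: "Q.same_type \<Lambda> N a b"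
  shows "\<exists>\<sigma>\<in>automorphisms Leq Meq N. map \<sigma> a = b"
proof -
  have \<Lambda>': "set \<Lambda> \<subseteq> eq_sorts L MM" using \<Lambda> by (simp add: sorts_eq)
  have ab: "a \<in> tuples Meq \<Lambda>" "b \<in> tuples Meq \<Lambda>" and same: "\<And>S. Q.defble \<Lambda> N S \<Longrightarrow> a \<in> S \<longleftrightarrow> b \<in> S"
    using st by (auto simp: Q.same_type_def)
  let ?M = "{x. hm x \<in> N}"
  have Ne: "N \<subseteq> elems Leq Meq" using N(1) Q.TV_elems by auto
  have Me: "?M \<subseteq> elems L MM"
  proof
    fix x assume "x \<in> ?M"
    then obtain s where s: "s \<in> eq_sorts L MM" "hm x \<in> univ Meq s" using Ne by (auto simp: elems_def sorts_eq)
    then obtain y where "hm x = cls s y" using univ_eq by auto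
    then have "s = home" by (simp add: hm_def cls_def)
    then have "hm x \<in> hm ` univ MM ()" using s(2) univ_home by simp
    then show "x \<in> elems L MM" using inj_hm by (auto simp: elems_univ dest: injD)
  qed
  have "|?M| \<le>o |N|"
    using card_of_ordLeq[of ?M N] inj_hm by (meson image_Collect_subsetI inj_on_subset subset_UNIV)
  then have Mk: "|?M| <o \<kappa>" using N(2) ordLeq_ordLess_trans by blast
  have cov: "covers ?M N" using N(1) TV_covers by (auto simp: covers_def)
  obtain xs where xs: "a = prj \<Lambda> xs" "reps \<Lambda> xs" by (rule prj_cases[OF ab(1) \<Lambda>'])
  obtain ws where ws: "b = prj \<Lambda> ws" "reps \<Lambda> ws" by (rule prj_cases[OF ab(2) \<Lambda>'])
  have be: "set b \<subseteq> elems Leq Meq" using Q.tuples_elems[OF ab(2) \<Lambda>] .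
  \<comment> \<open>With representatives of b as parameters, the condition of representing b becomes
    definable in the original structure.\<close>
  obtain A' where A': "covers A' (set b)" "A' \<subseteq> elems L MM" "|A'| <o \<kappa>"
    by (rule covers_exists[OF be small_finite]) simp_all
  have Qb: "Q.defble \<Lambda> (set b) {z \<in> tuples Meq \<Lambda>. z = b}"
    using Q.defbleI[of "set b" \<Lambda> "\<lambda>z. z = b"] Q.dfn_eq_const[of b "\<lambda>_::unit. \<Lambda>" "()" "set b" UNIV] ab(2) \<Lambda> by simp
  define \<S> where "\<S> = insert (pull \<Lambda> {b}) {S. defble (flat \<Lambda>) ?M S \<and> concat xs \<in> S}"
  have "\<exists>y\<in>tuples MM (flat \<Lambda>). \<forall>S\<in>\<S>. y \<in> S"
  proof (rule realize)
    show "?M \<union> A' \<subseteq> elems L MM" using Me A'(2) by simp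
    show "|?M \<union> A'| <o \<kappa>" by (rule small_Un[OF Mk A'(3)])
    fix S assume "S \<in> \<S>"
    moreover have "defble (flat \<Lambda>) A' (pull \<Lambda> {b})"
      using defble_pull[OF A'(1) \<Lambda>' Qb] ab(2) by (simp add: Collect_conv_if conj_commute[of "_ \<in> _"] cong: conj_cong)
    ultimately show "defble (flat \<Lambda>) (?M \<union> A') S"
      unfolding \<S>_def using defble_mono by blast
  next
    fix J assume J: "finite J" "J \<subseteq> \<S>"
    let ?J = "J - {pull \<Lambda> {b}}"
    let ?S = "{y \<in> tuples MM (flat \<Lambda>). \<forall>S\<in>?J. y \<in> S}"
    have "dfn ?M (\<lambda>_::unit. flat \<Lambda>) UNIV (\<lambda>u. \<forall>S\<in>?J. u () \<in> S)"
      by (intro dfn_ball dfn_mem) (use J in \<open>auto simp: \<S>_def\<close>)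
    \<comment> \<open>Compactness step: having a representative in the given finite part of the type
      of \<open>xs\<close> is definable over N. It holds of a, hence of b, which has the same type
      over N.\<close>
    from defble_push[OF \<Lambda>' defbleI[OF this]]
    have D: "Q.defble \<Lambda> N {a \<in> tuples Meq \<Lambda>. \<exists>xs. reps \<Lambda> xs \<and> prj \<Lambda> xs = a \<and> concat xs \<in> ?S}" .
    have "concat xs \<in> ?S" using J(2) reps_concat[OF xs(2)] by (auto simp: \<S>_def)
    then have "a \<in> {a \<in> tuples Meq \<Lambda>. \<exists>xs. reps \<Lambda> xs \<and> prj \<Lambda> xs = a \<and> concat xs \<in> ?S}"
      using ab(1) xs by blast
    then have "b \<in> {a \<in> tuples Meq \<Lambda>. \<exists>xs. reps \<Lambda> xs \<and> prj \<Lambda> xs = a \<and> concat xs \<in> ?S}"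
      using same[OF D] by simp
    then obtain ys where ys: "reps \<Lambda> ys" "prj \<Lambda> ys = b" "concat ys \<in> ?S" by blast
    then have "concat ys \<in> pull \<Lambda> {b}" by (simp add: pull_iff)
    then show "\<exists>y\<in>tuples MM (flat \<Lambda>). \<forall>S\<in>J. y \<in> S" using ys(3) by (intro bexI[of _ "concat ys"]) auto
  qed (rule unit_context)
  then obtain y where y: "y \<in> tuples MM (flat \<Lambda>)" "\<And>S. S \<in> \<S> \<Longrightarrow> y \<in> S" by blast
  obtain ys where ys: "y = concat ys" "reps \<Lambda> ys" by (rule reps_cases[OF y(1)])
  have pb: "prj \<Lambda> ys = b" using y(2)[of "pull \<Lambda> {b}"] ys by (simp add: \<S>_def pull_iff)
  have "same_type (flat \<Lambda>) ?M (concat xs) y"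
    unfolding same_type_def
  proof (intro conjI allI impI y(1) reps_concat xs(2))
    fix S assume S: "defble (flat \<Lambda>) ?M S"
    then have "defble (flat \<Lambda>) ?M (tuples MM (flat \<Lambda>) - S)"
      unfolding defble_def by (metis pforms_neg solutions_neg surj_pair)
    then show "concat xs \<in> S \<longleftrightarrow> y \<in> S"
      using y(2)[of S] y(2)[of "tuples MM (flat \<Lambda>) - S"] S reps_concat[OF xs(2)] by (auto simp: \<S>_def)
  qed
  from homogeneous_tuples[OF Me Mk this] obtain \<sigma> where \<sigma>: "\<sigma> \<in> automorphisms L MM ?M" "map \<sigma> (concat xs) = y" by blast
  have \<sigma>0: "\<sigma> \<in> automorphisms L MM {}" using \<sigma>(1) aut_mono[of "{}" ?M] by auto
  have "lift_aut \<sigma> e = e" if e: "e \<in> N" for e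
  proof -
    obtain s where s: "s \<in> eq_sorts L MM" "e \<in> univ Meq s" using Ne e by (auto simp: elems_def sorts_eq)
    then obtain x where "x \<in> tuples MM (nb (fst s))" "set x \<subseteq> ?M" "e = cls s x" using cov e unfolding covers_def by blast
    then show ?thesis using lift_aut_cls[OF \<sigma>0 s(1)] aut_id_on_tuple[OF \<sigma>(1)] by simp
  qed
  then have "lift_aut \<sigma> \<in> automorphisms Leq Meq N"
    unfolding Q.aut_fix[of "lift_aut \<sigma>" N] using lift_aut_automorphism[OF \<sigma>0] by blast
  moreover have "map (lift_aut \<sigma>) a = b"
  proof -
    have r: "reps \<Lambda> (map (map \<sigma>) xs)"
      using xs(2) aut_tuples[OF \<sigma>0 unit_context] by (auto simp: reps_def list.rel_map elim!: list_all2_mono)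
    have "concat (map (map \<sigma>) xs) = concat ys" using \<sigma>(2) ys(1) by (simp add: map_concat)
    then have "map (map \<sigma>) xs = ys" by (rule reps_concat_inj[OF r ys(2)])
    moreover have "map (lift_aut \<sigma>) (prj \<Lambda> xs) = prj \<Lambda> (map (map \<sigma>) xs)"
    proof (rule nth_equalityI)
      show "length (map (lift_aut \<sigma>) (prj \<Lambda> xs)) = length (prj \<Lambda> (map (map \<sigma>) xs))" by (simp add: prj_def)
      fix i assume "i < length (map (lift_aut \<sigma>) (prj \<Lambda> xs))"
      then have i: "i < length \<Lambda>" by (simp add: prj_def)
      have "\<Lambda> ! i \<in> eq_sorts L MM" using \<Lambda>' i by auto
      then show "map (lift_aut \<sigma>) (prj \<Lambda> xs) ! i = prj \<Lambda> (map (map \<sigma>) xs) ! i"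
        using i lift_aut_cls[OF \<sigma>0 _ reps_nth[OF xs(2) i]] prj_nth[OF xs(2) i] prj_nth[OF r i] reps_length[OF xs(2)]
        by (simp add: prj_def)
    qed
    ultimately show ?thesis using xs(1) pb by simp
  qed
  ultimately show ?thesis by blast
qed

lemma eq_sorts_small: "|eq_sorts L MM| <o \<kappa>"
proof -
  obtain Y :: "'k set" where Y: "infinite Y" "|Y| <o \<kappa>" "|Fm| \<le>o |Y|" "|sorts L| \<le>o |Y|" by (rule small_bound)
  have "eq_sorts L MM \<subseteq> UNIV \<times> Fm" by (auto simp: eq_sorts_def Fm_def)
  then have "|eq_sorts L MM| \<le>o |Y|"
    by (rule ordLeq_subset[rotated]) (intro ordLeq_Times ordLeq_nat Y)
  then show ?thesis using Y(2) ordLeq_ordLess_trans by blast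
qed

lemma monster_eq: "monster_struc Leq Meq \<kappa>"
proof (intro_locales; unfold_locales)
  show "Card_order \<kappa>" "natLeq <o \<kappa>" by (rule \<kappa>)+
  show "saturated \<kappa> Leq Meq" by (rule saturated_eq)
  have "{g. fn_sig Leq g \<noteq> None} \<subseteq> Base ` {f. fn_sig L f \<noteq> None} \<union> Proj ` eq_sorts L MM"
  proof
    fix g assume "g \<in> {g. fn_sig Leq g \<noteq> None}"
    then show "g \<in> Base ` {f. fn_sig L f \<noteq> None} \<union> Proj ` eq_sorts L MM"
      by (cases g) (auto simp: fn_sig_Base fn_sig_Proj split: if_splits)
  qed
  moreover have "|Base ` {f. fn_sig L f \<noteq> None} \<union> Proj ` eq_sorts L MM| <o \<kappa>"
    by (intro small_Un ordLeq_ordLess_trans[OF card_of_image] sig(1) eq_sorts_small)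
  ultimately show "|{g. fn_sig Leq g \<noteq> None}| <o \<kappa>" by (rule small_subset[rotated])
  have "{r. rel_sig Leq r \<noteq> None} = {r. rel_sig L r \<noteq> None}" by (auto simp: rel_sig_eq)
  then show "|{r. rel_sig Leq r \<noteq> None}| <o \<kappa>" using sig(2) by simp
  show "|sorts Leq| <o \<kappa>" using eq_sorts_small by (simp add: sorts_eq)
  show "|Pow A| <o \<kappa>" if "|A| <o \<kappa>" for A :: "'k set" using strong_limit[OF that] .
  show "\<exists>\<sigma>\<in>automorphisms Leq Meq N. map \<sigma> a = b"
    if "Q.TV N \<or> N = {}" "|N| <o \<kappa>" "set \<Lambda> \<subseteq> sorts Leq" "Q.same_type \<Lambda> N a b" for N \<Lambda> a b
    using homogeneous_eq[OF that] .
qed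

section \<open>Transfer of the tree property to the imaginaries\<close>

lemma consistent_lift:
  assumes "wff L (\<Gamma> @ \<Delta>) \<phi>" "\<And>i. i \<in> I \<Longrightarrow> c i \<in> tuples MM \<Delta>"
  shows "consistent Meq (map (\<lambda>_. home) \<Gamma>) ((\<lambda>i. (lift_fm \<phi>, map hm (c i))) ` I) \<longleftrightarrow>
    consistent MM \<Gamma> ((\<lambda>i. (\<phi>, c i)) ` I)"
proof -
  have w: "wff Leq (map (\<lambda>_. home) \<Gamma> @ map (\<lambda>_. home) \<Delta>) (lift_fm \<phi>)" using wff_lift[OF assms(1)] by simp
  have "sat Meq (map hm a @ map hm (c i)) (lift_fm \<phi>) \<longleftrightarrow> sat MM (a @ c i) \<phi>" if "a \<in> tuples MM \<Gamma>" "i \<in> I" for a i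
    using sat_lift[OF assms(1) tuples_append[OF that(1) assms(2)[OF that(2)]]] by simp
  then have *: "(\<forall>i\<in>J. sat Meq (map hm a @ map hm (c i)) (lift_fm \<phi>)) \<longleftrightarrow> (\<forall>i\<in>J. sat MM (a @ c i) \<phi>)"
    if "a \<in> tuples MM \<Gamma>" "J \<subseteq> I" for a J
    using that by blast
  show ?thesis
    unfolding Q.consistent_instances[OF w] consistent_instances[OF assms(1)] tuples_hm bex_simps
    using * by (simp cong: conj_cong bex_cong imp_cong)
qed

text \<open>The tree is carried over by \<open>hm\<close> node by node. Consistency agrees because
  the tuples of a home context are exactly the images of tuples of the original structure.\<close>

lemma tree_property_eq:
  assumes "has_tree_property L MM"
  shows "has_tree_property Leq Meq"
proof -
  obtain \<Gamma> \<Delta> \<phi> k and c :: "nat list \<Rightarrow> 'a list" where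
    tp: "set \<Gamma> \<subseteq> sorts L \<and> set \<Delta> \<subseteq> sorts L \<and> wff L (\<Gamma> @ \<Delta>) \<phi> \<and> 2 \<le> k \<and>
        (\<forall>\<eta>. c \<eta> \<in> tuples MM \<Delta>) \<and>
        (\<forall>\<eta> :: nat \<Rightarrow> nat. consistent MM \<Gamma> {(\<phi>, c (map \<eta> [0..<n])) | n. True}) \<and>
        (\<forall>\<nu> I. finite I \<and> card I = k \<longrightarrow> \<not> consistent MM \<Gamma> {(\<phi>, c (\<nu> @ [i])) | i. i \<in> I})"
    using assms unfolding has_tree_property_def by (elim exE)
  then have wf: "wff L (\<Gamma> @ \<Delta>) \<phi>" "2 \<le> k" and c: "\<And>\<eta>. c \<eta> \<in> tuples MM \<Delta>"
    and br: "\<And>\<eta> :: nat \<Rightarrow> nat. consistent MM \<Gamma> ((\<lambda>n. (\<phi>, c (map \<eta> [0..<n]))) ` UNIV)"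
    and si: "\<And>\<nu> I. finite I \<Longrightarrow> card I = k \<Longrightarrow> \<not> consistent MM \<Gamma> ((\<lambda>i. (\<phi>, c (\<nu> @ [i]))) ` I)"
    by (simp_all add: image_def setcompr_eq_image)
  let ?H = "map (\<lambda>_. home)"
  have s: "set (?H \<Gamma>) \<subseteq> sorts Leq" "set (?H \<Delta>) \<subseteq> sorts Leq" using home_sort by (auto simp: sorts_eq)
  have b: "consistent Meq (?H \<Gamma>) {(lift_fm \<phi>, map hm (c (map \<eta> [0..<n]))) | n. True}" for \<eta> :: "nat \<Rightarrow> nat"
    using consistent_lift[OF wf(1), of UNIV "\<lambda>n. c (map \<eta> [0..<n])"] br[of \<eta>] c by (simp add: full_SetCompr_eq)
  have i: "\<not> consistent Meq (?H \<Gamma>) {(lift_fm \<phi>, map hm (c (\<nu> @ [i]))) | i. i \<in> I}"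
    if "finite I" "card I = k" for \<nu> I
    using consistent_lift[OF wf(1), of I "\<lambda>i. c (\<nu> @ [i])"] si[OF that] c by (simp add: setcompr_eq_image)
  show ?thesis
    unfolding has_tree_property_def
    by (rule exI[of _ "?H \<Gamma>"], rule exI[of _ "?H \<Delta>"], rule exI[of _ "lift_fm \<phi>"], rule exI[of _ k],
        rule exI[of _ "\<lambda>\<eta>. map hm (c \<eta>)"])
      (use s b i wf wff_lift[OF wf(1)] c in \<open>simp add: tuples_hm\<close>)
qed

end

theorem theorem4p6:
  fixes L :: "('f, 'r, unit) lang"
    and T :: "('f, 'r, unit) fm set"
    and MM :: "('f, 'r, unit, 'm) struc"
    and \<kappa> :: "'k rel"
  assumes "language L"
    and "complete_theory TYPE('m) L T"
    and "has_infinite_models TYPE('m) L T"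
    and "monster_model \<kappa> L T MM"
    and "NSOP1 L MM"
    and "rosy \<kappa> L MM"
    and "stable_Kim_forking_over_models \<kappa> (eq_lang L MM) (eq_struc L MM)"
  shows "simple L MM"
proof -
  interpret one_sorted_monster L MM \<kappa>
    by unfold_locales (use assms(1,4) in \<open>auto simp: monster_model_def models_def\<close>)
  interpret E: monster_struc "eq_lang L MM" "eq_struc L MM" \<kappa>
    by (rule monster_eq)
  show ?thesis
    using tree_property_eq E.no_tree_property assms(6,7) unfolding simple_def rosy_def by blast
qed

end
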